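(* Let $N$ be a normal subgroup of a locally compact group $G$. Then the following statements hold. (i) If $G$ is weight regular, then $G/N$ is weight regular and $N$ is countable and open. (ii) If $G$ is weight regular and the sequence $0\to N\xrightarrow{\iota}G\xrightarrow{\pi}G/N\to0$ is split, then $G/N$ and $N$ are weight regular, where $\iota$ is the inclusion map and $\pi$ is the quotient map.
   Context: All groups are Hausdorff locally compact. A weight (weight function) on $G$ is a continuous function $\omega:G\to[1,\infty)$ with $\omega(e)=1$ and $\omega(xy)\le\omega(x)\omega(y)$ for all $x,y\in G$. $M(G,\omega)$ is the Banach algebra (under convolution, norm $\|\mu\|_\omega=\|\omega\mu\|$) of complex regular Borel measures $\mu$ on $G$ with $\omega\mu\in M(G)$. A functional $\lambda\in M(G,\omega)^*$ vanishes at infinity if for every $\varepsilon>0$ there is a compact $K\subseteq G$ with $|\langle\lambda,\mu\rangle|<\varepsilon$ for all $\mu\in M(G,\omega)$ with $|\mu|(K)=0$ and $\|\mu\|_\omega=1$. $M_*(G,\omega)$ is the (norm closed) subspace of $M(G,\omega)^*$ of all functionals that vanish at infinity. First Arens product: for a Banach algebra $\mathfrak A$, $f\in\mathfrak A^*$, $a,b\in\mathfrak A$, $\Phi,\Psi\in\mathfrak A^{**}$, put $\langle fa,b\rangle=\langle f,ab\rangle$, $\langle\Psi f,a\rangle=\langle\Psi,fa\rangle$, $\langle\Phi\diamond\Psi,f\rangle=\langle\Phi,\Psi f\rangle$. The same formulas, with $\mathfrak A=M(G,\omega)$ and $f$ in the left introverted subspace $M_*(G,\omega)$ of $M(G,\omega)^*$,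 define the product making $M_*(G,\omega)^*$ a Banach algebra. A Banach algebra $\mathfrak A$ is Arens regular if for every $\Phi\in\mathfrak A^{**}$ the map $\Psi\mapsto\Phi\diamond\Psi$ is weak$^*$-weak$^*$ continuous on $\mathfrak A^{**}$. A locally compact group $G$ is weight regular if there exists a weight function $\omega:G\to[1,\infty)$ such that $M_*(G,\omega)^*$ is Arens regular. A short exact sequence $0\to G_1\xrightarrow{f}G_2\xrightarrow{g}G_3\to0$ of group homomorphisms is split if there is a group homomorphism $h:G_2\to G_1$ with $hf=1_{G_1}$. *)

theory Defs
  imports "HOL-Analysis.Analysis" "HOL-Algebra.Coset" "HOL-Algebra.Elementary_Groups"
begin

section \<open>Locally compact groups and weights\<close>

locale topological_group = group G for G (structure) +
  fixes T :: "'a topology"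
  assumes topspace_eq_carrier: "topspace T = carrier G"
    and continuous_mult: "continuous_map (prod_topology T T) T (\<lambda>(x, y). x \<otimes> y)"
    and continuous_inv: "continuous_map T T (\<lambda>x. inv x)"

locale locally_compact_group = topological_group +
  assumes Hausdorff: "Hausdorff_space T"
    and locally_compact: "locally_compact_space T"

definition weight :: "('a, 'm) monoid_scheme \<Rightarrow> 'a topology \<Rightarrow> ('a \<Rightarrow> real) \<Rightarrow> bool" where
  "weight G T \<omega> \<longleftrightarrow>
     continuous_map T euclideanreal \<omega> \<and>
     (\<forall>x\<in>carrier G. 1 \<le> \<omega> x) \<and>
     \<omega> \<one>\<^bsub>G\<^esub> = 1 \<and>
     (\<forall>x\<in>carrier G. \<forall>y\<in>carrier G. \<omega> (x \<otimes>\<^bsub>G\<^esub> y) \<le> \<omega> x * \<omega> y)"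

definition quotient_topology :: "'a topology \<Rightarrow> ('a \<Rightarrow> 'b) \<Rightarrow> 'b topology" where
  "quotient_topology T f =
     topology (\<lambda>U. U \<subseteq> f ` topspace T \<and> openin T {x \<in> topspace T. f x \<in> U})"

lemma openin_quotient_topology:
  "openin (quotient_topology T f) U \<longleftrightarrow>
     U \<subseteq> f ` topspace T \<and> openin T {x \<in> topspace T. f x \<in> U}"
proof -
  let ?P = "\<lambda>U. U \<subseteq> f ` topspace T \<and> openin T {x \<in> topspace T. f x \<in> U}"
  have "istopology ?P"
    unfolding istopology_def
  proof (intro conjI allI impI)
    fix S S' assume S: "?P S" and S': "?P S'"
    have "{x \<in> topspace T. f x \<in> S \<inter> S'} =
        {x \<in> topspace T. f x \<in> S} \<inter> {x \<in> topspace T. f x \<in> S'}" by auto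
    then show "openin T {x \<in> topspace T. f x \<in> S \<inter> S'}" using S S' by auto
    show "S \<inter> S' \<subseteq> f ` topspace T" using S by auto
  next
    fix K assume K: "\<forall>S\<in>K. ?P S"
    have "{x \<in> topspace T. f x \<in> \<Union>K} = (\<Union>S\<in>K. {x \<in> topspace T. f x \<in> S})" by auto
    then show "openin T {x \<in> topspace T. f x \<in> \<Union>K}" using K by auto
    show "\<Union>K \<subseteq> f ` topspace T" using K by auto
  qed
  then show ?thesis
    unfolding quotient_topology_def by (simp add: topology_inverse')
qed

lemma topspace_quotient_topology: "topspace (quotient_topology T f) = f ` topspace T"
proof
  have "{x \<in> topspace T. f x \<in> f ` topspace T} = topspace T" by auto
  then have "openin (quotient_topology T f) (f ` topspace T)"
    by (simp add: openin_quotient_topology)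
  then show "f ` topspace T \<subseteq> topspace (quotient_topology T f)"
    by (rule openin_subset)
  show "topspace (quotient_topology T f) \<subseteq> f ` topspace T"
    using openin_quotient_topology[of T f "topspace (quotient_topology T f)"] by auto
qed

lemma quotient_map_quotient_topology: "quotient_map T (quotient_topology T f) f"
  unfolding quotient_map_def topspace_quotient_topology openin_quotient_topology by auto

definition split_short_exact ::
  "('a, 'm) monoid_scheme \<Rightarrow> ('a \<Rightarrow> 'b) \<Rightarrow> ('b, 'n) monoid_scheme \<Rightarrow> ('b \<Rightarrow> 'c) \<Rightarrow>
     ('c, 'k) monoid_scheme \<Rightarrow> bool" where
  "split_short_exact G1 f G2 g G3 \<longleftrightarrow>
     group G1 \<and> group G2 \<and> group G3 \<and>
     f \<in> mon G1 G2 \<and> g \<in> epi G2 G3 \<and> f ` carrier G1 = kernel G2 G3 g \<and>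
     (\<exists>h \<in> hom G2 G1. \<forall>x\<in>carrier G1. h (f x) = x)"


section \<open>Normed spaces and algebras with explicit carriers\<close>

record 'v normed_space = "'v partial_object" +
  vadd :: "'v \<Rightarrow> 'v \<Rightarrow> 'v"
  vscale :: "complex \<Rightarrow> 'v \<Rightarrow> 'v"
  vnorm :: "'v \<Rightarrow> real"

record 'v normed_algebra = "'v normed_space" +
  vmult :: "'v \<Rightarrow> 'v \<Rightarrow> 'v"

text \<open>Functionals are extensional, i.e. take the value \<^term>\<open>undefined\<close> outside the space,
  so that equality of functionals is equality on the space.\<close>

definition bounded_functionals :: "('v, 'm) normed_space_scheme \<Rightarrow> ('v \<Rightarrow> complex) set" where
  "bounded_functionals V =
     {f \<in> extensional (carrier V).
        (\<forall>x\<in>carrier V. \<forall>y\<in>carrier V. f (vadd V x y) = f x + f y) \<and>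
        (\<forall>c. \<forall>x\<in>carrier V. f (vscale V c x) = c * f x) \<and>
        (\<exists>C. \<forall>x\<in>carrier V. cmod (f x) \<le> C * vnorm V x)}"

definition dual :: "('v, 'm) normed_space_scheme \<Rightarrow> ('v \<Rightarrow> complex) normed_space" where
  "dual V =
     \<lparr>carrier = bounded_functionals V,
      vadd = (\<lambda>f g. \<lambda>x\<in>carrier V. f x + g x),
      vscale = (\<lambda>c f. \<lambda>x\<in>carrier V. c * f x),
      vnorm = (\<lambda>f. SUP x\<in>{x \<in> carrier V. vnorm V x \<le> 1}. cmod (f x))\<rparr>"

definition weak_star :: "('v, 'm) normed_space_scheme \<Rightarrow> ('v \<Rightarrow> complex) topology" where
  "weak_star V =
     subtopology (product_topology (\<lambda>_. euclidean) (carrier V)) (carrier (dual V))"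

text \<open>The first Arens product on the dual of a subspace \<open>X\<close> of the dual of \<open>A\<close>. For
  \<open>f \<in> X\<close>, the functional \<open>fa\<close> is \<^term>\<open>functional_act A f a\<close> and \<open>\<Psi>f\<close> is
  \<^term>\<open>bidual_act A \<Psi> f\<close>. The formulas are meaningful when \<open>X\<close> is left introverted,
  that is, when \<open>fa \<in> X\<close> and \<open>\<Psi>f \<in> X\<close> always hold.\<close>

definition functional_act ::
  "('v, 'm) normed_algebra_scheme \<Rightarrow> ('v \<Rightarrow> complex) \<Rightarrow> 'v \<Rightarrow> ('v \<Rightarrow> complex)" where
  "functional_act A f a = (\<lambda>b\<in>carrier A. f (vmult A a b))"

definition bidual_act ::
  "('v, 'm) normed_algebra_scheme \<Rightarrow> (('v \<Rightarrow> complex) \<Rightarrow> complex) \<Rightarrow>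
     ('v \<Rightarrow> complex) \<Rightarrow> ('v \<Rightarrow> complex)" where
  "bidual_act A \<Psi> f = (\<lambda>a\<in>carrier A. \<Psi> (functional_act A f a))"

definition arens_product ::
  "('v, 'm) normed_algebra_scheme \<Rightarrow> ('v \<Rightarrow> complex) set \<Rightarrow>
     (('v \<Rightarrow> complex) \<Rightarrow> complex) \<Rightarrow> (('v \<Rightarrow> complex) \<Rightarrow> complex) \<Rightarrow>
     (('v \<Rightarrow> complex) \<Rightarrow> complex)" where
  "arens_product A X \<Phi> \<Psi> = (\<lambda>f\<in>X. \<Phi> (bidual_act A \<Psi> f))"

definition introverted_dual ::
  "('v, 'm) normed_algebra_scheme \<Rightarrow> ('v \<Rightarrow> complex) set \<Rightarrow>
     (('v \<Rightarrow> complex) \<Rightarrow> complex) normed_algebra" where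
  "introverted_dual A X =
     normed_space.extend (dual ((dual A)\<lparr>carrier := X\<rparr>)) \<lparr>vmult = arens_product A X\<rparr>"

definition arens_regular :: "('v, 'm) normed_algebra_scheme \<Rightarrow> bool" where
  "arens_regular A \<longleftrightarrow>
     (\<forall>\<Phi> \<in> carrier (dual (dual A)).
        continuous_map (weak_star (dual A)) (weak_star (dual A))
          (\<lambda>\<Psi>. arens_product A (carrier (dual A)) \<Phi> \<Psi>))"


section \<open>Complex measures\<close>

definition borel_of :: "'a topology \<Rightarrow> 'a measure" where
  "borel_of T = sigma (topspace T) {U. openin T U}"

text \<open>Like \<^const>\<open>emeasure\<close>, complex measures vanish outside the \<open>\<sigma>\<close>-algebra. Only
  the measurable space underlying \<^term>\<open>M\<close> matters here and below.\<close>

definition complex_measures :: "'a measure \<Rightarrow> ('a set \<Rightarrow> complex) set" where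
  "complex_measures M =
     {\<mu>. (\<forall>E. E \<notin> sets M \<longrightarrow> \<mu> E = 0) \<and> \<mu> {} = 0 \<and>
         (\<forall>A. range A \<subseteq> sets M \<longrightarrow> disjoint_family A \<longrightarrow>
            (\<lambda>i::nat. \<mu> (A i)) sums \<mu> (\<Union>i. A i))}"

text \<open>The supremum over countable measurable partitions is itself a (finite) measure, so
  \<^const>\<open>measure_of\<close> does not alter it.\<close>

definition variation :: "'a measure \<Rightarrow> ('a set \<Rightarrow> complex) \<Rightarrow> 'a measure" where
  "variation M \<mu> = measure_of (space M) (sets M)
     (\<lambda>E. SUP A\<in>{A. range A \<subseteq> sets M \<and> disjoint_family A \<and> (\<Union>i. A i) = E}.
            \<Sum>i::nat. ennreal (cmod (\<mu> (A i))))"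

text \<open>The positive part \<open>\<nu>\<^sup>+(E) = sup {\<nu>(F). F \<subseteq> E}\<close> of the Jordan decomposition of a
  real measure; \<^const>\<open>ennreal\<close> truncates negative values to 0, which is harmless
  as \<^term>\<open>F = {}\<close> is admissible. The negative part is the positive part of \<open>-\<nu>\<close>.\<close>

definition jordan_pos :: "'a measure \<Rightarrow> ('a set \<Rightarrow> real) \<Rightarrow> 'a measure" where
  "jordan_pos M \<nu> = measure_of (space M) (sets M)
     (\<lambda>E. SUP F\<in>{F \<in> sets M. F \<subseteq> E}. ennreal (\<nu> F))"

definition complex_integral ::
  "'a measure \<Rightarrow> ('a set \<Rightarrow> complex) \<Rightarrow> ('a \<Rightarrow> complex) \<Rightarrow> complex" where
  "complex_integral M \<mu> f =
     (integral\<^sup>L (jordan_pos M (\<lambda>E. Re (\<mu> E))) f - integral\<^sup>L (jordan_pos M (\<lambda>E. - Re (\<mu> E))) f) +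
     \<i> * (integral\<^sup>L (jordan_pos M (\<lambda>E. Im (\<mu> E))) f - integral\<^sup>L (jordan_pos M (\<lambda>E. - Im (\<mu> E))) f)"

definition regular_measures :: "'a topology \<Rightarrow> ('a set \<Rightarrow> complex) set" where
  "regular_measures T =
     {\<mu> \<in> complex_measures (borel_of T).
        \<forall>E\<in>sets (borel_of T).
          emeasure (variation (borel_of T) \<mu>) E =
            (INF U\<in>{U. openin T U \<and> E \<subseteq> U}. emeasure (variation (borel_of T) \<mu>) U) \<and>
          emeasure (variation (borel_of T) \<mu>) E =
            (SUP K\<in>{K. compactin T K \<and> K \<subseteq> E}. emeasure (variation (borel_of T) \<mu>) K)}"


section \<open>Weighted measure algebras\<close>

text \<open>The measure \<open>\<omega>\<mu>\<close>, i.e. \<open>E \<mapsto> \<integral>\<^sub>E \<omega> d\<mu>\<close>.\<close>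

definition weighted_measure ::
  "'a topology \<Rightarrow> ('a \<Rightarrow> real) \<Rightarrow> ('a set \<Rightarrow> complex) \<Rightarrow> ('a set \<Rightarrow> complex)" where
  "weighted_measure T \<omega> \<mu> E =
     (if E \<in> sets (borel_of T)
      then complex_integral (borel_of T) \<mu> (\<lambda>x. complex_of_real (indicator E x * \<omega> x))
      else 0)"

text \<open>\<open>(\<mu> * \<nu>)(E) = \<integral>\<integral> 1\<^sub>E(xy) d\<mu>(x) d\<nu>(y)\<close>; the inner integral is the measure of a section.\<close>

definition convolution ::
  "('a, 'm) monoid_scheme \<Rightarrow> 'a topology \<Rightarrow> ('a set \<Rightarrow> complex) \<Rightarrow>
     ('a set \<Rightarrow> complex) \<Rightarrow> ('a set \<Rightarrow> complex)" where
  "convolution G T \<mu> \<nu> E =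
     (if E \<in> sets (borel_of T)
      then complex_integral (borel_of T) \<nu> (\<lambda>y. \<mu> {x \<in> carrier G. x \<otimes>\<^bsub>G\<^esub> y \<in> E})
      else 0)"

text \<open>Integrability of \<open>\<omega>\<close> is part of the requirement that \<open>\<omega>\<mu>\<close> be a complex measure; it has
  to be explicit because the integral of a non-integrable function is 0.\<close>

definition measure_algebra ::
  "('a, 'm) monoid_scheme \<Rightarrow> 'a topology \<Rightarrow> ('a \<Rightarrow> real) \<Rightarrow>
     ('a set \<Rightarrow> complex) normed_algebra" where
  "measure_algebra G T \<omega> =
     \<lparr>carrier = {\<mu> \<in> regular_measures T.
                   integrable (variation (borel_of T) \<mu>) \<omega> \<and>
                   weighted_measure T \<omega> \<mu> \<in> regular_measures T},
      vadd = (\<lambda>\<mu> \<nu> E. \<mu> E + \<nu> E),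
      vscale = (\<lambda>c \<mu> E. c * \<mu> E),
      vnorm = (\<lambda>\<mu>. measure (variation (borel_of T) (weighted_measure T \<omega> \<mu>)) (topspace T)),
      vmult = convolution G T\<rparr>"

definition vanishes_at_infinity ::
  "('a, 'm) monoid_scheme \<Rightarrow> 'a topology \<Rightarrow> ('a \<Rightarrow> real) \<Rightarrow>
     (('a set \<Rightarrow> complex) \<Rightarrow> complex) \<Rightarrow> bool" where
  "vanishes_at_infinity G T \<omega> f \<longleftrightarrow>
     (\<forall>\<epsilon>>0. \<exists>K. compactin T K \<and>
        (\<forall>\<mu>\<in>carrier (measure_algebra G T \<omega>).
           emeasure (variation (borel_of T) \<mu>) K = 0 \<longrightarrow>
           vnorm (measure_algebra G T \<omega>) \<mu> = 1 \<longrightarrow> cmod (f \<mu>) < \<epsilon>))"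

definition M_star ::
  "('a, 'm) monoid_scheme \<Rightarrow> 'a topology \<Rightarrow> ('a \<Rightarrow> real) \<Rightarrow>
     (('a set \<Rightarrow> complex) \<Rightarrow> complex) set" where
  "M_star G T \<omega> =
     {f \<in> carrier (dual (measure_algebra G T \<omega>)). vanishes_at_infinity G T \<omega> f}"

definition weight_regular :: "('a, 'm) monoid_scheme \<Rightarrow> 'a topology \<Rightarrow> bool" where
  "weight_regular G T \<longleftrightarrow>
     locally_compact_group G T \<and>
     (\<exists>\<omega>. weight G T \<omega> \<and>
        arens_regular (introverted_dual (measure_algebra G T \<omega>) (M_star G T \<omega>)))"

end

theory Submission
  imports Defs "HOL-Probability.Giry_Monad"
begin

text \<open>A group is weight regular if and only if it is countable and discrete, which passes to
  quotients and to subgroups.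

  Suppose that \<open>M\<^sub>*(G,\<omega>)\<^sup>*\<close> is Arens regular. If \<open>{\<omega> \<le> k}\<close> were infinite, it would contain
  sequences \<open>x\<close>, \<open>y\<close> such that no \<open>x\<^sub>n y\<^sub>m\<close> with \<open>m < n\<close> lies in \<open>E = {x\<^sub>n y\<^sub>m. n \<le> m}\<close>. Every element of
  \<open>M\<^sub>*(G,\<omega>)\<^sup>*\<close> has an absolutely summable discrete part, so its mass on \<open>E\<close> is a bounded
  functional, and the masses on \<open>E\<close> of the products \<open>\<delta>(x\<^sub>n) \<delta>(y\<^sub>m)\<close> have different iterated limits. Hence
  every \<open>{\<omega> \<le> k}\<close> is finite, \<open>G\<close> is countable, and it is discrete by the Baire category theorem.

  Conversely, a countable discrete group carries a proper weight with
  \<open>\<omega>(xy) \<le> \<omega>(x) + \<omega>(y)\<close>. Then \<open>\<omega>(xy) / (\<omega>(x) \<omega>(y))\<close> tends to 0 as \<open>x\<close> and \<open>y\<close> leave finite sets, and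
  all bilinear forms \<open>f(ab)\<close> are uniform limits of forms of finite rank.\<close>

section \<open>Complex measures\<close>

text \<open>Both directions compute inside the dual of \<open>M_star\<close>, so that dual must
  first be known to be a normed algebra under \<open>arens_product\<close>, for every locally
  compact group. Two obstacles shape this groundwork. \<open>variation\<close> and
  \<open>complex_integral\<close> are given by suprema and Jordan parts, which are awkward to
  calculate with; each complex measure is therefore rewritten as a density over a finite measure,
  where both become ordinary integrals. And without second countability multiplication need not be
  measurable for the product of the Borel algebras, so Fubini is not at hand; inner regularity
  replaces it: sections of open sets have lower semicontinuous measure. That \<open>M_star\<close>
  is left introverted rests on tightness: a functional on \<open>M_star\<close> nearly attains its
  norm on a functional concentrated on a compact set, and additivity of the measure norm over
  disjoint sets leaves little room elsewhere. For the proper weight, subadditivity bounds the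
  quotient by \<open>1 / \<omega> x + 1 / \<omega> y\<close>, which is small as soon as both points
  are far out.\<close>

text \<open>The value 0 off the sigma-algebra is the convention of \<open>complex_measures\<close>,
  so a complex measure with density \<open>f\<close> equals \<open>cmeas \<rho> f\<close> as a
  function on all sets.\<close>

definition cmeas :: "'a measure \<Rightarrow> ('a \<Rightarrow> complex) \<Rightarrow> 'a set \<Rightarrow> complex" where
  "cmeas \<rho> f E = (if E \<in> sets \<rho> then (LINT x:E|\<rho>. f x) else 0)"

lemma set_integrable_of_integrable:
  fixes f :: "'a \<Rightarrow> 'b::{banach, second_countable_topology}"
  assumes "integrable M f" "A \<in> sets M"
  shows "set_integrable M A f"
  unfolding set_integrable_def using integrable_mult_indicator[OF assms(2,1)] .

text \<open>Convergence comes from comparison with the integrals of the norm, whose sum is the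
  integral over the union and hence finite. The value of the sum is then countable additivity of the
  set integral.\<close>

lemma sums_set_integral:
  fixes f :: "'a \<Rightarrow> 'b::{banach, second_countable_topology}"
  assumes f: "integrable M f" and A: "range A \<subseteq> sets M" "disjoint_family A"
  shows "(\<lambda>i::nat. LINT x:A i|M. f x) sums (LINT x:(\<Union>i. A i)|M. f x)"
proof -
  have A': "A i \<in> sets M" for i using A by auto
  have [measurable]: "f \<in> borel_measurable M" using f by auto
  have fin: "(\<integral>\<^sup>+x. ennreal (norm (f x)) \<partial>M) < \<infinity>"
    using f by (simp add: integrable_iff_bounded)
  have "(\<Sum>i. ennreal (LINT x:A i|M. norm (f x))) = (\<Sum>i. \<integral>\<^sup>+x\<in>A i. ennreal (norm (f x)) \<partial>M)"
  proof (intro suminf_cong)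
    fix i
    have "integrable M (\<lambda>x. indicator (A i) x *\<^sub>R norm (f x))"
      using set_integrable_of_integrable[OF integrable_norm[OF f] A'[of i]]
      by (simp add: set_integrable_def)
    then show "ennreal (LINT x:A i|M. norm (f x)) = (\<integral>\<^sup>+x\<in>A i. ennreal (norm (f x)) \<partial>M)"
      unfolding set_lebesgue_integral_def
      by (subst nn_integral_eq_integral[symmetric])
        (auto intro!: nn_integral_cong split: split_indicator)
  qed
  also have "\<dots> = (\<integral>\<^sup>+x\<in>(\<Union>i. A i). ennreal (norm (f x)) \<partial>M)"
    using A A' by (subst nn_integral_disjoint_family) auto
  also have "\<dots> \<le> (\<integral>\<^sup>+x. ennreal (norm (f x)) \<partial>M)"
    by (intro nn_integral_mono) (auto split: split_indicator)
  finally have "(\<Sum>i. ennreal (LINT x:A i|M. norm (f x))) \<noteq> \<infinity>"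
    using fin by (simp add: less_top)
  moreover have "0 \<le> (LINT x:A i|M. norm (f x))" for i
    unfolding set_lebesgue_integral_def by (intro integral_nonneg_AE) auto
  ultimately have "summable (\<lambda>i. LINT x:A i|M. norm (f x))"
    by (intro summable_suminf_not_top) (auto simp: infinity_ennreal_def)
  moreover have "norm (LINT x:A i|M. f x) \<le> (LINT x:A i|M. norm (f x))" for i
    unfolding set_lebesgue_integral_def
    by (intro order_trans[OF integral_norm_bound]) simp
  ultimately have "summable (\<lambda>i. LINT x:A i|M. f x)"
    by (rule summable_comparison_test'[where N=0])
  moreover have "(\<Sum>i. LINT x:A i|M. f x) = (LINT x:(\<Union>i. A i)|M. f x)"
    using A A' f
    by (intro lebesgue_integral_countable_add[symmetric] set_integrable_of_integrable)
      (auto simp: disjoint_family_on_def)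
  ultimately show ?thesis by (metis summable_sums)
qed

lemma norm_integral_le:
  fixes f :: "'a \<Rightarrow> 'b::{banach, second_countable_topology}"
  assumes "integrable M f" "integrable M g" "\<And>x. x \<in> space M \<Longrightarrow> norm (f x) \<le> g x"
  shows "norm (integral\<^sup>L M f) \<le> (LINT x|M. g x)"
  using assms by (intro order_trans[OF integral_norm_bound] integral_mono) auto

lemma cmeas_in_complex_measures:
  assumes "integrable \<rho> f" "sets M = sets \<rho>"
  shows "cmeas \<rho> f \<in> complex_measures M"
  unfolding complex_measures_def
proof (safe)
  fix A :: "nat \<Rightarrow> 'a set" assume A: "range A \<subseteq> sets M" "disjoint_family A"
  then have "range A \<subseteq> sets \<rho>" using assms by simp
  moreover from this have "A i \<in> sets \<rho>" "(\<Union>i. A i) \<in> sets \<rho>" for i by auto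
  ultimately show "(\<lambda>i. cmeas \<rho> f (A i)) sums cmeas \<rho> f (\<Union> (range A))"
    using sums_set_integral[OF assms(1) _ A(2)] by (auto simp: cmeas_def)
qed (auto simp: cmeas_def assms set_lebesgue_integral_def)

lemma ennreal_integral_le_nn_integral:
  fixes h :: "'a \<Rightarrow> real"
  assumes "integrable M h"
  shows "ennreal (integral\<^sup>L M h) \<le> (\<integral>\<^sup>+x. ennreal (h x) \<partial>M)"
proof -
  have *: "integrable M (\<lambda>x. max 0 (h x))" using assms by simp
  have "ennreal (integral\<^sup>L M h) \<le> ennreal (integral\<^sup>L M (\<lambda>x. max 0 (h x)))"
    using assms * by (intro ennreal_leI integral_mono) auto
  also have "\<dots> = (\<integral>\<^sup>+x. ennreal (max 0 (h x)) \<partial>M)"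
    using * by (subst nn_integral_eq_integral) auto
  also have "\<dots> = (\<integral>\<^sup>+x. ennreal (h x) \<partial>M)"
    by (intro nn_integral_cong) (simp add: max_def ennreal_neg)
  finally show ?thesis .
qed

text \<open>An explicit Hahn decomposition: the supremum over subsets of \<open>E\<close> is
  attained on the part of \<open>E\<close> where \<open>g\<close> is positive. The coercion of
  \<open>g\<close> into \<open>ennreal\<close> truncates negative values, so the right-hand side is
  the density of the positive part.\<close>

lemma jordan_pos_density:
  fixes g :: "'a \<Rightarrow> real"
  assumes g: "integrable \<rho> g" and sets: "sets M = sets \<rho>"
    and \<nu>: "\<And>E. E \<in> sets \<rho> \<Longrightarrow> \<nu> E = (LINT x:E|\<rho>. g x)"
  shows "jordan_pos M \<nu> = density \<rho> g"
proof -
  have [measurable]: "g \<in> borel_measurable \<rho>" using g by auto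
  let ?D = "density \<rho> (\<lambda>x. ennreal (g x))"
  have nn: "ennreal (\<nu> F) \<le> emeasure ?D F" if "F \<in> sets \<rho>" for F
  proof -
    have "ennreal (\<nu> F) \<le> (\<integral>\<^sup>+x. ennreal (indicator F x *\<^sub>R g x) \<partial>\<rho>)"
      using ennreal_integral_le_nn_integral[of \<rho> "\<lambda>x. indicator F x *\<^sub>R g x"]
        set_integrable_of_integrable[OF g that]
      by (simp add: \<nu>[OF that] set_integrable_def set_lebesgue_integral_def)
    also have "\<dots> = emeasure ?D F"
      using that by (auto simp: emeasure_density intro!: nn_integral_cong split: split_indicator)
    finally show ?thesis .
  qed
  have eq: "(SUP F\<in>{F \<in> sets M. F \<subseteq> E}. ennreal (\<nu> F)) = emeasure ?D E" if "E \<in> sets \<rho>" for E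
  proof (rule antisym)
    show "(SUP F\<in>{F \<in> sets M. F \<subseteq> E}. ennreal (\<nu> F)) \<le> emeasure ?D E"
    proof (rule SUP_least)
      fix F assume "F \<in> {F \<in> sets M. F \<subseteq> E}"
      then show "ennreal (\<nu> F) \<le> emeasure ?D E"
        using nn[of F] emeasure_mono[of F E ?D] that sets by auto
    qed
    define F where "F = E \<inter> {x \<in> space \<rho>. 0 < g x}"
    have F: "F \<in> sets \<rho>" using that unfolding F_def by measurable
    have "emeasure ?D E = (\<integral>\<^sup>+x. ennreal (indicator F x *\<^sub>R g x) \<partial>\<rho>)"
      using that sets.sets_into_space[OF that]
      by (auto simp: emeasure_density F_def ennreal_neg split: split_indicator
          intro!: nn_integral_cong)
    also have "\<dots> = ennreal (\<nu> F)"
      using set_integrable_of_integrable[OF g F] F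
      by (subst nn_integral_eq_integral)
        (auto simp: \<nu> set_integrable_def set_lebesgue_integral_def F_def split: split_indicator)
    also have "\<dots> \<le> (SUP F\<in>{F \<in> sets M. F \<subseteq> E}. ennreal (\<nu> F))"
      by (rule SUP_upper) (use F sets in \<open>simp add: F_def\<close>)
    finally show "emeasure ?D E \<le> (SUP F\<in>{F \<in> sets M. F \<subseteq> E}. ennreal (\<nu> F))" .
  qed
  \<comment> \<open>\<open>measure_of\<close> recovers a measure from its own set function, so
    agreement of the two set functions on the sigma-algebra suffices.\<close>
  have "jordan_pos M \<nu> = measure_of (space ?D) (sets ?D) (emeasure ?D)"
    unfolding jordan_pos_def sets_density space_density sets sets_eq_imp_space_eq[OF sets]
    by (rule measure_of_eq[OF sets.space_closed])
      (use eq sets in \<open>simp add: sets.sigma_sets_eq\<close>)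
  then show ?thesis by (simp only: measure_of_of_measure)
qed

text \<open>The four Jordan parts have the densities \<open>max 0\<close> of \<open>Re f\<close>,
  \<open>- Re f\<close>, \<open>Im f\<close> and \<open>- Im f\<close>, each at most
  \<open>cmod (f x)\<close>, so integrability of \<open>h x * f x\<close> covers all four integrals.
  They recombine because \<open>max 0 r - max 0 (- r) = r\<close>.\<close>

lemma complex_integral_cmeas:
  assumes f: "integrable \<rho> f" and sets: "sets M = sets \<rho>"
    and h[measurable]: "h \<in> borel_measurable \<rho>" and hf: "integrable \<rho> (\<lambda>x. h x * f x)"
  shows "complex_integral M (cmeas \<rho> f) h = (LINT x|\<rho>. h x * f x)"
proof -
  have [measurable]: "f \<in> borel_measurable \<rho>" using f by auto
  let ?p = "\<lambda>g x. max 0 (g x) *\<^sub>R h x"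
  have part: "integral\<^sup>L (jordan_pos M \<nu>) h = (LINT x|\<rho>. ?p g x)"
    if g: "integrable \<rho> g" "\<And>E. E \<in> sets \<rho> \<Longrightarrow> \<nu> E = (LINT x:E|\<rho>. g x)" for \<nu> g
  proof -
    have "density \<rho> g = density \<rho> (\<lambda>x. ennreal (max 0 (g x)))"
      using g by (auto intro!: density_cong simp: max_def ennreal_neg)
    then show ?thesis
      using jordan_pos_density[OF g(1) sets g(2)] g(1)
      by (simp add: integral_density)
  qed
  have int: "integrable \<rho> (?p g)" if "g \<in> borel_measurable \<rho>" "\<And>x. \<bar>g x\<bar> \<le> cmod (f x)" for g
  proof (rule Bochner_Integration.integrable_bound[OF hf])
    show "?p g \<in> borel_measurable \<rho>" using that by measurable
    have "\<bar>max 0 (g x)\<bar> \<le> cmod (f x)" for x using that(2)[of x] by (auto simp: max_def)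
    then have "\<bar>max 0 (g x)\<bar> * cmod (h x) \<le> cmod (f x) * cmod (h x)" for x
      by (rule mult_right_mono) simp
    then show "AE x in \<rho>. norm (?p g x) \<le> norm (h x * f x)"
      by (simp add: norm_mult mult.commute[of "cmod (h _)"] del: abs_of_nonneg)
  qed
  have rE: "Re (cmeas \<rho> f E) = (LINT x:E|\<rho>. Re (f x))"
    and iE: "Im (cmeas \<rho> f E) = (LINT x:E|\<rho>. Im (f x))" if "E \<in> sets \<rho>" for E
    using that set_integrable_of_integrable[OF f that]
    by (auto simp: cmeas_def set_lebesgue_integral_def set_integrable_def
        simp flip: integral_Re integral_Im)
  have neg: "- (LINT x:E|\<rho>. g x) = (LINT x:E|\<rho>. - g x)" for E and g :: "'a \<Rightarrow> real"
    by (simp add: set_lebesgue_integral_def)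
  have "complex_integral M (cmeas \<rho> f) h =
      ((LINT x|\<rho>. ?p (\<lambda>x. Re (f x)) x) - (LINT x|\<rho>. ?p (\<lambda>x. - Re (f x)) x)) +
      \<i> * ((LINT x|\<rho>. ?p (\<lambda>x. Im (f x)) x) - (LINT x|\<rho>. ?p (\<lambda>x. - Im (f x)) x))"
    unfolding complex_integral_def using f
    by (subst (1 2 3 4) part) (auto simp: rE iE neg)
  also have "\<dots> = (LINT x|\<rho>. (?p (\<lambda>x. Re (f x)) x - ?p (\<lambda>x. - Re (f x)) x) +
      \<i> * (?p (\<lambda>x. Im (f x)) x - ?p (\<lambda>x. - Im (f x)) x))"
    using int by (simp add: abs_Re_le_cmod abs_Im_le_cmod)
  also have "\<dots> = (LINT x|\<rho>. h x * f x)"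
  proof (intro Bochner_Integration.integral_cong refl)
    fix x
    have m: "max 0 r *\<^sub>R c - max 0 (- r) *\<^sub>R c = r *\<^sub>R c" for r :: real and c :: complex
      by (auto simp: max_def)
    show "(?p (\<lambda>x. Re (f x)) x - ?p (\<lambda>x. - Re (f x)) x) +
        \<i> * (?p (\<lambda>x. Im (f x)) x - ?p (\<lambda>x. - Im (f x)) x) = h x * f x"
      unfolding m by (simp add: complex_eq_iff)
  qed
  finally show ?thesis .
qed

text \<open>The error \<open>2 * d\<close> per unit of mass is paid in two halves: once for
  replacing \<open>cmod (f x)\<close> by its value at a fixed point of \<open>A\<close>, and once
  for replacing the integral of that constant by the integral of \<open>f\<close>.\<close>

lemma emeasure_density_cell_le:
  fixes f :: "'a \<Rightarrow> complex"
  assumes "finite_measure \<rho>" and f: "integrable \<rho> f" and A: "A \<in> sets \<rho>"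
    and d: "\<And>x y. x \<in> A \<Longrightarrow> y \<in> A \<Longrightarrow> cmod (f x - f y) \<le> d"
  shows "emeasure (density \<rho> (\<lambda>x. ennreal (cmod (f x)))) A \<le>
    ennreal (cmod (LINT x:A|\<rho>. f x)) + ennreal (2 * d) * emeasure \<rho> A"
proof (cases "A = {}")
  case False
  interpret finite_measure \<rho> by fact
  obtain x0 where x0: "x0 \<in> A" using False by blast
  have d0: "0 \<le> d" using d[OF x0 x0] by simp
  have [measurable]: "f \<in> borel_measurable \<rho>" using f by auto
  define w where "w = f x0"
  have "emeasure (density \<rho> (\<lambda>x. ennreal (cmod (f x)))) A =
      (\<integral>\<^sup>+x. ennreal (cmod (f x)) * indicator A x \<partial>\<rho>)"
    using A by (simp add: emeasure_density)
  also have "\<dots> \<le> (\<integral>\<^sup>+x. ennreal (cmod w + d) * indicator A x \<partial>\<rho>)"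
  proof (intro nn_integral_mono)
    fix x
    have "cmod (f x) \<le> cmod w + d" if "x \<in> A"
      using d[OF that x0] norm_triangle_ineq2[of "f x" w] by (simp add: w_def)
    then show "ennreal (cmod (f x)) * indicator A x \<le> ennreal (cmod w + d) * indicator A x"
      by (auto split: split_indicator intro!: ennreal_leI)
  qed
  also have "\<dots> = ennreal ((cmod w + d) * measure \<rho> A)"
    using A d0 by (simp add: nn_integral_cmult_indicator emeasure_eq_measure ennreal_mult)
  also have "\<dots> \<le> ennreal (cmod (LINT x:A|\<rho>. f x) + 2 * d * measure \<rho> A)"
  proof (rule ennreal_leI)
    have fA: "set_integrable \<rho> A f" and wA: "set_integrable \<rho> A (\<lambda>x. w)"
      using set_integrable_of_integrable[OF f A] A
      by (auto simp: set_integrable_def emeasure_eq_measure less_top)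
    have "(LINT x:A|\<rho>. w) = measure \<rho> A *\<^sub>R w"
      unfolding set_lebesgue_integral_def
      using A by (subst integral_scaleR_left) (auto simp: emeasure_eq_measure)
    then have "cmod w * measure \<rho> A = cmod (LINT x:A|\<rho>. w)" by simp
    also have "(LINT x:A|\<rho>. w) = (LINT x:A|\<rho>. f x) + (LINT x:A|\<rho>. w - f x)"
      using set_integral_diff(2)[OF wA fA] by simp
    also have "cmod \<dots> \<le> cmod (LINT x:A|\<rho>. f x) + cmod (LINT x:A|\<rho>. w - f x)"
      by (rule norm_triangle_ineq)
    also have "cmod (LINT x:A|\<rho>. w - f x) \<le> (LINT x|\<rho>. d * indicator A x)"
      unfolding set_lebesgue_integral_def
    proof (rule norm_integral_le)
      show "integrable \<rho> (\<lambda>x. indicator A x *\<^sub>R (w - f x))"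
        using set_integral_diff(1)[OF wA fA] by (simp add: set_integrable_def)
      show "integrable \<rho> (\<lambda>x. d * indicator A x)"
        using A by (simp add: emeasure_eq_measure)
      show "norm (indicator A x *\<^sub>R (w - f x)) \<le> d * indicator A x" for x
        using d[OF x0, of x] by (auto simp: w_def split: split_indicator)
    qed
    also have "(LINT x|\<rho>. d * indicator A x) = d * measure \<rho> A" using A by simp
    finally show "(cmod w + d) * measure \<rho> A \<le>
        cmod (LINT x:A|\<rho>. f x) + 2 * d * measure \<rho> A"
      by (simp add: algebra_simps)
  qed
  also have "\<dots> = ennreal (cmod (LINT x:A|\<rho>. f x)) + ennreal (2 * d) * emeasure \<rho> A"
    using d0 by (simp add: ennreal_plus emeasure_eq_measure ennreal_mult)
  finally show ?thesis .
qed simp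

text \<open>The upper bound is the triangle inequality for integrals. For the lower bound,
  \<open>E\<close> is partitioned along a grid of small squares in the complex plane: on each cell
  \<open>f\<close> is nearly constant, so hardly any cancellation occurs in its integral.\<close>

lemma partition_sup_cmeas:
  assumes fin: "finite_measure \<rho>" and f: "integrable \<rho> f" and sets: "sets M = sets \<rho>"
    and E: "E \<in> sets \<rho>"
  shows "(SUP A\<in>{A :: nat \<Rightarrow> 'a set. range A \<subseteq> sets M \<and> disjoint_family A \<and> (\<Union>i. A i) = E}.
      \<Sum>i. ennreal (cmod (cmeas \<rho> f (A i)))) = emeasure (density \<rho> (\<lambda>x. ennreal (cmod (f x)))) E"
    (is "(SUP A\<in>?P. \<Sum>i. ennreal (cmod (cmeas \<rho> f (A i)))) = emeasure ?D E")
proof (rule antisym)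
  interpret finite_measure \<rho> by fact
  have [measurable]: "f \<in> borel_measurable \<rho>" using f by auto
  let ?S = "SUP A\<in>?P. \<Sum>i. ennreal (cmod (cmeas \<rho> f (A i)))"
  show "?S \<le> emeasure ?D E"
  proof (rule SUP_least)
    fix A assume A: "A \<in> ?P"
    then have Ai: "A i \<in> sets \<rho>" for i using sets by auto
    have "ennreal (cmod (cmeas \<rho> f (A i))) \<le> emeasure ?D (A i)" for i
    proof -
      have "ennreal (cmod (LINT x:A i|\<rho>. f x)) \<le>
          (\<integral>\<^sup>+x. norm (indicator (A i) x *\<^sub>R f x) \<partial>\<rho>)"
        unfolding set_lebesgue_integral_def
        using set_integrable_of_integrable[OF f Ai[of i]]
        by (intro integral_norm_bound_ennreal) (simp add: set_integrable_def)
      also have "\<dots> = emeasure ?D (A i)"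
        using Ai by (auto simp: emeasure_density intro!: nn_integral_cong split: split_indicator)
      finally show ?thesis using Ai by (simp add: cmeas_def)
    qed
    then have "(\<Sum>i. ennreal (cmod (cmeas \<rho> f (A i)))) \<le> (\<Sum>i. emeasure ?D (A i))"
      by (intro suminf_le) auto
    also have "\<dots> = emeasure ?D E"
      using A sets by (subst suminf_emeasure) auto
    finally show "(\<Sum>i. ennreal (cmod (cmeas \<rho> f (A i)))) \<le> emeasure ?D E" .
  qed
  show "emeasure ?D E \<le> ?S"
  proof (rule ennreal_le_epsilon)
    fix e :: real assume e: "0 < e"
    \<comment> \<open>The mesh makes the total loss \<open>4 * d * measure \<rho> E\<close> at most
      \<open>e\<close>: values in one cell differ by at most \<open>2 * d\<close>, and
      \<open>emeasure_density_cell_le\<close> doubles this.\<close>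
    define d where "d = e / (4 * (measure \<rho> E + 1))"
    have R: "0 < measure \<rho> E + 1" by (simp add: add_nonneg_pos)
    have d: "0 < d" using e R unfolding d_def by (simp add: zero_less_mult_iff)
    define cell where "cell z = (\<lfloor>Re z / d\<rfloor>, \<lfloor>Im z / d\<rfloor>)" for z
    have cell: "cmod (z - w) \<le> 2 * d" if "cell z = cell w" for z w
    proof -
      have fl: "\<bar>a - b\<bar> \<le> d" if "\<lfloor>a / d\<rfloor> = \<lfloor>b / d\<rfloor>" for a b :: real
      proof -
        have "\<bar>a / d - b / d\<bar> \<le> 1"
          using that floor_correct[of "a / d"] floor_correct[of "b / d"] by linarith
        then show ?thesis using d by (simp add: diff_divide_distrib[symmetric] abs_divide)
      qed
      have "\<bar>Re z - Re w\<bar> \<le> d" "\<bar>Im z - Im w\<bar> \<le> d"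
        using that fl by (auto simp: cell_def)
      then show ?thesis using cmod_le[of "z - w"] by simp
    qed
    \<comment> \<open>The cells are numbered through \<open>to_nat\<close>; an index that is not the
      code of a pair of integers yields the empty set, and disjointness is immediate.\<close>
    define A where "A k = {x \<in> space \<rho>. x \<in> E \<and> cell (f x) = from_nat k \<and> to_nat (cell (f x)) = k}"
      for k :: nat
    have A: "A k \<in> sets \<rho>" for k
    proof -
      obtain i j where "from_nat k = (i :: int, j :: int)" by (cases "from_nat k :: int \<times> int") auto
      then have "A k = (if to_nat (i, j) = k then
          {x \<in> space \<rho>. x \<in> E \<and> \<lfloor>Re (f x) / d\<rfloor> = i \<and> \<lfloor>Im (f x) / d\<rfloor> = j} else {})"
        unfolding A_def cell_def by auto
      then show ?thesis using E by simp
    qed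
    then have A': "range A \<subseteq> sets \<rho>" by auto
    have dis: "disjoint_family A" unfolding disjoint_family_on_def A_def by auto
    have UN: "(\<Union>k. A k) = E" using sets.sets_into_space[OF E] unfolding A_def by auto
    have "emeasure ?D E = (\<Sum>k. emeasure ?D (A k))"
      using A dis UN by (subst suminf_emeasure) auto
    also have "\<dots> \<le> (\<Sum>k. ennreal (cmod (cmeas \<rho> f (A k))) + ennreal (4 * d) * emeasure \<rho> (A k))"
    proof (intro suminf_le)
      fix k
      have "emeasure ?D (A k) \<le>
          ennreal (cmod (LINT x:A k|\<rho>. f x)) + ennreal (2 * (2 * d)) * emeasure \<rho> (A k)"
        by (rule emeasure_density_cell_le[OF fin f A]) (auto simp: A_def intro!: cell)
      then show "emeasure ?D (A k) \<le>
          ennreal (cmod (cmeas \<rho> f (A k))) + ennreal (4 * d) * emeasure \<rho> (A k)"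
        using A by (simp add: cmeas_def)
    qed auto
    also have "\<dots> = (\<Sum>k. ennreal (cmod (cmeas \<rho> f (A k)))) + ennreal (4 * d) * emeasure \<rho> E"
      using suminf_emeasure[of A \<rho>] A' dis UN by (subst suminf_add[symmetric]) simp_all
    also have "\<dots> \<le> ?S + ennreal e"
    proof (rule add_mono)
      show "(\<Sum>k. ennreal (cmod (cmeas \<rho> f (A k)))) \<le> ?S"
        by (rule SUP_upper) (use A dis UN sets in auto)
      have "4 * d * measure \<rho> E \<le> e"
        using e R by (simp add: d_def divide_simps)
      then show "ennreal (4 * d) * emeasure \<rho> E \<le> ennreal e"
        using d by (simp add: emeasure_eq_measure ennreal_mult[symmetric] ennreal_leI)
    qed
    finally show "emeasure ?D E \<le> ?S + ennreal e" .
  qed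
qed

lemma variation_cmeas:
  assumes fin: "finite_measure \<rho>" and f: "integrable \<rho> f" and sets: "sets M = sets \<rho>"
  shows "variation M (cmeas \<rho> f) = density \<rho> (\<lambda>x. ennreal (cmod (f x)))"
proof -
  let ?D = "density \<rho> (\<lambda>x. ennreal (cmod (f x)))"
  have "variation M (cmeas \<rho> f) = measure_of (space ?D) (sets ?D) (emeasure ?D)"
    unfolding variation_def sets_density space_density sets sets_eq_imp_space_eq[OF sets]
    by (rule measure_of_eq[OF sets.space_closed])
      (use partition_sup_cmeas[OF fin f sets] sets in \<open>simp add: sets.sigma_sets_eq\<close>)
  then show ?thesis by (simp only: measure_of_of_measure)
qed

section \<open>Signed measures and their Jordan decomposition\<close>

definition signed_measure :: "'a measure \<Rightarrow> ('a set \<Rightarrow> real) \<Rightarrow> bool" where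
  "signed_measure M \<nu> \<longleftrightarrow> \<nu> {} = 0 \<and>
     (\<forall>A. range A \<subseteq> sets M \<longrightarrow> disjoint_family A \<longrightarrow>
        (\<lambda>i::nat. \<nu> (A i)) sums \<nu> (\<Union>i. A i))"

lemma signed_measureI:
  assumes "\<nu> {} = 0"
    and "\<And>A :: nat \<Rightarrow> 'a set. range A \<subseteq> sets M \<Longrightarrow> disjoint_family A \<Longrightarrow> (\<lambda>i. \<nu> (A i)) sums \<nu> (\<Union>i. A i)"
  shows "signed_measure M \<nu>"
  using assms unfolding signed_measure_def by blast

lemma signed_measureD:
  assumes "signed_measure M \<nu>"
  shows "\<nu> {} = 0"
    and "range A \<subseteq> sets M \<Longrightarrow> disjoint_family A \<Longrightarrow> (\<lambda>i::nat. \<nu> (A i)) sums \<nu> (\<Union>i. A i)"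
  using assms unfolding signed_measure_def by blast+

lemma signed_measure_uminus:
  assumes "signed_measure M \<nu>"
  shows "signed_measure M (\<lambda>E. - \<nu> E)"
  by (rule signed_measureI) (simp_all add: signed_measureD[OF assms] sums_minus)

lemma signed_measure_Re_Im:
  assumes "\<mu> \<in> complex_measures M"
  shows "signed_measure M (\<lambda>E. Re (\<mu> E))" "signed_measure M (\<lambda>E. Im (\<mu> E))"
  using assms unfolding complex_measures_def
  by (auto intro!: signed_measureI sums_Re sums_Im simp del: sums_complex_iff)

lemma signed_measure_Un:
  assumes \<nu>: "signed_measure M \<nu>" and AB: "A \<in> sets M" "B \<in> sets M" "A \<inter> B = {}"
  shows "\<nu> (A \<union> B) = \<nu> A + \<nu> B"
proof -
  have "disjoint_family (binaryset A B)"
    using AB(3) by (simp add: disjoint_family_on_def binaryset_def) blast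
  moreover have "range (binaryset A B) \<subseteq> sets M"
    using AB by (simp add: range_binaryset_eq)
  ultimately have "(\<lambda>i. \<nu> (binaryset A B i)) sums \<nu> (\<Union>i. binaryset A B i)"
    by (intro signed_measureD(2)[OF \<nu>])
  moreover have "(\<lambda>i. \<nu> (binaryset A B i)) sums (\<nu> A + \<nu> B)"
    by (intro binaryset_sums signed_measureD(1)[OF \<nu>])
  ultimately show ?thesis by (metis UN_binaryset_eq sums_unique2)
qed

lemma signed_measure_Diff:
  assumes "signed_measure M \<nu>" "A \<in> sets M" "B \<in> sets M" "A \<subseteq> B"
  shows "\<nu> (B - A) = \<nu> B - \<nu> A"
proof -
  have "A \<union> (B - A) = B" using assms(4) by blast
  then show ?thesis using signed_measure_Un[of M \<nu> A "B - A"] assms by auto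
qed

text \<open>The terms may be negative: truncation at zero makes \<open>ennreal\<close> subadditive,
  so every partial sum is bounded by the truncated series.\<close>

lemma ennreal_sums_le:
  assumes "f sums s"
  shows "ennreal s \<le> (\<Sum>i. ennreal (f i))"
proof (rule LIMSEQ_le_const2)
  show "(\<lambda>n. ennreal (\<Sum>i<n. f i)) \<longlonglongrightarrow> ennreal s"
    using assms unfolding sums_def by (intro tendsto_ennrealI)
  have "ennreal (\<Sum>i<n. f i) \<le> (\<Sum>i<n. ennreal (f i))" for n
  proof (induction n)
    case (Suc n)
    have "ennreal ((\<Sum>i<n. f i) + f n) \<le> ennreal (\<Sum>i<n. f i) + ennreal (f n)"
    proof -
      have "ennreal ((\<Sum>i<n. f i) + f n) \<le> ennreal (max 0 (\<Sum>i<n. f i) + max 0 (f n))"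
        by (intro ennreal_leI add_mono) auto
      also have "\<dots> = ennreal (max 0 (\<Sum>i<n. f i)) + ennreal (max 0 (f n))"
        by (rule ennreal_plus) auto
      also have "\<dots> = ennreal (\<Sum>i<n. f i) + ennreal (f n)"
        by (simp add: max_def ennreal_neg)
      finally show ?thesis .
    qed
    from order_trans[OF this add_right_mono[OF Suc]] show ?case by simp
  qed simp
  moreover have "(\<Sum>i<n. ennreal (f i)) \<le> (\<Sum>i. ennreal (f i))" for n
    using sum_le_suminf[OF summableI, of "{..<n}" "\<lambda>i. ennreal (f i)"] by simp
  ultimately have "ennreal (\<Sum>i<n. f i) \<le> (\<Sum>i. ennreal (f i))" for n
    by (rule order_trans)
  then show "\<exists>N. \<forall>n\<ge>N. ennreal (\<Sum>i<n. f i) \<le> (\<Sum>i. ennreal (f i))" by blast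
qed

text \<open>The positive variation as a plain set function, that is, \<open>jordan_pos\<close>
  before \<open>measure_of\<close> is applied. The following lemmas show that it is a finite
  measure.\<close>

definition sup_charge :: "'a measure \<Rightarrow> ('a set \<Rightarrow> real) \<Rightarrow> 'a set \<Rightarrow> ennreal" where
  "sup_charge M \<nu> E = (SUP F\<in>{F \<in> sets M. F \<subseteq> E}. ennreal (\<nu> F))"

lemma sup_charge_upper: "F \<in> sets M \<Longrightarrow> F \<subseteq> E \<Longrightarrow> ennreal (\<nu> F) \<le> sup_charge M \<nu> E"
  unfolding sup_charge_def by (rule SUP_upper) simp

lemma sup_charge_mono: "E \<subseteq> E' \<Longrightarrow> sup_charge M \<nu> E \<le> sup_charge M \<nu> E'"
  unfolding sup_charge_def by (rule SUP_subset_mono) auto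

text \<open>A set of nonpositive charge contributes zero after truncation, so the other set alone
  competes in the supremum for the union; if both charges are nonnegative, the disjoint union
  competes.\<close>

lemma sup_charge_superadditive:
  assumes \<nu>: "signed_measure M \<nu>" and AB: "A \<inter> B = {}"
  shows "sup_charge M \<nu> A + sup_charge M \<nu> B \<le> sup_charge M \<nu> (A \<union> B)"
proof -
  have *: "ennreal (\<nu> F) + ennreal (\<nu> F') \<le> sup_charge M \<nu> (A \<union> B)"
    if F: "F \<in> sets M" "F \<subseteq> A" "F' \<in> sets M" "F' \<subseteq> B" for F F'
  proof -
    consider "\<nu> F \<le> 0" | "\<nu> F' \<le> 0" | "0 \<le> \<nu> F" "0 \<le> \<nu> F'" by linarith
    then show ?thesis
    proof cases
      case 3
      then have "ennreal (\<nu> F) + ennreal (\<nu> F') = ennreal (\<nu> (F \<union> F'))"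
        using F AB by (subst signed_measure_Un[OF \<nu>]) (auto simp: ennreal_plus)
      then show ?thesis using F sup_charge_upper[of "F \<union> F'" M "A \<union> B" \<nu>] by auto
    qed (use F sup_charge_upper[of F M "A \<union> B" \<nu>] sup_charge_upper[of F' M "A \<union> B" \<nu>]
      in \<open>auto simp: ennreal_neg\<close>)
  qed
  have ne: "{F \<in> sets M. F \<subseteq> X} \<noteq> {}" for X by auto
  show ?thesis
    unfolding sup_charge_def[of M \<nu> A] sup_charge_def[of M \<nu> B]
    unfolding ennreal_SUP_add_left[OF ne, symmetric]
  proof (rule SUP_least)
    fix F assume "F \<in> {F \<in> sets M. F \<subseteq> A}"
    then show "ennreal (\<nu> F) + (SUP F\<in>{F \<in> sets M. F \<subseteq> B}. ennreal (\<nu> F)) \<le>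
        sup_charge M \<nu> (A \<union> B)"
      using * by (subst ennreal_SUP_add_right) (auto intro!: SUP_least)
  qed
qed

text \<open>Superadditivity bounds the finite sums from above. Conversely, a competitor
  \<open>F\<close> for the union is cut along the sets \<open>A i\<close>, and the charges of the
  pieces sum to that of \<open>F\<close>.\<close>

lemma countably_additive_sup_charge:
  assumes \<nu>: "signed_measure M \<nu>"
  shows "countably_additive (sets M) (sup_charge M \<nu>)"
proof (rule countably_additiveI)
  fix A :: "nat \<Rightarrow> 'a set"
  assume A: "range A \<subseteq> sets M" "disjoint_family A" "(\<Union>i. A i) \<in> sets M"
  show "(\<Sum>i. sup_charge M \<nu> (A i)) = sup_charge M \<nu> (\<Union>i. A i)"
  proof (rule antisym)
    have "(\<Sum>i<n. sup_charge M \<nu> (A i)) \<le> sup_charge M \<nu> (\<Union>i<n. A i)" for n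
    proof (induction n)
      case (Suc n)
      have "A i \<inter> A n = {}" if "i < n" for i
        using that by (intro disjoint_family_onD[OF A(2)]) auto
      then have "(\<Union>i<n. A i) \<inter> A n = {}" by blast
      have "(\<Sum>i<Suc n. sup_charge M \<nu> (A i)) \<le>
          sup_charge M \<nu> (\<Union>i<n. A i) + sup_charge M \<nu> (A n)"
        using Suc by (auto intro: add_right_mono)
      also have "\<dots> \<le> sup_charge M \<nu> ((\<Union>i<n. A i) \<union> A n)"
        by (rule sup_charge_superadditive[OF \<nu>]) fact
      also have "(\<Union>i<n. A i) \<union> A n = (\<Union>i<Suc n. A i)" by (auto simp: less_Suc_eq)
      finally show ?case .
    qed simp
    then have "(\<Sum>i<n. sup_charge M \<nu> (A i)) \<le> sup_charge M \<nu> (\<Union>i. A i)" for n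
      by (rule order_trans) (intro sup_charge_mono, auto)
    then show "(\<Sum>i. sup_charge M \<nu> (A i)) \<le> sup_charge M \<nu> (\<Union>i. A i)"
      by (intro suminf_le_const summableI)
    show "sup_charge M \<nu> (\<Union>i. A i) \<le> (\<Sum>i. sup_charge M \<nu> (A i))"
      unfolding sup_charge_def[of M \<nu> "\<Union>i. A i"]
    proof (rule SUP_least)
      fix F assume "F \<in> {F \<in> sets M. F \<subseteq> (\<Union>i. A i)}"
      then have F: "F \<in> sets M" "F \<subseteq> (\<Union>i. A i)" by auto
      have "disjoint_family (\<lambda>i. F \<inter> A i)"
        using A(2) unfolding disjoint_family_on_def by blast
      moreover have "range (\<lambda>i. F \<inter> A i) \<subseteq> sets M" using A F by auto
      ultimately have "(\<lambda>i. \<nu> (F \<inter> A i)) sums \<nu> (\<Union>i. F \<inter> A i)"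
        using \<nu> unfolding signed_measure_def by blast
      also have "(\<Union>i. F \<inter> A i) = F" using F by blast
      finally have "ennreal (\<nu> F) \<le> (\<Sum>i. ennreal (\<nu> (F \<inter> A i)))" by (rule ennreal_sums_le)
      also have "\<dots> \<le> (\<Sum>i. sup_charge M \<nu> (A i))"
        using A F by (intro suminf_le sup_charge_upper) auto
      finally show "ennreal (\<nu> F) \<le> (\<Sum>i. sup_charge M \<nu> (A i))" .
    qed
  qed
qed

lemma emeasure_jordan_pos:
  assumes \<nu>: "signed_measure M \<nu>" and E: "E \<in> sets M"
  shows "emeasure (jordan_pos M \<nu>) E = sup_charge M \<nu> E"
proof (rule emeasure_measure_of)
  show "jordan_pos M \<nu> = measure_of (space M) (sets M) (sup_charge M \<nu>)"
    by (simp add: jordan_pos_def sup_charge_def[abs_def])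
  show "sets M \<subseteq> Pow (space M)" by (rule sets.space_closed)
  have "sup_charge M \<nu> {} = 0"
    using \<nu> by (auto simp: sup_charge_def signed_measure_def intro!: antisym SUP_least)
  then show "positive (sets (jordan_pos M \<nu>)) (sup_charge M \<nu>)" by (simp add: positive_def)
  show "countably_additive (sets (jordan_pos M \<nu>)) (sup_charge M \<nu>)"
    using countably_additive_sup_charge[OF \<nu>] by (simp add: jordan_pos_def)
  show "E \<in> sets (jordan_pos M \<nu>)" using E by (simp add: jordan_pos_def)
qed

text \<open>A set of infinite positive variation contains another such set for which the removed
  piece has charge at least 1 in absolute value. Iteration yields disjoint pieces whose charges
  would have to form a convergent series.\<close>

lemma sup_charge_finite:
  assumes \<nu>: "signed_measure M \<nu>" and E: "E \<in> sets M"
  shows "sup_charge M \<nu> E < \<infinity>"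
proof (rule ccontr)
  assume inf: "\<not> sup_charge M \<nu> E < \<infinity>"
  define bad where "bad X \<longleftrightarrow> X \<in> sets M \<and> sup_charge M \<nu> X = \<infinity>" for X
  have step: "\<exists>Y. bad Y \<and> Y \<subseteq> X \<and> 1 \<le> \<bar>\<nu> (X - Y)\<bar>" if X: "bad X" for X
  proof -
    \<comment> \<open>With \<open>\<nu> F\<close> above \<open>1 + \<bar>\<nu> X\<bar>\<close>, both
      \<open>F\<close> and \<open>X - F\<close> have charge at least 1 in absolute value, so either
      of them may be the piece that is removed.\<close>
    have "ennreal (1 + \<bar>\<nu> X\<bar>) < sup_charge M \<nu> X"
      using X by (simp add: bad_def ennreal_less_top)
    then obtain F where F: "F \<in> sets M" "F \<subseteq> X" "ennreal (1 + \<bar>\<nu> X\<bar>) < ennreal (\<nu> F)"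
      unfolding sup_charge_def less_SUP_iff by auto
    then have F': "1 + \<bar>\<nu> X\<bar> < \<nu> F" by (subst (asm) ennreal_less_iff) auto
    have XF: "X \<in> sets M" "X - F \<in> sets M" using X F by (auto simp: bad_def)
    have "sup_charge M \<nu> F + sup_charge M \<nu> (X - F) = sup_charge M \<nu> X"
    proof -
      have "emeasure (jordan_pos M \<nu>) F + emeasure (jordan_pos M \<nu>) (X - F) =
          emeasure (jordan_pos M \<nu>) (F \<union> (X - F))"
        using F XF by (intro plus_emeasure) (auto simp: jordan_pos_def)
      moreover have "F \<union> (X - F) = X" using F by blast
      ultimately show ?thesis using F XF by (simp add: emeasure_jordan_pos[OF \<nu>])
    qed
    then consider "sup_charge M \<nu> F = \<infinity>" | "sup_charge M \<nu> (X - F) = \<infinity>"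
      using X by (auto simp: bad_def)
    then show ?thesis
    proof cases
      case 1
      then show ?thesis
        using F F' XF signed_measure_Diff[OF \<nu> F(1) XF(1) F(2)]
        by (intro exI[of _ F]) (auto simp: bad_def)
    next
      case 2
      moreover have "X - (X - F) = F" using F by blast
      ultimately show ?thesis
        using F F' XF by (intro exI[of _ "X - F"]) (auto simp: bad_def)
    qed
  qed
  then obtain nxt where nxt: "\<And>X. bad X \<Longrightarrow> bad (nxt X) \<and> nxt X \<subseteq> X \<and> 1 \<le> \<bar>\<nu> (X - nxt X)\<bar>"
    by metis
  define X where "X n = (nxt ^^ n) E" for n
  have X_Suc: "X (Suc n) = nxt (X n)" for n by (simp add: X_def)
  have bad: "bad (X n)" for n
  proof (induction n)
    case 0
    show ?case using inf E by (simp add: bad_def X_def flip: less_top)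
  qed (use nxt X_Suc in auto)
  have dec: "X n \<subseteq> X m" if "m \<le> n" for m n
    by (rule lift_Suc_antimono_le[OF _ that]) (use nxt bad X_Suc in auto)
  define D where "D n = X n - X (Suc n)" for n
  have "range D \<subseteq> sets M" using bad by (auto simp: D_def bad_def)
  moreover have "disjoint_family D"
    unfolding disjoint_family_on_def D_def
    by (metis (no_types, lifting) Diff_iff Int_emptyI dec Suc_leI linorder_neqE_nat subsetD)
  ultimately have "(\<lambda>i. \<nu> (D i)) sums \<nu> (\<Union>i. D i)"
    using \<nu> by (auto simp: signed_measure_def)
  then have "(\<lambda>i. \<nu> (D i)) \<longlonglongrightarrow> 0" by (auto simp: sums_iff intro: summable_LIMSEQ_zero)
  then have "\<forall>\<^sub>F i in sequentially. \<bar>\<nu> (D i)\<bar> < 1"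
    by (auto dest!: tendstoD[where e=1])
  then obtain i where "\<bar>\<nu> (D i)\<bar> < 1" by (auto simp: eventually_sequentially)
  moreover have "1 \<le> \<bar>\<nu> (D i)\<bar>" using nxt[OF bad[of i]] by (simp add: D_def X_Suc)
  ultimately show False by simp
qed

lemma finite_measure_jordan_pos:
  assumes "signed_measure M \<nu>"
  shows "finite_measure (jordan_pos M \<nu>)"
proof (rule finite_measureI)
  have "space (jordan_pos M \<nu>) = space M" by (simp add: jordan_pos_def)
  then show "emeasure (jordan_pos M \<nu>) (space (jordan_pos M \<nu>)) \<noteq> \<infinity>"
    using emeasure_jordan_pos[OF assms sets.top] sup_charge_finite[OF assms sets.top] by simp
qed

text \<open>For \<open>F \<subseteq> E\<close> the identity
  \<open>\<nu> F = \<nu> E - \<nu> (E - F)\<close> bounds \<open>\<nu> F\<close> by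
  \<open>\<nu> E\<close> plus the negative variation of \<open>E\<close>. The supremum over
  \<open>F\<close> gives one inequality, and the same argument for \<open>- \<nu>\<close> gives the
  other.\<close>

lemma jordan_decomposition:
  assumes \<nu>: "signed_measure M \<nu>" and E: "E \<in> sets M"
  shows "\<nu> E = measure (jordan_pos M \<nu>) E - measure (jordan_pos M (\<lambda>E. - \<nu> E)) E"
proof -
  have le: "measure (jordan_pos M \<nu>) E \<le> \<nu> E + measure (jordan_pos M (\<lambda>E. - \<nu> E)) E"
    if \<nu>: "signed_measure M \<nu>" for \<nu>
  proof -
    let ?p = "jordan_pos M \<nu>" and ?n = "jordan_pos M (\<lambda>E. - \<nu> E)"
    interpret p: finite_measure ?p by (rule finite_measure_jordan_pos[OF \<nu>])
    interpret n: finite_measure ?n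
      by (rule finite_measure_jordan_pos[OF signed_measure_uminus[OF \<nu>]])
    have n_ge: "- \<nu> F \<le> measure ?n E" if "F \<in> sets M" "F \<subseteq> E" for F
    proof -
      have "ennreal (- \<nu> F) \<le> emeasure ?n E"
        using sup_charge_upper[OF that, of "\<lambda>E. - \<nu> E"]
        by (simp add: emeasure_jordan_pos[OF signed_measure_uminus[OF \<nu>] E])
      then show ?thesis
        by (simp add: n.emeasure_eq_measure ennreal_le_iff)
    qed
    have 0: "0 \<le> \<nu> E + measure ?n E" using n_ge[OF E] by simp
    have "emeasure ?p E \<le> ennreal (\<nu> E + measure ?n E)"
      unfolding emeasure_jordan_pos[OF \<nu> E] sup_charge_def
    proof (rule SUP_least)
      fix F assume F: "F \<in> {F \<in> sets M. F \<subseteq> E}"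
      then show "ennreal (\<nu> F) \<le> ennreal (\<nu> E + measure ?n E)"
        using n_ge[of "E - F"] signed_measure_Diff[OF \<nu>, of F E] E
        by (intro ennreal_leI) auto
    qed
    then show ?thesis using 0 by (simp add: p.emeasure_eq_measure)
  qed
  show ?thesis using le[OF \<nu>] le[OF signed_measure_uminus[OF \<nu>]] by simp
qed

section \<open>Sums of measures and Radon-Nikodym densities\<close>

definition add_measure :: "'a measure \<Rightarrow> 'a measure \<Rightarrow> 'a measure" where
  "add_measure M N = measure_of (space M) (sets M) (\<lambda>E. emeasure M E + emeasure N E)"

lemma sets_add_measure [simp, measurable_cong]: "sets (add_measure M N) = sets M"
  and space_add_measure [simp]: "space (add_measure M N) = space M"
  by (simp_all add: add_measure_def)

lemma emeasure_add_measure: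
  assumes sets: "sets N = sets M" and E: "E \<in> sets M"
  shows "emeasure (add_measure M N) E = emeasure M E + emeasure N E"
proof (rule emeasure_measure_of[OF add_measure_def sets.space_closed])
  show "positive (sets (add_measure M N)) (\<lambda>E. emeasure M E + emeasure N E)"
    by (simp add: positive_def)
  show "countably_additive (sets (add_measure M N)) (\<lambda>E. emeasure M E + emeasure N E)"
  proof (rule countably_additiveI)
    fix A :: "nat \<Rightarrow> 'a set"
    assume A: "range A \<subseteq> sets (add_measure M N)" "disjoint_family A"
    then show "(\<Sum>i. emeasure M (A i) + emeasure N (A i)) =
        emeasure M (\<Union> (range A)) + emeasure N (\<Union> (range A))"
      using sets suminf_emeasure[of A M] suminf_emeasure[of A N]
      by (simp add: suminf_add[symmetric])
  qed
  show "E \<in> sets (add_measure M N)" using E by simp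
qed

lemma finite_measure_add_measure:
  assumes "finite_measure M" "finite_measure N" "sets N = sets M"
  shows "finite_measure (add_measure M N)"
proof (rule finite_measureI)
  interpret M: finite_measure M by fact
  interpret N: finite_measure N by fact
  show "emeasure (add_measure M N) (space (add_measure M N)) \<noteq> \<infinity>"
    by (simp add: emeasure_add_measure[OF assms(3)] M.emeasure_eq_measure N.emeasure_eq_measure)
qed

lemma real_density_representation:
  assumes "finite_measure \<rho>" "finite_measure m" "sets m = sets \<rho>" "absolutely_continuous \<rho> m"
  obtains g :: "'a \<Rightarrow> real" where "integrable \<rho> g" "\<And>E. E \<in> sets \<rho> \<Longrightarrow> measure m E = (LINT x:E|\<rho>. g x)"
proof -
  interpret \<rho>: finite_measure \<rho> by fact
  interpret m: finite_measure m by fact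
  obtain D where D: "D \<in> borel_measurable \<rho>" "AE x in \<rho>. RN_deriv \<rho> m x = ennreal (D x)"
    "\<And>x. 0 \<le> D x"
    using \<rho>.real_RN_deriv[OF assms(2,4,3)] by metis
  have "density \<rho> (RN_deriv \<rho> m) = m" by (rule \<rho>.density_RN_deriv[OF assms(4,3)])
  then have m: "m = density \<rho> D"
    using D by (subst density_cong[symmetric, of "RN_deriv \<rho> m"]) auto
  have em: "emeasure m E = (\<integral>\<^sup>+x. ennreal (indicator E x *\<^sub>R D x) \<partial>\<rho>)" if "E \<in> sets \<rho>" for E
    using D that by (auto simp: m emeasure_density intro!: nn_integral_cong split: split_indicator)
  have int: "integrable \<rho> (\<lambda>x. indicator E x *\<^sub>R D x)" if "E \<in> sets \<rho>" for E
  proof (rule integrableI_nonneg)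
    show "(\<integral>\<^sup>+x. ennreal (indicator E x *\<^sub>R D x) \<partial>\<rho>) < \<infinity>"
      unfolding em[OF that, symmetric] by (simp add: m.emeasure_eq_measure)
  qed (use D that in auto)
  show thesis
  proof
    show "integrable \<rho> D"
      using int[OF sets.top] by (rule Bochner_Integration.integrable_cong[THEN iffD1, rotated 2]) auto
    fix E assume E: "E \<in> sets \<rho>"
    have "emeasure m E = ennreal (LINT x:E|\<rho>. D x)"
      unfolding em[OF E] set_lebesgue_integral_def
      using D int[OF E] by (intro nn_integral_eq_integral) auto
    moreover have "0 \<le> (LINT x:E|\<rho>. D x)"
      unfolding set_lebesgue_integral_def using D by (intro integral_nonneg_AE) auto
    ultimately show "measure m E = (LINT x:E|\<rho>. D x)"
      by (simp add: Sigma_Algebra.measure_def)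
  qed
qed

text \<open>Every measurable subset of a \<open>\<rho>\<close>-null set has charge 0, so the
  supremum in \<open>jordan_pos\<close> vanishes there: both Jordan parts are absolutely continuous,
  and Radon-Nikodym applies to each.\<close>

lemma signed_density_representation:
  assumes \<nu>: "signed_measure M \<nu>" and \<rho>: "finite_measure \<rho>" and sets: "sets \<rho> = sets M"
    and null: "\<And>E. E \<in> sets M \<Longrightarrow> emeasure \<rho> E = 0 \<Longrightarrow> \<nu> E = 0"
  obtains g where "integrable \<rho> g" "\<And>E. E \<in> sets M \<Longrightarrow> \<nu> E = (LINT x:E|\<rho>. g x)"
proof -
  have ac: "absolutely_continuous \<rho> (jordan_pos M \<nu>)"
    if \<nu>: "signed_measure M \<nu>" "\<And>E. E \<in> sets M \<Longrightarrow> emeasure \<rho> E = 0 \<Longrightarrow> \<nu> E = 0" for \<nu>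
    unfolding absolutely_continuous_def
  proof
    fix E assume "E \<in> null_sets \<rho>"
    then have E: "E \<in> sets M" "emeasure \<rho> E = 0" using sets by auto
    have "\<nu> F = 0" if "F \<in> sets M" "F \<subseteq> E" for F
    proof (rule \<nu>(2)[OF that(1)])
      have "emeasure \<rho> F \<le> emeasure \<rho> E" using that E sets by (intro emeasure_mono) auto
      then show "emeasure \<rho> F = 0" using E by simp
    qed
    then have "emeasure (jordan_pos M \<nu>) E = 0"
      unfolding emeasure_jordan_pos[OF \<nu>(1) E(1)] sup_charge_def
      by (intro antisym SUP_least) auto
    then show "E \<in> null_sets (jordan_pos M \<nu>)" using E by (auto simp: jordan_pos_def)
  qed
  have sj: "sets (jordan_pos M \<nu>) = sets \<rho>" for \<nu> by (simp add: jordan_pos_def sets)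
  note \<nu>' = signed_measure_uminus[OF \<nu>]
  obtain g where g: "integrable \<rho> g"
    "\<And>E. E \<in> sets \<rho> \<Longrightarrow> measure (jordan_pos M \<nu>) E = (LINT x:E|\<rho>. g x)"
    using real_density_representation[OF \<rho> finite_measure_jordan_pos[OF \<nu>] sj ac[OF \<nu> null]] by metis
  obtain h where h: "integrable \<rho> h"
    "\<And>E. E \<in> sets \<rho> \<Longrightarrow> measure (jordan_pos M (\<lambda>E. - \<nu> E)) E = (LINT x:E|\<rho>. h x)"
    using real_density_representation[OF \<rho> finite_measure_jordan_pos[OF \<nu>'] sj ac[OF \<nu>']] null
    by (metis neg_equal_0_iff_equal)
  show thesis
  proof
    show "integrable \<rho> (\<lambda>x. g x - h x)" using g h by simp
    fix E assume E: "E \<in> sets M"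
    then have E': "E \<in> sets \<rho>" using sets by simp
    show "\<nu> E = (LINT x:E|\<rho>. g x - h x)"
      using jordan_decomposition[OF \<nu> E] g h E'
      by (simp add: set_integral_diff set_integrable_of_integrable)
  qed
qed

lemma complex_density_representation:
  assumes \<mu>: "\<mu> \<in> complex_measures M" and \<rho>: "finite_measure \<rho>" and sets: "sets \<rho> = sets M"
    and null: "\<And>E. E \<in> sets M \<Longrightarrow> emeasure \<rho> E = 0 \<Longrightarrow> \<mu> E = 0"
  obtains f where "integrable \<rho> f" "\<mu> = cmeas \<rho> f"
proof -
  obtain g where g: "integrable \<rho> g" "\<And>E. E \<in> sets M \<Longrightarrow> Re (\<mu> E) = (LINT x:E|\<rho>. g x)"
    using signed_density_representation[OF signed_measure_Re_Im(1)[OF \<mu>] \<rho> sets] null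
    by (metis zero_complex.simps(1))
  obtain h where h: "integrable \<rho> h" "\<And>E. E \<in> sets M \<Longrightarrow> Im (\<mu> E) = (LINT x:E|\<rho>. h x)"
    using signed_density_representation[OF signed_measure_Re_Im(2)[OF \<mu>] \<rho> sets] null
    by (metis zero_complex.simps(2))
  let ?f = "\<lambda>x. complex_of_real (g x) + \<i> * complex_of_real (h x)"
  have f: "integrable \<rho> ?f" using g h by (intro Bochner_Integration.integrable_add integrable_mult_right) auto
  have "\<mu> E = cmeas \<rho> ?f E" for E
  proof (cases "E \<in> sets M")
    case True
    then have E: "E \<in> sets \<rho>" using sets by simp
    have i: "integrable \<rho> (\<lambda>x. indicator E x *\<^sub>R ?f x)"
      using set_integrable_of_integrable[OF f E] by (simp add: set_integrable_def)
    have "Re (cmeas \<rho> ?f E) = (LINT x:E|\<rho>. g x)" "Im (cmeas \<rho> ?f E) = (LINT x:E|\<rho>. h x)"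
      using E by (simp_all add: cmeas_def set_lebesgue_integral_def integral_Re[OF i, symmetric]
          integral_Im[OF i, symmetric])
    then show ?thesis using g h True by (simp add: complex_eq_iff)
  next
    case False
    then show ?thesis using \<mu> sets by (simp add: cmeas_def complex_measures_def)
  qed
  then have "\<mu> = cmeas \<rho> ?f" by blast
  with f show thesis by (rule that)
qed

text \<open>The sum of the four Jordan parts dominates \<open>\<mu>\<close>. This reduces facts
  about an arbitrary complex measure to facts about densities.\<close>

lemma complex_measure_ex_density:
  assumes \<mu>: "\<mu> \<in> complex_measures M"
  obtains \<rho> f where "finite_measure \<rho>" "sets \<rho> = sets M" "integrable \<rho> f" "\<mu> = cmeas \<rho> f"
proof -
  note R = signed_measure_Re_Im(1)[OF \<mu>] and I = signed_measure_Re_Im(2)[OF \<mu>]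
  note R' = signed_measure_uminus[OF R] and I' = signed_measure_uminus[OF I]
  define a where "a = jordan_pos M (\<lambda>E. Re (\<mu> E))"
  define b where "b = jordan_pos M (\<lambda>E. - Re (\<mu> E))"
  define c where "c = jordan_pos M (\<lambda>E. Im (\<mu> E))"
  define d where "d = jordan_pos M (\<lambda>E. - Im (\<mu> E))"
  define \<rho> where "\<rho> = add_measure (add_measure a b) (add_measure c d)"
  have sets: "sets a = sets M" "sets b = sets M" "sets c = sets M" "sets d = sets M" "sets \<rho> = sets M"
    by (simp_all add: a_def b_def c_def d_def \<rho>_def jordan_pos_def)
  have fin: "finite_measure \<rho>"
    unfolding \<rho>_def a_def b_def c_def d_def
    by (intro finite_measure_add_measure finite_measure_jordan_pos R R' I I')
      (simp_all add: jordan_pos_def)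
  have null: "\<mu> E = 0" if E: "E \<in> sets M" and 0: "emeasure \<rho> E = 0" for E
  proof -
    have "emeasure \<rho> E = emeasure a E + emeasure b E + (emeasure c E + emeasure d E)"
      unfolding \<rho>_def using E sets by (simp add: emeasure_add_measure)
    then have "measure a E = 0" "measure b E = 0" "measure c E = 0" "measure d E = 0"
      using 0 by (auto simp: Sigma_Algebra.measure_def)
    then show ?thesis
      using jordan_decomposition[OF R E] jordan_decomposition[OF I E]
      by (simp add: a_def b_def c_def d_def complex_eq_iff)
  qed
  from complex_density_representation[OF \<mu> fin sets(5) null]
  show thesis using that[OF fin sets(5)] by metis
qed

section \<open>Total variation and polar decomposition\<close>

lemma space_variation [simp]: "space (variation M \<mu>) = space M"
  and sets_variation [simp, measurable_cong]: "sets (variation M \<mu>) = sets M"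
  by (simp_all add: variation_def)

text \<open>If \<open>\<mu>\<close> has density \<open>f\<close> over \<open>\<rho>\<close>, its
  variation has density \<open>cmod (f x)\<close>; dividing \<open>f\<close> by its modulus leaves
  the phase \<open>u\<close>.\<close>

lemma polar_decomposition:
  assumes \<mu>: "\<mu> \<in> complex_measures M"
  shows finite_measure_variation: "finite_measure (variation M \<mu>)"
    and ex_polar: "\<exists>u \<in> borel_measurable M. (\<forall>x. cmod (u x) = 1) \<and> \<mu> = cmeas (variation M \<mu>) u"
proof -
  obtain \<rho> f where \<rho>: "finite_measure \<rho>" "sets \<rho> = sets M" and f: "integrable \<rho> f"
    and \<mu>_eq: "\<mu> = cmeas \<rho> f"
    using complex_measure_ex_density[OF \<mu>] by blast
  have V: "variation M \<mu> = density \<rho> (\<lambda>x. ennreal (cmod (f x)))"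
    unfolding \<mu>_eq using variation_cmeas[OF \<rho>(1) f] \<rho>(2) by simp
  have [measurable]: "f \<in> borel_measurable \<rho>" using f by auto
  show "finite_measure (variation M \<mu>)"
    using f by (intro finite_measureI)
      (simp add: V emeasure_density integrable_iff_bounded sets_eq_imp_space_eq[OF \<rho>(2), symmetric] cong: nn_integral_cong)
  \<comment> \<open>The value 1 at the zeros of \<open>f\<close>, a null set of the variation, makes
    \<open>u\<close> unimodular everywhere and not only almost everywhere.\<close>
  define u where "u x = (if f x = 0 then 1 else sgn (f x))" for x
  have [measurable]: "u \<in> borel_measurable \<rho>" unfolding u_def sgn_div_norm by measurable
  have u1: "cmod (u x) = 1" for x by (simp add: u_def norm_sgn)
  have fu: "cmod (f x) *\<^sub>R u x = f x" for x
    by (simp add: u_def sgn_div_norm)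
  have "\<mu> E = cmeas (variation M \<mu>) u E" for E
  proof (cases "E \<in> sets \<rho>")
    case True
    have "(LINT x:E|variation M \<mu>. u x) = (LINT x|\<rho>. cmod (f x) *\<^sub>R (indicator E x *\<^sub>R u x))"
      unfolding V set_lebesgue_integral_def using True by (subst integral_density) auto
    also have "\<dots> = (LINT x:E|\<rho>. f x)"
      unfolding set_lebesgue_integral_def
      by (intro Bochner_Integration.integral_cong) (auto simp: fu split: split_indicator)
    finally show ?thesis using True \<rho> by (simp add: cmeas_def \<mu>_eq)
  qed (simp add: cmeas_def \<mu>_eq \<rho>)
  then show "\<exists>u \<in> borel_measurable M. (\<forall>x. cmod (u x) = 1) \<and> \<mu> = cmeas (variation M \<mu>) u"
    using u1 \<rho>(2) by (intro bexI[of _ u]) (auto cong: measurable_cong_sets)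
qed

text \<open>The variation is the least measure dominating \<open>cmod (\<mu> E)\<close>, because
  each of its partition sums is bounded by the corresponding sum for \<open>P\<close>.\<close>

lemma emeasure_variation_le:
  assumes \<mu>: "\<mu> \<in> complex_measures M" and P: "sets P = sets M"
    and le: "\<And>E. E \<in> sets M \<Longrightarrow> ennreal (cmod (\<mu> E)) \<le> emeasure P E"
    and E: "E \<in> sets M"
  shows "emeasure (variation M \<mu>) E \<le> emeasure P E"
proof -
  obtain \<rho> f where \<rho>: "finite_measure \<rho>" "sets \<rho> = sets M" and f: "integrable \<rho> f"
    and \<mu>_eq: "\<mu> = cmeas \<rho> f"
    using complex_measure_ex_density[OF \<mu>] by blast
  have "emeasure (variation M \<mu>) E = emeasure (density \<rho> (\<lambda>x. ennreal (cmod (f x)))) E"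
    unfolding \<mu>_eq using variation_cmeas[OF \<rho>(1) f] \<rho>(2) by simp
  also have "\<dots> \<le> emeasure P E"
    unfolding partition_sup_cmeas[OF \<rho>(1) f \<rho>(2)[symmetric] E[folded \<rho>(2)], symmetric]
      \<mu>_eq[symmetric]
  proof (rule SUP_least)
    fix A assume A: "A \<in> {A :: nat \<Rightarrow> 'a set. range A \<subseteq> sets M \<and> disjoint_family A \<and> (\<Union>i. A i) = E}"
    then have "(\<Sum>i. ennreal (cmod (\<mu> (A i)))) \<le> (\<Sum>i. emeasure P (A i))"
      by (intro suminf_le le) auto
    also have "\<dots> = emeasure P E" using A P by (subst suminf_emeasure) auto
    finally show "(\<Sum>i. ennreal (cmod (\<mu> (A i)))) \<le> emeasure P E" .
  qed
  finally show ?thesis .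
qed

lemma cmod_le_variation:
  assumes \<mu>: "\<mu> \<in> complex_measures M"
  shows "cmod (\<mu> E) \<le> measure (variation M \<mu>) E"
proof (cases "E \<in> sets M")
  case True
  interpret V: finite_measure "variation M \<mu>" by (rule finite_measure_variation[OF \<mu>])
  obtain u where u: "u \<in> borel_measurable M" "\<And>x. cmod (u x) = 1" "\<mu> = cmeas (variation M \<mu>) u"
    using ex_polar[OF \<mu>] by blast
  have "integrable (variation M \<mu>) u"
    by (rule V.integrable_const_bound[where B=1]) (use u in auto)
  then have "integrable (variation M \<mu>) (\<lambda>x. indicator E x *\<^sub>R u x)"
    using True by (intro integrable_mult_indicator) auto
  then have "cmod (LINT x|variation M \<mu>. indicator E x *\<^sub>R u x) \<le>
      (LINT x|variation M \<mu>. indicator E x)"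
    by (rule norm_integral_le)
      (use True u(2) in \<open>auto simp: V.emeasure_eq_measure split: split_indicator\<close>)
  also have "(LINT x|variation M \<mu>. indicator E x *\<^sub>R u x) = cmeas (variation M \<mu>) u E"
    using True by (simp add: cmeas_def set_lebesgue_integral_def)
  finally show ?thesis using True u(3) by simp
qed (use \<mu> in \<open>simp add: complex_measures_def\<close>)

section \<open>Radon measures\<close>

lemma ex2I: "P a b \<Longrightarrow> \<exists>a b. P a b"
  by blast

lemma space_borel_of [simp]: "space (borel_of T) = topspace T"
  unfolding borel_of_def by (rule space_measure_of) (auto dest: openin_subset)

lemma sets_borel_of: "sets (borel_of T) = sigma_sets (topspace T) {U. openin T U}"
  unfolding borel_of_def by (rule sets_measure_of) (auto dest: openin_subset)

lemma openin_sets_borel_of: "openin T U \<Longrightarrow> U \<in> sets (borel_of T)"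
  unfolding sets_borel_of by (rule sigma_sets.Basic) simp

lemma closedin_sets_borel_of:
  assumes "closedin T C" shows "C \<in> sets (borel_of T)"
proof -
  have "topspace T - (topspace T - C) = C" using closedin_subset[OF assms] by blast
  moreover have "topspace T - (topspace T - C) \<in> sets (borel_of T)"
    using assms openin_sets_borel_of[of T "topspace T - C"] sets.compl_sets[of "topspace T - C" "borel_of T"]
    by (simp add: closedin_def)
  ultimately show ?thesis by simp
qed

lemma compactin_sets_borel_of: "Hausdorff_space T \<Longrightarrow> compactin T K \<Longrightarrow> K \<in> sets (borel_of T)"
  by (intro closedin_sets_borel_of compactin_imp_closedin)

lemma measurable_borel_of:
  assumes "continuous_map T T' f"
  shows "f \<in> measurable (borel_of T) (borel_of T')"
  unfolding borel_of_def[of T']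
proof (rule measurable_measure_of)
  show "{U. openin T' U} \<subseteq> Pow (topspace T')" by (auto dest: openin_subset)
  show "f \<in> space (borel_of T) \<rightarrow> topspace T'"
    using assms by (auto simp: continuous_map_def)
  fix U assume "U \<in> {U. openin T' U}"
  then have "openin T {x \<in> topspace T. f x \<in> U}" using assms by (auto simp: continuous_map_def)
  moreover have "{x \<in> topspace T. f x \<in> U} = f -` U \<inter> space (borel_of T)" by auto
  ultimately show "f -` U \<inter> space (borel_of T) \<in> sets (borel_of T)"
    by (metis openin_sets_borel_of)
qed

lemma borel_measurable_borel_of:
  assumes "continuous_map T euclideanreal f"
  shows "f \<in> borel_measurable (borel_of T)"
proof (rule borel_measurableI)
  fix S :: "real set" assume "open S"
  then have "openin T {x \<in> topspace T. f x \<in> S}" using assms by (auto simp: continuous_map_def)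
  moreover have "{x \<in> topspace T. f x \<in> S} = f -` S \<inter> space (borel_of T)" by auto
  ultimately show "f -` S \<inter> space (borel_of T) \<in> sets (borel_of T)"
    by (metis openin_sets_borel_of)
qed

text \<open>A sandwich form of regularity, equivalent for the variation of a complex measure to the
  infimum and supremum conditions of \<open>regular_measures\<close>. Smallness of
  \<open>U - K\<close> passes easily to sums of measures and to absolutely continuous
  measures.\<close>

definition radon :: "'a topology \<Rightarrow> 'a measure \<Rightarrow> bool" where
  "radon T \<rho> \<longleftrightarrow> finite_measure \<rho> \<and> sets \<rho> = sets (borel_of T) \<and>
     (\<forall>E\<in>sets \<rho>. \<forall>e>0. \<exists>K U. compactin T K \<and> openin T U \<and> K \<subseteq> E \<and> E \<subseteq> U \<and>
        measure \<rho> (U - K) < e)"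

lemma radonD:
  assumes "radon T \<rho>"
  shows radon_finite_measure: "finite_measure \<rho>" and radon_sets: "sets \<rho> = sets (borel_of T)"
    and radon_space: "space \<rho> = topspace T"
  using assms sets_eq_imp_space_eq[of \<rho> "borel_of T"] by (auto simp: radon_def)

lemma radon_approx:
  assumes "radon T \<rho>" "E \<in> sets (borel_of T)" "0 < e"
  obtains K U where "compactin T K" "openin T U" "K \<subseteq> E" "E \<subseteq> U" "measure \<rho> (U - K) < e"
  using assms unfolding radon_def by blast

lemma radon_regular_measures_iff:
  assumes H: "Hausdorff_space T" and \<mu>: "\<mu> \<in> complex_measures (borel_of T)"
  shows "\<mu> \<in> regular_measures T \<longleftrightarrow> radon T (variation (borel_of T) \<mu>)"
proof -
  let ?V = "variation (borel_of T) \<mu>"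
  interpret V: finite_measure ?V by (rule finite_measure_variation[OF \<mu>])
  have K_sets: "K \<in> sets (borel_of T)" if "compactin T K" for K
    using compactin_sets_borel_of[OF H that] .
  have D: "measure ?V (U - K) = measure ?V U - measure ?V K"
    if "openin T U" "compactin T K" "K \<subseteq> U" for U K
    using that K_sets openin_sets_borel_of by (intro V.finite_measure_Diff) auto
  show ?thesis
  proof
    assume reg: "\<mu> \<in> regular_measures T"
    show "radon T ?V"
      unfolding radon_def
    proof (intro conjI ballI allI impI)
      fix E and e :: real assume E: "E \<in> sets ?V" and e: "0 < e"
      then have E': "E \<in> sets (borel_of T)" by simp
      have inf: "emeasure ?V E = (INF U\<in>{U. openin T U \<and> E \<subseteq> U}. emeasure ?V U)"
        and sup: "emeasure ?V E = (SUP K\<in>{K. compactin T K \<and> K \<subseteq> E}. emeasure ?V K)"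
        using reg E' unfolding regular_measures_def by blast+
      have "emeasure ?V E < ennreal (measure ?V E + e / 2)"
        using e unfolding V.emeasure_eq_measure by (subst ennreal_less_iff) auto
      then have "(INF U\<in>{U. openin T U \<and> E \<subseteq> U}. emeasure ?V U) < ennreal (measure ?V E + e / 2)"
        unfolding inf .
      then obtain U where U: "openin T U" "E \<subseteq> U" "measure ?V U < measure ?V E + e / 2"
        unfolding INF_less_iff using e
        by (auto simp: V.emeasure_eq_measure ennreal_less_iff simp del: ennreal_plus)
      obtain K where K: "compactin T K" "K \<subseteq> E" "measure ?V E - e / 2 < measure ?V K"
      \<comment> \<open>A negative bound would be truncated by \<open>ennreal\<close>; in that case
        the empty set already serves as \<open>K\<close>.\<close>
      proof (cases "measure ?V E - e / 2 < 0")
        case True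
        then show thesis
          using that[of "{}"] by simp
      next
        case False
        then have "ennreal (measure ?V E - e / 2) < emeasure ?V E"
          using e unfolding V.emeasure_eq_measure by (subst ennreal_less_iff) auto
        then have "ennreal (measure ?V E - e / 2) < (SUP K\<in>{K. compactin T K \<and> K \<subseteq> E}. emeasure ?V K)"
          unfolding sup .
        then show thesis
          unfolding less_SUP_iff using False that
          by (auto simp: V.emeasure_eq_measure ennreal_less_iff)
      qed
      show "\<exists>K U. compactin T K \<and> openin T U \<and> K \<subseteq> E \<and> E \<subseteq> U \<and> measure ?V (U - K) < e"
        using U K D[of U K] by (intro ex2I[of _ K U]) auto
    qed (simp_all add: V.finite_measure_axioms)
  next
    assume r: "radon T ?V"
    have "emeasure ?V E = (INF U\<in>{U. openin T U \<and> E \<subseteq> U}. emeasure ?V U) \<and>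
          emeasure ?V E = (SUP K\<in>{K. compactin T K \<and> K \<subseteq> E}. emeasure ?V K)"
      if E: "E \<in> sets (borel_of T)" for E
    proof (intro conjI antisym)
      show "emeasure ?V E \<le> (INF U\<in>{U. openin T U \<and> E \<subseteq> U}. emeasure ?V U)"
        by (intro INF_greatest emeasure_mono) (auto simp: openin_sets_borel_of)
      show "(SUP K\<in>{K. compactin T K \<and> K \<subseteq> E}. emeasure ?V K) \<le> emeasure ?V E"
        using E by (intro SUP_least emeasure_mono) auto
      have *: "\<exists>K U. compactin T K \<and> openin T U \<and> K \<subseteq> E \<and> E \<subseteq> U \<and>
          measure ?V U < measure ?V E + e \<and> measure ?V E < measure ?V K + e" if e: "0 < e" for e
      proof -
        obtain K U where KU: "compactin T K" "openin T U" "K \<subseteq> E" "E \<subseteq> U" "measure ?V (U - K) < e"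
          using radon_approx[OF r E e] by blast
        moreover have "measure ?V K \<le> measure ?V E" "measure ?V E \<le> measure ?V U"
          using KU E K_sets openin_sets_borel_of by (auto intro!: V.finite_measure_mono)
        ultimately show ?thesis using D[of U K]
          by (intro ex2I[of _ K U]) auto
      qed
      show "(INF U\<in>{U. openin T U \<and> E \<subseteq> U}. emeasure ?V U) \<le> emeasure ?V E"
      proof (rule ennreal_le_epsilon)
        fix e :: real assume e: "0 < e"
        from *[OF e] obtain U where U: "openin T U" "E \<subseteq> U" "measure ?V U < measure ?V E + e" by blast
        have "(INF U\<in>{U. openin T U \<and> E \<subseteq> U}. emeasure ?V U) \<le> emeasure ?V U"
          using U by (intro INF_lower) auto
        also have "\<dots> \<le> emeasure ?V E + ennreal e"
          using U e by (simp add: V.emeasure_eq_measure flip: ennreal_plus)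
        finally show "(INF U\<in>{U. openin T U \<and> E \<subseteq> U}. emeasure ?V U) \<le> emeasure ?V E + ennreal e" .
      qed
      show "emeasure ?V E \<le> (SUP K\<in>{K. compactin T K \<and> K \<subseteq> E}. emeasure ?V K)"
      proof (rule ennreal_le_epsilon)
        fix e :: real assume e: "0 < e"
        from *[OF e] obtain K where K: "compactin T K" "K \<subseteq> E" "measure ?V E < measure ?V K + e" by blast
        have "emeasure ?V E \<le> emeasure ?V K + ennreal e"
          using K e by (simp add: V.emeasure_eq_measure flip: ennreal_plus)
        also have "\<dots> \<le> (SUP K\<in>{K. compactin T K \<and> K \<subseteq> E}. emeasure ?V K) + ennreal e"
          using K by (intro add_right_mono SUP_upper) auto
        finally show "emeasure ?V E \<le> (SUP K\<in>{K. compactin T K \<and> K \<subseteq> E}. emeasure ?V K) + ennreal e" .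
      qed
    qed
    then show "\<mu> \<in> regular_measures T" using \<mu> unfolding regular_measures_def by blast
  qed
qed

text \<open>Sandwiches of \<open>\<rho>\<close>-measure below \<open>1 / Suc n\<close> are made
  nested. Their differences decrease to a \<open>\<rho>\<close>-null set, which is
  \<open>\<kappa>\<close>-null, so continuity from above makes the \<open>\<kappa>\<close>-measure
  of some difference small.\<close>

lemma radon_absolutely_continuous:
  assumes H: "Hausdorff_space T" and \<rho>: "radon T \<rho>" and \<kappa>: "finite_measure \<kappa>"
    and sets: "sets \<kappa> = sets \<rho>" and ac: "\<And>E. E \<in> sets \<rho> \<Longrightarrow> emeasure \<rho> E = 0 \<Longrightarrow> emeasure \<kappa> E = 0"
  shows "radon T \<kappa>"
  unfolding radon_def
proof (intro conjI ballI allI impI \<kappa>)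
  note s\<rho> = radon_sets[OF \<rho>]
  show "sets \<kappa> = sets (borel_of T)" using sets s\<rho> by simp
  interpret \<rho>: finite_measure \<rho> by (rule radon_finite_measure[OF \<rho>])
  interpret \<kappa>: finite_measure \<kappa> by fact
  fix E and e :: real assume E: "E \<in> sets \<kappa>" and e: "0 < e"
  then have E': "E \<in> sets (borel_of T)" using sets s\<rho> by simp
  have "\<exists>K U. compactin T K \<and> openin T U \<and> K \<subseteq> E \<and> E \<subseteq> U \<and> measure \<rho> (U - K) < 1 / Suc n" for n
    using radon_approx[OF \<rho> E', of "1 / Suc n"] by (metis zero_less_divide_1_iff of_nat_0_less_iff zero_less_Suc)
  then obtain K U where KU: "\<And>n. compactin T (K n)" "\<And>n. openin T (U n)" "\<And>n. K n \<subseteq> E" "\<And>n. E \<subseteq> U n"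
    "\<And>n. measure \<rho> (U n - K n) < 1 / Suc n" by metis
  define K' where "K' n = (\<Union>i\<le>n. K i)" for n
  define U' where "U' n = (\<Inter>i\<le>n. U i)" for n
  define D where "D n = U' n - K' n" for n
  have K': "compactin T (K' n)" for n
    unfolding K'_def using KU(1) by (intro compactin_Union) auto
  have U': "openin T (U' n)" for n
    unfolding U'_def using KU(2) by (intro openin_Inter) auto
  have D_sets: "D n \<in> sets (borel_of T)" for n
    unfolding D_def using compactin_sets_borel_of[OF H K'] openin_sets_borel_of[OF U'] by auto
  have dec: "decseq D"
    unfolding decseq_def D_def U'_def K'_def by fastforce
  have "measure \<rho> (\<Inter>n. D n) \<le> 1 / Suc n" for n
  proof -
    have "measure \<rho> (\<Inter>n. D n) \<le> measure \<rho> (U n - K n)"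
      using KU compactin_sets_borel_of[OF H KU(1)[of n]] openin_sets_borel_of[OF KU(2)[of n]]
      by (intro \<rho>.finite_measure_mono) (auto simp: s\<rho> D_def U'_def K'_def)
    then show ?thesis using KU(5)[of n] by simp
  qed
  then have "measure \<rho> (\<Inter>n. D n) \<le> 0"
    using LIMSEQ_inverse_real_of_nat by (intro LIMSEQ_le_const) (auto simp: inverse_eq_divide)
  then have "emeasure \<rho> (\<Inter>n. D n) = 0"
    by (simp add: \<rho>.emeasure_eq_measure measure_le_0_iff)
  then have "emeasure \<kappa> (\<Inter>n. D n) = 0"
    using D_sets by (intro ac) (auto simp: s\<rho>)
  moreover have "(\<lambda>n. measure \<kappa> (D n)) \<longlonglongrightarrow> measure \<kappa> (\<Inter>n. D n)"
    using D_sets dec by (intro \<kappa>.finite_Lim_measure_decseq) (auto simp: sets s\<rho>)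
  ultimately have "(\<lambda>n. measure \<kappa> (D n)) \<longlonglongrightarrow> 0" by (simp add: Sigma_Algebra.measure_def)
  then obtain n where "measure \<kappa> (D n) < e"
    using e by (metis (no_types, lifting) LIMSEQ_D abs_of_nonneg diff_zero measure_nonneg order_refl real_norm_def)
  then show "\<exists>K U. compactin T K \<and> openin T U \<and> K \<subseteq> E \<and> E \<subseteq> U \<and> measure \<kappa> (U - K) < e"
    using K' U' KU by (intro ex2I[of _ "K' n" "U' n"]) (auto simp: D_def K'_def U'_def; blast)
qed

lemma radon_add_measure:
  assumes H: "Hausdorff_space T" and M: "radon T M" and N: "radon T N"
  shows "radon T (add_measure M N)"
  unfolding radon_def
proof (intro conjI ballI allI impI)
  interpret M: finite_measure M by (rule radon_finite_measure[OF M])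
  interpret N: finite_measure N by (rule radon_finite_measure[OF N])
  have NM: "sets N = sets M" using radon_sets[OF M] radon_sets[OF N] by simp
  interpret S: finite_measure "add_measure M N"
    by (rule finite_measure_add_measure[OF M.finite_measure_axioms N.finite_measure_axioms NM])
  show "finite_measure (add_measure M N)" by (rule S.finite_measure_axioms)
  show "sets (add_measure M N) = sets (borel_of T)" using radon_sets[OF M] by simp
  fix E and e :: real assume E: "E \<in> sets (add_measure M N)" and e: "0 < e"
  then have E': "E \<in> sets (borel_of T)" using radon_sets[OF M] by simp
  have e2: "0 < e / 2" using e by simp
  obtain K U where KU: "compactin T K" "openin T U" "K \<subseteq> E" "E \<subseteq> U" "measure M (U - K) < e / 2"
    using radon_approx[OF M E' e2] by blast
  obtain L W where LW: "compactin T L" "openin T W" "L \<subseteq> E" "E \<subseteq> W" "measure N (W - L) < e / 2"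
    using radon_approx[OF N E' e2] by blast
  let ?D = "(U \<inter> W) - (K \<union> L)"
  have sets: "U - K \<in> sets M" "W - L \<in> sets N" "?D \<in> sets M"
    using compactin_sets_borel_of[OF H KU(1)] compactin_sets_borel_of[OF H LW(1)]
      openin_sets_borel_of[OF KU(2)] openin_sets_borel_of[OF LW(2)]
    unfolding radon_sets[OF M] radon_sets[OF N] by blast+
  have "ennreal (measure (add_measure M N) ?D) = ennreal (measure M ?D + measure N ?D)"
    using sets NM by (simp add: emeasure_add_measure[OF NM] ennreal_plus
        flip: M.emeasure_eq_measure N.emeasure_eq_measure S.emeasure_eq_measure)
  then have "measure (add_measure M N) ?D = measure M ?D + measure N ?D"
    by (subst (asm) ennreal_inj) auto
  also have "\<dots> \<le> measure M (U - K) + measure N (W - L)"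
    using sets by (intro add_mono M.finite_measure_mono N.finite_measure_mono) auto
  also have "\<dots> < e" using KU LW by simp
  finally show "\<exists>K U. compactin T K \<and> openin T U \<and> K \<subseteq> E \<and> E \<subseteq> U \<and> measure (add_measure M N) (U - K) < e"
    using KU LW by (intro ex2I[of _ "K \<union> L" "U \<inter> W"]) (auto intro: compactin_Un openin_Int)
qed

lemma radon_return:
  assumes H: "Hausdorff_space T" and x: "x \<in> topspace T"
  shows "radon T (return (borel_of T) x)"
  unfolding radon_def
proof (intro conjI ballI allI impI)
  show "finite_measure (return (borel_of T) x)"
    using x sets.top[of "borel_of T"] by (intro finite_measureI) (simp add: emeasure_return)
  show "sets (return (borel_of T) x) = sets (borel_of T)" by simp
  fix E and e :: real assume E: "E \<in> sets (return (borel_of T) x)" and e: "0 < e"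
  have c: "compactin T {x}" using x by simp
  have o: "openin T (topspace T - {x})"
    using compactin_imp_closedin[OF H c] by blast
  have sub: "E \<subseteq> topspace T" using sets.sets_into_space[OF E] by simp
  show "\<exists>K U. compactin T K \<and> openin T U \<and> K \<subseteq> E \<and> E \<subseteq> U \<and> measure (return (borel_of T) x) (U - K) < e"
  proof (cases "x \<in> E")
    case True
    then show ?thesis
      using c sub e openin_sets_borel_of[OF o]
      by (intro ex2I[of _ "{x}" "topspace T"]) (auto simp: measure_return)
  next
    case False
    then show ?thesis
      using o sub e openin_sets_borel_of[OF o]
      by (intro ex2I[of _ "{}" "topspace T - {x}"]) (auto simp: measure_return)
  qed
qed

text \<open>The sets that can be squeezed between a closed and an open set form a sigma-algebra, and
  the assumption puts the open sets into it. Intersecting the closed set with a compact set of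
  almost full measure then makes it compact.\<close>

lemma radonI_open:
  assumes H: "Hausdorff_space T" and fin: "finite_measure \<rho>" and sets: "sets \<rho> = sets (borel_of T)"
    and inner: "\<And>U e. openin T U \<Longrightarrow> 0 < e \<Longrightarrow> \<exists>K. compactin T K \<and> K \<subseteq> U \<and> measure \<rho> (U - K) < e"
  shows "radon T \<rho>"
  unfolding radon_def
proof (intro conjI ballI allI impI fin sets)
  interpret \<rho>: finite_measure \<rho> by fact
  have sp: "space \<rho> = topspace T" using sets_eq_imp_space_eq[OF sets] by simp
  have co: "C \<in> sets \<rho>" if "closedin T C" for C using closedin_sets_borel_of[OF that] sets by simp
  have oo: "C \<in> sets \<rho>" if "openin T C" for C using openin_sets_borel_of[OF that] sets by simp
  have key: "\<forall>e>0. \<exists>C U. closedin T C \<and> openin T U \<and> C \<subseteq> E \<and> E \<subseteq> U \<and> measure \<rho> (U - C) < e"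
    if "E \<in> sigma_sets (topspace T) {U. openin T U}" for E
    using that
  proof (induction)
    case (Basic U)
    then have U: "openin T U" by simp
    show ?case
    proof (intro allI impI)
      fix e :: real assume "0 < e"
      then obtain K where "compactin T K" "K \<subseteq> U" "measure \<rho> (U - K) < e"
        using inner[OF U] by blast
      then show "\<exists>C V. closedin T C \<and> openin T V \<and> C \<subseteq> U \<and> U \<subseteq> V \<and> measure \<rho> (V - C) < e"
        using U compactin_imp_closedin[OF H] by (intro ex2I[of _ K U]) auto
    qed
  next
    case Empty
    show ?case by (intro allI impI ex2I[of _ "{}" "{}"]) auto
  next
    case (Compl E)
    show ?case
    proof (intro allI impI)
      fix e :: real assume e: "0 < e"
      obtain C U where CU: "closedin T C" "openin T U" "C \<subseteq> E" "E \<subseteq> U" "measure \<rho> (U - C) < e"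
        using Compl.IH[rule_format, OF e] by metis
      have "(topspace T - C) - (topspace T - U) = U - C" using openin_subset[OF CU(2)] by blast
      then show "\<exists>C U. closedin T C \<and> openin T U \<and> C \<subseteq> topspace T - E \<and> topspace T - E \<subseteq> U \<and> measure \<rho> (U - C) < e"
        using closedin_diff[OF closedin_topspace CU(2)] openin_diff[OF openin_topspace CU(1)] CU(3-5)
        by (intro ex2I[of _ "topspace T - U" "topspace T - C"] conjI) (simp_all add: Diff_mono)
    qed
  next
    case (Union E)
    show ?case
    proof (intro allI impI)
      fix e :: real assume e: "0 < e"
      have "\<exists>C U. closedin T C \<and> openin T U \<and> C \<subseteq> E i \<and> E i \<subseteq> U \<and> measure \<rho> (U - C) < e / 2 * (1/2) ^ Suc i" for i
        by (rule Union.IH[rule_format]) (use e in simp)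
      then obtain C U where CU: "\<And>i. closedin T (C i)" "\<And>i. openin T (U i)" "\<And>i. C i \<subseteq> E i" "\<And>i. E i \<subseteq> U i"
        "\<And>i. measure \<rho> (U i - C i) < e / 2 * (1/2) ^ Suc i" by metis
      define U' where "U' = (\<Union>i. U i)"
      \<comment> \<open>A countable union of closed sets need not be closed, so only finitely many
        are used. The remainder is absorbed by continuity from above, for which the errors were
        chosen to total only \<open>e / 2\<close>.\<close>
      define C' where "C' n = (\<Union>i\<le>n. C i)" for n :: nat
      have U': "openin T U'" unfolding U'_def using CU(2) by auto
      have C': "closedin T (C' n)" for n
        unfolding C'_def using CU(1) by (intro closedin_Union) auto
      have s: "(\<lambda>i. e / 2 * (1/2) ^ Suc i) sums (e / 2 * 1)"
        by (intro sums_mult power_half_series)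
      have summ: "summable (\<lambda>i. measure \<rho> (U i - C i))"
        by (rule summable_comparison_test'[OF sums_summable[OF s], of 0]) (use CU(5) less_imp_le in auto)
      have "measure \<rho> (\<Union>i. U i - C i) \<le> (\<Sum>i. measure \<rho> (U i - C i))"
        using oo[OF CU(2)] co[OF CU(1)] summ
        by (intro \<rho>.finite_measure_subadditive_countably) (auto intro!: sets.Diff)
      also have "\<dots> \<le> (\<Sum>i. e / 2 * (1/2) ^ Suc i)"
        using CU(5) summ sums_summable[OF s] by (intro suminf_le less_imp_le) auto
      also have "\<dots> = e / 2" using sums_unique[OF s] by simp
      finally have le: "measure \<rho> (\<Union>i. U i - C i) \<le> e / 2" .
      have lim: "(\<lambda>n. measure \<rho> (U' - C' n)) \<longlonglongrightarrow> measure \<rho> (\<Inter>n. U' - C' n)"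
      proof (rule \<rho>.finite_Lim_measure_decseq)
        show "range (\<lambda>n. U' - C' n) \<subseteq> sets \<rho>" using oo[OF U'] co[OF C'] by (auto intro!: sets.Diff)
        have "C' m \<subseteq> C' n" if "m \<le> n" for m n
          using that unfolding C'_def by (intro UN_mono) auto
        then show "decseq (\<lambda>n. U' - C' n)"
          unfolding decseq_def by blast
      qed
      have "measure \<rho> (\<Inter>n. U' - C' n) \<le> measure \<rho> (\<Union>i. U i - C i)"
      proof (rule \<rho>.finite_measure_mono)
        show "(\<Inter>n. U' - C' n) \<subseteq> (\<Union>i. U i - C i)"
        proof
          fix x assume x: "x \<in> (\<Inter>n. U' - C' n)"
          then obtain i where i: "x \<in> U i" unfolding U'_def by auto
          have "x \<notin> C' i" using x by auto
          then have "x \<notin> C i" unfolding C'_def by auto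
          with i show "x \<in> (\<Union>i. U i - C i)" by auto
        qed
        show "(\<Union>i. U i - C i) \<in> sets \<rho>" using oo[OF CU(2)] co[OF CU(1)] by (auto intro!: sets.Diff)
      qed
      then have "measure \<rho> (\<Inter>n. U' - C' n) < e" using le e by linarith
      from order_tendstoD(2)[OF lim this]
      obtain n where "measure \<rho> (U' - C' n) < e" by (auto simp: eventually_sequentially)
      then show "\<exists>C U. closedin T C \<and> openin T U \<and> C \<subseteq> \<Union> (range E) \<and> \<Union> (range E) \<subseteq> U \<and> measure \<rho> (U - C) < e"
      proof (intro ex2I[of _ "C' n" U'] conjI)
        show "C' n \<subseteq> \<Union> (range E)" unfolding C'_def using CU(3) by (intro UN_mono) auto
        show "\<Union> (range E) \<subseteq> U'" unfolding U'_def using CU(4) by (intro UN_mono) auto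
      qed (rule U' C')+
    qed
  qed
  fix E and e :: real assume E: "E \<in> sets \<rho>" and e: "0 < e"
  obtain K where K: "compactin T K" "measure \<rho> (topspace T - K) < e / 2"
    using inner[of "topspace T" "e / 2"] e by auto
  have sig: "E \<in> sigma_sets (topspace T) {U. openin T U}" using E unfolding sets sets_borel_of .
  have "\<exists>C U. closedin T C \<and> openin T U \<and> C \<subseteq> E \<and> E \<subseteq> U \<and> measure \<rho> (U - C) < e / 2"
    by (rule key[OF sig, rule_format]) (use e in simp)
  then obtain C U where CU: "closedin T C" "openin T U" "C \<subseteq> E" "E \<subseteq> U" "measure \<rho> (U - C) < e / 2"
    by metis
  have KC: "compactin T (K \<inter> C)" using K CU by (metis compact_Int_closedin)
  have Ks: "K \<in> sets \<rho>" using compactin_imp_closedin[OF H K(1)] co by blast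
  have "measure \<rho> (U - K \<inter> C) \<le> measure \<rho> ((U - C) \<union> (topspace T - K))"
  proof (rule \<rho>.finite_measure_mono)
    show "U - K \<inter> C \<subseteq> (U - C) \<union> (topspace T - K)" using openin_subset[OF CU(2)] by auto
    show "(U - C) \<union> (topspace T - K) \<in> sets \<rho>"
      using oo[OF CU(2)] co[OF CU(1)] Ks oo[OF openin_topspace] by (intro sets.Un sets.Diff)
  qed
  also have "\<dots> \<le> measure \<rho> (U - C) + measure \<rho> (topspace T - K)"
    using oo[OF CU(2)] co[OF CU(1)] Ks oo[OF openin_topspace]
    by (intro measure_Un_le sets.Diff)
  also have "\<dots> < e" using K CU by simp
  finally show "\<exists>K U. compactin T K \<and> openin T U \<and> K \<subseteq> E \<and> E \<subseteq> U \<and> measure \<rho> (U - K) < e"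
    using KC CU by (intro ex2I[of _ "K \<inter> C" U] conjI) auto
qed

section \<open>Convolution\<close>

definition right_section :: "('a, 'm) monoid_scheme \<Rightarrow> 'a set \<Rightarrow> 'a \<Rightarrow> 'a set" where
  "right_section G E y = {x \<in> carrier G. x \<otimes>\<^bsub>G\<^esub> y \<in> E}"

lemma right_section_simps:
  "right_section G {} y = {}"
  "right_section G (A \<union> B) y = right_section G A y \<union> right_section G B y"
  "right_section G (A \<inter> B) y = right_section G A y \<inter> right_section G B y"
  "right_section G (A - B) y = right_section G A y - right_section G B y"
  "right_section G (\<Union>i\<in>I. F i) y = (\<Union>i\<in>I. right_section G (F i) y)"
  by (auto simp: right_section_def)

lemma right_section_mono: "A \<subseteq> B \<Longrightarrow> right_section G A y \<subseteq> right_section G B y"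
  by (auto simp: right_section_def)

lemma disjoint_family_right_section:
  fixes A :: "'i \<Rightarrow> 'a set"
  assumes "disjoint_family A"
  shows "disjoint_family (\<lambda>i. right_section G (A i) y)"
  unfolding disjoint_family_on_def
proof (intro ballI impI)
  fix i j :: 'i assume "i \<noteq> j"
  then have "A i \<inter> A j = {}" using disjoint_family_onD[OF assms, of i j] by simp
  then show "right_section G (A i) y \<inter> right_section G (A j) y = {}"
    by (simp flip: right_section_simps add: right_section_simps(1))
qed

text \<open>The convolution of positive measures, by the section formula rather than as the image of
  a product measure: the product of the Borel algebras may be smaller than the Borel algebra of the
  product space.\<close>

definition conv_measure :: "('a, 'm) monoid_scheme \<Rightarrow> 'a topology \<Rightarrow> 'a measure \<Rightarrow> 'a measure \<Rightarrow> 'a measure" where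
  "conv_measure G T V W = measure_of (topspace T) (sets (borel_of T))
     (\<lambda>E. \<integral>\<^sup>+y. emeasure V (right_section G E y) \<partial>W)"

lemma sets_conv_measure [simp, measurable_cong]: "sets (conv_measure G T V W) = sets (borel_of T)"
  using sets.space_closed[of "borel_of T"] sets.sigma_sets_eq[of "borel_of T"]
  by (simp add: conv_measure_def sets_measure_of)

lemma space_conv_measure [simp]: "space (conv_measure G T V W) = topspace T"
  using sets_eq_imp_space_eq[OF sets_conv_measure] by simp

context locally_compact_group
begin

lemma continuous_right_translation:
  assumes "y \<in> carrier G"
  shows "continuous_map T T (\<lambda>x. x \<otimes> y)"
proof -
  have "continuous_map T (prod_topology T T) (\<lambda>x. (x, y))"
    using assms by (intro continuous_map_pairedI) (auto simp: topspace_eq_carrier)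
  from continuous_map_compose[OF this continuous_mult] show ?thesis
    by (simp add: comp_def)
qed

lemma openin_right_section:
  assumes "openin T U" "y \<in> carrier G"
  shows "openin T (right_section G U y)"
  using continuous_right_translation[OF assms(2)] assms(1)
  by (simp add: continuous_map_def right_section_def topspace_eq_carrier)

lemma right_section_sets:
  assumes "E \<in> sets (borel_of T)" "y \<in> carrier G"
  shows "right_section G E y \<in> sets (borel_of T)"
proof -
  have "(\<lambda>x. x \<otimes> y) -` E \<inter> space (borel_of T) \<in> sets (borel_of T)"
    by (rule measurable_sets[OF measurable_borel_of[OF continuous_right_translation[OF assms(2)]] assms(1)])
  also have "(\<lambda>x. x \<otimes> y) -` E \<inter> space (borel_of T) = right_section G E y"
    by (auto simp: right_section_def topspace_eq_carrier)
  finally show ?thesis .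
qed

text \<open>The tube lemma for the preimage of \<open>U\<close> under multiplication: a compact set
  that translation by \<open>y\<close> carries into \<open>U\<close> is still carried there by
  nearby translations.\<close>

lemma right_section_nbhd:
  assumes U: "openin T U" and y: "y \<in> carrier G" and K: "compactin T K" "K \<subseteq> right_section G U y"
  obtains N where "openin T N" "y \<in> N" "\<And>y'. y' \<in> N \<Longrightarrow> K \<subseteq> right_section G U y'"
proof -
  let ?W = "{z \<in> topspace (prod_topology T T). (case z of (x, y) \<Rightarrow> x \<otimes> y) \<in> U}"
  have W: "openin (prod_topology T T) ?W"
    by (rule openin_continuous_map_preimage[OF continuous_mult U])
  have "K \<times> {y} \<subseteq> ?W" using K y by (auto simp: right_section_def topspace_eq_carrier)
  from tube_lemma_left[OF W K(1) _ this] y obtain A N where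
    AN: "openin T A" "openin T N" "K \<subseteq> A" "y \<in> N" "A \<times> N \<subseteq> ?W"
    by (auto simp: topspace_eq_carrier)
  show thesis
  proof (rule that[OF AN(2,4)])
    fix y' assume "y' \<in> N"
    show "K \<subseteq> right_section G U y'"
    proof
      fix x assume "x \<in> K"
      then have "(x, y') \<in> ?W" using AN(3,5) \<open>y' \<in> N\<close> by blast
      then show "x \<in> right_section G U y'"
        by (simp add: right_section_def topspace_eq_carrier)
    qed
  qed
qed

lemma compact_in_right_section:
  assumes V: "radon T V" and U: "openin T U" and y: "y \<in> carrier G"
    and t: "t < measure V (right_section G U y)"
  obtains K where "compactin T K" "K \<subseteq> right_section G U y" "t < measure V K"
proof -
  interpret V: finite_measure V by (rule radon_finite_measure[OF V])
  define e where "e = measure V (right_section G U y) - t"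
  have e: "0 < e" using t by (simp add: e_def)
  have S: "right_section G U y \<in> sets (borel_of T)"
    by (rule right_section_sets[OF openin_sets_borel_of[OF U] y])
  obtain K O' where KO: "compactin T K" "openin T O'" "K \<subseteq> right_section G U y" "right_section G U y \<subseteq> O'"
    "measure V (O' - K) < e"
    using radon_approx[OF V S e] by blast
  have Ks: "K \<in> sets V" using compactin_sets_borel_of[OF Hausdorff KO(1)] radon_sets[OF V] by simp
  have Os: "O' \<in> sets V" using openin_sets_borel_of[OF KO(2)] radon_sets[OF V] by simp
  have "measure V (right_section G U y) \<le> measure V (K \<union> (O' - K))"
    using KO Ks Os by (intro V.finite_measure_mono) auto
  also have "\<dots> \<le> measure V K + measure V (O' - K)"
    using Ks Os by (intro measure_Un_le) auto
  also have "\<dots> < measure V K + e" using KO by simp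
  finally have K_t: "t < measure V K" by (simp add: e_def)
  show thesis by (rule that[OF KO(1,3) K_t])
qed

text \<open>Lower semicontinuity: a compact part of the section at \<open>y\<close> with measure
  above \<open>t\<close> lies in the sections at all nearby points.\<close>

lemma openin_section_greater:
  assumes V: "radon T V" and U: "openin T U"
  shows "openin T {y \<in> carrier G. t < measure V (right_section G U y)}"
  unfolding openin_subopen[of T "{y \<in> carrier G. t < measure V (right_section G U y)}"]
proof (intro ballI)
  interpret V: finite_measure V by (rule radon_finite_measure[OF V])
  fix y assume "y \<in> {y \<in> carrier G. t < measure V (right_section G U y)}"
  then have y: "y \<in> carrier G" and t: "t < measure V (right_section G U y)" by auto
  obtain K where K: "compactin T K" "K \<subseteq> right_section G U y" "t < measure V K"
    using compact_in_right_section[OF V U y t] by blast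
  obtain N where N: "openin T N" "y \<in> N" "\<And>y'. y' \<in> N \<Longrightarrow> K \<subseteq> right_section G U y'"
    using right_section_nbhd[OF U y K(1,2)] by blast
  have "N \<subseteq> {y \<in> carrier G. t < measure V (right_section G U y)}"
  proof
    fix y' assume y': "y' \<in> N"
    then have c: "y' \<in> carrier G" using openin_subset[OF N(1)] by (auto simp: topspace_eq_carrier)
    have "measure V K \<le> measure V (right_section G U y')"
      using N(3)[OF y'] right_section_sets[OF openin_sets_borel_of[OF U] c] radon_sets[OF V]
      by (intro V.finite_measure_mono) auto
    then show "y' \<in> {y \<in> carrier G. t < measure V (right_section G U y)}" using K(3) c by simp
  qed
  then show "\<exists>N. openin T N \<and> y \<in> N \<and> N \<subseteq> {y \<in> carrier G. t < measure V (right_section G U y)}"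
    using N by blast
qed

text \<open>Lower semicontinuity settles the open sets, which generate the Borel algebra and are
  stable under intersection; complements and disjoint unions follow by Dynkin's argument. This
  replaces measurability of sections of sets in a product algebra.\<close>

lemma measurable_measure_right_section:
  assumes V: "radon T V" and E: "E \<in> sets (borel_of T)"
  shows "(\<lambda>y. measure V (right_section G E y)) \<in> borel_measurable (borel_of T)"
proof -
  interpret V: finite_measure V by (rule radon_finite_measure[OF V])
  have S: "right_section G E y \<in> sets V" if "E \<in> sets (borel_of T)" "y \<in> topspace T" for E y
    using right_section_sets[OF that(1)] that(2) radon_sets[OF V] by (simp add: topspace_eq_carrier)
  have int_stable: "Int_stable {U. openin T U}" by (auto simp: Int_stable_def)
  have pow: "{U. openin T U} \<subseteq> Pow (topspace T)" by (auto dest: openin_subset)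
  have E': "E \<in> sigma_sets (topspace T) {U. openin T U}" using E unfolding sets_borel_of .
  show ?thesis
    using int_stable pow E'
  proof (induction rule: sigma_sets_induct_disjoint)
    case (basic U)
    then have U: "openin T U" by simp
    show ?case
    proof (rule borel_measurableI_greater)
      fix t
      have "openin T {y \<in> space (borel_of T). t < measure V (right_section G U y)}"
        using openin_section_greater[OF V U] by (simp add: topspace_eq_carrier)
      then show "{y \<in> space (borel_of T). t < measure V (right_section G U y)} \<in> sets (borel_of T)"
        by (rule openin_sets_borel_of)
    qed
  next
    case empty
    show ?case by (simp add: right_section_simps)
  next
    case (compl E)
    have E: "E \<in> sets (borel_of T)" using compl(1) unfolding sets_borel_of .
    have "measure V (right_section G (topspace T - E) y) = measure V (topspace T) - measure V (right_section G E y)"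
      if y: "y \<in> topspace T" for y
    proof -
      have "right_section G (topspace T - E) y = topspace T - right_section G E y"
        using y by (auto simp: right_section_def topspace_eq_carrier)
      then show ?thesis
        using S[OF E y] sets.sets_into_space[OF S[OF E y]] radon_space[OF V] sets.top[of V]
        by (simp add: V.finite_measure_Diff)
    qed
    then show ?case
      using compl(2) by (subst measurable_cong[where g="\<lambda>y. measure V (topspace T) - measure V (right_section G E y)"]) auto
  next
    case (union A)
    have A: "A i \<in> sets (borel_of T)" for i using union(2) unfolding sets_borel_of by auto
    have "(\<lambda>i. measure V (right_section G (A i) y)) sums measure V (right_section G (\<Union>i. A i) y)"
      if y: "y \<in> topspace T" for y
      unfolding right_section_simps
      using S[OF A y] disjoint_family_right_section[OF union(1)]
      by (intro V.finite_measure_UNION) auto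
    then have "measure V (right_section G (\<Union>i. A i) y) = (\<Sum>i. measure V (right_section G (A i) y))"
      if "y \<in> topspace T" for y
      using that by (simp add: sums_iff)
    then show ?case
      using union(3) by (subst measurable_cong[where g="\<lambda>y. \<Sum>i. measure V (right_section G (A i) y)"]) auto
  qed
qed

lemma measurable_emeasure_right_section:
  assumes V: "radon T V" and E: "E \<in> sets (borel_of T)"
  shows "(\<lambda>y. emeasure V (right_section G E y)) \<in> borel_measurable (borel_of T)"
proof -
  interpret V: finite_measure V by (rule radon_finite_measure[OF V])
  show ?thesis
    using measurable_measure_right_section[OF assms] by (simp add: V.emeasure_eq_measure)
qed

lemma emeasure_conv_measure:
  assumes V: "radon T V" and W: "radon T W" and E: "E \<in> sets (borel_of T)"
  shows "emeasure (conv_measure G T V W) E = (\<integral>\<^sup>+y. emeasure V (right_section G E y) \<partial>W)"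
proof (rule emeasure_measure_of[OF conv_measure_def])
  show "sets (borel_of T) \<subseteq> Pow (topspace T)" using sets.space_closed[of "borel_of T"] by simp
  show "positive (sets (conv_measure G T V W)) (\<lambda>E. \<integral>\<^sup>+y. emeasure V (right_section G E y) \<partial>W)"
    by (simp add: positive_def right_section_simps)
  show "E \<in> sets (conv_measure G T V W)" using E by simp
  show "countably_additive (sets (conv_measure G T V W)) (\<lambda>E. \<integral>\<^sup>+y. emeasure V (right_section G E y) \<partial>W)"
  proof (rule countably_additiveI)
    fix A :: "nat \<Rightarrow> 'a set" assume A: "range A \<subseteq> sets (conv_measure G T V W)" "disjoint_family A"
    then have Ai: "A i \<in> sets (borel_of T)" for i by auto
    have m: "(\<lambda>y. emeasure V (right_section G (A i) y)) \<in> borel_measurable W" for i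
      using measurable_emeasure_right_section[OF V Ai] radon_sets[OF W] by (simp cong: measurable_cong_sets)
    have "(\<Sum>i. \<integral>\<^sup>+y. emeasure V (right_section G (A i) y) \<partial>W) =
        (\<integral>\<^sup>+y. (\<Sum>i. emeasure V (right_section G (A i) y)) \<partial>W)"
      using m by (rule nn_integral_suminf[symmetric])
    also have "\<dots> = (\<integral>\<^sup>+y. emeasure V (right_section G (\<Union>i. A i) y) \<partial>W)"
    proof (rule nn_integral_cong)
      fix y assume "y \<in> space W"
      then have "y \<in> carrier G" using radon_space[OF W] by (simp add: topspace_eq_carrier)
      then show "(\<Sum>i. emeasure V (right_section G (A i) y)) = emeasure V (right_section G (\<Union>i. A i) y)"
        unfolding right_section_simps
        using right_section_sets[OF Ai] radon_sets[OF V] disjoint_family_right_section[OF A(2)]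
        by (intro suminf_emeasure) auto
    qed
    finally show "(\<Sum>i. \<integral>\<^sup>+y. emeasure V (right_section G (A i) y) \<partial>W) =
        (\<integral>\<^sup>+y. emeasure V (right_section G (\<Union> (range A)) y) \<partial>W)" .
  qed
qed

text \<open>A substitute for Tonelli's theorem, by induction on the measurable function.
  Measurability of the inner integral is part of the claim because the sum and limit steps need it
  for the functions already treated.\<close>

lemma nn_integral_conv_measure:
  assumes V: "radon T V" and W: "radon T W" and h: "h \<in> borel_measurable (borel_of T)"
  shows "(\<lambda>y. \<integral>\<^sup>+x. h (x \<otimes> y) \<partial>V) \<in> borel_measurable W \<and>
    (\<integral>\<^sup>+x. h x \<partial>conv_measure G T V W) = (\<integral>\<^sup>+y. \<integral>\<^sup>+x. h (x \<otimes> y) \<partial>V \<partial>W)"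
  using h
proof (induction rule: borel_measurable_induct)
  have spV: "space V = carrier G" and spW: "space W = carrier G"
    using radon_space[OF V] radon_space[OF W] by (simp_all add: topspace_eq_carrier)
  have sp: "topspace T = carrier G" by (rule topspace_eq_carrier)
  have mV: "(\<lambda>x. f (x \<otimes> y)) \<in> borel_measurable V"
    if f: "f \<in> borel_measurable (borel_of T)" and "y \<in> carrier G" for f :: "'a \<Rightarrow> ennreal" and y
  proof -
    have "(\<lambda>x. x \<otimes> y) \<in> measurable V (borel_of T)"
      using measurable_borel_of[OF continuous_right_translation[OF that(2)]] radon_sets[OF V]
      by (simp cong: measurable_cong_sets)
    from measurable_compose[OF this f] show ?thesis .
  qed
  note mP = measurable_cong_sets[OF sets_conv_measure refl]
  {
    case (cong f g)
    have 1: "(\<integral>\<^sup>+x. f (x \<otimes> y) \<partial>V) = (\<integral>\<^sup>+x. g (x \<otimes> y) \<partial>V)" if "y \<in> space W" for y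
      using that cong(3) by (intro nn_integral_cong) (simp add: spV spW sp)
    have 2: "(\<integral>\<^sup>+x. f x \<partial>conv_measure G T V W) = (\<integral>\<^sup>+x. g x \<partial>conv_measure G T V W)"
      using cong(3) by (intro nn_integral_cong) simp
    from cong(4) show ?case
      using 1 2 by (simp cong: measurable_cong nn_integral_cong)
  next
    case (set A)
    have eq: "(\<integral>\<^sup>+x. indicator A (x \<otimes> y) \<partial>V) = emeasure V (right_section G A y)" if "y \<in> space W" for y
    proof -
      have y: "y \<in> carrier G" using that spW by simp
      have "(\<integral>\<^sup>+x. indicator A (x \<otimes> y) \<partial>V) = (\<integral>\<^sup>+x. indicator (right_section G A y) x \<partial>V)"
        by (intro nn_integral_cong) (auto simp: spV right_section_def split: split_indicator)
      then show ?thesis using right_section_sets[OF set y] radon_sets[OF V] by simp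
    qed
    have "(\<lambda>y. emeasure V (right_section G A y)) \<in> borel_measurable W"
      using measurable_emeasure_right_section[OF V set] radon_sets[OF W] by (simp cong: measurable_cong_sets)
    then show ?case
      using set by (simp add: eq emeasure_conv_measure[OF V W] cong: measurable_cong nn_integral_cong)
  next
    case (mult u c)
    have eq: "(\<integral>\<^sup>+x. c * u (x \<otimes> y) \<partial>V) = c * (\<integral>\<^sup>+x. u (x \<otimes> y) \<partial>V)" if "y \<in> space W" for y
      using that mult(2) by (intro nn_integral_cmult mV) (simp_all add: spW)
    have [measurable]: "(\<lambda>y. \<integral>\<^sup>+x. u (x \<otimes> y) \<partial>V) \<in> borel_measurable W" using mult(4) by simp
    show ?case
      using mult by (auto simp: eq nn_integral_cmult mP cong: measurable_cong nn_integral_cong)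
  next
    case (add u v)
    have eq: "(\<integral>\<^sup>+x. v (x \<otimes> y) + u (x \<otimes> y) \<partial>V) = (\<integral>\<^sup>+x. v (x \<otimes> y) \<partial>V) + (\<integral>\<^sup>+x. u (x \<otimes> y) \<partial>V)"
      if "y \<in> space W" for y
      using that add by (intro nn_integral_add mV) (simp_all add: spW)
    have [measurable]: "(\<lambda>y. \<integral>\<^sup>+x. u (x \<otimes> y) \<partial>V) \<in> borel_measurable W"
      "(\<lambda>y. \<integral>\<^sup>+x. v (x \<otimes> y) \<partial>V) \<in> borel_measurable W" using add by simp_all
    show ?case
      using add by (auto simp: eq nn_integral_add mP cong: measurable_cong nn_integral_cong)
  next
    case (seq U)
    note inc = incseqD[OF \<open>incseq U\<close>, THEN le_funD]
    have U: "U i \<in> borel_measurable (borel_of T)" for i by (rule seq)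
    have [measurable]: "(\<lambda>y. \<integral>\<^sup>+x. U i (x \<otimes> y) \<partial>V) \<in> borel_measurable W"
      and IH: "(\<integral>\<^sup>+x. U i x \<partial>conv_measure G T V W) = (\<integral>\<^sup>+y. \<integral>\<^sup>+x. U i (x \<otimes> y) \<partial>V \<partial>W)" for i
      using seq by blast+
    have eq: "(\<integral>\<^sup>+x. (SUP i. U i) (x \<otimes> y) \<partial>V) = (SUP i. \<integral>\<^sup>+x. U i (x \<otimes> y) \<partial>V)" if "y \<in> space W" for y
      using that U unfolding SUP_apply
      by (intro nn_integral_monotone_convergence_SUP mV) (auto simp: spW incseq_def le_fun_def inc)
    have 1: "(\<integral>\<^sup>+y. (SUP i. \<integral>\<^sup>+x. U i (x \<otimes> y) \<partial>V) \<partial>W) = (SUP i. \<integral>\<^sup>+y. \<integral>\<^sup>+x. U i (x \<otimes> y) \<partial>V \<partial>W)"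
      by (intro nn_integral_monotone_convergence_SUP)
        (auto simp: incseq_def le_fun_def inc intro!: nn_integral_mono)
    have 2: "(\<integral>\<^sup>+x. (SUP i. U i) x \<partial>conv_measure G T V W) = (SUP i. \<integral>\<^sup>+x. U i x \<partial>conv_measure G T V W)"
      unfolding SUP_apply using U
      by (intro nn_integral_monotone_convergence_SUP) (auto simp: mP incseq_def le_fun_def inc)
    have 3: "(\<lambda>y. SUP i. \<integral>\<^sup>+x. U i (x \<otimes> y) \<partial>V) \<in> borel_measurable W"
      by (intro borel_measurable_SUP) auto
    show ?case
    proof
      show "(\<lambda>y. \<integral>\<^sup>+x. (SUP i. U i) (x \<otimes> y) \<partial>V) \<in> borel_measurable W"
        using 3 measurable_cong[of W "\<lambda>y. \<integral>\<^sup>+x. (SUP i. U i) (x \<otimes> y) \<partial>V", OF eq] by blast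
      show "(\<integral>\<^sup>+x. (SUP i. U i) x \<partial>conv_measure G T V W) =
          (\<integral>\<^sup>+y. \<integral>\<^sup>+x. (SUP i. U i) (x \<otimes> y) \<partial>V \<partial>W)"
        unfolding 2 IH 1[symmetric] by (rule nn_integral_cong[OF eq, symmetric])
    qed
  }
qed

lemma finite_measure_conv_measure:
  assumes V: "radon T V" and W: "radon T W"
  shows "finite_measure (conv_measure G T V W)"
proof (rule finite_measureI)
  interpret V: finite_measure V by (rule radon_finite_measure[OF V])
  interpret W: finite_measure W by (rule radon_finite_measure[OF W])
  have "emeasure (conv_measure G T V W) (space (conv_measure G T V W)) =
      (\<integral>\<^sup>+y. emeasure V (right_section G (topspace T) y) \<partial>W)"
    unfolding space_conv_measure
    by (rule emeasure_conv_measure[OF V W openin_sets_borel_of[OF openin_topspace]])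
  also have "\<dots> \<le> (\<integral>\<^sup>+y. emeasure V (space V) \<partial>W)"
    by (intro nn_integral_mono emeasure_space)
  also have "\<dots> < \<infinity>" by (simp add: V.emeasure_eq_measure W.emeasure_eq_measure ennreal_mult_less_top)
  finally show "emeasure (conv_measure G T V W) (space (conv_measure G T V W)) \<noteq> \<infinity>" by simp
qed

lemma compactin_mult:
  assumes "compactin T C" "compactin T Q"
  shows "compactin T ((\<lambda>(x, y). x \<otimes> y) ` (C \<times> Q))"
  by (rule image_compactin[OF _ continuous_mult]) (use assms in \<open>simp add: compactin_Times\<close>)

text \<open>Take a compact part \<open>C\<close> of the section and a compact neighbourhood
  \<open>Q\<close> of \<open>y\<close> such that \<open>C\<close> lies in the section of
  \<open>U\<close> at every point of \<open>Q\<close>. The product of \<open>C\<close> and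
  \<open>Q\<close> is compact, lies in \<open>U\<close>, and its section at each point of
  \<open>Q\<close> contains \<open>C\<close>.\<close>

lemma compact_lift_right_section:
  assumes V: "radon T V" and U: "openin T U" and y: "y \<in> carrier G"
    and t: "t < measure V (right_section G U y)"
  shows "\<exists>N K. openin T N \<and> y \<in> N \<and> compactin T K \<and> K \<subseteq> U \<and>
    (\<forall>y'\<in>N. t < measure V (right_section G K y'))"
proof -
  interpret V: finite_measure V by (rule radon_finite_measure[OF V])
  obtain C where C: "compactin T C" "C \<subseteq> right_section G U y" "t < measure V C"
    using compact_in_right_section[OF V U y t] by blast
  obtain N where N: "openin T N" "y \<in> N" "\<And>y'. y' \<in> N \<Longrightarrow> C \<subseteq> right_section G U y'"
    using right_section_nbhd[OF U y C(1,2)] by blast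
  have nb: "neighbourhood_base_of (compactin T) T"
    using locally_compact Hausdorff locally_compact_space_neighbourhood_base by blast
  obtain N' Q where Q: "openin T N'" "compactin T Q" "y \<in> N'" "N' \<subseteq> Q" "Q \<subseteq> N"
    using nb[unfolded neighbourhood_base_of, rule_format, OF conjI[OF N(1,2)]] by metis
  define K where "K = (\<lambda>(x, y). x \<otimes> y) ` (C \<times> Q)"
  have K: "compactin T K" unfolding K_def by (rule compactin_mult[OF C(1) Q(2)])
  have KU: "K \<subseteq> U"
  proof
    fix z assume "z \<in> K"
    then obtain x q where "x \<in> C" "q \<in> Q" "z = x \<otimes> q" by (auto simp: K_def)
    then show "z \<in> U" using N(3)[of q] Q(5) by (auto simp: right_section_def)
  qed
  have "t < measure V (right_section G K y')" if y': "y' \<in> N'" for y'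
  proof -
    have c: "y' \<in> carrier G" using openin_subset[OF Q(1)] y' by (auto simp: topspace_eq_carrier)
    have "C \<subseteq> right_section G K y'"
      using C(2) Q(4) y' by (auto simp: right_section_def K_def)
    then have "measure V C \<le> measure V (right_section G K y')"
      using right_section_sets[OF compactin_sets_borel_of[OF Hausdorff K] c] radon_sets[OF V]
      by (intro V.finite_measure_mono) auto
    then show ?thesis using C(3) by simp
  qed
  then show ?thesis using Q(1,3) K KU by blast
qed

text \<open>Finitely many neighbourhoods from \<open>compact_lift_right_section\<close> cover
  \<open>L\<close>; the union of the corresponding compact sets works for all of
  \<open>L\<close>.\<close>

lemma compact_lift_right_section_compact:
  assumes V: "radon T V" and U: "openin T U" and L: "compactin T L"
    and t: "\<And>y. y \<in> L \<Longrightarrow> t < measure V (right_section G U y)"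
  shows "\<exists>K. compactin T K \<and> K \<subseteq> U \<and> (\<forall>y\<in>L. t < measure V (right_section G K y))"
proof -
  interpret V: finite_measure V by (rule radon_finite_measure[OF V])
  have Lc: "L \<subseteq> carrier G" using compactin_subset_topspace[OF L] by (simp add: topspace_eq_carrier)
  have "\<forall>y\<in>L. \<exists>N K. openin T N \<and> y \<in> N \<and> compactin T K \<and> K \<subseteq> U \<and>
      (\<forall>y'\<in>N. t < measure V (right_section G K y'))"
    using compact_lift_right_section[OF V U] t Lc by blast
  then obtain N K where NK: "\<And>y. y \<in> L \<Longrightarrow> openin T (N y)" "\<And>y. y \<in> L \<Longrightarrow> y \<in> N y"
    "\<And>y. y \<in> L \<Longrightarrow> compactin T (K y)" "\<And>y. y \<in> L \<Longrightarrow> K y \<subseteq> U"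
    "\<And>y y'. y \<in> L \<Longrightarrow> y' \<in> N y \<Longrightarrow> t < measure V (right_section G (K y) y')"
    by metis
  have cov: "L \<subseteq> \<Union> (N ` L)" using NK(2) by blast
  obtain \<F> where F: "finite \<F>" "\<F> \<subseteq> N ` L" "L \<subseteq> \<Union>\<F>"
    using compactinD[OF L _ cov] NK(1) by (metis imageE)
  obtain D where D: "finite D" "D \<subseteq> L" "\<F> = N ` D"
    using finite_subset_image[OF F(1,2)] by blast
  define K' where "K' = \<Union> (K ` D)"
  have K': "compactin T K'"
    unfolding K'_def using D NK(3) by (intro compactin_Union) auto
  have "t < measure V (right_section G K' y)" if y: "y \<in> L" for y
  proof -
    obtain d where d: "d \<in> D" "y \<in> N d" using F(3) D(3) y by auto
    have "measure V (right_section G (K d) y) \<le> measure V (right_section G K' y)"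
      using d right_section_sets[OF compactin_sets_borel_of[OF Hausdorff K'], of y] y Lc radon_sets[OF V]
      by (intro V.finite_measure_mono right_section_mono) (auto simp: K'_def)
    then show ?thesis using NK(5)[of d y] d D(2) by fastforce
  qed
  then show ?thesis using K' NK(4) D(2) by (intro exI[of _ K'] conjI) (auto simp: K'_def)
qed

text \<open>By \<open>radonI_open\<close> only open sets need inner approximation. The measure of
  the section of \<open>U\<close> is cut into levels of height \<open>\<delta>\<close>. Each
  superlevel set is open and filled by a compact set \<open>L i\<close> up to
  \<open>W\<close>-measure \<open>\<eta>\<close>, and over \<open>L i\<close> a compact subset of
  \<open>U\<close> keeps its sections above the same level. Outside small exceptional sets the
  sections of \<open>U - K\<close> then have measure at most \<open>\<delta>\<close>.\<close>

lemma radon_conv_measure: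
  assumes V: "radon T V" and W: "radon T W"
  shows "radon T (conv_measure G T V W)"
proof (rule radonI_open[OF Hausdorff finite_measure_conv_measure[OF V W] sets_conv_measure])
  interpret V: finite_measure V by (rule radon_finite_measure[OF V])
  interpret W: finite_measure W by (rule radon_finite_measure[OF W])
  interpret P: finite_measure "conv_measure G T V W" by (rule finite_measure_conv_measure[OF V W])
  fix U and e :: real assume U: "openin T U" and e: "0 < e"
  define v where "v = measure V (space V)"
  define w where "w = measure W (space W)"
  have vw: "0 \<le> v" "0 \<le> w" by (simp_all add: v_def w_def)
  \<comment> \<open>The constant \<open>\<delta>\<close>, integrated over \<open>W\<close>, stays
    below \<open>e / 2\<close>; the summand 1 keeps the denominator positive.\<close>
  define \<delta> where "\<delta> = e / (2 * (w + 1))"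
  have \<delta>: "0 < \<delta>" using e vw by (simp add: \<delta>_def)
  obtain n :: nat where n: "v \<le> real n * \<delta>"
    using reals_Archimedean3[OF \<delta>] less_imp_le by meson
  \<comment> \<open>There are \<open>n + 1\<close> exceptional sets, on which the section measure is
    bounded only by \<open>v\<close>. With this \<open>\<eta>\<close> their total contribution also
    stays below \<open>e / 2\<close>.\<close>
  define \<eta> where "\<eta> = e / (2 * (v + 1) * (real n + 1))"
  have \<eta>: "0 < \<eta>" using e vw by (simp add: \<eta>_def)
  define Ob where "Ob i = {y \<in> carrier G. real i * \<delta> < measure V (right_section G U y)}" for i :: nat
  have Ob: "openin T (Ob i)" for i unfolding Ob_def by (rule openin_section_greater[OF V U])
  have "\<exists>L. compactin T L \<and> L \<subseteq> Ob i \<and> measure W (Ob i - L) < \<eta>" for i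
  proof -
    obtain L O' where LO: "compactin T L" "openin T O'" "L \<subseteq> Ob i" "Ob i \<subseteq> O'" "measure W (O' - L) < \<eta>"
      using radon_approx[OF W openin_sets_borel_of[OF Ob[of i]] \<eta>] by blast
    have "measure W (Ob i - L) \<le> measure W (O' - L)"
      using LO compactin_sets_borel_of[OF Hausdorff LO(1)] openin_sets_borel_of[OF LO(2)] radon_sets[OF W]
      by (intro W.finite_measure_mono) auto
    then show ?thesis using LO by (intro exI[of _ L]) auto
  qed
  then obtain L where L: "\<And>i. compactin T (L i)" "\<And>i. L i \<subseteq> Ob i" "\<And>i. measure W (Ob i - L i) < \<eta>"
    by metis
  have "\<exists>K. compactin T K \<and> K \<subseteq> U \<and> (\<forall>y\<in>L i. real i * \<delta> < measure V (right_section G K y))" for i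
    by (rule compact_lift_right_section_compact[OF V U L(1)]) (use L(2) in \<open>auto simp: Ob_def\<close>)
  then obtain Ki where Ki: "\<And>i. compactin T (Ki i)" "\<And>i. Ki i \<subseteq> U"
    "\<And>i y. y \<in> L i \<Longrightarrow> real i * \<delta> < measure V (right_section G (Ki i) y)" by metis
  define K where "K = (\<Union>i\<le>n. Ki i)"
  have K: "compactin T K" unfolding K_def using Ki(1) by (intro compactin_Union) auto
  have KU: "K \<subseteq> U" unfolding K_def using Ki(2) by blast
  have Ks: "K \<in> sets (borel_of T)" by (rule compactin_sets_borel_of[OF Hausdorff K])
  have Us: "U \<in> sets (borel_of T)" by (rule openin_sets_borel_of[OF U])
  have Sv: "right_section G E y \<in> sets V" if "E \<in> sets (borel_of T)" "y \<in> carrier G" for E y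
    using right_section_sets[OF that] radon_sets[OF V] by simp
  have Ds: "Ob i - L i \<in> sets W" for i
    using openin_sets_borel_of[OF Ob[of i]] compactin_sets_borel_of[OF Hausdorff L(1)[of i]] radon_sets[OF W]
    by auto
  define f where "f y = \<delta> + (\<Sum>i\<le>n. v * indicator (Ob i - L i) y)" for y
  have f0: "0 \<le> f y" for y
    using \<delta> vw by (auto simp: f_def intro!: add_nonneg_nonneg sum_nonneg)
  have bound: "measure V (right_section G (U - K) y) \<le> f y" if y: "y \<in> carrier G" for y
  proof (cases "\<exists>i\<le>n. y \<in> Ob i - L i")
    case True
    then obtain i where i: "i \<le> n" "y \<in> Ob i - L i" by blast
    have "measure V (right_section G (U - K) y) \<le> v"
      unfolding v_def by (rule V.bounded_measure)
    also have "v = v * indicator (Ob i - L i) y" using i by simp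
    also have "\<dots> \<le> (\<Sum>i\<le>n. v * indicator (Ob i - L i) y)"
      using i vw by (intro member_le_sum) auto
    also have "\<dots> \<le> f y" using \<delta> by (simp add: f_def)
    finally show ?thesis .
  next
    case False
    define g where "g = measure V (right_section G U y)"
    have diff: "measure V (right_section G (U - K) y) = g - measure V (right_section G K y)"
      unfolding right_section_simps g_def
      by (rule V.finite_measure_Diff[OF Sv[OF Us y] Sv[OF Ks y] right_section_mono[OF KU]])
    have "g \<le> v" unfolding g_def v_def by (rule V.bounded_measure)
    then have ex: "g \<le> real n * \<delta>" using n by simp
    \<comment> \<open>The least level not below \<open>g\<close>. If it is \<open>Suc i\<close>,
      then \<open>g\<close> exceeds level \<open>i\<close>, so \<open>y\<close> lies in
      \<open>L i\<close> and the section of \<open>K\<close> exceeds level \<open>i\<close> as well,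
      which leaves a gap of at most \<open>\<delta>\<close>.\<close>
    define j where "j = (LEAST j. g \<le> real j * \<delta>)"
    have j: "g \<le> real j * \<delta>" unfolding j_def using ex by (rule LeastI)
    have jn: "j \<le> n" unfolding j_def using ex by (rule Least_le)
    have "g - measure V (right_section G K y) \<le> \<delta>"
    proof (cases j)
      case 0
      have "0 \<le> measure V (right_section G K y)" by simp
      moreover have "g \<le> 0" using j 0 by simp
      ultimately show ?thesis using \<delta> by linarith
    next
      case (Suc i)
      have "\<not> g \<le> real i * \<delta>" using not_less_Least[of i "\<lambda>j. g \<le> real j * \<delta>"] Suc by (simp add: j_def)
      then have "y \<in> Ob i" using y by (simp add: Ob_def g_def)
      then have "y \<in> L i" using False Suc jn by auto
      then have "real i * \<delta> < measure V (right_section G (Ki i) y)" by (rule Ki(3))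
      moreover have "Ki i \<subseteq> K" unfolding K_def by (intro UN_upper) (use Suc jn in simp)
      then have "measure V (right_section G (Ki i) y) \<le> measure V (right_section G K y)"
        using Sv[OF Ks y] by (intro V.finite_measure_mono right_section_mono)
      ultimately show ?thesis using j Suc by (simp add: algebra_simps)
    qed
    moreover have "\<delta> \<le> f y" using vw by (auto simp: f_def intro!: sum_nonneg)
    ultimately show ?thesis using diff by simp
  qed
  have int: "integrable W (\<lambda>y. v * indicator (Ob i - L i) y)" for i
    using Ds[of i] by (simp add: W.emeasure_eq_measure)
  have fint: "integrable W f"
    unfolding f_def by (intro Bochner_Integration.integrable_add Bochner_Integration.integrable_sum int W.integrable_const)
  have "emeasure (conv_measure G T V W) (U - K) = (\<integral>\<^sup>+y. emeasure V (right_section G (U - K) y) \<partial>W)"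
    using Us Ks by (intro emeasure_conv_measure[OF V W]) auto
  also have "\<dots> \<le> (\<integral>\<^sup>+y. ennreal (f y) \<partial>W)"
    using bound radon_space[OF W]
    by (intro nn_integral_mono) (simp add: V.emeasure_eq_measure topspace_eq_carrier ennreal_leI)
  also have "\<dots> = ennreal (LINT y|W. f y)"
    using fint f0 by (intro nn_integral_eq_integral) auto
  also have "(LINT y|W. f y) = (LINT y|W. \<delta>) + (\<Sum>i\<le>n. LINT y|W. v * indicator (Ob i - L i) y)"
    unfolding f_def
    by (subst Bochner_Integration.integral_add)
      (simp_all only: int W.integrable_const Bochner_Integration.integrable_sum Bochner_Integration.integral_sum)
  also have "\<dots> = \<delta> * w + (\<Sum>i\<le>n. v * measure W (Ob i - L i))"
    using Ds by (simp add: w_def)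
  finally have "ennreal (measure (conv_measure G T V W) (U - K)) \<le>
      ennreal (\<delta> * w + (\<Sum>i\<le>n. v * measure W (Ob i - L i)))"
    by (simp add: P.emeasure_eq_measure)
  then have "measure (conv_measure G T V W) (U - K) \<le> \<delta> * w + (\<Sum>i\<le>n. v * measure W (Ob i - L i))"
    using \<delta> vw by (subst (asm) ennreal_le_iff) (auto intro!: add_nonneg_nonneg sum_nonneg)
  also have "\<dots> \<le> \<delta> * w + (\<Sum>i\<le>n. v * \<eta>)"
    using L(3) vw by (intro add_left_mono sum_mono mult_left_mono) (auto intro: less_imp_le)
  also have "\<dots> = \<delta> * w + (real n + 1) * (v * \<eta>)" by simp
  also have "(real n + 1) * (v * \<eta>) = ((real n + 1) * (e * v)) / ((real n + 1) * (2 * (v + 1)))"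
    by (simp add: \<eta>_def mult_ac)
  also have "\<dots> = (e * v) / (2 * (v + 1))"
    by (rule nonzero_mult_divide_mult_cancel_left) simp
  also have "\<dots> = e / 2 * (v / (v + 1))" by simp
  also have "\<delta> * w = e / 2 * (w / (w + 1))" using vw by (simp add: \<delta>_def field_simps)
  also have "e / 2 * (w / (w + 1)) + e / 2 * (v / (v + 1)) < e / 2 * 1 + e / 2 * 1"
    using e vw by (intro add_strict_mono mult_strict_left_mono) (auto simp: divide_simps)
  finally show "\<exists>K. compactin T K \<and> K \<subseteq> U \<and> measure (conv_measure G T V W) (U - K) < e"
    using K KU by auto
qed

end

section \<open>Integrals against complex measures; bilinearity and regularity of convolution\<close>

lemma integrable_variation_cmeas_iff:
  fixes h :: "'a \<Rightarrow> complex"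
  assumes \<rho>: "finite_measure \<rho>" and f: "integrable \<rho> f" and sets: "sets M = sets \<rho>"
    and h[measurable]: "h \<in> borel_measurable \<rho>"
  shows "integrable (variation M (cmeas \<rho> f)) h \<longleftrightarrow> integrable \<rho> (\<lambda>x. h x * f x)"
proof -
  have [measurable]: "f \<in> borel_measurable \<rho>" using f by auto
  have "integrable (variation M (cmeas \<rho> f)) h \<longleftrightarrow> integrable \<rho> (\<lambda>x. cmod (f x) *\<^sub>R h x)"
    unfolding variation_cmeas[OF \<rho> f sets] by (subst integrable_density) auto
  also have "\<dots> \<longleftrightarrow> integrable \<rho> (\<lambda>x. norm (cmod (f x) *\<^sub>R h x))"
    by (rule integrable_norm_iff[symmetric]) measurable
  also have "(\<lambda>x. norm (cmod (f x) *\<^sub>R h x)) = (\<lambda>x. norm (h x * f x))"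
    by (auto simp: norm_mult)
  also have "integrable \<rho> (\<lambda>x. norm (h x * f x)) \<longleftrightarrow> integrable \<rho> (\<lambda>x. h x * f x)"
    by (rule integrable_norm_iff) measurable
  finally show ?thesis .
qed

text \<open>The sum of the two variations dominates both measures, and over a common base measure
  addition of measures becomes addition of densities.\<close>

lemma common_density:
  assumes \<mu>: "\<mu> \<in> complex_measures M" and \<nu>: "\<nu> \<in> complex_measures M"
  obtains f g where "finite_measure (add_measure (variation M \<mu>) (variation M \<nu>))"
    "integrable (add_measure (variation M \<mu>) (variation M \<nu>)) f"
    "integrable (add_measure (variation M \<mu>) (variation M \<nu>)) g"
    "\<mu> = cmeas (add_measure (variation M \<mu>) (variation M \<nu>)) f"
    "\<nu> = cmeas (add_measure (variation M \<mu>) (variation M \<nu>)) g"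
proof -
  let ?\<rho> = "add_measure (variation M \<mu>) (variation M \<nu>)"
  have fin: "finite_measure ?\<rho>"
    by (intro finite_measure_add_measure finite_measure_variation \<mu> \<nu>) simp
  have sets: "sets ?\<rho> = sets M" by simp
  have z: "\<mu> E = 0 \<and> \<nu> E = 0" if E: "E \<in> sets M" "emeasure ?\<rho> E = 0" for E
  proof -
    have "emeasure (variation M \<mu>) E = 0" "emeasure (variation M \<nu>) E = 0"
      using E by (simp_all add: emeasure_add_measure)
    then have "measure (variation M \<mu>) E = 0" "measure (variation M \<nu>) E = 0"
      by (simp_all add: Sigma_Algebra.measure_def)
    then show ?thesis
      using cmod_le_variation[OF \<mu>, of E] cmod_le_variation[OF \<nu>, of E] by simp
  qed
  obtain f where f: "integrable ?\<rho> f" "\<mu> = cmeas ?\<rho> f"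
    using complex_density_representation[OF \<mu> fin sets] z by metis
  obtain g where g: "integrable ?\<rho> g" "\<nu> = cmeas ?\<rho> g"
    using complex_density_representation[OF \<nu> fin sets] z by metis
  show thesis by (rule that[OF fin f(1) g(1) f(2) g(2)])
qed

lemma cmeas_add:
  assumes "integrable \<rho> f" "integrable \<rho> g"
  shows "(\<lambda>E. cmeas \<rho> f E + cmeas \<rho> g E) = cmeas \<rho> (\<lambda>x. f x + g x)"
  using assms by (auto simp: cmeas_def set_integral_add set_integrable_of_integrable)

lemma cmeas_scale: "(\<lambda>E. c * cmeas \<rho> f E) = cmeas \<rho> (\<lambda>x. c * f x)"
  by (auto simp: cmeas_def)

lemma complex_integral_polar:
  assumes \<nu>: "\<nu> = cmeas (variation M \<nu>) u" "\<nu> \<in> complex_measures M"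
    and u: "u \<in> borel_measurable M" "\<And>x. cmod (u x) = 1" and h: "integrable (variation M \<nu>) h"
  shows "integrable (variation M \<nu>) (\<lambda>x. h x * u x)"
    and "complex_integral M \<nu> h = (LINT x|variation M \<nu>. h x * u x)"
proof -
  interpret finite_measure "variation M \<nu>" by (rule finite_measure_variation[OF \<nu>(2)])
  have ui: "integrable (variation M \<nu>) u"
    by (rule integrable_const_bound[where B=1]) (use u in auto)
  have [measurable]: "u \<in> borel_measurable (variation M \<nu>)" "h \<in> borel_measurable (variation M \<nu>)"
    using u h by auto
  show i: "integrable (variation M \<nu>) (\<lambda>x. h x * u x)"
    by (rule Bochner_Integration.integrable_bound[OF h]) (auto simp: norm_mult u)
  have "complex_integral M (cmeas (variation M \<nu>) u) h = (LINT x|variation M \<nu>. h x * u x)"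
    by (rule complex_integral_cmeas[OF ui _ _ i]) auto
  then show "complex_integral M \<nu> h = (LINT x|variation M \<nu>. h x * u x)" using \<nu>(1) by simp
qed

text \<open>Jordan parts are not additive in the measure, so additivity is read off from densities
  over a common base.\<close>

lemma complex_integral_add_measure:
  assumes \<mu>: "\<mu> \<in> complex_measures M" and \<nu>: "\<nu> \<in> complex_measures M"
    and h: "integrable (variation M \<mu>) h" "integrable (variation M \<nu>) h"
  shows "complex_integral M (\<lambda>E. \<mu> E + \<nu> E) h = complex_integral M \<mu> h + complex_integral M \<nu> h"
proof -
  let ?\<rho> = "add_measure (variation M \<mu>) (variation M \<nu>)"
  obtain f g where fg: "finite_measure ?\<rho>" "integrable ?\<rho> f" "integrable ?\<rho> g"
    "\<mu> = cmeas ?\<rho> f" "\<nu> = cmeas ?\<rho> g"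
    using common_density[OF \<mu> \<nu>] by blast
  have s: "sets M = sets ?\<rho>" by simp
  have hm: "h \<in> borel_measurable ?\<rho>"
    using h(1) measurable_cong_sets[of ?\<rho> "variation M \<mu>" borel borel] by auto
  have i: "integrable ?\<rho> (\<lambda>x. h x * f x)" "integrable ?\<rho> (\<lambda>x. h x * g x)"
    using integrable_variation_cmeas_iff[OF fg(1,2) s hm] integrable_variation_cmeas_iff[OF fg(1,3) s hm] h
    by (simp_all flip: fg(4,5))
  have "complex_integral M (cmeas ?\<rho> (\<lambda>x. f x + g x)) h = (LINT x|?\<rho>. h x * (f x + g x))"
    by (rule complex_integral_cmeas) (use fg i hm in \<open>auto simp: distrib_left\<close>)
  also have "\<dots> = (LINT x|?\<rho>. h x * f x) + (LINT x|?\<rho>. h x * g x)"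
    using i by (simp add: distrib_left)
  also have "\<dots> = complex_integral M (cmeas ?\<rho> f) h + complex_integral M (cmeas ?\<rho> g) h"
    by (simp only: complex_integral_cmeas[OF fg(2) s hm i(1)] complex_integral_cmeas[OF fg(3) s hm i(2)])
  finally show ?thesis
    by (simp only: cmeas_add[OF fg(2,3), symmetric] flip: fg(4,5))
qed

lemma complex_integral_scale_measure:
  assumes \<mu>: "\<mu> \<in> complex_measures M" and h: "integrable (variation M \<mu>) h"
  shows "complex_integral M (\<lambda>E. c * \<mu> E) h = c * complex_integral M \<mu> h"
proof -
  interpret finite_measure "variation M \<mu>" by (rule finite_measure_variation[OF \<mu>])
  obtain u where u: "u \<in> borel_measurable M" "\<And>x. cmod (u x) = 1" "\<mu> = cmeas (variation M \<mu>) u"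
    using ex_polar[OF \<mu>] by blast
  have ui: "integrable (variation M \<mu>) u"
    by (rule integrable_const_bound[where B=1]) (use u in auto)
  note i = complex_integral_polar[OF u(3) \<mu> u(1,2) h]
  have "complex_integral M (cmeas (variation M \<mu>) (\<lambda>x. c * u x)) h = (LINT x|variation M \<mu>. h x * (c * u x))"
    by (rule complex_integral_cmeas) (use ui i(1) h in \<open>auto simp: mult.left_commute\<close>)
  also have "\<dots> = c * (LINT x|variation M \<mu>. h x * u x)"
    by (simp add: mult.left_commute)
  finally show ?thesis
    unfolding i(2) cmeas_scale[symmetric] u(3)[symmetric] .
qed

lemma sets_jordan_pos: "sets (jordan_pos M \<nu>) = sets M"
  by (simp add: jordan_pos_def)

context locally_compact_group
begin

lemma radon_variation:
  assumes "\<mu> \<in> regular_measures T"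
  shows "radon T (variation (borel_of T) \<mu>)" "\<mu> \<in> complex_measures (borel_of T)"
  using assms radon_regular_measures_iff[OF Hausdorff] by (auto simp: regular_measures_def)

text \<open>The bound by \<open>cmod (\<mu> F)\<close> is shared by the real and imaginary parts and
  their negatives. It makes the Jordan part absolutely continuous with respect to the variation of
  \<open>\<mu>\<close>, and regularity is inherited.\<close>

lemma radon_jordan_pos:
  assumes \<mu>: "\<mu> \<in> regular_measures T" and \<nu>: "signed_measure (borel_of T) \<nu>"
    and le: "\<And>F. \<bar>\<nu> F\<bar> \<le> cmod (\<mu> F)"
  shows "radon T (jordan_pos (borel_of T) \<nu>)"
proof (rule radon_absolutely_continuous[OF Hausdorff radon_variation(1)[OF \<mu>] finite_measure_jordan_pos[OF \<nu>]])
  let ?V = "variation (borel_of T) \<mu>"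
  interpret V: finite_measure ?V by (rule finite_measure_variation[OF radon_variation(2)[OF \<mu>]])
  show "sets (jordan_pos (borel_of T) \<nu>) = sets ?V" by (simp add: sets_jordan_pos)
  fix E assume E: "E \<in> sets ?V" and 0: "emeasure ?V E = 0"
  have E': "E \<in> sets (borel_of T)" using E by simp
  have "\<nu> F = 0" if "F \<in> sets (borel_of T)" "F \<subseteq> E" for F
  proof -
    have "measure ?V F \<le> measure ?V E" using that E by (intro V.finite_measure_mono) auto
    also have "\<dots> = 0" using 0 by (simp add: Sigma_Algebra.measure_def)
    finally have "cmod (\<mu> F) \<le> 0"
      using cmod_le_variation[OF radon_variation(2)[OF \<mu>], of F] by linarith
    then show ?thesis using le[of F] by linarith
  qed
  then have "sup_charge (borel_of T) \<nu> E = 0"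
    unfolding sup_charge_def by (intro antisym SUP_least) auto
  then show "emeasure (jordan_pos (borel_of T) \<nu>) E = 0"
    by (simp add: emeasure_jordan_pos[OF \<nu> E'])
qed

lemma measurable_complex_right_section:
  assumes \<mu>: "\<mu> \<in> regular_measures T" and E: "E \<in> sets (borel_of T)"
  shows "(\<lambda>y. \<mu> (right_section G E y)) \<in> borel_measurable (borel_of T)"
proof -
  note c = radon_variation(2)[OF \<mu>]
  note R = signed_measure_Re_Im(1)[OF c] and I = signed_measure_Re_Im(2)[OF c]
  have [measurable]:
    "(\<lambda>y. measure (jordan_pos (borel_of T) (\<lambda>E. Re (\<mu> E))) (right_section G E y)) \<in> borel_measurable (borel_of T)"
    "(\<lambda>y. measure (jordan_pos (borel_of T) (\<lambda>E. - Re (\<mu> E))) (right_section G E y)) \<in> borel_measurable (borel_of T)"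
    "(\<lambda>y. measure (jordan_pos (borel_of T) (\<lambda>E. Im (\<mu> E))) (right_section G E y)) \<in> borel_measurable (borel_of T)"
    "(\<lambda>y. measure (jordan_pos (borel_of T) (\<lambda>E. - Im (\<mu> E))) (right_section G E y)) \<in> borel_measurable (borel_of T)"
    by (intro measurable_measure_right_section E radon_jordan_pos[OF \<mu>] R I signed_measure_uminus;
        simp add: abs_Re_le_cmod abs_Im_le_cmod)+
  show ?thesis
  proof (subst measurable_cong)
    fix y assume "y \<in> space (borel_of T)"
    then have s: "right_section G E y \<in> sets (borel_of T)"
      using right_section_sets[OF E] by (simp add: topspace_eq_carrier)
    show "\<mu> (right_section G E y) = complex_of_real
        (measure (jordan_pos (borel_of T) (\<lambda>E. Re (\<mu> E))) (right_section G E y) -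
         measure (jordan_pos (borel_of T) (\<lambda>E. - Re (\<mu> E))) (right_section G E y)) + \<i> * complex_of_real
        (measure (jordan_pos (borel_of T) (\<lambda>E. Im (\<mu> E))) (right_section G E y) -
         measure (jordan_pos (borel_of T) (\<lambda>E. - Im (\<mu> E))) (right_section G E y))"
      using jordan_decomposition[OF R s] jordan_decomposition[OF I s] by (simp add: complex_eq_iff)
  qed measurable
qed

lemma cmod_right_section_le:
  assumes \<mu>: "\<mu> \<in> regular_measures T"
  shows "cmod (\<mu> F) \<le> measure (variation (borel_of T) \<mu>) (topspace T)"
proof -
  interpret V: finite_measure "variation (borel_of T) \<mu>"
    by (rule finite_measure_variation[OF radon_variation(2)[OF \<mu>]])
  show ?thesis
    using cmod_le_variation[OF radon_variation(2)[OF \<mu>], of F] V.bounded_measure[of F] by simp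
qed

lemma integrable_right_section:
  assumes \<mu>: "\<mu> \<in> regular_measures T" and \<nu>: "\<nu> \<in> regular_measures T" and E: "E \<in> sets (borel_of T)"
  shows "integrable (variation (borel_of T) \<nu>) (\<lambda>y. \<mu> (right_section G E y))"
proof -
  interpret W: finite_measure "variation (borel_of T) \<nu>"
    by (rule finite_measure_variation[OF radon_variation(2)[OF \<nu>]])
  show ?thesis
    using measurable_complex_right_section[OF \<mu> E] cmod_right_section_le[OF \<mu>]
    by (intro W.integrable_const_bound[where B="measure (variation (borel_of T) \<mu>) (topspace T)"]) auto
qed

lemma convolution_eq:
  "convolution G T \<mu> \<nu> E = (if E \<in> sets (borel_of T)
     then complex_integral (borel_of T) \<nu> (\<lambda>y. \<mu> (right_section G E y)) else 0)"
  by (simp add: convolution_def right_section_def)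

lemma convolution_add_left:
  assumes "\<mu> \<in> regular_measures T" "\<mu>' \<in> regular_measures T" "\<nu> \<in> regular_measures T"
  shows "convolution G T (\<lambda>E. \<mu> E + \<mu>' E) \<nu> = (\<lambda>E. convolution G T \<mu> \<nu> E + convolution G T \<mu>' \<nu> E)"
proof
  fix E
  note c = radon_variation(2)[OF assms(3)]
  obtain u where u: "u \<in> borel_measurable (borel_of T)" "\<And>x. cmod (u x) = 1"
    "\<nu> = cmeas (variation (borel_of T) \<nu>) u"
    using ex_polar[OF c] by blast
  note p = complex_integral_polar[OF u(3) c u(1,2)]
  note i1 = integrable_right_section[OF assms(1,3)] and i2 = integrable_right_section[OF assms(2,3)]
  show "convolution G T (\<lambda>E. \<mu> E + \<mu>' E) \<nu> E = convolution G T \<mu> \<nu> E + convolution G T \<mu>' \<nu> E"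
    unfolding convolution_eq
    using p(2)[OF i1] p(2)[OF i2] p(1)[OF i1] p(1)[OF i2]
      p(2)[OF Bochner_Integration.integrable_add[OF i1 i2]]
    by (simp add: distrib_right)
qed

lemma convolution_scale_left:
  assumes "\<mu> \<in> regular_measures T" "\<nu> \<in> regular_measures T"
  shows "convolution G T (\<lambda>E. c * \<mu> E) \<nu> = (\<lambda>E. c * convolution G T \<mu> \<nu> E)"
proof
  fix E
  note cc = radon_variation(2)[OF assms(2)]
  obtain u where u: "u \<in> borel_measurable (borel_of T)" "\<And>x. cmod (u x) = 1"
    "\<nu> = cmeas (variation (borel_of T) \<nu>) u"
    using ex_polar[OF cc] by blast
  note p = complex_integral_polar[OF u(3) cc u(1,2)]
  note i1 = integrable_right_section[OF assms]
  show "convolution G T (\<lambda>E. c * \<mu> E) \<nu> E = c * convolution G T \<mu> \<nu> E"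
    unfolding convolution_eq
    using p(2)[OF i1] p(2)[OF integrable_mult_right[OF i1, of c]]
    by (simp add: mult.assoc)
qed

lemma convolution_add_right:
  assumes "\<mu> \<in> regular_measures T" "\<nu> \<in> regular_measures T" "\<nu>' \<in> regular_measures T"
  shows "convolution G T \<mu> (\<lambda>E. \<nu> E + \<nu>' E) = (\<lambda>E. convolution G T \<mu> \<nu> E + convolution G T \<mu> \<nu>' E)"
  unfolding convolution_eq
  using complex_integral_add_measure[OF radon_variation(2)[OF assms(2)] radon_variation(2)[OF assms(3)]]
    integrable_right_section[OF assms(1,2)] integrable_right_section[OF assms(1,3)]
  by auto

lemma convolution_scale_right:
  assumes "\<mu> \<in> regular_measures T" "\<nu> \<in> regular_measures T"
  shows "convolution G T \<mu> (\<lambda>E. c * \<nu> E) = (\<lambda>E. c * convolution G T \<mu> \<nu> E)"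
  unfolding convolution_eq
  using complex_integral_scale_measure[OF radon_variation(2)[OF assms(2)]]
    integrable_right_section[OF assms]
  by auto

lemma cmod_convolution_le:
  assumes \<mu>: "\<mu> \<in> regular_measures T" and \<nu>: "\<nu> \<in> regular_measures T"
  shows "ennreal (cmod (convolution G T \<mu> \<nu> E)) \<le>
    emeasure (conv_measure G T (variation (borel_of T) \<mu>) (variation (borel_of T) \<nu>)) E"
proof (cases "E \<in> sets (borel_of T)")
  case True
  let ?V = "variation (borel_of T) \<mu>" and ?W = "variation (borel_of T) \<nu>"
  note c = radon_variation(2)[OF \<nu>]
  note V = radon_variation(1)[OF \<mu>] and W = radon_variation(1)[OF \<nu>]
  interpret V: finite_measure ?V by (rule radon_finite_measure[OF V])
  obtain u where u: "u \<in> borel_measurable (borel_of T)" "\<And>x. cmod (u x) = 1" "\<nu> = cmeas ?W u"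
    using ex_polar[OF c] by blast
  note p = complex_integral_polar[OF u(3) c u(1,2) integrable_right_section[OF \<mu> \<nu> True]]
  have "convolution G T \<mu> \<nu> E = (LINT y|?W. \<mu> (right_section G E y) * u y)"
    using True p(2) by (simp add: convolution_eq)
  then have "ennreal (cmod (convolution G T \<mu> \<nu> E)) \<le> (\<integral>\<^sup>+y. norm (\<mu> (right_section G E y) * u y) \<partial>?W)"
    using integral_norm_bound_ennreal[OF p(1)] by simp
  also have "\<dots> \<le> (\<integral>\<^sup>+y. emeasure ?V (right_section G E y) \<partial>?W)"
    by (intro nn_integral_mono)
      (simp add: norm_mult u(2) V.emeasure_eq_measure ennreal_leI cmod_le_variation[OF radon_variation(2)[OF \<mu>]])
  also have "\<dots> = emeasure (conv_measure G T ?V ?W) E"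
    by (rule emeasure_conv_measure[OF V W True, symmetric])
  finally show ?thesis .
qed (simp add: convolution_eq)

text \<open>Countable additivity of \<open>\<mu>\<close> on sections is integrated by dominated
  convergence. The total variation of \<open>\<mu>\<close> bounds all partial sums, because the
  sections of disjoint sets are disjoint.\<close>

lemma convolution_in_complex_measures:
  assumes \<mu>: "\<mu> \<in> regular_measures T" and \<nu>: "\<nu> \<in> regular_measures T"
  shows "convolution G T \<mu> \<nu> \<in> complex_measures (borel_of T)"
proof -
  let ?V = "variation (borel_of T) \<mu>" and ?W = "variation (borel_of T) \<nu>"
  let ?B = "borel_of T"
  note c = radon_variation(2)[OF \<nu>]
  note V = radon_variation(1)[OF \<mu>] and W = radon_variation(1)[OF \<nu>]
  interpret V: finite_measure ?V by (rule radon_finite_measure[OF V])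
  interpret W: finite_measure ?W by (rule radon_finite_measure[OF W])
  obtain u where u: "u \<in> borel_measurable ?B" "\<And>x. cmod (u x) = 1" "\<nu> = cmeas ?W u"
    using ex_polar[OF c] by blast
  note p = complex_integral_polar[OF u(3) c u(1,2) integrable_right_section[OF \<mu> \<nu>]]
  have ceq: "convolution G T \<mu> \<nu> E = (LINT y|?W. \<mu> (right_section G E y) * u y)" if "E \<in> sets ?B" for E
    using that p(2)[OF that] by (simp add: convolution_eq)
  have s: "signed_measure ?B (\<lambda>E. Re (\<mu> E))" "signed_measure ?B (\<lambda>E. Im (\<mu> E))"
    by (rule signed_measure_Re_Im[OF radon_variation(2)[OF \<mu>]])+
  have "(\<lambda>i. convolution G T \<mu> \<nu> (A i)) sums convolution G T \<mu> \<nu> (\<Union>i. A i)"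
    if A: "range A \<subseteq> sets ?B" "disjoint_family A" for A :: "nat \<Rightarrow> 'a set"
  proof -
    have Ai: "A i \<in> sets ?B" for i using A by auto
    then have UA: "(\<Union>i. A i) \<in> sets ?B" by blast
    let ?f = "\<lambda>i y. \<mu> (right_section G (A i) y) * u y"
    have "(\<lambda>n. LINT y|?W. (\<Sum>i<n. ?f i y)) \<longlonglongrightarrow> (LINT y|?W. \<mu> (right_section G (\<Union>i. A i) y) * u y)"
    proof (rule integral_dominated_convergence[where w="\<lambda>_. measure ?V (space ?V)"])
      show "(\<lambda>y. \<mu> (right_section G (\<Union>i. A i) y) * u y) \<in> borel_measurable ?W"
        using p(1)[OF UA] by auto
      show "(\<lambda>y. \<Sum>i<n. ?f i y) \<in> borel_measurable ?W" for n
        using p(1)[OF Ai] by (intro borel_measurable_sum) auto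
      show "integrable ?W (\<lambda>_. measure ?V (space ?V))" by simp
      show "AE y in ?W. (\<lambda>n. \<Sum>i<n. ?f i y) \<longlonglongrightarrow> \<mu> (right_section G (\<Union>i. A i) y) * u y"
      proof (rule AE_I2)
        fix y assume "y \<in> space ?W"
        then have y: "y \<in> carrier G" by (simp add: topspace_eq_carrier)
        have "range (\<lambda>i. right_section G (A i) y) \<subseteq> sets ?B"
          using right_section_sets[OF Ai y] by auto
        then have "(\<lambda>i. \<mu> (right_section G (A i) y)) sums \<mu> (\<Union>i. right_section G (A i) y)"
          using radon_variation(2)[OF \<mu>] disjoint_family_right_section[OF A(2), of G y]
          unfolding complex_measures_def by blast
        then have "(\<lambda>i. ?f i y) sums (\<mu> (\<Union>i. right_section G (A i) y) * u y)"
          by (rule sums_mult2)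
        then show "(\<lambda>n. \<Sum>i<n. ?f i y) \<longlonglongrightarrow> \<mu> (right_section G (\<Union>i. A i) y) * u y"
          by (simp add: sums_def right_section_simps)
      qed
      show "AE y in ?W. norm (\<Sum>i<n. ?f i y) \<le> measure ?V (space ?V)" for n
      proof (rule AE_I2)
        fix y assume "y \<in> space ?W"
        then have y: "y \<in> carrier G" by (simp add: topspace_eq_carrier)
        have "norm (\<Sum>i<n. ?f i y) \<le> (\<Sum>i<n. measure ?V (right_section G (A i) y))"
          by (intro sum_norm_le) (simp add: norm_mult u(2) cmod_le_variation[OF radon_variation(2)[OF \<mu>]])
        also have "\<dots> = measure ?V (\<Union>i<n. right_section G (A i) y)"
          using right_section_sets[OF Ai y] disjoint_family_right_section[OF A(2), of G y]
          by (intro V.finite_measure_finite_Union[symmetric])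
            (auto intro: disjoint_family_on_mono[of "{..<n}" UNIV])
        also have "\<dots> \<le> measure ?V (space ?V)" by (rule V.bounded_measure)
        finally show "norm (\<Sum>i<n. ?f i y) \<le> measure ?V (space ?V)" .
      qed
    qed
    then show ?thesis
      using p(1)[OF Ai] by (simp add: sums_def ceq[OF Ai] ceq[OF UA] Bochner_Integration.integral_sum)
  qed
  moreover have "convolution G T \<mu> \<nu> {} = 0"
  proof -
    have "\<mu> {} = 0" using radon_variation(2)[OF \<mu>] by (simp add: complex_measures_def)
    then show ?thesis by (simp add: ceq right_section_simps)
  qed
  ultimately show ?thesis
    unfolding complex_measures_def by (auto simp: convolution_eq)
qed

lemma variation_convolution_le:
  assumes \<mu>: "\<mu> \<in> regular_measures T" and \<nu>: "\<nu> \<in> regular_measures T" and E: "E \<in> sets (borel_of T)"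
  shows "emeasure (variation (borel_of T) (convolution G T \<mu> \<nu>)) E \<le>
    emeasure (conv_measure G T (variation (borel_of T) \<mu>) (variation (borel_of T) \<nu>)) E"
  by (rule emeasure_variation_le[OF convolution_in_complex_measures[OF \<mu> \<nu>] _ cmod_convolution_le[OF \<mu> \<nu>] E]) simp

text \<open>The variation of the convolution is dominated by the convolution of the variations,
  which is Radon by \<open>radon_conv_measure\<close>; regularity passes down by absolute
  continuity.\<close>

lemma convolution_in_regular_measures:
  assumes \<mu>: "\<mu> \<in> regular_measures T" and \<nu>: "\<nu> \<in> regular_measures T"
  shows "convolution G T \<mu> \<nu> \<in> regular_measures T"
  unfolding radon_regular_measures_iff[OF Hausdorff convolution_in_complex_measures[OF \<mu> \<nu>]]
proof (rule radon_absolutely_continuous[OF Hausdorff])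
  show "radon T (conv_measure G T (variation (borel_of T) \<mu>) (variation (borel_of T) \<nu>))"
    by (intro radon_conv_measure radon_variation(1) \<mu> \<nu>)
  show "finite_measure (variation (borel_of T) (convolution G T \<mu> \<nu>))"
    by (rule finite_measure_variation[OF convolution_in_complex_measures[OF \<mu> \<nu>]])
  fix E assume "E \<in> sets (conv_measure G T (variation (borel_of T) \<mu>) (variation (borel_of T) \<nu>))"
    "emeasure (conv_measure G T (variation (borel_of T) \<mu>) (variation (borel_of T) \<nu>)) E = 0"
  then show "emeasure (variation (borel_of T) (convolution G T \<mu> \<nu>)) E = 0"
    using variation_convolution_le[OF \<mu> \<nu>, of E] by simp
qed simp

end

section \<open>Weighted measure algebras\<close>

locale weighted_group = locally_compact_group G T for G (structure) and T +
  fixes \<omega> :: "'a \<Rightarrow> real"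
  assumes weight: "weight G T \<omega>"
begin

abbreviation "B \<equiv> borel_of T"
abbreviation "M \<equiv> measure_algebra G T \<omega>"
abbreviation "nrm \<equiv> vnorm M"

lemma \<omega>_measurable [measurable]: "\<omega> \<in> borel_measurable B"
  using weight by (intro borel_measurable_borel_of) (simp add: weight_def)

lemma \<omega>_ge_1: "x \<in> topspace T \<Longrightarrow> 1 \<le> \<omega> x"
  using weight by (simp add: weight_def topspace_eq_carrier)

lemma \<omega>_mult_le: "x \<in> topspace T \<Longrightarrow> y \<in> topspace T \<Longrightarrow> \<omega> (x \<otimes> y) \<le> \<omega> x * \<omega> y"
  using weight by (simp add: weight_def topspace_eq_carrier)

lemma M_simps:
  "vadd M = (\<lambda>\<mu> \<nu> E. \<mu> E + \<nu> E)" "vscale M = (\<lambda>c \<mu> E. c * \<mu> E)" "vmult M = convolution G T"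
  by (simp_all add: measure_algebra_def)

lemma radon_density:
  assumes \<rho>: "radon T \<rho>" and f: "integrable \<rho> f"
  shows "radon T (density \<rho> (\<lambda>x. ennreal (cmod (f x))))"
proof (rule radon_absolutely_continuous[OF Hausdorff \<rho>])
  have [measurable]: "f \<in> borel_measurable \<rho>" using f by auto
  show "finite_measure (density \<rho> (\<lambda>x. ennreal (cmod (f x))))"
    using f by (intro finite_measureI) (simp add: emeasure_density integrable_iff_bounded cong: nn_integral_cong)
  fix E assume "E \<in> sets \<rho>" "emeasure \<rho> E = 0"
  then have "E \<in> null_sets \<rho>" by auto
  then have "E \<in> null_sets (density \<rho> (\<lambda>x. ennreal (cmod (f x))))"
    using absolutely_continuousI_density[of "\<lambda>x. ennreal (cmod (f x))" \<rho>]
    by (auto simp: absolutely_continuous_def)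
  then show "emeasure (density \<rho> (\<lambda>x. ennreal (cmod (f x)))) E = 0" by auto
qed simp

lemma cmeas_regular:
  assumes \<rho>: "radon T \<rho>" and f: "integrable \<rho> f"
  shows "cmeas \<rho> f \<in> regular_measures T"
proof -
  have c: "cmeas \<rho> f \<in> complex_measures B"
    by (rule cmeas_in_complex_measures[OF f]) (simp add: radon_sets[OF \<rho>])
  show ?thesis
    unfolding radon_regular_measures_iff[OF Hausdorff c]
      variation_cmeas[OF radon_finite_measure[OF \<rho>] f radon_sets[OF \<rho>, symmetric]]
    by (rule radon_density[OF \<rho> f])
qed

lemma \<omega>_measurable_radon: "radon T \<rho> \<Longrightarrow> \<omega> \<in> borel_measurable \<rho>"
  using measurable_cong_sets[OF radon_sets refl] \<omega>_measurable by blast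

lemma weighted_cmeas:
  fixes f :: "'a \<Rightarrow> complex"
  assumes \<rho>: "radon T \<rho>" and f: "integrable \<rho> f" and wf: "integrable \<rho> (\<lambda>x. \<omega> x * f x)"
  shows "weighted_measure T \<omega> (cmeas \<rho> f) = cmeas \<rho> (\<lambda>x. \<omega> x * f x)"
proof
  fix E
  note [measurable] = \<omega>_measurable_radon[OF \<rho>]
  show "weighted_measure T \<omega> (cmeas \<rho> f) E = cmeas \<rho> (\<lambda>x. \<omega> x * f x) E"
  proof (cases "E \<in> sets B")
    case True
    then have E[measurable]: "E \<in> sets \<rho>" using radon_sets[OF \<rho>] by simp
    have eq: "complex_of_real (indicator E x * \<omega> x) * f x = indicator E x *\<^sub>R (\<omega> x * f x)" for x
      by (simp add: scaleR_conv_of_real)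
    have "complex_integral B (cmeas \<rho> f) (\<lambda>x. complex_of_real (indicator E x * \<omega> x)) =
        (LINT x|\<rho>. complex_of_real (indicator E x * \<omega> x) * f x)"
    proof (rule complex_integral_cmeas[OF f radon_sets[OF \<rho>, symmetric]])
      show "integrable \<rho> (\<lambda>x. complex_of_real (indicator E x * \<omega> x) * f x)"
        unfolding eq using integrable_mult_indicator[OF E wf] .
    qed measurable
    then show ?thesis
      using True E unfolding eq by (simp add: weighted_measure_def cmeas_def set_lebesgue_integral_def)
  next
    case False
    then show ?thesis using radon_sets[OF \<rho>] by (simp add: weighted_measure_def cmeas_def)
  qed
qed

text \<open>Multiplication by \<open>\<omega>\<close> turns the density \<open>f\<close> into
  \<open>\<omega> x * f x\<close>, whose variation has density
  \<open>\<omega> x * cmod (f x)\<close>; membership and norm are both read off from this.\<close>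

lemma carrier_cmeas:
  assumes \<rho>: "radon T \<rho>" and f: "integrable \<rho> f" and wf: "integrable \<rho> (\<lambda>x. \<omega> x * cmod (f x))"
  shows "cmeas \<rho> f \<in> carrier M" and "nrm (cmeas \<rho> f) = (LINT x|\<rho>. \<omega> x * cmod (f x))"
proof -
  note [measurable] = \<omega>_measurable_radon[OF \<rho>]
  have [measurable]: "f \<in> borel_measurable \<rho>" using f by auto
  note fin = radon_finite_measure[OF \<rho>] and sets = radon_sets[OF \<rho>, symmetric]
  have w0: "0 \<le> \<omega> x" if "x \<in> space \<rho>" for x using \<omega>_ge_1[of x] that radon_space[OF \<rho>] by simp
  have wf': "integrable \<rho> (\<lambda>x. \<omega> x * f x)"
    by (rule Bochner_Integration.integrable_bound[OF wf]) (auto simp: norm_mult)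
  have "integrable (variation B (cmeas \<rho> f)) \<omega>"
    unfolding variation_cmeas[OF fin f sets] using wf
    by (subst integrable_density) (auto simp: mult.commute)
  moreover have "weighted_measure T \<omega> (cmeas \<rho> f) \<in> regular_measures T"
    unfolding weighted_cmeas[OF \<rho> f wf'] by (rule cmeas_regular[OF \<rho> wf'])
  ultimately show "cmeas \<rho> f \<in> carrier M"
    using cmeas_regular[OF \<rho> f] by (simp add: measure_algebra_def)
  have "nrm (cmeas \<rho> f) = measure (density \<rho> (\<lambda>x. ennreal (cmod (\<omega> x * f x)))) (topspace T)"
    by (simp add: measure_algebra_def weighted_cmeas[OF \<rho> f wf'] variation_cmeas[OF fin wf' sets])
  also have "emeasure (density \<rho> (\<lambda>x. ennreal (cmod (\<omega> x * f x)))) (topspace T) =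
      (\<integral>\<^sup>+x. ennreal (\<omega> x * cmod (f x)) \<partial>\<rho>)"
    using sets.top[of \<rho>] w0 radon_space[OF \<rho>]
    by (subst emeasure_density) (auto simp: norm_mult intro!: nn_integral_cong)
  then have "measure (density \<rho> (\<lambda>x. ennreal (cmod (\<omega> x * f x)))) (topspace T) = (LINT x|\<rho>. \<omega> x * cmod (f x))"
    using w0 wf by (subst (asm) nn_integral_eq_integral)
      (auto simp: Sigma_Algebra.measure_def intro!: AE_I2 integral_nonneg_AE)
  finally show "nrm (cmeas \<rho> f) = (LINT x|\<rho>. \<omega> x * cmod (f x))" .
qed

lemma carrier_regular: "\<mu> \<in> carrier M \<Longrightarrow> \<mu> \<in> regular_measures T"
  by (simp add: measure_algebra_def)

lemma carrier_integrable: "\<mu> \<in> carrier M \<Longrightarrow> integrable (variation B \<mu>) \<omega>"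
  by (simp add: measure_algebra_def)

lemma carrier_polar:
  assumes \<mu>: "\<mu> \<in> carrier M"
  obtains u where "u \<in> borel_measurable B" "\<And>x. cmod (u x) = 1" "\<mu> = cmeas (variation B \<mu>) u"
    "integrable (variation B \<mu>) u"
proof -
  note c = radon_variation(2)[OF carrier_regular[OF \<mu>]]
  interpret V: finite_measure "variation B \<mu>" by (rule finite_measure_variation[OF c])
  obtain u where u: "u \<in> borel_measurable B" "\<And>x. cmod (u x) = 1" "\<mu> = cmeas (variation B \<mu>) u"
    using ex_polar[OF c] by blast
  have "integrable (variation B \<mu>) u"
    by (rule V.integrable_const_bound[where B=1]) (use u(1,2) in auto)
  with u show thesis by (rule that)
qed

lemma carrierI:
  assumes \<mu>: "\<mu> \<in> regular_measures T" "integrable (variation B \<mu>) \<omega>"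
  shows "\<mu> \<in> carrier M" and "nrm \<mu> = (LINT x|variation B \<mu>. \<omega> x)"
proof -
  note c = radon_variation[OF \<mu>(1)]
  interpret V: finite_measure "variation B \<mu>" by (rule finite_measure_variation[OF c(2)])
  obtain u where u: "u \<in> borel_measurable B" "\<And>x. cmod (u x) = 1" "\<mu> = cmeas (variation B \<mu>) u"
    using ex_polar[OF c(2)] by blast
  have ui: "integrable (variation B \<mu>) u"
    by (rule V.integrable_const_bound[where B=1]) (use u(1,2) in auto)
  have "integrable (variation B \<mu>) (\<lambda>x. \<omega> x * cmod (u x))" using \<mu>(2) u(2) by simp
  note C = carrier_cmeas[OF c(1) ui this, folded u(3)]
  show "\<mu> \<in> carrier M" by (rule C(1))
  show "nrm \<mu> = (LINT x|variation B \<mu>. \<omega> x)" using C(2) u(2) by simp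
qed

lemma nrm_eq: "\<mu> \<in> carrier M \<Longrightarrow> nrm \<mu> = (LINT x|variation B \<mu>. \<omega> x)"
  by (rule carrierI(2)[OF carrier_regular carrier_integrable])

lemma nn_integral_weight:
  assumes \<mu>: "\<mu> \<in> carrier M"
  shows "(\<integral>\<^sup>+x. ennreal (\<omega> x) \<partial>variation B \<mu>) = ennreal (nrm \<mu>)"
proof -
  have "0 \<le> \<omega> x" if "x \<in> topspace T" for x using \<omega>_ge_1[OF that] by simp
  then show ?thesis
    unfolding nrm_eq[OF \<mu>] by (intro nn_integral_eq_integral carrier_integrable[OF \<mu>] AE_I2) simp
qed

lemma nrm_nonneg: "\<mu> \<in> carrier M \<Longrightarrow> 0 \<le> nrm \<mu>"
  by (simp add: measure_algebra_def)

lemma carrier_common: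
  assumes \<mu>: "\<mu> \<in> carrier M" and \<nu>: "\<nu> \<in> carrier M"
  obtains \<rho> f g where "radon T \<rho>" "integrable \<rho> f" "integrable \<rho> g" "\<mu> = cmeas \<rho> f" "\<nu> = cmeas \<rho> g"
    "integrable \<rho> (\<lambda>x. \<omega> x * cmod (f x))" "integrable \<rho> (\<lambda>x. \<omega> x * cmod (g x))"
proof -
  note c = radon_variation[OF carrier_regular[OF \<mu>]] and d = radon_variation[OF carrier_regular[OF \<nu>]]
  let ?\<rho> = "add_measure (variation B \<mu>) (variation B \<nu>)"
  obtain f g where fg: "integrable ?\<rho> f" "integrable ?\<rho> g" "\<mu> = cmeas ?\<rho> f" "\<nu> = cmeas ?\<rho> g"
    using common_density[OF c(2) d(2)] by blast
  have \<rho>: "radon T ?\<rho>" by (rule radon_add_measure[OF Hausdorff c(1) d(1)])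
  note [measurable] = \<omega>_measurable_radon[OF \<rho>]
  have [measurable]: "f \<in> borel_measurable ?\<rho>" "g \<in> borel_measurable ?\<rho>" using fg by auto
  note fin = radon_finite_measure[OF \<rho>] and sets = radon_sets[OF \<rho>, symmetric]
  have "integrable (density ?\<rho> (\<lambda>x. ennreal (cmod (f x)))) \<omega>"
    using carrier_integrable[OF \<mu>] variation_cmeas[OF fin fg(1) sets] fg(3) by metis
  then have 1: "integrable ?\<rho> (\<lambda>x. \<omega> x * cmod (f x))"
    by (subst (asm) integrable_density) (auto simp: mult.commute)
  have "integrable (density ?\<rho> (\<lambda>x. ennreal (cmod (g x)))) \<omega>"
    using carrier_integrable[OF \<nu>] variation_cmeas[OF fin fg(2) sets] fg(4) by metis
  then have 2: "integrable ?\<rho> (\<lambda>x. \<omega> x * cmod (g x))"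
    by (subst (asm) integrable_density) (auto simp: mult.commute)
  show thesis by (rule that[OF \<rho> fg 1 2])
qed

lemma vadd_closed:
  assumes \<mu>: "\<mu> \<in> carrier M" and \<nu>: "\<nu> \<in> carrier M"
  shows "(\<lambda>E. \<mu> E + \<nu> E) \<in> carrier M" and "nrm (\<lambda>E. \<mu> E + \<nu> E) \<le> nrm \<mu> + nrm \<nu>"
proof -
  obtain \<rho> f g where \<rho>: "radon T \<rho>" and fg: "integrable \<rho> f" "integrable \<rho> g" "\<mu> = cmeas \<rho> f" "\<nu> = cmeas \<rho> g"
    and i: "integrable \<rho> (\<lambda>x. \<omega> x * cmod (f x))" "integrable \<rho> (\<lambda>x. \<omega> x * cmod (g x))"
    using carrier_common[OF \<mu> \<nu>] by metis
  note [measurable] = \<omega>_measurable_radon[OF \<rho>]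
  have [measurable]: "f \<in> borel_measurable \<rho>" "g \<in> borel_measurable \<rho>" using fg by auto
  have le: "\<omega> x * cmod (f x + g x) \<le> \<omega> x * cmod (f x) + \<omega> x * cmod (g x)" if "x \<in> space \<rho>" for x
    using \<omega>_ge_1[of x] that radon_space[OF \<rho>] norm_triangle_ineq[of "f x" "g x"]
    by (simp flip: distrib_left add: mult_left_mono)
  have w0: "0 \<le> \<omega> x" if "x \<in> space \<rho>" for x using \<omega>_ge_1[of x] that radon_space[OF \<rho>] by simp
  have ifg: "integrable \<rho> (\<lambda>x. f x + g x)" using fg by simp
  have iw: "integrable \<rho> (\<lambda>x. \<omega> x * cmod (f x + g x))"
    by (rule Bochner_Integration.integrable_bound[OF Bochner_Integration.integrable_add[OF i]])
      (use le w0 in \<open>auto intro!: AE_I2 simp: abs_mult\<close>)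
  note C = carrier_cmeas[OF \<rho> ifg iw]
  have eq: "(\<lambda>E. \<mu> E + \<nu> E) = cmeas \<rho> (\<lambda>x. f x + g x)"
    unfolding fg(3,4) by (rule cmeas_add[OF fg(1,2)])
  show "(\<lambda>E. \<mu> E + \<nu> E) \<in> carrier M" unfolding eq by (rule C(1))
  have "nrm (\<lambda>E. \<mu> E + \<nu> E) \<le> (LINT x|\<rho>. \<omega> x * cmod (f x) + \<omega> x * cmod (g x))"
    unfolding eq C(2) using iw i le by (intro integral_mono) auto
  also have "\<dots> = nrm \<mu> + nrm \<nu>"
    unfolding fg(3,4) carrier_cmeas(2)[OF \<rho> fg(1) i(1)] carrier_cmeas(2)[OF \<rho> fg(2) i(2)]
    using i by simp
  finally show "nrm (\<lambda>E. \<mu> E + \<nu> E) \<le> nrm \<mu> + nrm \<nu>" .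
qed

lemma vscale_closed:
  assumes \<mu>: "\<mu> \<in> carrier M"
  shows "(\<lambda>E. c * \<mu> E) \<in> carrier M" and "nrm (\<lambda>E. c * \<mu> E) = cmod c * nrm \<mu>"
proof -
  obtain u where u: "u \<in> borel_measurable B" "\<And>x. cmod (u x) = 1" "\<mu> = cmeas (variation B \<mu>) u"
    "integrable (variation B \<mu>) u"
    using carrier_polar[OF \<mu>] by metis
  have \<rho>: "radon T (variation B \<mu>)" by (rule radon_variation(1)[OF carrier_regular[OF \<mu>]])
  have i: "integrable (variation B \<mu>) (\<lambda>x. c * u x)" using u(4) by simp
  have w: "integrable (variation B \<mu>) (\<lambda>x. \<omega> x * cmod (c * u x))"
    using carrier_integrable[OF \<mu>] by (simp add: norm_mult u(2))
  note C = carrier_cmeas[OF \<rho> i w]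
  have eq: "(\<lambda>E. c * \<mu> E) = cmeas (variation B \<mu>) (\<lambda>x. c * u x)"
    using cmeas_scale[of c "variation B \<mu>" u] u(3) by simp
  show "(\<lambda>E. c * \<mu> E) \<in> carrier M" unfolding eq by (rule C(1))
  show "nrm (\<lambda>E. c * \<mu> E) = cmod c * nrm \<mu>"
    unfolding eq C(2) nrm_eq[OF \<mu>] by (simp add: norm_mult u(2))
qed

section \<open>Restriction of measures to a set, tightness\<close>

definition res :: "'a set \<Rightarrow> ('a set \<Rightarrow> complex) \<Rightarrow> 'a set \<Rightarrow> complex" where
  "res A \<mu> E = (if E \<in> sets B then \<mu> (E \<inter> A) else 0)"

definition dirac :: "'a \<Rightarrow> 'a set \<Rightarrow> complex" where
  "dirac x E = (if E \<in> sets B then indicator E x else 0)"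

lemma compact_sets: "compactin T K \<Longrightarrow> K \<in> sets B"
  by (rule compactin_sets_borel_of[OF Hausdorff])

lemma sets_compl: "A \<in> sets B \<Longrightarrow> topspace T - A \<in> sets B"
  using sets.compl_sets[of A B] by simp

lemma res_cmeas:
  assumes "sets \<rho> = sets B" "A \<in> sets B"
  shows "res A (cmeas \<rho> f) = cmeas \<rho> (\<lambda>x. indicator A x *\<^sub>R f x)"
  using assms by (auto simp: res_def cmeas_def set_lebesgue_integral_def fun_eq_iff indicator_inter_arith mult.commute)

lemma res_props:
  assumes \<mu>: "\<mu> \<in> carrier M" and A: "A \<in> sets B"
  shows res_closed: "res A \<mu> \<in> carrier M"
    and nrm_res: "nrm (res A \<mu>) = (LINT x:A|variation B \<mu>. \<omega> x)"
    and variation_res: "E \<in> sets B \<Longrightarrow> emeasure (variation B (res A \<mu>)) E = emeasure (variation B \<mu>) (E \<inter> A)"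
proof -
  obtain u where u: "u \<in> borel_measurable B" "\<And>x. cmod (u x) = 1" "\<mu> = cmeas (variation B \<mu>) u"
    "integrable (variation B \<mu>) u"
    using carrier_polar[OF \<mu>] by metis
  have \<rho>: "radon T (variation B \<mu>)" by (rule radon_variation(1)[OF carrier_regular[OF \<mu>]])
  have A': "A \<in> sets (variation B \<mu>)" using A by simp
  have eq: "res A \<mu> = cmeas (variation B \<mu>) (\<lambda>x. indicator A x *\<^sub>R u x)"
    using res_cmeas[OF radon_sets[OF \<rho>] A, of u] u(3) by simp
  have i: "integrable (variation B \<mu>) (\<lambda>x. indicator A x *\<^sub>R u x)"
    by (rule integrable_mult_indicator[OF A' u(4)])
  have w: "integrable (variation B \<mu>) (\<lambda>x. \<omega> x * cmod (indicator A x *\<^sub>R u x))"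
    using integrable_mult_indicator[OF A' carrier_integrable[OF \<mu>]] by (simp add: u(2) mult.commute)
  note C = carrier_cmeas[OF \<rho> i w]
  show "res A \<mu> \<in> carrier M" unfolding eq by (rule C(1))
  show "nrm (res A \<mu>) = (LINT x:A|variation B \<mu>. \<omega> x)"
    unfolding eq C(2) set_lebesgue_integral_def by (simp add: u(2) mult.commute)
  show "emeasure (variation B (res A \<mu>)) E = emeasure (variation B \<mu>) (E \<inter> A)" if E: "E \<in> sets B"
  proof -
    have "variation B (res A \<mu>) = density (variation B \<mu>) (\<lambda>x. ennreal (cmod (indicator A x *\<^sub>R u x)))"
      unfolding eq by (rule variation_cmeas[OF radon_finite_measure[OF \<rho>] i]) simp
    also have "(\<lambda>x. ennreal (cmod (indicator A x *\<^sub>R u x))) = indicator A"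
      by (auto simp: u(2) split: split_indicator)
    finally show ?thesis using A' E by (simp add: emeasure_density nn_integral_indicator' indicator_inter_arith[symmetric] Int_commute flip: indicator_inter_arith)
  qed
qed

text \<open>The norm is of L1 type, an integral of \<open>\<omega>\<close> over the variation, hence
  additive over a set and its complement. Dually, functionals living on the two pieces combine like
  a maximum, which is the key to \<open>A_tight\<close>.\<close>

lemma nrm_res_split:
  assumes \<mu>: "\<mu> \<in> carrier M" and A: "A \<in> sets B"
  shows "nrm (res A \<mu>) + nrm (res (topspace T - A) \<mu>) = nrm \<mu>"
proof -
  note i = set_integrable_of_integrable[OF carrier_integrable[OF \<mu>]]
  have "nrm (res A \<mu>) + nrm (res (topspace T - A) \<mu>) =
      (LINT x:A \<union> (topspace T - A)|variation B \<mu>. \<omega> x)"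
    unfolding nrm_res[OF \<mu> A] nrm_res[OF \<mu> sets_compl[OF A]]
    using A sets_compl[OF A] by (intro set_integral_Un[symmetric] i) auto
  also have "A \<union> (topspace T - A) = space (variation B \<mu>)"
    using sets.sets_into_space[OF A] by auto
  also have "(LINT x:space (variation B \<mu>)|variation B \<mu>. \<omega> x) = nrm \<mu>"
    unfolding nrm_eq[OF \<mu>] by (rule set_integral_space[OF carrier_integrable[OF \<mu>]])
  finally show ?thesis .
qed

lemma res_le: "\<mu> \<in> carrier M \<Longrightarrow> A \<in> sets B \<Longrightarrow> nrm (res A \<mu>) \<le> nrm \<mu>"
  using nrm_res_split[of \<mu> A] nrm_nonneg[OF res_closed[OF _ sets_compl]] by fastforce

lemma carrier_complex: "\<mu> \<in> carrier M \<Longrightarrow> \<mu> \<in> complex_measures B"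
  using radon_variation(2)[OF carrier_regular] .

lemma carrier_zero_off: "\<mu> \<in> carrier M \<Longrightarrow> E \<notin> sets B \<Longrightarrow> \<mu> E = 0"
  using carrier_complex unfolding complex_measures_def by blast

lemma cmod_le_emeasure: "\<mu> \<in> carrier M \<Longrightarrow> emeasure (variation B \<mu>) E = 0 \<Longrightarrow> \<mu> E = 0"
  using cmod_le_variation[OF carrier_complex, of \<mu> E] by (simp add: Sigma_Algebra.measure_def)

lemma carrier_Un:
  assumes \<mu>: "\<mu> \<in> carrier M" and AB: "A \<in> sets B" "A' \<in> sets B" "A \<inter> A' = {}"
  shows "\<mu> (A \<union> A') = \<mu> A + \<mu> A'"
  using signed_measure_Un[OF signed_measure_Re_Im(1)[OF carrier_complex[OF \<mu>]] AB]
    signed_measure_Un[OF signed_measure_Re_Im(2)[OF carrier_complex[OF \<mu>]] AB]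
  by (simp add: complex_eq_iff)

lemma res_add_compl:
  assumes \<mu>: "\<mu> \<in> carrier M" and A: "A \<in> sets B"
  shows "(\<lambda>E. res A \<mu> E + res (topspace T - A) \<mu> E) = \<mu>"
proof
  fix E
  show "res A \<mu> E + res (topspace T - A) \<mu> E = \<mu> E"
  proof (cases "E \<in> sets B")
    case True
    have "E = (E \<inter> A) \<union> (E \<inter> (topspace T - A))"
      using sets.sets_into_space[OF True] by auto
    then have "\<mu> E = \<mu> (E \<inter> A) + \<mu> (E \<inter> (topspace T - A))"
      using carrier_Un[OF \<mu>, of "E \<inter> A" "E \<inter> (topspace T - A)"] True A sets_compl[OF A] by auto
    then show ?thesis using True by (simp add: res_def)
  qed (simp add: res_def carrier_zero_off[OF \<mu>])
qed

lemma res_add: "res A (\<lambda>E. \<mu> E + \<nu> E) = (\<lambda>E. res A \<mu> E + res A \<nu> E)"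
  by (auto simp: res_def)

lemma res_scale: "res A (\<lambda>E. c * \<mu> E) = (\<lambda>E. c * res A \<mu> E)"
  by (auto simp: res_def)

text \<open>Regularity is used for \<open>\<omega>\<close> times the variation rather than for the
  variation, so that the weighted tail is small although \<open>\<omega>\<close> may be
  unbounded.\<close>

lemma tight:
  assumes \<mu>: "\<mu> \<in> carrier M" and e: "0 < e"
  shows "\<exists>K. compactin T K \<and> nrm (res (topspace T - K) \<mu>) < e"
proof -
  have \<rho>: "radon T (variation B \<mu>)" by (rule radon_variation(1)[OF carrier_regular[OF \<mu>]])
  have i: "integrable (variation B \<mu>) (\<lambda>x. complex_of_real (\<omega> x))"
    using carrier_integrable[OF \<mu>] by (rule integrable_of_real)
  let ?k = "density (variation B \<mu>) (\<lambda>x. ennreal (cmod (complex_of_real (\<omega> x))))"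
  have \<kappa>: "radon T ?k" by (rule radon_density[OF \<rho> i])
  obtain K U where KU: "compactin T K" "topspace T \<subseteq> U" "openin T U" "measure ?k (U - K) < e"
    using radon_approx[OF \<kappa> openin_sets_borel_of[OF openin_topspace] e] by metis
  have U: "U = topspace T" using KU(2,3) openin_subset by blast
  have s: "topspace T - K \<in> sets B" by (rule sets_compl[OF compact_sets[OF KU(1)]])
  have w0: "0 \<le> \<omega> x" if "x \<in> topspace T" for x using \<omega>_ge_1[OF that] by simp
  have "emeasure ?k (topspace T - K) = (\<integral>\<^sup>+x. ennreal (indicator (topspace T - K) x *\<^sub>R \<omega> x) \<partial>variation B \<mu>)"
    using s by (subst emeasure_density)
      (auto intro!: nn_integral_cong simp: w0 split: split_indicator)
  also have "\<dots> = ennreal (nrm (res (topspace T - K) \<mu>))"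
    unfolding nrm_res[OF \<mu> s] set_lebesgue_integral_def
    using set_integrable_of_integrable[OF carrier_integrable[OF \<mu>]] s
    by (intro nn_integral_eq_integral)
      (auto simp: set_integrable_def w0 split: split_indicator intro!: AE_I2)
  finally have "measure ?k (topspace T - K) = nrm (res (topspace T - K) \<mu>)"
    using nrm_nonneg[OF res_closed[OF \<mu> s]] by (simp add: Sigma_Algebra.measure_def)
  then show ?thesis using KU U by metis
qed

lemma AE_not_null:
  assumes "A \<in> sets B" "emeasure (variation B \<mu>) (topspace T - A) = 0"
  shows "AE x in variation B \<mu>. x \<in> A"
  by (rule AE_I[of _ _ "topspace T - A"]) (use assms sets_compl in auto)

section \<open>Norm and support of convolutions, Dirac measures\<close>

text \<open>The factor \<open>r\<close> is kept general: \<open>r = 1\<close> on the whole group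
  gives a submultiplicative norm, and a small \<open>r\<close> off a finite set is the source of
  Arens regularity for a proper weight.\<close>

lemma convolution_bound:
  assumes \<mu>: "\<mu> \<in> carrier M" and \<nu>: "\<nu> \<in> carrier M" and A: "A \<in> sets B" "A' \<in> sets B"
    and null: "emeasure (variation B \<mu>) (topspace T - A) = 0" "emeasure (variation B \<nu>) (topspace T - A') = 0"
    and r: "0 \<le> r" "\<And>x y. x \<in> A \<Longrightarrow> y \<in> A' \<Longrightarrow> \<omega> (x \<otimes> y) \<le> r * \<omega> x * \<omega> y"
  shows "convolution G T \<mu> \<nu> \<in> carrier M" and "nrm (convolution G T \<mu> \<nu>) \<le> r * nrm \<mu> * nrm \<nu>"
proof -
  let ?V = "variation B \<mu>" and ?W = "variation B \<nu>"
  let ?c = "convolution G T \<mu> \<nu>" and ?P = "conv_measure G T (variation B \<mu>) (variation B \<nu>)"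
  note V = radon_variation(1)[OF carrier_regular[OF \<mu>]] and W = radon_variation(1)[OF carrier_regular[OF \<nu>]]
  note reg = convolution_in_regular_measures[OF carrier_regular[OF \<mu>] carrier_regular[OF \<nu>]]
  have w0: "0 \<le> \<omega> x" if "x \<in> topspace T" for x using \<omega>_ge_1[OF that] by simp
  have "(\<integral>\<^sup>+x. ennreal (\<omega> x) \<partial>variation B ?c) \<le> (\<integral>\<^sup>+x. ennreal (\<omega> x) \<partial>?P)"
    using variation_convolution_le[OF carrier_regular[OF \<mu>] carrier_regular[OF \<nu>]]
    by (intro nn_integral_mono_measure) (auto simp: le_measure)
  also have "\<dots> = (\<integral>\<^sup>+y. \<integral>\<^sup>+x. ennreal (\<omega> (x \<otimes> y)) \<partial>?V \<partial>?W)"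
    using nn_integral_conv_measure[OF V W, of "\<lambda>x. ennreal (\<omega> x)"] by simp
  also have "\<dots> \<le> (\<integral>\<^sup>+y. ennreal (r * \<omega> y * nrm \<mu>) \<partial>?W)"
  proof (rule nn_integral_mono_AE, rule AE_mp[OF AE_not_null[OF A(2) null(2)]], rule AE_I2, rule impI)
    fix y assume y: "y \<in> space ?W" "y \<in> A'"
    then have yw: "0 \<le> r * \<omega> y" using r w0 by simp
    have "(\<integral>\<^sup>+x. ennreal (\<omega> (x \<otimes> y)) \<partial>?V) \<le> (\<integral>\<^sup>+x. ennreal (r * \<omega> y) * ennreal (\<omega> x) \<partial>?V)"
    proof (rule nn_integral_mono_AE, rule AE_mp[OF AE_not_null[OF A(1) null(1)]], rule AE_I2, rule impI)
      fix x assume "x \<in> space ?V" "x \<in> A"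
      then show "ennreal (\<omega> (x \<otimes> y)) \<le> ennreal (r * \<omega> y) * ennreal (\<omega> x)"
        using r(2)[of x y] y yw w0 by (simp add: ennreal_mult[symmetric] mult_ac ennreal_leI)
    qed
    also have "\<dots> = ennreal (r * \<omega> y) * ennreal (nrm \<mu>)"
      by (subst nn_integral_cmult) (auto simp: nn_integral_weight[OF \<mu>])
    finally show "(\<integral>\<^sup>+x. ennreal (\<omega> (x \<otimes> y)) \<partial>?V) \<le> ennreal (r * \<omega> y * nrm \<mu>)"
      using yw nrm_nonneg[OF \<mu>] by (simp add: ennreal_mult)
  qed
  also have "\<dots> = (\<integral>\<^sup>+y. ennreal (r * nrm \<mu>) * ennreal (\<omega> y) \<partial>?W)"
    using r(1) nrm_nonneg[OF \<mu>] w0 by (intro nn_integral_cong) (simp add: ennreal_mult[symmetric] mult_ac)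
  also have "\<dots> = ennreal (r * nrm \<mu>) * ennreal (nrm \<nu>)"
    by (subst nn_integral_cmult) (auto simp: nn_integral_weight[OF \<nu>])
  also have "\<dots> = ennreal (r * nrm \<mu> * nrm \<nu>)"
    using r(1) nrm_nonneg[OF \<mu>] nrm_nonneg[OF \<nu>] by (simp add: ennreal_mult)
  finally have le: "(\<integral>\<^sup>+x. ennreal (\<omega> x) \<partial>variation B ?c) \<le> ennreal (r * nrm \<mu> * nrm \<nu>)" .
  then have i: "integrable (variation B ?c) \<omega>"
    using w0 by (intro integrableI_nonneg) (auto intro: le_less_trans)
  show c: "?c \<in> carrier M" by (rule carrierI(1)[OF reg i])
  have "ennreal (nrm ?c) \<le> ennreal (r * nrm \<mu> * nrm \<nu>)"
    using le unfolding nn_integral_weight[OF c] .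
  then show "nrm ?c \<le> r * nrm \<mu> * nrm \<nu>"
    using r(1) nrm_nonneg[OF \<mu>] nrm_nonneg[OF \<nu>] by (subst (asm) ennreal_le_iff) auto
qed

lemma convolution_closed:
  assumes \<mu>: "\<mu> \<in> carrier M" and \<nu>: "\<nu> \<in> carrier M"
  shows "convolution G T \<mu> \<nu> \<in> carrier M" and "nrm (convolution G T \<mu> \<nu>) \<le> nrm \<mu> * nrm \<nu>"
  using convolution_bound[OF \<mu> \<nu> sets_compl[of "{}"] sets_compl[of "{}"], of 1] \<omega>_mult_le by auto

lemma null_section_convolution:
  assumes \<mu>: "\<mu> \<in> carrier M" and \<nu>: "\<nu> \<in> carrier M" and K: "K \<in> sets B" and A: "A \<in> sets B"
    and null: "emeasure (variation B \<nu>) (topspace T - A) = 0"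
    and sec: "\<And>y. y \<in> A \<Longrightarrow> emeasure (variation B \<mu>) (right_section G K y) = 0"
  shows "emeasure (variation B (convolution G T \<mu> \<nu>)) K = 0"
proof -
  note V = radon_variation(1)[OF carrier_regular[OF \<mu>]] and W = radon_variation(1)[OF carrier_regular[OF \<nu>]]
  have "emeasure (variation B (convolution G T \<mu> \<nu>)) K \<le>
      emeasure (conv_measure G T (variation B \<mu>) (variation B \<nu>)) K"
    by (rule variation_convolution_le[OF carrier_regular[OF \<mu>] carrier_regular[OF \<nu>] K])
  also have "\<dots> = (\<integral>\<^sup>+y. emeasure (variation B \<mu>) (right_section G K y) \<partial>variation B \<nu>)"
    by (rule emeasure_conv_measure[OF V W K])
  also have "\<dots> = (\<integral>\<^sup>+y. 0 \<partial>variation B \<nu>)"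
    by (rule nn_integral_cong_AE, rule AE_mp[OF AE_not_null[OF A null]]) (use sec in auto)
  finally show ?thesis by simp
qed

text \<open>The witness is the product of \<open>K0\<close> with the inverses of \<open>K\<close>:
  if \<open>x \<otimes> y\<close> lies in \<open>K0\<close> and \<open>y\<close> in
  \<open>K\<close>, then \<open>x\<close> lies in this compact set.\<close>

lemma support_left:
  assumes K0: "compactin T K0" and K: "compactin T K"
  shows "\<exists>L. compactin T L \<and> (\<forall>\<mu>\<in>carrier M. \<forall>\<nu>\<in>carrier M. emeasure (variation B \<mu>) L = 0 \<longrightarrow>
    emeasure (variation B \<nu>) (topspace T - K) = 0 \<longrightarrow>
    emeasure (variation B (convolution G T \<mu> \<nu>)) K0 = 0)"
proof -
  define L where "L = (\<lambda>(x, y). x \<otimes> y) ` (K0 \<times> (\<lambda>x. inv x) ` K)"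
  have Kc: "K \<subseteq> carrier G" "K0 \<subseteq> carrier G"
    using compactin_subset_topspace[OF K] compactin_subset_topspace[OF K0] by (simp_all add: topspace_eq_carrier)
  have L: "compactin T L"
    unfolding L_def by (intro compactin_mult K0 image_compactin[OF K continuous_inv])
  have "emeasure (variation B (convolution G T \<mu> \<nu>)) K0 = 0"
    if \<mu>: "\<mu> \<in> carrier M" and \<nu>: "\<nu> \<in> carrier M" and n: "emeasure (variation B \<mu>) L = 0"
      "emeasure (variation B \<nu>) (topspace T - K) = 0" for \<mu> \<nu>
  proof (rule null_section_convolution[OF \<mu> \<nu> compact_sets[OF K0] compact_sets[OF K] n(2)])
    fix y assume y: "y \<in> K"
    have "right_section G K0 y \<subseteq> L"
    proof
      fix x assume x: "x \<in> right_section G K0 y"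
      then have "x = (x \<otimes> y) \<otimes> inv y"
        using y Kc by (auto simp: right_section_def inv_solve_right)
      then show "x \<in> L"
        using x y unfolding L_def right_section_def by (intro image_eqI[of _ _ "(x \<otimes> y, inv y)"]) auto
    qed
    then have "emeasure (variation B \<mu>) (right_section G K0 y) \<le> emeasure (variation B \<mu>) L"
      using compact_sets[OF L] by (intro emeasure_mono) auto
    then show "emeasure (variation B \<mu>) (right_section G K0 y) = 0" using n by simp
  qed
  then show ?thesis using L by blast
qed

text \<open>The mirror image, with the product of the inverses of \<open>K\<close> and
  \<open>K0\<close>. For \<open>y\<close> outside it, the whole section of \<open>K0\<close> at
  \<open>y\<close> avoids \<open>K\<close> and is therefore null for \<open>\<mu>\<close>.\<close>

lemma support_right:
  assumes K0: "compactin T K0" and K: "compactin T K"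
  shows "\<exists>L. compactin T L \<and> (\<forall>\<mu>\<in>carrier M. \<forall>\<nu>\<in>carrier M. emeasure (variation B \<mu>) (topspace T - K) = 0 \<longrightarrow>
    emeasure (variation B \<nu>) L = 0 \<longrightarrow>
    emeasure (variation B (convolution G T \<mu> \<nu>)) K0 = 0)"
proof -
  define L where "L = (\<lambda>(x, y). x \<otimes> y) ` ((\<lambda>x. inv x) ` K \<times> K0)"
  have Kc: "K \<subseteq> carrier G" "K0 \<subseteq> carrier G"
    using compactin_subset_topspace[OF K] compactin_subset_topspace[OF K0] by (simp_all add: topspace_eq_carrier)
  have L: "compactin T L"
    unfolding L_def by (intro compactin_mult K0 image_compactin[OF K continuous_inv])
  have "emeasure (variation B (convolution G T \<mu> \<nu>)) K0 = 0"
    if \<mu>: "\<mu> \<in> carrier M" and \<nu>: "\<nu> \<in> carrier M" and n: "emeasure (variation B \<mu>) (topspace T - K) = 0"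
      "emeasure (variation B \<nu>) L = 0" for \<mu> \<nu>
  proof (rule null_section_convolution[OF \<mu> \<nu> compact_sets[OF K0] sets_compl[OF compact_sets[OF L]]])
    have "topspace T - (topspace T - L) = L" using compactin_subset_topspace[OF L] by auto
    then show "emeasure (variation B \<nu>) (topspace T - (topspace T - L)) = 0" using n by simp
    fix y assume y: "y \<in> topspace T - L"
    have "right_section G K0 y \<subseteq> topspace T - K"
    proof
      fix x assume x: "x \<in> right_section G K0 y"
      have xy: "x \<in> carrier G" "y \<in> carrier G" "x \<otimes> y \<in> K0"
        using x y by (auto simp: right_section_def topspace_eq_carrier)
      have "x \<notin> K"
      proof
        assume "x \<in> K"
        moreover have "y = inv x \<otimes> (x \<otimes> y)" using xy by (simp flip: m_assoc)
        ultimately have "y \<in> L" using xy unfolding L_def by (intro image_eqI[of _ _ "(inv x, x \<otimes> y)"]) auto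
        then show False using y by blast
      qed
      then show "x \<in> topspace T - K" using xy by (simp add: topspace_eq_carrier)
    qed
    then have "emeasure (variation B \<mu>) (right_section G K0 y) \<le> emeasure (variation B \<mu>) (topspace T - K)"
      using sets_compl[OF compact_sets[OF K]] by (intro emeasure_mono) auto
    then show "emeasure (variation B \<mu>) (right_section G K0 y) = 0" using n by simp
  qed
  then show ?thesis using L by blast
qed

lemma singleton_sets: "x \<in> topspace T \<Longrightarrow> {x} \<in> sets B"
  by (rule compact_sets) simp

lemma finite_sets:
  assumes F: "finite F" "F \<subseteq> topspace T"
  shows "F \<in> sets B"
proof (rule sets.countable)
  show "{x} \<in> sets B" if "x \<in> F" for x using that F(2) by (intro singleton_sets) blast
  show "countable F" using F(1) by (rule countable_finite)
qed

lemma dirac_cmeas: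
  assumes x: "x \<in> topspace T"
  shows "dirac x = cmeas (return B x) (\<lambda>_. 1)"
proof
  fix E
  have "(LINT z:E|return B x. (1 :: complex)) = indicator E x" if E: "E \<in> sets B"
  proof -
    have "(LINT z:E|return B x. (1 :: complex)) = indicator E x *\<^sub>R 1"
      unfolding set_lebesgue_integral_def using x E by (intro integral_return) auto
    then show ?thesis by (simp split: split_indicator)
  qed
  then show "dirac x E = cmeas (return B x) (\<lambda>_. 1) E" by (simp add: dirac_def cmeas_def)
qed

lemma dirac_props:
  assumes x: "x \<in> topspace T"
  shows dirac_closed: "dirac x \<in> carrier M" and nrm_dirac: "nrm (dirac x) = \<omega> x"
proof -
  have \<rho>: "radon T (return B x)" by (rule radon_return[OF Hausdorff x])
  have sp: "x \<in> space B" using x by simp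
  interpret R: prob_space "return B x" by (rule prob_space_return[OF sp])
  have i: "integrable (return B x) (\<lambda>_. 1 :: complex)" by simp
  have w: "integrable (return B x) (\<lambda>y. \<omega> y * cmod (1 :: complex))"
    using \<omega>_measurable_radon[OF \<rho>] sp by (intro integrableI_bounded) (auto simp: nn_integral_return)
  note eq = dirac_cmeas[OF x]
  note C = carrier_cmeas[OF \<rho> i w]
  show "dirac x \<in> carrier M" unfolding eq by (rule C(1))
  show "nrm (dirac x) = \<omega> x" unfolding eq C(2) using sp \<omega>_measurable_radon[OF \<rho>] by (simp add: integral_return)
qed

lemma convolution_dirac:
  assumes x: "x \<in> topspace T" and y: "y \<in> topspace T"
  shows "convolution G T (dirac x) (dirac y) = dirac (x \<otimes> y)"
proof
  fix E
  show "convolution G T (dirac x) (dirac y) E = dirac (x \<otimes> y) E"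
  proof (cases "E \<in> sets B")
    case True
    have spy: "y \<in> space B" using y by simp
    interpret R: prob_space "return B y" by (rule prob_space_return[OF spy])
    have i: "integrable (return B y) (\<lambda>_. 1 :: complex)" by simp
    note eq = dirac_cmeas[OF y]
    have m: "(\<lambda>z. dirac x (right_section G E z)) \<in> borel_measurable (return B y)"
      using measurable_complex_right_section[OF carrier_regular[OF dirac_closed[OF x]] True] by simp
    have ii: "integrable (return B y) (\<lambda>z. dirac x (right_section G E z) * 1)"
      using m by (intro R.integrable_const_bound[where B=1]) (auto simp: dirac_def split: split_indicator)
    have "complex_integral B (cmeas (return B y) (\<lambda>_. 1)) (\<lambda>z. dirac x (right_section G E z)) =
        (LINT z|return B y. dirac x (right_section G E z) * 1)"
      by (rule complex_integral_cmeas[OF i _ m ii]) simp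
    also have "\<dots> = dirac x (right_section G E y)"
      using spy m by (simp add: integral_return)
    also have "\<dots> = dirac (x \<otimes> y) E"
      using right_section_sets[OF True, of y] True x y
      by (auto simp: dirac_def right_section_def topspace_eq_carrier split: split_indicator)
    finally show ?thesis using True eq by (simp add: convolution_eq)
  qed (simp add: convolution_eq dirac_def)
qed

lemma sum_point_masses_le:
  assumes \<mu>: "\<mu> \<in> carrier M" and F: "finite F" "F \<subseteq> topspace T"
  shows "(\<Sum>x\<in>F. cmod (\<mu> {x}) * \<omega> x) \<le> nrm \<mu>"
proof -
  interpret V: finite_measure "variation B \<mu>" by (rule finite_measure_variation[OF carrier_complex[OF \<mu>]])
  have s: "{x} \<in> sets (variation B \<mu>)" if "x \<in> F" for x using finite_sets[of "{x}"] that F(2) by simp blast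
  have Fs: "F \<in> sets B" by (rule finite_sets[OF F])
  have "(\<Sum>x\<in>F. cmod (\<mu> {x}) * \<omega> x) \<le> (\<Sum>x\<in>F. measure (variation B \<mu>) {x} * \<omega> x)"
    using F by (intro sum_mono mult_right_mono cmod_le_variation[OF carrier_complex[OF \<mu>]])
      (use \<omega>_ge_1 in \<open>fastforce\<close>)
  also have "\<dots> = (\<Sum>x\<in>F. LINT y:{x}|variation B \<mu>. \<omega> y)"
  proof (intro sum.cong refl)
    fix x assume x: "x \<in> F"
    have "(LINT y:{x}|variation B \<mu>. \<omega> y) = (LINT y:{x}|variation B \<mu>. \<omega> x)"
      by (rule set_lebesgue_integral_cong[OF s[OF x]]) simp
    also have "\<dots> = measure (variation B \<mu>) {x} * \<omega> x"
      using s[OF x] x F(2) by (simp add: set_lebesgue_integral_def subset_iff)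
    finally show "measure (variation B \<mu>) {x} * \<omega> x = (LINT y:{x}|variation B \<mu>. \<omega> y)" by simp
  qed
  also have "\<dots> = (LINT y:(\<Union>x\<in>F. {x})|variation B \<mu>. \<omega> y)"
    by (rule set_integral_finite_Union[symmetric, OF F(1) _ set_integrable_of_integrable[OF carrier_integrable[OF \<mu>] s] s])
      (auto simp: disjoint_family_on_def)
  also have "\<dots> = nrm (res F \<mu>)" by (simp add: nrm_res[OF \<mu> Fs])
  also have "\<dots> \<le> nrm \<mu>" by (rule res_le[OF \<mu> Fs])
  finally show ?thesis .
qed

lemma res_finite:
  assumes \<mu>: "\<mu> \<in> carrier M" and F: "finite F" "F \<subseteq> topspace T"
  shows "res F \<mu> = (\<lambda>E. \<Sum>x\<in>F. \<mu> {x} * dirac x E)"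
  using F
proof (induction)
  case empty
  have "\<mu> {} = 0" using carrier_complex[OF \<mu>] by (simp add: complex_measures_def)
  then show ?case by (auto simp: res_def)
next
  case (insert x F)
  have Fs: "F \<in> sets B" using insert by (intro finite_sets) auto
  have xs: "{x} \<in> sets B" using insert by (intro singleton_sets) auto
  show ?case
  proof
    fix E
    show "res (insert x F) \<mu> E = (\<Sum>x\<in>insert x F. \<mu> {x} * dirac x E)"
    proof (cases "E \<in> sets B")
      case True
      have "\<mu> (E \<inter> insert x F) = \<mu> (E \<inter> {x}) + \<mu> (E \<inter> F)"
      proof -
        have "E \<inter> insert x F = (E \<inter> {x}) \<union> (E \<inter> F)" by blast
        moreover have "(E \<inter> {x}) \<inter> (E \<inter> F) = {}" using insert(2) by blast
        ultimately show ?thesis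
          using carrier_Un[OF \<mu> sets.Int[OF True xs] sets.Int[OF True Fs]] by simp
      qed
      moreover have "\<mu> (E \<inter> {x}) = \<mu> {x} * dirac x E"
      proof (cases "x \<in> E")
        case False
        have "\<mu> {} = 0" using carrier_complex[OF \<mu>] by (simp add: complex_measures_def)
        then show ?thesis using False True by (simp add: dirac_def)
      qed (use True in \<open>simp add: dirac_def\<close>)
      moreover have "\<mu> (E \<inter> F) = (\<Sum>x\<in>F. \<mu> {x} * dirac x E)"
        using insert fun_cong[OF insert(3), of E] True by (simp add: res_def)
      ultimately show ?thesis using True insert by (simp add: res_def)
    qed (simp add: res_def dirac_def)
  qed
qed

end

section \<open>Duals and Arens regularity\<close>

text \<open>Records with explicit carriers come without axioms. The closure and homogeneity
  properties collected here let \<open>dual_bound\<close> pass from the supremum over the unit ball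
  to a bound on the whole space.\<close>

definition nspace :: "('v, 'm) normed_space_scheme \<Rightarrow> bool" where
  "nspace V \<longleftrightarrow> carrier V \<noteq> {} \<and>
     (\<forall>x\<in>carrier V. \<forall>y\<in>carrier V. vadd V x y \<in> carrier V) \<and>
     (\<forall>c. \<forall>x\<in>carrier V. vscale V c x \<in> carrier V) \<and>
     (\<forall>x\<in>carrier V. 0 \<le> vnorm V x) \<and>
     (\<forall>c. \<forall>x\<in>carrier V. vnorm V (vscale V c x) = cmod c * vnorm V x)"

lemma nspaceD:
  assumes "nspace V"
  shows "carrier V \<noteq> {}"
    and "x \<in> carrier V \<Longrightarrow> y \<in> carrier V \<Longrightarrow> vadd V x y \<in> carrier V"
    and "x \<in> carrier V \<Longrightarrow> vscale V c x \<in> carrier V"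
    and "x \<in> carrier V \<Longrightarrow> 0 \<le> vnorm V x"
    and "x \<in> carrier V \<Longrightarrow> vnorm V (vscale V c x) = cmod c * vnorm V x"
  using assms unfolding nspace_def by blast+

lemma dual_simps:
  "carrier (dual V) = bounded_functionals V"
  "vadd (dual V) f g = (\<lambda>x\<in>carrier V. f x + g x)"
  "vscale (dual V) c f = (\<lambda>x\<in>carrier V. c * f x)"
  "vnorm (dual V) f = (SUP x\<in>{x \<in> carrier V. vnorm V x \<le> 1}. cmod (f x))"
  by (simp_all add: dual_def)

lemma dual_apply:
  "x \<in> carrier V \<Longrightarrow> vadd (dual V) f g x = f x + g x"
  "x \<notin> carrier V \<Longrightarrow> vadd (dual V) f g x = undefined"
  "x \<in> carrier V \<Longrightarrow> vscale (dual V) c f x = c * f x"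
  "x \<notin> carrier V \<Longrightarrow> vscale (dual V) c f x = undefined"
  by (simp_all add: dual_simps)

lemma in_dualI:
  assumes "f \<in> extensional (carrier V)"
    and "\<And>x y. x \<in> carrier V \<Longrightarrow> y \<in> carrier V \<Longrightarrow> f (vadd V x y) = f x + f y"
    and "\<And>c x. x \<in> carrier V \<Longrightarrow> f (vscale V c x) = c * f x"
    and "\<And>x. x \<in> carrier V \<Longrightarrow> cmod (f x) \<le> C * vnorm V x"
  shows "f \<in> carrier (dual V)"
  using assms unfolding dual_simps bounded_functionals_def by blast

lemma in_dualD:
  assumes "f \<in> carrier (dual V)"
  shows "f \<in> extensional (carrier V)"
    and "x \<in> carrier V \<Longrightarrow> y \<in> carrier V \<Longrightarrow> f (vadd V x y) = f x + f y"
    and "x \<in> carrier V \<Longrightarrow> f (vscale V c x) = c * f x"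
  using assms unfolding dual_simps bounded_functionals_def by blast+

lemma dual_eqI:
  assumes "f \<in> carrier (dual V)" "g \<in> carrier (dual V)" "\<And>x. x \<in> carrier V \<Longrightarrow> f x = g x"
  shows "f = g"
  using assms in_dualD(1) by (metis extensionalityI)

lemma dual_norm_upper:
  assumes V: "nspace V" and f: "f \<in> carrier (dual V)" and x: "x \<in> carrier V" "vnorm V x \<le> 1"
  shows "cmod (f x) \<le> vnorm (dual V) f"
proof -
  obtain C where C: "\<And>x. x \<in> carrier V \<Longrightarrow> cmod (f x) \<le> C * vnorm V x"
    using f unfolding dual_simps bounded_functionals_def by blast
  have "cmod (f y) \<le> \<bar>C\<bar>" if "y \<in> carrier V" "vnorm V y \<le> 1" for y
  proof -
    have "cmod (f y) \<le> \<bar>C\<bar> * vnorm V y"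
      using C[OF that(1)] nspaceD(4)[OF V that(1)] by (meson abs_ge_self mult_right_mono order_trans)
    also have "\<dots> \<le> \<bar>C\<bar> * 1" using that by (intro mult_left_mono) auto
    finally show ?thesis by simp
  qed
  then have "bdd_above ((\<lambda>x. cmod (f x)) ` {x \<in> carrier V. vnorm V x \<le> 1})"
    by (intro bdd_aboveI[of _ "\<bar>C\<bar>"]) auto
  then show ?thesis unfolding dual_simps using x by (intro cSUP_upper) auto
qed

text \<open>Rescaling moves \<open>x\<close> into the unit ball. If its norm is 0, the constant in
  the definition of a bounded functional already forces \<open>f x = 0\<close>.\<close>

lemma dual_bound:
  assumes V: "nspace V" and f: "f \<in> carrier (dual V)" and x: "x \<in> carrier V"
  shows "cmod (f x) \<le> vnorm (dual V) f * vnorm V x"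
proof (cases "vnorm V x = 0")
  case True
  obtain C where "cmod (f x) \<le> C * vnorm V x"
    using f x unfolding dual_simps bounded_functionals_def by blast
  then show ?thesis using True by simp
next
  case False
  then have pos: "0 < vnorm V x" using nspaceD(4)[OF V x] by simp
  define c where "c = complex_of_real (1 / vnorm V x)"
  have c: "cmod c = 1 / vnorm V x" using pos by (simp add: c_def norm_divide)
  have y: "vscale V c x \<in> carrier V" by (rule nspaceD(3)[OF V x])
  have "vnorm V (vscale V c x) \<le> 1" using nspaceD(5)[OF V x, of c] c pos by simp
  from dual_norm_upper[OF V f y this] have "cmod c * cmod (f x) \<le> vnorm (dual V) f"
    using in_dualD(3)[OF f x] by (simp add: norm_mult)
  then show ?thesis using pos by (simp add: c divide_simps)
qed

lemma dual_norm_le: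
  assumes V: "nspace V" and C: "0 \<le> C" "\<And>x. x \<in> carrier V \<Longrightarrow> cmod (f x) \<le> C * vnorm V x"
  shows "vnorm (dual V) f \<le> C"
  unfolding dual_simps
proof (rule cSUP_least)
  obtain x where x: "x \<in> carrier V" using nspaceD(1)[OF V] by blast
  have "vscale V 0 x \<in> {x \<in> carrier V. vnorm V x \<le> 1}"
    using nspaceD(3,5)[OF V x, of 0] by simp
  then show "{x \<in> carrier V. vnorm V x \<le> 1} \<noteq> {}" by blast
  fix x assume x: "x \<in> {x \<in> carrier V. vnorm V x \<le> 1}"
  have "cmod (f x) \<le> C * vnorm V x" using C(2) x by blast
  also have "\<dots> \<le> C * 1" using x C(1) by (intro mult_left_mono) auto
  finally show "cmod (f x) \<le> C" by simp
qed

lemma dual_norm_nonneg: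
  assumes V: "nspace V" and f: "f \<in> carrier (dual V)"
  shows "0 \<le> vnorm (dual V) f"
proof -
  obtain x where x: "x \<in> carrier V" using nspaceD(1)[OF V] by blast
  have "cmod (f (vscale V 0 x)) \<le> vnorm (dual V) f"
    using nspaceD(3,5)[OF V x, of 0] by (intro dual_norm_upper[OF V f]) auto
  then show ?thesis by (meson norm_ge_zero order_trans)
qed

lemma dual_vadd_closed:
  assumes V: "nspace V" and f: "f \<in> carrier (dual V)" and g: "g \<in> carrier (dual V)"
  shows "vadd (dual V) f g \<in> carrier (dual V)"
proof (rule in_dualI[where C="vnorm (dual V) f + vnorm (dual V) g"])
  fix x assume x: "x \<in> carrier V"
  have "cmod (f x + g x) \<le> cmod (f x) + cmod (g x)" by (rule norm_triangle_ineq)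
  also have "\<dots> \<le> vnorm (dual V) f * vnorm V x + vnorm (dual V) g * vnorm V x"
    by (intro add_mono dual_bound V f g x)
  finally show "cmod (vadd (dual V) f g x) \<le> (vnorm (dual V) f + vnorm (dual V) g) * vnorm V x"
    using x by (simp add: dual_simps distrib_right)
qed (simp_all add: dual_simps(2) nspaceD[OF V] in_dualD[OF f] in_dualD[OF g] algebra_simps)

lemma dual_vscale_closed:
  assumes V: "nspace V" and f: "f \<in> carrier (dual V)"
  shows "vscale (dual V) c f \<in> carrier (dual V)"
proof (rule in_dualI[where C="cmod c * vnorm (dual V) f"])
  fix x assume x: "x \<in> carrier V"
  show "cmod (vscale (dual V) c f x) \<le> cmod c * vnorm (dual V) f * vnorm V x"
    using x dual_bound[OF V f x] by (simp add: dual_simps(3) norm_mult mult.assoc mult_left_mono)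
qed (simp_all add: dual_simps(3) nspaceD[OF V] in_dualD[OF f] algebra_simps)

lemma dual_norm_scale_le:
  assumes V: "nspace V" and f: "f \<in> carrier (dual V)"
  shows "vnorm (dual V) (vscale (dual V) c f) \<le> cmod c * vnorm (dual V) f"
proof (rule dual_norm_le[OF V])
  show "0 \<le> cmod c * vnorm (dual V) f" using dual_norm_nonneg[OF V f] by simp
  fix x assume x: "x \<in> carrier V"
  show "cmod (vscale (dual V) c f x) \<le> cmod c * vnorm (dual V) f * vnorm V x"
    using x dual_bound[OF V f x] by (simp add: dual_simps(3) norm_mult mult.assoc mult_left_mono)
qed

lemma dual_norm_scale:
  assumes V: "nspace V" and f: "f \<in> carrier (dual V)"
  shows "vnorm (dual V) (vscale (dual V) c f) = cmod c * vnorm (dual V) f"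
proof (rule antisym[OF dual_norm_scale_le[OF V f]])
  note cf = dual_vscale_closed[OF V f, of c]
  show "cmod c * vnorm (dual V) f \<le> vnorm (dual V) (vscale (dual V) c f)"
  proof (cases "c = 0")
    case True
    then show ?thesis using dual_norm_nonneg[OF V cf] by simp
  next
    case False
    have "vscale (dual V) (1 / c) (vscale (dual V) c f) = f"
      using False f by (intro dual_eqI[of _ V] dual_vscale_closed V) (auto simp: dual_simps(3))
    then have "vnorm (dual V) f \<le> cmod (1 / c) * vnorm (dual V) (vscale (dual V) c f)"
      using dual_norm_scale_le[OF V cf, of "1 / c"] by simp
    then show ?thesis using False by (simp add: norm_divide divide_simps mult.commute)
  qed
qed

lemma zero_in_dual:
  assumes V: "nspace V"
  shows "(\<lambda>x\<in>carrier V. 0) \<in> carrier (dual V)"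
  by (rule in_dualI[where C=0]) (simp_all add: nspaceD[OF V])

lemma nspace_dual:
  assumes V: "nspace V"
  shows "nspace (dual V)"
  unfolding nspace_def
  using zero_in_dual[OF V] dual_vadd_closed[OF V] dual_vscale_closed[OF V] dual_norm_nonneg[OF V]
    dual_norm_scale[OF V] by blast

section \<open>Weak star cluster points of bounded sequences\<close>

definition eval :: "('v, 'm) normed_space_scheme \<Rightarrow> 'v \<Rightarrow> ('v \<Rightarrow> complex) \<Rightarrow> complex" where
  "eval V x = (\<lambda>g\<in>carrier (dual V). g x)"

lemma eval_in_bidual:
  assumes V: "nspace V" and x: "x \<in> carrier V"
  shows "eval V x \<in> carrier (dual (dual V))"
proof (rule in_dualI[where C="vnorm V x"])
  fix g assume g: "g \<in> carrier (dual V)"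
  show "cmod (eval V x g) \<le> vnorm V x * vnorm (dual V) g"
    using dual_bound[OF V g x] g by (simp add: eval_def mult.commute)
qed (use x in \<open>simp_all add: eval_def dual_vadd_closed[OF V] dual_vscale_closed[OF V]\<close>,
  simp_all add: dual_simps)

lemma topspace_weak_star: "topspace (weak_star V) = carrier (dual V)"
proof -
  have "carrier (dual V) \<subseteq> extensional (carrier V)" using in_dualD(1) by blast
  then show ?thesis by (auto simp: weak_star_def PiE_def)
qed

lemma continuous_weak_star_eval:
  assumes "x \<in> carrier V"
  shows "continuous_map (weak_star V) euclidean (\<lambda>f. f x)"
  unfolding weak_star_def
  by (intro continuous_map_from_subtopology continuous_map_product_projection assms)

text \<open>Cluster points are used instead of convergent subsequences because a compact product of
  uncountably many discs need not be sequentially compact.\<close>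

lemma compact_sequence_cluster:
  fixes s :: "nat \<Rightarrow> 'x"
  assumes K: "compactin X K" and s: "\<And>n. s n \<in> K"
  obtains p where "p \<in> K" "\<And>U. openin X U \<Longrightarrow> p \<in> U \<Longrightarrow> infinite {n. s n \<in> U}"
proof (rule ccontr)
  assume "\<not> thesis"
  then have "\<forall>p\<in>K. \<exists>U. openin X U \<and> p \<in> U \<and> finite {n. s n \<in> U}" using that by metis
  then obtain U where U: "\<And>p. p \<in> K \<Longrightarrow> openin X (U p)" "\<And>p. p \<in> K \<Longrightarrow> p \<in> U p"
    "\<And>p. p \<in> K \<Longrightarrow> finite {n. s n \<in> U p}" by metis
  have cov: "K \<subseteq> \<Union> (U ` K)" using U(2) by blast
  obtain \<F> where F: "finite \<F>" "\<F> \<subseteq> U ` K" "K \<subseteq> \<Union>\<F>"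
    using compactinD[OF K _ cov] U(1) by (metis imageE)
  have "finite (\<Union>W\<in>\<F>. {n. s n \<in> W})" using F(1,2) U(3) by (intro finite_UN_I) auto
  moreover have "(\<Union>W\<in>\<F>. {n. s n \<in> W}) = UNIV" using F(3) s by blast
  ultimately show False by simp
qed

lemma cluster_limit:
  fixes F :: "'x \<Rightarrow> complex"
  assumes F: "continuous_map X euclidean F" and p: "p \<in> topspace X"
    and cl: "\<And>U. openin X U \<Longrightarrow> p \<in> U \<Longrightarrow> infinite {n. s n \<in> U}"
    and lim: "(\<lambda>n. F (s n)) \<longlonglongrightarrow> l"
  shows "F p = l"
proof (rule ccontr)
  assume "F p \<noteq> l"
  then obtain A A' where A: "open A" "open A'" "F p \<in> A" "l \<in> A'" "A \<inter> A' = {}"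
    using hausdorff by metis
  have "openin X {x \<in> topspace X. F x \<in> A}"
    using openin_continuous_map_preimage[OF F, of A] A(1) by simp
  then have "infinite {n. s n \<in> {x \<in> topspace X. F x \<in> A}}" using p A(3) by (intro cl) auto
  moreover have "finite {n. F (s n) \<notin> A'}"
    using topological_tendstoD[OF lim A(2,4)] by (simp add: eventually_cofinite[symmetric] cofinite_eq_sequentially)
  moreover have "{n. s n \<in> {x \<in> topspace X. F x \<in> A}} \<subseteq> {n. F (s n) \<notin> A'}" using A(5) by blast
  ultimately show False using finite_subset by blast
qed

text \<open>Banach-Alaoglu in the product of the discs that contain the values
  \<open>g (x n)\<close>. The cluster point is linear because each linear relation says that a
  continuous function of the coordinates vanishes, and it vanishes along the sequence. The second
  conclusion replaces passing to a convergent subnet.\<close>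

lemma bidual_cluster_point:
  fixes V :: "('v, 'm) normed_space_scheme"
  assumes V: "nspace V" and x: "\<And>n. x n \<in> carrier V" "\<And>n. vnorm V (x n) \<le> k"
  obtains \<Phi> where "\<Phi> \<in> carrier (dual (dual V))"
    "\<And>F l. continuous_map (weak_star (dual V)) euclidean F \<Longrightarrow> (\<lambda>n. F (eval V (x n))) \<longlonglongrightarrow> l \<Longrightarrow> F \<Phi> = (l :: complex)"
proof -
  let ?D = "carrier (dual V)"
  let ?P = "product_topology (\<lambda>_ :: 'v \<Rightarrow> complex. euclidean :: complex topology) ?D"
  let ?K = "PiE ?D (\<lambda>g. cball 0 (k * vnorm (dual V) g))"
  have K: "compactin ?P ?K" by (simp add: compactin_PiE)
  have mem: "eval V (x n) \<in> ?K" for n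
  proof (rule PiE_I)
    fix g assume g: "g \<in> ?D"
    have "cmod (g (x n)) \<le> vnorm (dual V) g * vnorm V (x n)" by (rule dual_bound[OF V g x(1)])
    also have "\<dots> \<le> vnorm (dual V) g * k"
      using x(2) dual_norm_nonneg[OF V g] by (rule mult_left_mono)
    finally show "eval V (x n) g \<in> cball 0 (k * vnorm (dual V) g)"
      using g by (simp add: eval_def mult.commute)
  qed (simp add: eval_def)
  obtain \<Phi> where \<Phi>: "\<Phi> \<in> ?K" "\<And>U. openin ?P U \<Longrightarrow> \<Phi> \<in> U \<Longrightarrow> infinite {n. eval V (x n) \<in> U}"
    by (rule compact_sequence_cluster[OF K mem]) (rule that; assumption)
  have top: "\<Phi> \<in> topspace ?P" using \<Phi>(1) by (auto simp: PiE_def)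
  note lim = cluster_limit[OF _ top \<Phi>(2)]
  have pr: "continuous_map ?P euclidean (\<lambda>\<Theta>. \<Theta> g)" if "g \<in> ?D" for g
    by (rule continuous_map_product_projection[OF that])
  have \<Phi>D: "\<Phi> \<in> carrier (dual (dual V))"
  proof (rule in_dualI[where C=k])
    show "\<Phi> \<in> extensional ?D" using \<Phi>(1) by (simp add: PiE_def)
    fix g assume g: "g \<in> ?D"
    show "cmod (\<Phi> g) \<le> k * vnorm (dual V) g" using PiE_mem[OF \<Phi>(1) g] by simp
    fix c
    have "continuous_map ?P euclidean ((\<lambda>z. c * z) \<circ> (\<lambda>\<Theta>. \<Theta> g))"
      by (rule continuous_map_compose[OF pr[OF g]]) (simp add: continuous_on_mult_left)
    then have "continuous_map ?P euclidean (\<lambda>\<Theta>. \<Theta> (vscale (dual V) c g) - c * \<Theta> g)"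
      by (intro continuous_map_diff pr dual_vscale_closed V g) (simp add: comp_def)
    then have "\<Phi> (vscale (dual V) c g) - c * \<Phi> g = 0"
    proof (rule lim)
      have "eval V (x n) (vscale (dual V) c g) = c * eval V (x n) g" for n
        by (rule in_dualD(3)[OF eval_in_bidual[OF V x(1)] g])
      then show "(\<lambda>n. eval V (x n) (vscale (dual V) c g) - c * eval V (x n) g) \<longlonglongrightarrow> 0" by simp
    qed
    then show "\<Phi> (vscale (dual V) c g) = c * \<Phi> g" by simp
    fix h assume h: "h \<in> ?D"
    have "continuous_map ?P euclidean (\<lambda>\<Theta>. \<Theta> (vadd (dual V) g h) - (\<Theta> g + \<Theta> h))"
      by (intro continuous_map_diff continuous_map_add pr dual_vadd_closed V g h)
    then have "\<Phi> (vadd (dual V) g h) - (\<Phi> g + \<Phi> h) = 0"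
    proof (rule lim)
      have "eval V (x n) (vadd (dual V) g h) = eval V (x n) g + eval V (x n) h" for n
        by (rule in_dualD(2)[OF eval_in_bidual[OF V x(1)] g h])
      then show "(\<lambda>n. eval V (x n) (vadd (dual V) g h) - (eval V (x n) g + eval V (x n) h)) \<longlonglongrightarrow> 0" by simp
    qed
    then show "\<Phi> (vadd (dual V) g h) = \<Phi> g + \<Phi> h" by simp
  qed
  show thesis
  proof (rule that[OF \<Phi>D])
    fix F :: "(('v \<Rightarrow> complex) \<Rightarrow> complex) \<Rightarrow> complex" and l
    assume F: "continuous_map (weak_star (dual V)) euclidean F" "(\<lambda>n. F (eval V (x n))) \<longlonglongrightarrow> l"
    show "F \<Phi> = l"
    proof (rule cluster_limit[where s="\<lambda>n. eval V (x n)", OF F(1) _ _ ])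
      show "(\<lambda>n. F (eval V (x n))) \<longlonglongrightarrow> l" by (rule F(2))
      show "\<Phi> \<in> topspace (weak_star (dual V))" using \<Phi>D by (simp add: topspace_weak_star)
      fix U assume U: "openin (weak_star (dual V)) U" "\<Phi> \<in> U"
      then obtain W where W: "openin ?P W" "U = W \<inter> carrier (dual (dual V))"
        unfolding weak_star_def openin_subtopology by blast
      have "{n. eval V (x n) \<in> U} = {n. eval V (x n) \<in> W}"
        using eval_in_bidual[OF V x(1)] W(2) by blast
      then show "infinite {n. eval V (x n) \<in> U}" using \<Phi>(2)[OF W(1)] U(2) W(2) by simp
    qed
  qed
qed

section \<open>The Arens product and criteria for Arens regularity\<close>

definition nalgebra :: "('v, 'm) normed_algebra_scheme \<Rightarrow> real \<Rightarrow> bool" where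
  "nalgebra A K \<longleftrightarrow> nspace A \<and> 0 \<le> K \<and>
     (\<forall>a\<in>carrier A. \<forall>b\<in>carrier A. vmult A a b \<in> carrier A \<and> vnorm A (vmult A a b) \<le> K * vnorm A a * vnorm A b) \<and>
     (\<forall>a\<in>carrier A. \<forall>a'\<in>carrier A. \<forall>b\<in>carrier A. vmult A (vadd A a a') b = vadd A (vmult A a b) (vmult A a' b)) \<and>
     (\<forall>a\<in>carrier A. \<forall>b\<in>carrier A. \<forall>b'\<in>carrier A. vmult A a (vadd A b b') = vadd A (vmult A a b) (vmult A a b')) \<and>
     (\<forall>c. \<forall>a\<in>carrier A. \<forall>b\<in>carrier A. vmult A (vscale A c a) b = vscale A c (vmult A a b)) \<and>
     (\<forall>c. \<forall>a\<in>carrier A. \<forall>b\<in>carrier A. vmult A a (vscale A c b) = vscale A c (vmult A a b))"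

lemma nalgebraD:
  assumes "nalgebra A K"
  shows "nspace A" and "0 \<le> K"
    and "a \<in> carrier A \<Longrightarrow> b \<in> carrier A \<Longrightarrow> vmult A a b \<in> carrier A"
    and "a \<in> carrier A \<Longrightarrow> b \<in> carrier A \<Longrightarrow> vnorm A (vmult A a b) \<le> K * vnorm A a * vnorm A b"
    and "a \<in> carrier A \<Longrightarrow> a' \<in> carrier A \<Longrightarrow> b \<in> carrier A \<Longrightarrow> vmult A (vadd A a a') b = vadd A (vmult A a b) (vmult A a' b)"
    and "a \<in> carrier A \<Longrightarrow> b \<in> carrier A \<Longrightarrow> b' \<in> carrier A \<Longrightarrow> vmult A a (vadd A b b') = vadd A (vmult A a b) (vmult A a b')"
    and "a \<in> carrier A \<Longrightarrow> b \<in> carrier A \<Longrightarrow> vmult A (vscale A c a) b = vscale A c (vmult A a b)"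
    and "a \<in> carrier A \<Longrightarrow> b \<in> carrier A \<Longrightarrow> vmult A a (vscale A c b) = vscale A c (vmult A a b)"
  using assms unfolding nalgebra_def by blast+

lemma functional_act_props:
  assumes A: "nalgebra A K" and f: "f \<in> carrier (dual A)" and a: "a \<in> carrier A"
  shows functional_act_closed: "functional_act A f a \<in> carrier (dual A)"
    and functional_act_norm: "vnorm (dual A) (functional_act A f a) \<le> K * vnorm (dual A) f * vnorm A a"
proof -
  note V = nalgebraD(1)[OF A] and D = nalgebraD[OF A]
  have b: "cmod (functional_act A f a b) \<le> (K * vnorm (dual A) f * vnorm A a) * vnorm A b"
    if b: "b \<in> carrier A" for b
  proof -
    have "cmod (f (vmult A a b)) \<le> vnorm (dual A) f * vnorm A (vmult A a b)"
      by (rule dual_bound[OF V f D(3)[OF a b]])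
    also have "\<dots> \<le> vnorm (dual A) f * (K * vnorm A a * vnorm A b)"
      by (intro mult_left_mono D(4)[OF a b] dual_norm_nonneg[OF V f])
    finally show ?thesis using b by (simp add: functional_act_def mult_ac)
  qed
  show "functional_act A f a \<in> carrier (dual A)"
  proof (rule in_dualI[OF _ _ _ b])
    show "functional_act A f a \<in> extensional (carrier A)" by (simp add: functional_act_def)
    fix b assume b: "b \<in> carrier A"
    show "functional_act A f a (vscale A c b) = c * functional_act A f a b" for c
      using a b by (simp add: functional_act_def D nspaceD[OF V] in_dualD[OF f])
    fix b' assume b': "b' \<in> carrier A"
    show "functional_act A f a (vadd A b b') = functional_act A f a b + functional_act A f a b'"
      using a b b' by (simp add: functional_act_def D nspaceD[OF V] in_dualD[OF f])
  qed
  have "0 \<le> K * vnorm (dual A) f * vnorm A a"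
    using D(2) dual_norm_nonneg[OF V f] nspaceD(4)[OF V a] by simp
  then show "vnorm (dual A) (functional_act A f a) \<le> K * vnorm (dual A) f * vnorm A a"
    by (rule dual_norm_le[OF V _ b])
qed

lemma functional_act_linear:
  assumes A: "nalgebra A K" and f: "f \<in> carrier (dual A)" and a: "a \<in> carrier A"
  shows "a' \<in> carrier A \<Longrightarrow> functional_act A f (vadd A a a') = vadd (dual A) (functional_act A f a) (functional_act A f a')"
    and "functional_act A f (vscale A c a) = vscale (dual A) c (functional_act A f a)"
    and "g \<in> carrier (dual A) \<Longrightarrow> functional_act A (vadd (dual A) f g) a = vadd (dual A) (functional_act A f a) (functional_act A g a)"
    and "functional_act A (vscale (dual A) c f) a = vscale (dual A) c (functional_act A f a)"
  using a by (auto simp: functional_act_def dual_simps(2,3) nalgebraD[OF A] in_dualD[OF f] fun_eq_iff restrict_def)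

text \<open>Stated for a subspace \<open>X\<close> of the dual so that it serves the full dual as
  well as \<open>M_star\<close>. The assumption on \<open>functional_act\<close> is the first half
  of left introversion.\<close>

lemma bidual_act_props:
  assumes A: "nalgebra A K" and X: "X \<subseteq> carrier (dual A)" "nspace ((dual A)\<lparr>carrier := X\<rparr>)"
    and b: "b \<in> carrier (dual ((dual A)\<lparr>carrier := X\<rparr>))" and h: "h \<in> X"
    and act: "\<And>a. a \<in> carrier A \<Longrightarrow> functional_act A h a \<in> X"
  shows "bidual_act A b h \<in> carrier (dual A)"
    and "a \<in> carrier A \<Longrightarrow> cmod (bidual_act A b h a) \<le>
      K * vnorm (dual ((dual A)\<lparr>carrier := X\<rparr>)) b * vnorm (dual A) h * vnorm A a"
proof -
  let ?X = "(dual A)\<lparr>carrier := X\<rparr>"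
  note V = nalgebraD(1)[OF A] and D = nalgebraD[OF A]
  have hD: "h \<in> carrier (dual A)" using h X(1) by blast
  have bound: "cmod (bidual_act A b h a) \<le> K * vnorm (dual ?X) b * vnorm (dual A) h * vnorm A a"
    if a: "a \<in> carrier A" for a
  proof -
    have "cmod (b (functional_act A h a)) \<le> vnorm (dual ?X) b * vnorm ?X (functional_act A h a)"
      using act[OF a] by (intro dual_bound[OF X(2) b]) simp
    also have "vnorm ?X (functional_act A h a) = vnorm (dual A) (functional_act A h a)" by simp
    also have "vnorm (dual ?X) b * vnorm (dual A) (functional_act A h a) \<le>
        vnorm (dual ?X) b * (K * vnorm (dual A) h * vnorm A a)"
      by (intro mult_left_mono functional_act_norm[OF A hD a] dual_norm_nonneg[OF X(2) b])
    finally show ?thesis using a by (simp add: bidual_act_def mult_ac)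
  qed
  show "a \<in> carrier A \<Longrightarrow> cmod (bidual_act A b h a) \<le>
      K * vnorm (dual ?X) b * vnorm (dual A) h * vnorm A a" by (rule bound)
  show "bidual_act A b h \<in> carrier (dual A)"
  proof (rule in_dualI[OF _ _ _ bound])
    show "bidual_act A b h \<in> extensional (carrier A)" by (simp add: bidual_act_def)
    fix a assume a: "a \<in> carrier A"
    have sc: "b (vscale (dual A) c (functional_act A h a)) = c * b (functional_act A h a)" for c
      using in_dualD(3)[OF b, of "functional_act A h a" c] act[OF a] by simp
    show "bidual_act A b h (vscale A c a) = c * bidual_act A b h a" for c
      using a nspaceD(3)[OF V a, of c] sc by (simp add: bidual_act_def functional_act_linear(2)[OF A hD a])
    fix a' assume a': "a' \<in> carrier A"
    have ad: "b (vadd (dual A) (functional_act A h a) (functional_act A h a')) =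
        b (functional_act A h a) + b (functional_act A h a')"
      using in_dualD(2)[OF b, of "functional_act A h a" "functional_act A h a'"] act[OF a] act[OF a'] by simp
    show "bidual_act A b h (vadd A a a') = bidual_act A b h a + bidual_act A b h a'"
      using a a' nspaceD(2)[OF V a a'] ad by (simp add: bidual_act_def functional_act_linear(1)[OF A hD a a'])
  qed
qed

lemma bidual_act_full:
  assumes A: "nalgebra A K" and \<Psi>: "\<Psi> \<in> carrier (dual (dual A))" and f: "f \<in> carrier (dual A)"
  shows "bidual_act A \<Psi> f \<in> carrier (dual A)"
    and "a \<in> carrier A \<Longrightarrow> cmod (bidual_act A \<Psi> f a) \<le> K * vnorm (dual (dual A)) \<Psi> * vnorm (dual A) f * vnorm A a"
  using bidual_act_props[OF A subset_refl, of \<Psi> f] nspace_dual[OF nalgebraD(1)[OF A]] \<Psi> f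
    functional_act_closed[OF A f] by simp_all

text \<open>One direction of Grothendieck's double limit criterion. With cluster points
  \<open>\<Phi>\<close> of the \<open>a n\<close> and \<open>\<Psi>\<close> of the
  \<open>b n\<close> in the bidual, the product of \<open>\<Phi>\<close> with each embedded
  \<open>b m\<close> takes the value \<open>q\<close> at \<open>f\<close>, and weak star continuity
  carries this value to \<open>\<Psi>\<close>. The definition of the product gives \<open>p\<close>
  at the same place.\<close>

lemma arens_regular_iterated_limits:
  assumes A: "nalgebra A K" and reg: "arens_regular A" and f: "f \<in> carrier (dual A)"
    and a: "\<And>n. a n \<in> carrier A" "\<And>n. vnorm A (a n) \<le> k"
    and b: "\<And>n. b n \<in> carrier A" "\<And>n. vnorm A (b n) \<le> k"
    and p: "\<And>n. (\<lambda>m. f (vmult A (a n) (b m))) \<longlonglongrightarrow> p"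
    and q: "\<And>m. (\<lambda>n. f (vmult A (a n) (b m))) \<longlonglongrightarrow> q"
  shows "p = q"
proof -
  note V = nalgebraD(1)[OF A]
  let ?D = "carrier (dual A)"
  obtain \<Phi> where \<Phi>: "\<Phi> \<in> carrier (dual (dual A))"
    "\<And>F l. continuous_map (weak_star (dual A)) euclidean F \<Longrightarrow> (\<lambda>n. F (eval A (a n))) \<longlonglongrightarrow> l \<Longrightarrow> F \<Phi> = (l :: complex)"
    by (rule bidual_cluster_point[OF V a]) (rule that; assumption)
  obtain \<Psi> where \<Psi>: "\<Psi> \<in> carrier (dual (dual A))"
    "\<And>F l. continuous_map (weak_star (dual A)) euclidean F \<Longrightarrow> (\<lambda>n. F (eval A (b n))) \<longlonglongrightarrow> l \<Longrightarrow> F \<Psi> = (l :: complex)"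
    by (rule bidual_cluster_point[OF V b]) (rule that; assumption)
  have \<Phi>_lim: "\<Phi> g = l" if "g \<in> ?D" "(\<lambda>n. g (a n)) \<longlonglongrightarrow> l" for g l
    using \<Phi>(2)[OF continuous_weak_star_eval[OF that(1)], of l] that by (simp add: eval_def)
  have \<Psi>_lim: "\<Psi> g = l" if "g \<in> ?D" "(\<lambda>n. g (b n)) \<longlonglongrightarrow> l" for g l
    using \<Psi>(2)[OF continuous_weak_star_eval[OF that(1)], of l] that by (simp add: eval_def)
  let ?F = "\<lambda>\<Theta>. arens_product A ?D \<Phi> \<Theta> f"
  have "continuous_map (weak_star (dual A)) (weak_star (dual A)) (arens_product A ?D \<Phi>)"
    using reg \<Phi>(1) unfolding arens_regular_def by blast
  from continuous_map_compose[OF this continuous_weak_star_eval[OF f]]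
  have F: "continuous_map (weak_star (dual A)) euclidean ?F" by (simp add: comp_def)
  have "?F (eval A (b m)) = q" for m
  proof -
    let ?g = "bidual_act A (eval A (b m)) f"
    have "?g (a n) = f (vmult A (a n) (b m))" for n
      using a(1) b(1) functional_act_closed[OF A f a(1)]
      by (simp add: bidual_act_def eval_def functional_act_def)
    then have "\<Phi> ?g = q"
      using q by (intro \<Phi>_lim bidual_act_full(1)[OF A eval_in_bidual[OF V b(1)] f]) simp
    then show ?thesis using f by (simp add: arens_product_def)
  qed
  then have "?F \<Psi> = q" by (intro \<Psi>(2)[OF F]) simp
  \<comment> \<open>No continuity of the product enters here: applying \<open>\<Psi>\<close> first
    takes the limit over \<open>m\<close> and leaves a functional that is constantly
    \<open>p\<close> along the sequence \<open>a\<close>.\<close>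
  moreover have "?F \<Psi> = p"
  proof -
    let ?g = "bidual_act A \<Psi> f"
    have "?g (a n) = p" for n
    proof -
      have "\<Psi> (functional_act A f (a n)) = p"
        using p[of n] b(1) by (intro \<Psi>_lim functional_act_closed[OF A f a(1)]) (simp add: functional_act_def)
      then show ?thesis using a(1) by (simp add: bidual_act_def)
    qed
    then have "\<Phi> ?g = p"
      by (intro \<Phi>_lim bidual_act_full(1)[OF A \<Psi>(1) f]) simp
    then show ?thesis using f by (simp add: arens_product_def)
  qed
  ultimately show ?thesis by simp
qed

text \<open>The weak star topology is coordinatewise, so for fixed \<open>f\<close> it suffices that
  the value of the product at \<open>f\<close> is evaluation of \<open>\<Psi>\<close> at a fixed
  \<open>g\<close>. The rest of the proof shows that the product stays in the bidual.\<close>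

lemma arens_regularI:
  assumes A: "nalgebra A K"
    and ex: "\<And>f \<Phi>. f \<in> carrier (dual A) \<Longrightarrow> \<Phi> \<in> carrier (dual (dual A)) \<Longrightarrow>
      \<exists>g\<in>carrier (dual A). \<forall>\<Psi>\<in>carrier (dual (dual A)). \<Phi> (bidual_act A \<Psi> f) = \<Psi> g"
  shows "arens_regular A"
  unfolding arens_regular_def
proof
  note V = nalgebraD(1)[OF A] and V' = nspace_dual[OF nalgebraD(1)[OF A]]
  let ?D = "carrier (dual A)"
  fix \<Phi> assume \<Phi>: "\<Phi> \<in> carrier (dual (dual A))"
  have closed: "arens_product A ?D \<Phi> \<Psi> \<in> carrier (dual (dual A))" if \<Psi>: "\<Psi> \<in> carrier (dual (dual A))" for \<Psi>
  proof (rule in_dualI[where C="vnorm (dual (dual A)) \<Phi> * (K * vnorm (dual (dual A)) \<Psi>)"])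
    show "arens_product A ?D \<Phi> \<Psi> \<in> extensional ?D" by (simp add: arens_product_def)
    fix f assume f: "f \<in> ?D"
    note bf = bidual_act_full[OF A \<Psi> f]
    have "vnorm (dual A) (bidual_act A \<Psi> f) \<le> K * vnorm (dual (dual A)) \<Psi> * vnorm (dual A) f"
      by (rule dual_norm_le[OF V _ bf(2)])
        (simp_all add: nalgebraD(2)[OF A] dual_norm_nonneg[OF V' \<Psi>] dual_norm_nonneg[OF V f])
    then have "vnorm (dual (dual A)) \<Phi> * vnorm (dual A) (bidual_act A \<Psi> f) \<le>
        vnorm (dual (dual A)) \<Phi> * (K * vnorm (dual (dual A)) \<Psi> * vnorm (dual A) f)"
      by (rule mult_left_mono) (rule dual_norm_nonneg[OF V' \<Phi>])
    with dual_bound[OF V' \<Phi> bf(1)]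
    show "cmod (arens_product A ?D \<Phi> \<Psi> f) \<le> vnorm (dual (dual A)) \<Phi> * (K * vnorm (dual (dual A)) \<Psi>) * vnorm (dual A) f"
      using f by (simp add: arens_product_def mult_ac)
    have s: "bidual_act A \<Psi> (vscale (dual A) c f) = vscale (dual A) c (bidual_act A \<Psi> f)" for c
    proof
      fix a
      show "bidual_act A \<Psi> (vscale (dual A) c f) a = vscale (dual A) c (bidual_act A \<Psi> f) a"
        using in_dualD(3)[OF \<Psi> functional_act_closed[OF A f], of a c]
        by (cases "a \<in> carrier A") (simp_all add: bidual_act_def functional_act_linear(4)[OF A f] dual_apply)
    qed
    show "arens_product A ?D \<Phi> \<Psi> (vscale (dual A) c f) = c * arens_product A ?D \<Phi> \<Psi> f" for c
      using f dual_vscale_closed[OF V f] in_dualD(3)[OF \<Phi> bf(1)] by (simp add: arens_product_def s)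
    fix g assume g: "g \<in> ?D"
    have ad: "bidual_act A \<Psi> (vadd (dual A) f g) = vadd (dual A) (bidual_act A \<Psi> f) (bidual_act A \<Psi> g)"
    proof
      fix a
      show "bidual_act A \<Psi> (vadd (dual A) f g) a = vadd (dual A) (bidual_act A \<Psi> f) (bidual_act A \<Psi> g) a"
        using in_dualD(2)[OF \<Psi> functional_act_closed[OF A f] functional_act_closed[OF A g], of a a]
        by (cases "a \<in> carrier A") (simp_all add: bidual_act_def functional_act_linear(3)[OF A f _ g] dual_apply)
    qed
    show "arens_product A ?D \<Phi> \<Psi> (vadd (dual A) f g) = arens_product A ?D \<Phi> \<Psi> f + arens_product A ?D \<Phi> \<Psi> g"
      using f g dual_vadd_closed[OF V f g] in_dualD(2)[OF \<Phi> bf(1) bidual_act_full(1)[OF A \<Psi> g]]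
      by (simp add: arens_product_def ad)
  qed
  show "continuous_map (weak_star (dual A)) (weak_star (dual A)) (\<lambda>\<Psi>. arens_product A ?D \<Phi> \<Psi>)"
    unfolding weak_star_def[of "dual A"] continuous_map_in_subtopology continuous_map_componentwise
    unfolding weak_star_def[of "dual A", symmetric]
  proof (intro conjI ballI)
    show "arens_product A ?D \<Phi> ` topspace (weak_star (dual A)) \<subseteq> extensional ?D"
      by (auto simp: arens_product_def)
    fix f assume f: "f \<in> ?D"
    obtain g where g: "g \<in> ?D" "\<And>\<Psi>. \<Psi> \<in> carrier (dual (dual A)) \<Longrightarrow> \<Phi> (bidual_act A \<Psi> f) = \<Psi> g"
      using ex[OF f \<Phi>] by blast
    show "continuous_map (weak_star (dual A)) euclidean (\<lambda>\<Psi>. arens_product A ?D \<Phi> \<Psi> f)"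
      by (rule continuous_map_eq[OF continuous_weak_star_eval[OF g(1)]])
        (use g(2) f in \<open>simp add: topspace_weak_star arens_product_def\<close>)
  next
    show "arens_product A ?D \<Phi> \<in> topspace (weak_star (dual A)) \<rightarrow> carrier (dual (dual A))"
      using closed by (simp add: topspace_weak_star)
  qed
qed

section \<open>The dual of the functionals vanishing at infinity\<close>

context weighted_group
begin

abbreviation "null K \<mu> \<equiv> emeasure (variation B \<mu>) K = 0"

lemma nspace_M: "nspace M"
proof -
  have "dirac \<one> \<in> carrier M" by (rule dirac_closed) (simp add: topspace_eq_carrier)
  then show ?thesis
    unfolding nspace_def M_simps using vadd_closed(1) vscale_closed nrm_nonneg by blast
qed

lemma nalgebra_M: "nalgebra M 1"
  unfolding nalgebra_def M_simps
  using nspace_M convolution_closed convolution_add_left convolution_add_right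
    convolution_scale_left convolution_scale_right carrier_regular
  by (auto simp: M_simps)

text \<open>If all \<open>\<mu> (E \<inter> K)\<close> vanish, the restriction to \<open>K\<close>
  is the zero function and its variation is dominated by the null measure. In this form nullity is
  visibly stable under scalar multiples.\<close>

lemma null_iff:
  assumes \<mu>: "\<mu> \<in> carrier M" and K: "K \<in> sets B"
  shows "null K \<mu> \<longleftrightarrow> (\<forall>E\<in>sets B. \<mu> (E \<inter> K) = 0)"
proof
  assume n: "null K \<mu>"
  show "\<forall>E\<in>sets B. \<mu> (E \<inter> K) = 0"
  proof
    fix E assume "E \<in> sets B"
    have "emeasure (variation B \<mu>) (E \<inter> K) \<le> emeasure (variation B \<mu>) K"
      using K by (intro emeasure_mono) auto
    then show "\<mu> (E \<inter> K) = 0" using n by (intro cmod_le_emeasure[OF \<mu>]) simp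
  qed
next
  assume z: "\<forall>E\<in>sets B. \<mu> (E \<inter> K) = 0"
  have r: "res K \<mu> E = 0" for E using z by (simp add: res_def)
  have "emeasure (variation B (res K \<mu>)) (topspace T) \<le> emeasure (null_measure B) (topspace T)"
    by (rule emeasure_variation_le[OF carrier_complex[OF res_closed[OF \<mu> K]]])
      (simp_all add: r openin_sets_borel_of)
  then have "emeasure (variation B \<mu>) (topspace T \<inter> K) = 0"
    using variation_res[OF \<mu> K openin_sets_borel_of[OF openin_topspace]] by simp
  moreover have "topspace T \<inter> K = K" using sets.sets_into_space[OF K] by auto
  ultimately show "null K \<mu>" by simp
qed

lemma null_scale:
  assumes "\<mu> \<in> carrier M" "K \<in> sets B" "null K \<mu>"
  shows "null K (\<lambda>E. c * \<mu> E)"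
  using assms by (simp add: null_iff vscale_closed)

lemma null_mono:
  assumes "null K' \<mu>" "K' \<in> sets B" "K \<subseteq> K'"
  shows "null K \<mu>"
proof -
  have "emeasure (variation B \<mu>) K \<le> emeasure (variation B \<mu>) K'"
    using assms by (intro emeasure_mono) auto
  then show ?thesis using assms by simp
qed

lemma null_res:
  assumes \<mu>: "\<mu> \<in> carrier M" and A: "A \<in> sets B" and K: "K \<in> sets B"
  shows "null K \<mu> \<Longrightarrow> null K (res A \<mu>)" and "K \<inter> A = {} \<Longrightarrow> null K (res A \<mu>)"
proof -
  assume n: "null K \<mu>"
  have "emeasure (variation B \<mu>) (K \<inter> A) \<le> emeasure (variation B \<mu>) K"
    using K by (intro emeasure_mono) auto
  then show "null K (res A \<mu>)" using n variation_res[OF \<mu> A K] by simp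
next
  assume "K \<inter> A = {}"
  then show "null K (res A \<mu>)" using variation_res[OF \<mu> A K] by simp
qed

abbreviation "X \<equiv> M_star G T \<omega>"
abbreviation "XS \<equiv> (dual M)\<lparr>carrier := X\<rparr>"
abbreviation "A \<equiv> introverted_dual M X"

lemma X_dual: "h \<in> X \<Longrightarrow> h \<in> carrier (dual M)"
  by (simp add: M_star_def)

text \<open>Rescaling removes the normalisation from the definition of vanishing at infinity;
  elements of norm 0 are covered because a bounded functional vanishes on them.\<close>

lemma X_small:
  assumes h: "h \<in> X" and e: "0 < e"
  shows "\<exists>K. compactin T K \<and> (\<forall>\<mu>\<in>carrier M. null K \<mu> \<longrightarrow> cmod (h \<mu>) \<le> e * nrm \<mu>)"
proof -
  obtain K where K: "compactin T K"
    "\<And>\<mu>. \<mu> \<in> carrier M \<Longrightarrow> null K \<mu> \<Longrightarrow> nrm \<mu> = 1 \<Longrightarrow> cmod (h \<mu>) < e"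
    using h e unfolding M_star_def vanishes_at_infinity_def by blast
  have "cmod (h \<mu>) \<le> e * nrm \<mu>" if \<mu>: "\<mu> \<in> carrier M" and n: "null K \<mu>" for \<mu>
  proof (cases "nrm \<mu> = 0")
    case True
    then show ?thesis using dual_bound[OF nspace_M X_dual[OF h] \<mu>] by simp
  next
    case False
    then have pos: "0 < nrm \<mu>" using nrm_nonneg[OF \<mu>] by simp
    define c where "c = complex_of_real (1 / nrm \<mu>)"
    have c: "cmod c = 1 / nrm \<mu>" using pos by (simp add: c_def norm_divide)
    have "cmod (h (\<lambda>E. c * \<mu> E)) < e"
      using pos c by (intro K(2) vscale_closed(1)[OF \<mu>] null_scale[OF \<mu> compact_sets[OF K(1)] n])
        (simp add: vscale_closed(2)[OF \<mu>])
    moreover have "h (\<lambda>E. c * \<mu> E) = c * h \<mu>"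
      using in_dualD(3)[OF X_dual[OF h] \<mu>, of c] by (simp add: M_simps)
    ultimately show ?thesis using pos c by (simp add: norm_mult divide_simps mult.commute)
  qed
  then show ?thesis using K(1) by blast
qed

lemma X_I:
  assumes h: "h \<in> carrier (dual M)"
    and small: "\<And>e. 0 < e \<Longrightarrow> \<exists>K. compactin T K \<and> (\<forall>\<mu>\<in>carrier M. null K \<mu> \<longrightarrow> cmod (h \<mu>) \<le> e * nrm \<mu>)"
  shows "h \<in> X"
  unfolding M_star_def vanishes_at_infinity_def
proof (intro CollectI conjI h allI impI)
  fix e :: real assume e: "0 < e"
  \<comment> \<open>Half of \<open>e\<close> turns the weak inequality into the strict one of the
    definition.\<close>
  then obtain K where K: "compactin T K" "\<And>\<mu>. \<mu> \<in> carrier M \<Longrightarrow> null K \<mu> \<Longrightarrow> cmod (h \<mu>) \<le> e / 2 * nrm \<mu>"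
    using small[of "e / 2"] by (metis half_gt_zero)
  have "cmod (h \<mu>) < e" if "\<mu> \<in> carrier M" "null K \<mu>" "nrm \<mu> = 1" for \<mu>
    using K(2)[OF that(1,2)] that(3) e by simp
  then show "\<exists>K. compactin T K \<and> (\<forall>\<mu>\<in>carrier M. null K \<mu> \<longrightarrow> nrm \<mu> = 1 \<longrightarrow> cmod (h \<mu>) < e)"
    using K(1) by blast
qed

lemma X_vadd:
  assumes h: "h \<in> X" and g: "g \<in> X"
  shows "vadd (dual M) h g \<in> X"
proof (rule X_I[OF dual_vadd_closed[OF nspace_M X_dual[OF h] X_dual[OF g]]])
  fix e :: real assume e: "0 < e"
  then have e2: "0 < e / 2" by simp
  obtain K where K: "compactin T K" "\<And>\<mu>. \<mu> \<in> carrier M \<Longrightarrow> null K \<mu> \<Longrightarrow> cmod (h \<mu>) \<le> e / 2 * nrm \<mu>"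
    using X_small[OF h e2] by blast
  obtain L where L: "compactin T L" "\<And>\<mu>. \<mu> \<in> carrier M \<Longrightarrow> null L \<mu> \<Longrightarrow> cmod (g \<mu>) \<le> e / 2 * nrm \<mu>"
    using X_small[OF g e2] by blast
  have KL: "compactin T (K \<union> L)" by (rule compactin_Un[OF K(1) L(1)])
  have "cmod (vadd (dual M) h g \<mu>) \<le> e * nrm \<mu>" if \<mu>: "\<mu> \<in> carrier M" and n: "null (K \<union> L) \<mu>" for \<mu>
  proof -
    have "cmod (h \<mu> + g \<mu>) \<le> cmod (h \<mu>) + cmod (g \<mu>)" by (rule norm_triangle_ineq)
    also have "\<dots> \<le> e / 2 * nrm \<mu> + e / 2 * nrm \<mu>"
      by (intro add_mono K(2) L(2) \<mu> null_mono[OF n compact_sets[OF KL]]) auto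
    finally show ?thesis using \<mu> by (simp add: dual_apply)
  qed
  then show "\<exists>K. compactin T K \<and> (\<forall>\<mu>\<in>carrier M. null K \<mu> \<longrightarrow> cmod (vadd (dual M) h g \<mu>) \<le> e * nrm \<mu>)"
    using KL by blast
qed

lemma X_vscale:
  assumes h: "h \<in> X"
  shows "vscale (dual M) c h \<in> X"
proof (rule X_I[OF dual_vscale_closed[OF nspace_M X_dual[OF h]]])
  fix e :: real assume e: "0 < e"
  have c1: "0 < cmod c + 1" using norm_ge_zero[of c] by linarith
  then have e': "0 < e / (cmod c + 1)" using e by simp
  obtain K where K: "compactin T K" "\<And>\<mu>. \<mu> \<in> carrier M \<Longrightarrow> null K \<mu> \<Longrightarrow> cmod (h \<mu>) \<le> e / (cmod c + 1) * nrm \<mu>"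
    using X_small[OF h e'] by blast
  have "cmod (vscale (dual M) c h \<mu>) \<le> e * nrm \<mu>" if \<mu>: "\<mu> \<in> carrier M" and n: "null K \<mu>" for \<mu>
  proof -
    have "cmod c * cmod (h \<mu>) \<le> (cmod c + 1) * (e / (cmod c + 1) * nrm \<mu>)"
      by (intro mult_mono K(2)[OF \<mu> n]) auto
    then show ?thesis using \<mu> c1 by (simp add: dual_apply norm_mult)
  qed
  then show "\<exists>K. compactin T K \<and> (\<forall>\<mu>\<in>carrier M. null K \<mu> \<longrightarrow> cmod (vscale (dual M) c h \<mu>) \<le> e * nrm \<mu>)"
    using K(1) by blast
qed

lemma XS_simps: "carrier XS = X" "vadd XS = vadd (dual M)" "vscale XS = vscale (dual M)" "vnorm XS = vnorm (dual M)"
  by simp_all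

lemma zero_X: "(\<lambda>\<mu>\<in>carrier M. 0) \<in> X"
  by (rule X_I[OF zero_in_dual[OF nspace_M]])
    (auto intro!: exI[of _ "{}"] mult_nonneg_nonneg nrm_nonneg)

lemma nspace_XS: "nspace XS"
  unfolding nspace_def XS_simps
  using zero_X X_vadd X_vscale dual_norm_nonneg[OF nspace_M X_dual] dual_norm_scale[OF nspace_M X_dual] by blast

section \<open>Left introversion of \<open>M_star\<close>\<close>

text \<open>The transpose of \<open>res\<close>, that is, the functional cut off to
  \<open>C\<close>.\<close>

definition hres :: "'a set \<Rightarrow> (('a set \<Rightarrow> complex) \<Rightarrow> complex) \<Rightarrow> (('a set \<Rightarrow> complex) \<Rightarrow> complex)" where
  "hres C h = (\<lambda>\<mu>\<in>carrier M. h (res C \<mu>))"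

lemma hres_bound:
  assumes h: "h \<in> carrier (dual M)" and C: "C \<in> sets B" and \<mu>: "\<mu> \<in> carrier M"
  shows "cmod (hres C h \<mu>) \<le> vnorm (dual M) h * nrm (res C \<mu>)"
  using dual_bound[OF nspace_M h res_closed[OF \<mu> C]] \<mu> by (simp add: hres_def)

lemma hres_dual:
  assumes h: "h \<in> carrier (dual M)" and C: "C \<in> sets B"
  shows "hres C h \<in> carrier (dual M)"
proof (rule in_dualI[where C="vnorm (dual M) h"])
  show "hres C h \<in> extensional (carrier M)" by (simp add: hres_def)
  fix \<mu> assume \<mu>: "\<mu> \<in> carrier M"
  have "vnorm (dual M) h * nrm (res C \<mu>) \<le> vnorm (dual M) h * nrm \<mu>"
    by (intro mult_left_mono res_le[OF \<mu> C] dual_norm_nonneg[OF nspace_M h])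
  then show "cmod (hres C h \<mu>) \<le> vnorm (dual M) h * nrm \<mu>"
    using hres_bound[OF h C \<mu>] by linarith
  show "hres C h (vscale M c \<mu>) = c * hres C h \<mu>" for c
    using in_dualD(3)[OF h res_closed[OF \<mu> C], of c] nspaceD(3)[OF nspace_M \<mu>, of c] \<mu>
    by (simp add: hres_def M_simps res_scale)
  fix \<nu> assume \<nu>: "\<nu> \<in> carrier M"
  show "hres C h (vadd M \<mu> \<nu>) = hres C h \<mu> + hres C h \<nu>"
    using in_dualD(2)[OF h res_closed[OF \<mu> C] res_closed[OF \<nu> C]] nspaceD(2)[OF nspace_M \<mu> \<nu>] \<mu> \<nu>
    by (simp add: hres_def M_simps res_add)
qed

lemma hres_X:
  assumes h: "h \<in> X" and C: "C \<in> sets B"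
  shows "hres C h \<in> X"
proof (rule X_I[OF hres_dual[OF X_dual[OF h] C]])
  fix e :: real assume e: "0 < e"
  obtain K where K: "compactin T K" "\<And>\<mu>. \<mu> \<in> carrier M \<Longrightarrow> null K \<mu> \<Longrightarrow> cmod (h \<mu>) \<le> e * nrm \<mu>"
    using X_small[OF h e] by blast
  have "cmod (hres C h \<mu>) \<le> e * nrm \<mu>" if \<mu>: "\<mu> \<in> carrier M" and n: "null K \<mu>" for \<mu>
  proof -
    have "cmod (h (res C \<mu>)) \<le> e * nrm (res C \<mu>)"
      by (intro K(2) res_closed[OF \<mu> C] null_res(1)[OF \<mu> C compact_sets[OF K(1)] n])
    also have "\<dots> \<le> e * nrm \<mu>" using e by (intro mult_left_mono res_le[OF \<mu> C]) auto
    finally show ?thesis using \<mu> by (simp add: hres_def)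
  qed
  then show "\<exists>K. compactin T K \<and> (\<forall>\<mu>\<in>carrier M. null K \<mu> \<longrightarrow> cmod (hres C h \<mu>) \<le> e * nrm \<mu>)"
    using K(1) by blast
qed

lemma hres_split:
  assumes h: "h \<in> carrier (dual M)" and C: "C \<in> sets B"
  shows "vadd (dual M) (hres C h) (hres (topspace T - C) h) = h"
proof (rule dual_eqI[of _ M])
  note C' = sets_compl[OF C]
  show "vadd (dual M) (hres C h) (hres (topspace T - C) h) \<in> carrier (dual M)"
    by (intro dual_vadd_closed nspace_M hres_dual h C C')
  fix \<mu> assume \<mu>: "\<mu> \<in> carrier M"
  show "vadd (dual M) (hres C h) (hres (topspace T - C) h) \<mu> = h \<mu>"
    using in_dualD(2)[OF h res_closed[OF \<mu> C] res_closed[OF \<mu> C']] \<mu>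
    by (simp add: dual_apply hres_def M_simps res_add_compl[OF \<mu> C])
qed (rule h)

text \<open>The measure \<open>\<mu>\<close> is split into a part on a compact \<open>K\<close> and
  a tail of small norm. For the part on \<open>K\<close>, \<open>support_right\<close> makes the
  convolution null on the compact set that belongs to \<open>h\<close>, as soon as
  \<open>\<nu>\<close> is null on \<open>L\<close>.\<close>

lemma functional_act_X:
  assumes h: "h \<in> X" and \<mu>: "\<mu> \<in> carrier M"
  shows "functional_act M h \<mu> \<in> X"
proof (rule X_I[OF functional_act_closed[OF nalgebra_M X_dual[OF h] \<mu>]])
  fix e :: real assume e: "0 < e"
  note hD = X_dual[OF h]
  define n1 where "n1 = nrm \<mu>"
  define n2 where "n2 = vnorm (dual M) h"
  have n: "0 \<le> n1" "0 \<le> n2" using nrm_nonneg[OF \<mu>] dual_norm_nonneg[OF nspace_M hD] by (simp_all add: n1_def n2_def)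
  define e1 where "e1 = e / (2 * (n1 + 1))"
  define e2 where "e2 = e / (2 * (n2 + 1))"
  have e12: "0 < e1" "0 < e2" using e n by (simp_all add: e1_def e2_def)
  obtain K0 where K0: "compactin T K0" "\<And>\<mu>. \<mu> \<in> carrier M \<Longrightarrow> null K0 \<mu> \<Longrightarrow> cmod (h \<mu>) \<le> e1 * nrm \<mu>"
    using X_small[OF h e12(1)] by blast
  obtain K where K: "compactin T K" "nrm (res (topspace T - K) \<mu>) < e2"
    using tight[OF \<mu> e12(2)] by blast
  obtain L where L: "compactin T L" "\<And>\<mu> \<nu>. \<mu> \<in> carrier M \<Longrightarrow> \<nu> \<in> carrier M \<Longrightarrow>
      null (topspace T - K) \<mu> \<Longrightarrow> null L \<nu> \<Longrightarrow> null K0 (convolution G T \<mu> \<nu>)"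
    using support_right[OF K0(1) K(1)] by blast
  note Ks = compact_sets[OF K(1)] and Ks' = sets_compl[OF compact_sets[OF K(1)]]
  let ?a = "res K \<mu>" and ?b = "res (topspace T - K) \<mu>"
  note a = res_closed[OF \<mu> Ks] and b = res_closed[OF \<mu> Ks']
  have "cmod (functional_act M h \<mu> \<nu>) \<le> e * nrm \<nu>" if \<nu>: "\<nu> \<in> carrier M" and n\<nu>: "null L \<nu>" for \<nu>
  proof -
    note \<nu>0 = nrm_nonneg[OF \<nu>]
    have "convolution G T \<mu> \<nu> = (\<lambda>E. convolution G T ?a \<nu> E + convolution G T ?b \<nu> E)"
      using convolution_add_left[OF carrier_regular[OF a] carrier_regular[OF b] carrier_regular[OF \<nu>]]
      by (simp add: res_add_compl[OF \<mu> Ks])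
    then have "h (convolution G T \<mu> \<nu>) = h (convolution G T ?a \<nu>) + h (convolution G T ?b \<nu>)"
      using in_dualD(2)[OF hD convolution_closed(1)[OF a \<nu>] convolution_closed(1)[OF b \<nu>]] by (simp add: M_simps)
    then have "cmod (h (convolution G T \<mu> \<nu>)) \<le> cmod (h (convolution G T ?a \<nu>)) + cmod (h (convolution G T ?b \<nu>))"
      by (simp add: norm_triangle_ineq)
    also have "cmod (h (convolution G T ?a \<nu>)) \<le> e1 * nrm (convolution G T ?a \<nu>)"
      using null_res(2)[OF \<mu> Ks Ks'] by (intro K0(2) convolution_closed a \<nu> L(2) n\<nu>) auto
    also have "\<dots> \<le> e1 * (n1 * nrm \<nu>)"
    proof (intro mult_left_mono)
      have "nrm (convolution G T ?a \<nu>) \<le> nrm ?a * nrm \<nu>" by (rule convolution_closed(2)[OF a \<nu>])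
      also have "\<dots> \<le> n1 * nrm \<nu>" unfolding n1_def by (intro mult_right_mono res_le[OF \<mu> Ks] \<nu>0)
      finally show "nrm (convolution G T ?a \<nu>) \<le> n1 * nrm \<nu>" .
    qed (use e12 in simp)
    also have "cmod (h (convolution G T ?b \<nu>)) \<le> n2 * nrm (convolution G T ?b \<nu>)"
      unfolding n2_def by (rule dual_bound[OF nspace_M hD convolution_closed(1)[OF b \<nu>]])
    also have "\<dots> \<le> n2 * (e2 * nrm \<nu>)"
    proof (intro mult_left_mono n)
      have "nrm (convolution G T ?b \<nu>) \<le> nrm ?b * nrm \<nu>" by (rule convolution_closed(2)[OF b \<nu>])
      also have "\<dots> \<le> e2 * nrm \<nu>" using K(2) by (intro mult_right_mono \<nu>0) simp
      finally show "nrm (convolution G T ?b \<nu>) \<le> e2 * nrm \<nu>" .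
    qed
    also have "e1 * (n1 * nrm \<nu>) = e / 2 * (n1 / (n1 + 1)) * nrm \<nu>" by (simp add: e1_def)
    also have "n2 * (e2 * nrm \<nu>) = e / 2 * (n2 / (n2 + 1)) * nrm \<nu>" by (simp add: e2_def)
    also have "e / 2 * (n1 / (n1 + 1)) * nrm \<nu> + e / 2 * (n2 / (n2 + 1)) * nrm \<nu> =
        (e / 2 * (n1 / (n1 + 1)) + e / 2 * (n2 / (n2 + 1))) * nrm \<nu>"
      by (simp only: distrib_right)
    also have "\<dots> \<le> (e / 2 * 1 + e / 2 * 1) * nrm \<nu>"
      using e n by (intro mult_right_mono add_mono mult_left_mono \<nu>0) (auto simp: divide_simps)
    finally show ?thesis using \<nu> by (simp add: functional_act_def M_simps)
  qed
  then show "\<exists>K. compactin T K \<and> (\<forall>\<nu>\<in>carrier M. null K \<nu> \<longrightarrow> cmod (functional_act M h \<mu> \<nu>) \<le> e * nrm \<nu>)"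
    using L(1) by blast
qed

lemma A_simps:
  "carrier A = carrier (dual XS)" "vadd A = vadd (dual XS)" "vscale A = vscale (dual XS)"
  "vnorm A = vnorm (dual XS)" "vmult A = arens_product M X"
  by (simp_all add: introverted_dual_def normed_space.defs dual_def)

lemma A_apply:
  assumes "b \<in> carrier A"
  shows "g \<in> X \<Longrightarrow> h \<in> X \<Longrightarrow> b (vadd (dual M) g h) = b g + b h"
    and "g \<in> X \<Longrightarrow> b (vscale (dual M) c g) = c * b g"
    and "g \<in> X \<Longrightarrow> cmod (b g) \<le> vnorm A b * vnorm (dual M) g"
  using in_dualD(2)[of b XS g h] in_dualD(3)[of b XS g c] dual_bound[OF nspace_XS, of b g] assms
  by (simp_all add: A_simps(1,4))

lemma A_norm_nonneg: "b \<in> carrier A \<Longrightarrow> 0 \<le> vnorm A b"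
  using dual_norm_nonneg[OF nspace_XS] by (simp add: A_simps)

text \<open>Choose \<open>g\<close> of norm at most 1 that nearly attains the norm \<open>N\<close>
  of \<open>b\<close>; since \<open>g\<close> vanishes at infinity, its cut-off to a suitable
  compact \<open>K\<close> still gives more than \<open>N - e\<close>. For \<open>h\<close> of norm
  \<open>r\<close>, combine \<open>r\<close> times this cut-off with the part of \<open>h\<close>
  off \<open>K\<close>, the phases adjusted so that the moduli of the values of \<open>b\<close>
  add. The combination has norm at most \<open>r\<close>, so at most \<open>e * r\<close> is left
  for the part of \<open>h\<close> off \<open>K\<close>.\<close>

lemma A_tight:
  assumes b: "b \<in> carrier A" and e: "0 < e"
  shows "\<exists>K. compactin T K \<and> (\<forall>g\<in>X. cmod (b (hres (topspace T - K) g)) \<le> e * vnorm (dual M) g)"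
proof -
  define N where "N = vnorm A b"
  have N: "0 \<le> N" unfolding N_def by (rule A_norm_nonneg[OF b])
  have "\<exists>g\<in>X. vnorm (dual M) g \<le> 1 \<and> N - e / 2 < cmod (b g)"
  proof (rule ccontr)
    assume "\<not> ?thesis"
    then have *: "\<And>g. g \<in> X \<Longrightarrow> vnorm (dual M) g \<le> 1 \<Longrightarrow> cmod (b g) \<le> N - e / 2" by force
    have "vnorm (dual XS) b \<le> N - e / 2"
      unfolding dual_simps(4)[of XS b] XS_simps
    proof (rule cSUP_least)
      have "vnorm (dual M) (\<lambda>\<mu>\<in>carrier M. 0) \<le> 0" by (rule dual_norm_le[OF nspace_M]) auto
      then show "{x \<in> X. vnorm (dual M) x \<le> 1} \<noteq> {}" using zero_X by force
    qed (use * in auto)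
    then show False using e by (simp add: N_def A_simps)
  qed
  then obtain g where g: "g \<in> X" "vnorm (dual M) g \<le> 1" "N - e / 2 < cmod (b g)" by blast
  note gD = X_dual[OF g(1)]
  \<comment> \<open>With this \<open>\<delta>\<close> the part of \<open>g\<close> off
    \<open>K\<close> costs at most \<open>N * \<delta> \<le> e / 2\<close>; the other
    \<open>e / 2\<close> is the defect of \<open>g\<close> from attaining the norm.\<close>
  define \<delta> where "\<delta> = e / (2 * (N + 1))"
  have \<delta>: "0 < \<delta>" using e N by (simp add: \<delta>_def)
  obtain K where K: "compactin T K" "\<And>\<mu>. \<mu> \<in> carrier M \<Longrightarrow> null K \<mu> \<Longrightarrow> cmod (g \<mu>) \<le> \<delta> * nrm \<mu>"
    using X_small[OF g(1) \<delta>] by blast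
  note Ks = compact_sets[OF K(1)] and Ks' = sets_compl[OF compact_sets[OF K(1)]]
  let ?C = "topspace T - K"
  have "vnorm (dual M) (hres ?C g) \<le> \<delta>"
  proof (rule dual_norm_le[OF nspace_M])
    fix \<mu> assume \<mu>: "\<mu> \<in> carrier M"
    have "cmod (g (res ?C \<mu>)) \<le> \<delta> * nrm (res ?C \<mu>)"
      using null_res(2)[OF \<mu> Ks' Ks] by (intro K(2) res_closed[OF \<mu> Ks']) auto
    also have "\<dots> \<le> \<delta> * nrm \<mu>" using \<delta> by (intro mult_left_mono res_le[OF \<mu> Ks']) auto
    finally show "cmod (hres ?C g \<mu>) \<le> \<delta> * nrm \<mu>" using \<mu> by (simp add: hres_def)
  qed (use \<delta> in simp)
  then have "N * vnorm (dual M) (hres ?C g) \<le> N * \<delta>" using N by (rule mult_left_mono)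
  also have "N * \<delta> = e / 2 * (N / (N + 1))" by (simp add: \<delta>_def)
  also have "\<dots> \<le> e / 2 * 1" using e N by (intro mult_left_mono) auto
  finally have small: "cmod (b (hres ?C g)) \<le> e / 2"
    using A_apply(3)[OF b hres_X[OF g(1) Ks']] by (simp add: N_def)
  have "b g = b (hres K g) + b (hres ?C g)"
    using A_apply(1)[OF b hres_X[OF g(1) Ks] hres_X[OF g(1) Ks']] hres_split[OF gD Ks] by simp
  then have "cmod (b g) \<le> cmod (b (hres K g)) + e / 2"
    using norm_triangle_ineq[of "b (hres K g)" "b (hres ?C g)"] small by simp
  then have big: "N - e < cmod (b (hres K g))" using g(3) by simp
  have "cmod (b (hres ?C h)) \<le> e * vnorm (dual M) h" if h: "h \<in> X" for h
  proof -
    note hD = X_dual[OF h]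
    define r where "r = vnorm (dual M) h"
    have r: "0 \<le> r" unfolding r_def by (rule dual_norm_nonneg[OF nspace_M hD])
    \<comment> \<open>A factor of modulus 1 that rotates \<open>z\<close> to \<open>cmod z\<close>,
      with the value 1 at 0 to keep it unimodular.\<close>
    define ph where "ph z = (if z = 0 then 1 else cnj z / cmod z)" for z :: complex
    have ph: "cmod (ph z) = 1" "ph z * z = cmod z" for z
      by (auto simp: ph_def norm_divide complex_norm_square[symmetric] power2_eq_square mult.commute[of "cnj z"])
    define c1 where "c1 = ph (b (hres K g)) * r"
    define c2 where "c2 = ph (b (hres ?C h))"
    have c1: "cmod c1 = r" and c2: "cmod c2 = 1" using r by (simp_all add: c1_def c2_def norm_mult ph)
    let ?u = "vscale (dual M) c1 (hres K g)" and ?v = "vscale (dual M) c2 (hres ?C h)"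
    let ?k = "vadd (dual M) ?u ?v"
    have uv: "?u \<in> X" "?v \<in> X" by (intro X_vscale hres_X g(1) h Ks Ks')+
    have k: "?k \<in> X" by (rule X_vadd[OF uv])
    have "b ?k = c1 * b (hres K g) + c2 * b (hres ?C h)"
      using A_apply(1)[OF b uv] A_apply(2)[OF b hres_X[OF g(1) Ks]] A_apply(2)[OF b hres_X[OF h Ks']] by simp
    also have "\<dots> = complex_of_real (r * cmod (b (hres K g)) + cmod (b (hres ?C h)))"
      using ph(2) by (simp add: c1_def c2_def mult_ac)
    finally have bk: "cmod (b ?k) = r * cmod (b (hres K g)) + cmod (b (hres ?C h))"
      using r by (simp only: norm_of_real) simp
    \<comment> \<open>The two summands see disjoint parts of \<open>\<mu>\<close>, each with a
      factor of at most \<open>r\<close>. Additivity of the norm over these parts keeps the bound at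
      \<open>r\<close>, where the triangle inequality alone would give \<open>2 * r\<close>.\<close>
    have "vnorm (dual M) ?k \<le> r"
    proof (rule dual_norm_le[OF nspace_M r])
      fix \<mu> assume \<mu>: "\<mu> \<in> carrier M"
      have "cmod (?k \<mu>) \<le> cmod (c1 * hres K g \<mu>) + cmod (c2 * hres ?C h \<mu>)"
        using \<mu> by (simp add: dual_apply norm_triangle_ineq)
      also have "\<dots> = r * cmod (hres K g \<mu>) + cmod (hres ?C h \<mu>)" by (simp add: norm_mult c1 c2)
      also have "cmod (hres K g \<mu>) \<le> 1 * nrm (res K \<mu>)"
        using hres_bound[OF gD Ks \<mu>] g(2) nrm_nonneg[OF res_closed[OF \<mu> Ks]]
        by (meson mult_right_mono order_trans)
      also have "cmod (hres ?C h \<mu>) \<le> r * nrm (res ?C \<mu>)"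
        unfolding r_def by (rule hres_bound[OF hD Ks' \<mu>])
      finally have "cmod (?k \<mu>) \<le> r * (1 * nrm (res K \<mu>)) + r * nrm (res ?C \<mu>)"
        using r by (simp add: mult_left_mono)
      then show "cmod (?k \<mu>) \<le> r * nrm \<mu>"
        by (simp add: nrm_res_split[OF \<mu> Ks, symmetric] distrib_left)
    qed
    from mult_left_mono[OF this N] have "cmod (b ?k) \<le> N * r"
      using A_apply(3)[OF b k] unfolding N_def by linarith
    then have "cmod (b (hres ?C h)) \<le> r * (N - cmod (b (hres K g)))" using bk by (simp add: algebra_simps)
    also have "\<dots> \<le> r * e" using big r by (intro mult_left_mono) auto
    finally show ?thesis by (simp add: r_def mult.commute)
  qed
  then show ?thesis using K(1) by blast
qed

lemma bidual_act_dual: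
  assumes b: "b \<in> carrier A" and h: "h \<in> X"
  shows "bidual_act M b h \<in> carrier (dual M)"
    and "\<mu> \<in> carrier M \<Longrightarrow> cmod (bidual_act M b h \<mu>) \<le> vnorm A b * vnorm (dual M) h * nrm \<mu>"
  using bidual_act_props[OF nalgebra_M _ nspace_XS b[unfolded A_simps] h functional_act_X[OF h]] X_dual
  by (auto simp: A_simps)

text \<open>The second half of left introversion. By \<open>A_tight\<close> only the part of the
  functional \<open>functional_act M h \<mu>\<close> on a compact \<open>K\<close> matters for
  \<open>b\<close>, and there \<open>support_left\<close> makes \<open>h\<close> see only
  convolutions that are null on its compact set once \<open>\<mu>\<close> is null on
  \<open>L\<close>.\<close>

lemma bidual_act_X:
  assumes b: "b \<in> carrier A" and h: "h \<in> X"
  shows "bidual_act M b h \<in> X"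
proof (rule X_I[OF bidual_act_dual(1)[OF b h]])
  fix e :: real assume e: "0 < e"
  note hD = X_dual[OF h]
  define n1 where "n1 = vnorm (dual M) h"
  define n2 where "n2 = vnorm A b"
  have n: "0 \<le> n1" "0 \<le> n2" using A_norm_nonneg[OF b] dual_norm_nonneg[OF nspace_M hD] by (simp_all add: n1_def n2_def)
  define e1 where "e1 = e / (2 * (n1 + 1))"
  define e2 where "e2 = e / (2 * (n2 + 1))"
  have e12: "0 < e1" "0 < e2" using e n by (simp_all add: e1_def e2_def)
  obtain K where K: "compactin T K" "\<And>g. g \<in> X \<Longrightarrow> cmod (b (hres (topspace T - K) g)) \<le> e1 * vnorm (dual M) g"
    using A_tight[OF b e12(1)] by blast
  obtain K0 where K0: "compactin T K0" "\<And>\<mu>. \<mu> \<in> carrier M \<Longrightarrow> null K0 \<mu> \<Longrightarrow> cmod (h \<mu>) \<le> e2 * nrm \<mu>"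
    using X_small[OF h e12(2)] by blast
  obtain L where L: "compactin T L" "\<And>\<mu> \<nu>. \<mu> \<in> carrier M \<Longrightarrow> \<nu> \<in> carrier M \<Longrightarrow>
      null L \<mu> \<Longrightarrow> null (topspace T - K) \<nu> \<Longrightarrow> null K0 (convolution G T \<mu> \<nu>)"
    using support_left[OF K0(1) K(1)] by blast
  note Ks = compact_sets[OF K(1)] and Ks' = sets_compl[OF compact_sets[OF K(1)]]
  let ?C = "topspace T - K"
  have "cmod (bidual_act M b h \<mu>) \<le> e * nrm \<mu>" if \<mu>: "\<mu> \<in> carrier M" and n\<mu>: "null L \<mu>" for \<mu>
  proof -
    note \<mu>0 = nrm_nonneg[OF \<mu>]
    let ?g = "functional_act M h \<mu>"
    have g: "?g \<in> X" by (rule functional_act_X[OF h \<mu>])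
    have "b ?g = b (hres K ?g) + b (hres ?C ?g)"
      using A_apply(1)[OF b hres_X[OF g Ks] hres_X[OF g Ks']] hres_split[OF X_dual[OF g] Ks] by simp
    then have "cmod (b ?g) \<le> cmod (b (hres K ?g)) + cmod (b (hres ?C ?g))" by (simp add: norm_triangle_ineq)
    also have "cmod (b (hres K ?g)) \<le> n2 * vnorm (dual M) (hres K ?g)"
      unfolding n2_def by (rule A_apply(3)[OF b hres_X[OF g Ks]])
    also have "\<dots> \<le> n2 * (e2 * nrm \<mu>)"
    proof (intro mult_left_mono n dual_norm_le[OF nspace_M])
      show "0 \<le> e2 * nrm \<mu>" using e12 \<mu>0 by simp
      fix \<nu> assume \<nu>: "\<nu> \<in> carrier M"
      note r\<nu> = res_closed[OF \<nu> Ks]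
      have "cmod (h (convolution G T \<mu> (res K \<nu>))) \<le> e2 * nrm (convolution G T \<mu> (res K \<nu>))"
        using null_res(2)[OF \<nu> Ks Ks'] by (intro K0(2) convolution_closed \<mu> r\<nu> L(2) n\<mu>) auto
      also have "\<dots> \<le> e2 * (nrm \<mu> * nrm \<nu>)"
      proof (intro mult_left_mono)
        have "nrm (convolution G T \<mu> (res K \<nu>)) \<le> nrm \<mu> * nrm (res K \<nu>)" by (rule convolution_closed(2)[OF \<mu> r\<nu>])
        also have "\<dots> \<le> nrm \<mu> * nrm \<nu>" by (intro mult_left_mono res_le[OF \<nu> Ks] \<mu>0)
        finally show "nrm (convolution G T \<mu> (res K \<nu>)) \<le> nrm \<mu> * nrm \<nu>" .
      qed (use e12 in simp)
      finally show "cmod (hres K ?g \<nu>) \<le> e2 * nrm \<mu> * nrm \<nu>"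
        using \<nu> r\<nu> by (simp add: hres_def functional_act_def M_simps mult.assoc)
    qed
    also have "cmod (b (hres ?C ?g)) \<le> e1 * vnorm (dual M) ?g" by (rule K(2)[OF g])
    also have "\<dots> \<le> e1 * (n1 * nrm \<mu>)"
      using functional_act_norm[OF nalgebra_M hD \<mu>] e12 by (intro mult_left_mono) (auto simp: n1_def)
    also have "n2 * (e2 * nrm \<mu>) = e / 2 * (n2 / (n2 + 1)) * nrm \<mu>" by (simp add: e2_def)
    also have "e1 * (n1 * nrm \<mu>) = e / 2 * (n1 / (n1 + 1)) * nrm \<mu>" by (simp add: e1_def)
    also have "e / 2 * (n2 / (n2 + 1)) * nrm \<mu> + e / 2 * (n1 / (n1 + 1)) * nrm \<mu> =
        (e / 2 * (n2 / (n2 + 1)) + e / 2 * (n1 / (n1 + 1))) * nrm \<mu>"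
      by (simp only: distrib_right)
    also have "\<dots> \<le> (e / 2 * 1 + e / 2 * 1) * nrm \<mu>"
      using e n by (intro mult_right_mono add_mono mult_left_mono \<mu>0) (auto simp: divide_simps)
    finally show ?thesis using \<mu> by (simp add: bidual_act_def)
  qed
  then show "\<exists>K. compactin T K \<and> (\<forall>\<mu>\<in>carrier M. null K \<mu> \<longrightarrow> cmod (bidual_act M b h \<mu>) \<le> e * nrm \<mu>)"
    using L(1) by blast
qed

lemma bidual_act_norm:
  assumes b: "b \<in> carrier A" and h: "h \<in> X"
  shows "vnorm (dual M) (bidual_act M b h) \<le> vnorm A b * vnorm (dual M) h"
  by (rule dual_norm_le[OF nspace_M _ bidual_act_dual(2)[OF b h]])
    (simp_all add: A_norm_nonneg[OF b] dual_norm_nonneg[OF nspace_M X_dual[OF h]])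

lemma bidual_act_linear:
  assumes b: "b \<in> carrier A" and h: "h \<in> X"
  shows "g \<in> X \<Longrightarrow> bidual_act M b (vadd (dual M) h g) = vadd (dual M) (bidual_act M b h) (bidual_act M b g)"
    and "bidual_act M b (vscale (dual M) c h) = vscale (dual M) c (bidual_act M b h)"
    and "bidual_act M (vadd A b b') h = vadd (dual M) (bidual_act M b h) (bidual_act M b' h)"
    and "bidual_act M (vscale A c b) h = vscale (dual M) c (bidual_act M b h)"
proof -
  show "bidual_act M b (vadd (dual M) h g) = vadd (dual M) (bidual_act M b h) (bidual_act M b g)" if g: "g \<in> X"
  proof
    fix \<mu>
    show "bidual_act M b (vadd (dual M) h g) \<mu> = vadd (dual M) (bidual_act M b h) (bidual_act M b g) \<mu>"
      using A_apply(1)[OF b functional_act_X[OF h] functional_act_X[OF g], of \<mu> \<mu>]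
      by (cases "\<mu> \<in> carrier M") (simp_all add: bidual_act_def dual_apply functional_act_linear(3)[OF nalgebra_M X_dual[OF h] _ X_dual[OF g]])
  qed
  show "bidual_act M b (vscale (dual M) c h) = vscale (dual M) c (bidual_act M b h)"
  proof
    fix \<mu>
    show "bidual_act M b (vscale (dual M) c h) \<mu> = vscale (dual M) c (bidual_act M b h) \<mu>"
      using A_apply(2)[OF b functional_act_X[OF h], of \<mu> c]
      by (cases "\<mu> \<in> carrier M") (simp_all add: bidual_act_def dual_apply functional_act_linear(4)[OF nalgebra_M X_dual[OF h]])
  qed
  have app: "vadd A b b' f = b f + b' f" "vscale A c b f = c * b f" if "f \<in> X" for f
    using that dual_apply(1)[of f XS b b'] dual_apply(3)[of f XS c b] by (simp_all add: A_simps)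
  show "bidual_act M (vadd A b b') h = vadd (dual M) (bidual_act M b h) (bidual_act M b' h)"
  proof
    fix \<mu>
    show "bidual_act M (vadd A b b') h \<mu> = vadd (dual M) (bidual_act M b h) (bidual_act M b' h) \<mu>"
      using app(1)[OF functional_act_X[OF h], of \<mu>]
      by (cases "\<mu> \<in> carrier M") (simp_all add: bidual_act_def dual_apply)
  qed
  show "bidual_act M (vscale A c b) h = vscale (dual M) c (bidual_act M b h)"
  proof
    fix \<mu>
    show "bidual_act M (vscale A c b) h \<mu> = vscale (dual M) c (bidual_act M b h) \<mu>"
      using app(2)[OF functional_act_X[OF h], of \<mu>]
      by (cases "\<mu> \<in> carrier M") (simp_all add: bidual_act_def dual_apply)
  qed
qed

section \<open>The dual of \<open>M_star\<close> as a normed algebra\<close>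

lemma A_I:
  assumes "a \<in> extensional X"
    and "\<And>g h. g \<in> X \<Longrightarrow> h \<in> X \<Longrightarrow> a (vadd (dual M) g h) = a g + a h"
    and "\<And>c g. g \<in> X \<Longrightarrow> a (vscale (dual M) c g) = c * a g"
    and "\<And>g. g \<in> X \<Longrightarrow> cmod (a g) \<le> C * vnorm (dual M) g"
  shows "a \<in> carrier A"
  unfolding A_simps by (rule in_dualI[where C=C]) (use assms in \<open>simp_all add: XS_simps\<close>)

lemma A_norm_le:
  assumes "0 \<le> C" "\<And>g. g \<in> X \<Longrightarrow> cmod (a g) \<le> C * vnorm (dual M) g"
  shows "vnorm A a \<le> C"
  unfolding A_simps using assms by (intro dual_norm_le[OF nspace_XS]) simp_all

lemma A_ext:
  assumes "a \<in> carrier A" "b \<in> carrier A" "\<And>g. g \<in> X \<Longrightarrow> a g = b g"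
  shows "a = b"
  using assms dual_eqI[of a XS b] by (simp add: A_simps)

lemma A_op_apply:
  "g \<in> X \<Longrightarrow> vadd A a b g = a g + b g" "g \<in> X \<Longrightarrow> vscale A c a g = c * a g"
  "g \<in> X \<Longrightarrow> vmult A a b g = a (bidual_act M b g)"
  using dual_apply(1)[of g XS a b] dual_apply(3)[of g XS c a] by (simp_all add: A_simps arens_product_def)

lemma nspace_A: "nspace A"
  using nspace_dual[OF nspace_XS] unfolding nspace_def A_simps .

lemma A_mult:
  assumes a: "a \<in> carrier A" and b: "b \<in> carrier A"
  shows "vmult A a b \<in> carrier A" and "vnorm A (vmult A a b) \<le> vnorm A a * vnorm A b"
proof -
  have bound: "cmod (vmult A a b g) \<le> (vnorm A a * vnorm A b) * vnorm (dual M) g" if g: "g \<in> X" for g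
  proof -
    have "cmod (a (bidual_act M b g)) \<le> vnorm A a * vnorm (dual M) (bidual_act M b g)"
      by (rule A_apply(3)[OF a bidual_act_X[OF b g]])
    also have "\<dots> \<le> vnorm A a * (vnorm A b * vnorm (dual M) g)"
      by (intro mult_left_mono bidual_act_norm[OF b g] A_norm_nonneg[OF a])
    finally show ?thesis using g by (simp add: A_op_apply mult.assoc)
  qed
  show "vmult A a b \<in> carrier A"
  proof (rule A_I[OF _ _ _ bound])
    show "vmult A a b \<in> extensional X" by (simp add: A_simps arens_product_def)
    fix g assume g: "g \<in> X"
    show "vmult A a b (vscale (dual M) c g) = c * vmult A a b g" for c
      using g X_vscale[OF g] A_apply(2)[OF a bidual_act_X[OF b g]]
      by (simp add: A_op_apply bidual_act_linear(2)[OF b g])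
    fix h assume h: "h \<in> X"
    show "vmult A a b (vadd (dual M) g h) = vmult A a b g + vmult A a b h"
      using g h X_vadd[OF g h] A_apply(1)[OF a bidual_act_X[OF b g] bidual_act_X[OF b h]]
      by (simp add: A_op_apply bidual_act_linear(1)[OF b g h])
  qed
  show "vnorm A (vmult A a b) \<le> vnorm A a * vnorm A b"
    by (rule A_norm_le[OF _ bound]) (simp add: A_norm_nonneg[OF a] A_norm_nonneg[OF b])
qed

lemma nalgebra_A: "nalgebra A 1"
  unfolding nalgebra_def
proof (intro conjI ballI allI)
  note cl = nspaceD(2,3)[OF nspace_A]
  fix a b assume a: "a \<in> carrier A" and b: "b \<in> carrier A"
  show "vmult A a b \<in> carrier A" "vnorm A (vmult A a b) \<le> 1 * vnorm A a * vnorm A b"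
    using A_mult[OF a b] by simp_all
  fix c
  show "vmult A (vscale A c a) b = vscale A c (vmult A a b)"
    by (rule A_ext) (simp_all add: A_mult cl a b A_op_apply bidual_act_X)
  show "vmult A a (vscale A c b) = vscale A c (vmult A a b)"
    by (rule A_ext) (simp_all add: A_mult cl a b A_op_apply bidual_act_X bidual_act_linear(4)[OF b] A_apply(2)[OF a])
  fix b' assume b': "b' \<in> carrier A"
  show "vmult A a (vadd A b b') = vadd A (vmult A a b) (vmult A a b')"
    by (rule A_ext) (simp_all add: A_mult cl a b b' A_op_apply bidual_act_X bidual_act_linear(3)[OF b] A_apply(1)[OF a])
next
  note cl = nspaceD(2,3)[OF nspace_A]
  fix a a' b assume "a \<in> carrier A" "a' \<in> carrier A" "b \<in> carrier A"
  then show "vmult A (vadd A a a') b = vadd A (vmult A a b) (vmult A a' b)"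
    by (intro A_ext) (simp_all add: A_mult cl A_op_apply bidual_act_X)
qed (simp_all add: nspace_A)

end

lemma dual_sum_apply:
  fixes \<phi> :: "'i \<Rightarrow> 'v \<Rightarrow> complex"
  assumes V: "nspace V" and \<Psi>: "\<Psi> \<in> carrier (dual (dual V))" and I: "finite I"
    and \<phi>: "\<And>i. i \<in> I \<Longrightarrow> \<phi> i \<in> carrier (dual V)"
  shows "(\<lambda>x\<in>carrier V. \<Sum>i\<in>I. c i * \<phi> i x) \<in> carrier (dual V) \<and>
    \<Psi> (\<lambda>x\<in>carrier V. \<Sum>i\<in>I. c i * \<phi> i x) = (\<Sum>i\<in>I. c i * \<Psi> (\<phi> i))"
  using I \<phi>
proof (induction I)
  case empty
  have z: "(\<lambda>x\<in>carrier V. 0) \<in> carrier (dual V)" by (rule zero_in_dual[OF V])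
  have "vscale (dual V) 0 (\<lambda>x\<in>carrier V. 0) = (\<lambda>x\<in>carrier V. 0)" by (auto simp: dual_simps(3))
  then have "\<Psi> (\<lambda>x\<in>carrier V. 0) = 0" using in_dualD(3)[OF \<Psi> z, of 0] by simp
  then show ?case using z by (simp only: sum.empty simp_thms)
next
  case (insert i I)
  let ?s = "\<lambda>I. \<lambda>x\<in>carrier V. \<Sum>i\<in>I. c i * \<phi> i x"
  have p: "\<And>i. i \<in> I \<Longrightarrow> \<phi> i \<in> carrier (dual V)" using insert.prems by simp
  note IH = conjunct1[OF insert.IH[OF p]] conjunct2[OF insert.IH[OF p]]
  have \<phi>i: "\<phi> i \<in> carrier (dual V)" using insert.prems by simp
  note sc = dual_vscale_closed[OF V \<phi>i, of "c i"]
  have eq: "?s (insert i I) = vadd (dual V) (vscale (dual V) (c i) (\<phi> i)) (?s I)"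
    using insert.hyps by (auto simp: dual_simps(2,3) fun_eq_iff)
  show ?case
    unfolding eq using dual_vadd_closed[OF V sc IH(1)] in_dualD(2)[OF \<Psi> sc IH(1)] in_dualD(3)[OF \<Psi> \<phi>i, of "c i"]
      IH(2) insert.hyps by (simp del: restrict_apply)
qed

section \<open>Point masses\<close>

context weighted_group
begin

definition mass :: "'a \<Rightarrow> ('a set \<Rightarrow> complex) \<Rightarrow> complex" where
  "mass x = (\<lambda>\<mu>\<in>carrier M. \<mu> {x})"

text \<open>The canonical image of \<open>dirac x\<close> in \<open>A\<close>. These elements
  multiply like group elements by \<open>point_mult\<close>, which turns questions about the product
  of \<open>A\<close> into combinatorics in the group.\<close>

definition point :: "'a \<Rightarrow> (('a set \<Rightarrow> complex) \<Rightarrow> complex) \<Rightarrow> complex" where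
  "point x = (\<lambda>h\<in>X. h (dirac x))"

text \<open>Coefficients of modulus at most 1 and \<open>\<omega> \<ge> 1\<close> give norm at most
  1. The functional vanishes on every measure that is null on the compact set \<open>F\<close>, so a
  single compact set serves all \<open>e\<close>.\<close>

lemma masses_X:
  assumes F: "finite F" "F \<subseteq> topspace T" and c: "\<And>x. x \<in> F \<Longrightarrow> cmod (c x) \<le> 1"
  shows "(\<lambda>\<mu>\<in>carrier M. \<Sum>x\<in>F. c x * \<mu> {x}) \<in> X"
    and "vnorm (dual M) (\<lambda>\<mu>\<in>carrier M. \<Sum>x\<in>F. c x * \<mu> {x}) \<le> 1"
proof -
  let ?h = "\<lambda>\<mu>\<in>carrier M. \<Sum>x\<in>F. c x * \<mu> {x}"
  have b: "cmod (?h \<mu>) \<le> 1 * nrm \<mu>" if \<mu>: "\<mu> \<in> carrier M" for \<mu>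
  proof -
    have "cmod (\<Sum>x\<in>F. c x * \<mu> {x}) \<le> (\<Sum>x\<in>F. cmod (\<mu> {x}) * \<omega> x)"
    proof (rule sum_norm_le)
      fix x assume x: "x \<in> F"
      have "cmod (c x) * cmod (\<mu> {x}) \<le> 1 * cmod (\<mu> {x})" by (rule mult_right_mono[OF c[OF x]]) simp
      also have "\<dots> \<le> \<omega> x * cmod (\<mu> {x})"
        using x F(2) by (intro mult_right_mono \<omega>_ge_1) auto
      finally show "cmod (c x * \<mu> {x}) \<le> cmod (\<mu> {x}) * \<omega> x" by (simp add: norm_mult mult.commute)
    qed
    also have "\<dots> \<le> nrm \<mu>" by (rule sum_point_masses_le[OF \<mu> F])
    finally show ?thesis using \<mu> by simp
  qed
  have D: "?h \<in> carrier (dual M)"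
  proof (rule in_dualI[OF _ _ _ b])
    show "?h \<in> extensional (carrier M)" by (rule restrict_extensional)
  qed (use nspaceD[OF nspace_M] in \<open>auto simp: M_simps sum.distrib distrib_left sum_distrib_left mult_ac\<close>)
  have K: "compactin T F" by (rule finite_imp_compactin[OF F(2,1)])
  have z: "?h \<mu> = 0" if \<mu>: "\<mu> \<in> carrier M" and n: "null F \<mu>" for \<mu>
  proof -
    have "\<mu> {x} = 0" if "x \<in> F" for x
    proof (rule cmod_le_emeasure[OF \<mu>])
      show "null {x} \<mu>" using null_mono[OF n compact_sets[OF K]] that by blast
    qed
    then show ?thesis using \<mu> by simp
  qed
  show "?h \<in> X"
  proof (rule X_I[OF D])
    fix e :: real assume e: "0 < e"
    have "cmod (?h \<mu>) \<le> e * nrm \<mu>" if "\<mu> \<in> carrier M" "null F \<mu>" for \<mu>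
      using z[OF that] e nrm_nonneg[OF that(1)] by simp
    then show "\<exists>K. compactin T K \<and> (\<forall>\<mu>\<in>carrier M. null K \<mu> \<longrightarrow> cmod (?h \<mu>) \<le> e * nrm \<mu>)"
      using K by blast
  qed
  show "vnorm (dual M) ?h \<le> 1" by (rule dual_norm_le[OF nspace_M _ b]) simp_all
qed

lemma mass_X: "x \<in> topspace T \<Longrightarrow> mass x \<in> X"
  using masses_X(1)[of "{x}" "\<lambda>_. 1"] by (simp add: mass_def)

lemma A_masses:
  assumes a: "a \<in> carrier A" and F: "finite F" "F \<subseteq> topspace T"
  shows "(\<lambda>\<mu>\<in>carrier M. \<Sum>x\<in>F. c x * \<mu> {x}) \<in> X \<and>
    a (\<lambda>\<mu>\<in>carrier M. \<Sum>x\<in>F. c x * \<mu> {x}) = (\<Sum>x\<in>F. c x * a (mass x))"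
  using F
proof (induction F)
  case empty
  have "vscale (dual M) 0 (\<lambda>\<mu>\<in>carrier M. 0) = (\<lambda>\<mu>\<in>carrier M. 0)" by (auto simp: dual_simps(3))
  then have "a (\<lambda>\<mu>\<in>carrier M. 0) = 0" using A_apply(2)[OF a zero_X, of 0] by simp
  then show ?case using zero_X by (simp only: sum.empty simp_thms)
next
  case (insert x F)
  have x: "x \<in> topspace T" and F: "F \<subseteq> topspace T" using insert.prems by simp_all
  have m: "vscale (dual M) (c x) (mass x) \<in> X" by (rule X_vscale[OF mass_X[OF x]])
  note IH = conjunct1[OF insert.IH[OF F]] conjunct2[OF insert.IH[OF F]]
  have eq: "(\<lambda>\<mu>\<in>carrier M. \<Sum>x\<in>insert x F. c x * \<mu> {x}) =
      vadd (dual M) (vscale (dual M) (c x) (mass x)) (\<lambda>\<mu>\<in>carrier M. \<Sum>x\<in>F. c x * \<mu> {x})"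
    using insert.hyps by (auto simp: dual_simps(2,3) mass_def fun_eq_iff)
  show ?case
    unfolding eq using X_vadd[OF m IH(1)] A_apply(1)[OF a m IH(1)] A_apply(2)[OF a mass_X[OF x], of "c x"] IH(2) insert.hyps
    by (simp del: restrict_apply)
qed

text \<open>Phases \<open>c x\<close> turn the sum of moduli into the value of \<open>a\<close> at
  one functional of norm at most 1, provided by \<open>masses_X\<close>. The bound does not depend
  on \<open>F\<close>, which yields summability over any set.\<close>

lemma sum_masses_le:
  assumes a: "a \<in> carrier A" and F: "finite F" "F \<subseteq> topspace T"
  shows "(\<Sum>x\<in>F. cmod (a (mass x))) \<le> vnorm A a"
proof -
  define c where "c x = (if a (mass x) = 0 then 1 else cnj (a (mass x)) / cmod (a (mass x)))" for x
  have c: "cmod (c x) = 1" "c x * a (mass x) = cmod (a (mass x))" for x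
    by (auto simp: c_def norm_divide complex_norm_square[symmetric] power2_eq_square mult.commute[of "cnj _"])
  have c1: "\<And>x. x \<in> F \<Longrightarrow> cmod (c x) \<le> 1" using c(1) by simp
  have "complex_of_real (\<Sum>x\<in>F. cmod (a (mass x))) = a (\<lambda>\<mu>\<in>carrier M. \<Sum>x\<in>F. c x * \<mu> {x})"
    by (simp only: conjunct2[OF A_masses[where c=c, OF a F]] c(2) of_real_sum)
  then have "cmod (complex_of_real (\<Sum>x\<in>F. cmod (a (mass x)))) \<le> vnorm A a * vnorm (dual M) (\<lambda>\<mu>\<in>carrier M. \<Sum>x\<in>F. c x * \<mu> {x})"
    using A_apply(3)[OF a masses_X(1)[OF F c1]] by simp
  also have "\<dots> \<le> vnorm A a * 1"
    by (intro mult_left_mono masses_X(2)[OF F c1] A_norm_nonneg[OF a])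
  finally have "\<bar>\<Sum>x\<in>F. cmod (a (mass x))\<bar> \<le> vnorm A a" by (simp only: norm_of_real mult_1_right)
  then show ?thesis by linarith
qed

lemma point_A:
  assumes x: "x \<in> topspace T"
  shows "point x \<in> carrier A" and "vnorm A (point x) \<le> \<omega> x"
proof -
  have b: "cmod (point x g) \<le> \<omega> x * vnorm (dual M) g" if "g \<in> X" for g
    using dual_bound[OF nspace_M X_dual[OF that] dirac_closed[OF x]] that
    by (simp add: point_def nrm_dirac[OF x] mult.commute)
  show "point x \<in> carrier A"
  proof (rule A_I[OF _ _ _ b])
    show "point x \<in> extensional X" unfolding point_def by (rule restrict_extensional)
  qed (use X_vadd X_vscale dirac_closed[OF x] in \<open>auto simp: point_def dual_apply\<close>)
  show "vnorm A (point x) \<le> \<omega> x" using \<omega>_ge_1[OF x] by (intro A_norm_le[OF _ b]) auto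
qed

lemma point_mult:
  assumes x: "x \<in> topspace T" and y: "y \<in> topspace T"
  shows "vmult A (point x) (point y) = point (x \<otimes> y)"
proof (rule A_ext)
  have xy: "x \<otimes> y \<in> topspace T" using x y by (simp add: topspace_eq_carrier)
  show "vmult A (point x) (point y) \<in> carrier A" by (rule A_mult(1)[OF point_A(1)[OF x] point_A(1)[OF y]])
  show "point (x \<otimes> y) \<in> carrier A" by (rule point_A(1)[OF xy])
  fix g assume g: "g \<in> X"
  have "vmult A (point x) (point y) g = functional_act M g (dirac x) (dirac y)"
    using g bidual_act_X[OF point_A(1)[OF y] g] functional_act_X[OF g dirac_closed[OF x]] dirac_closed[OF x]
    by (simp add: A_op_apply point_def[of x] bidual_act_def) (simp add: point_def)
  also have "\<dots> = g (dirac (x \<otimes> y))"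
    using dirac_closed[OF y] by (simp add: functional_act_def M_simps convolution_dirac[OF x y])
  finally show "vmult A (point x) (point y) g = point (x \<otimes> y) g" using g by (simp add: point_def)
qed

lemma point_mass:
  assumes "x \<in> topspace T" "z \<in> topspace T"
  shows "point z (mass x) = (if z = x then 1 else 0)"
  using assms mass_X[OF assms(1)] dirac_closed[OF assms(2)] singleton_sets[OF assms(1)]
  by (auto simp: point_def mass_def dirac_def)

text \<open>\<^term>\<open>mass x\<close> is the functional \<open>\<mu> \<mapsto> \<mu>{x}\<close> in \<^term>\<open>X\<close>, so \<^term>\<open>a (mass x)\<close> is the mass of
  \<^term>\<open>a\<close> at \<open>x\<close>, and the sum runs over the discrete part of \<^term>\<open>a\<close>.\<close>

definition mass_on :: "'a set \<Rightarrow> ((('a set \<Rightarrow> complex) \<Rightarrow> complex) \<Rightarrow> complex) \<Rightarrow> complex" where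
  "mass_on E = (\<lambda>a\<in>carrier A. \<Sum>\<^sub>\<infinity>x\<in>E. a (mass x))"

lemma masses_abs_summable:
  assumes a: "a \<in> carrier A" and E: "E \<subseteq> topspace T"
  shows "(\<lambda>x. cmod (a (mass x))) summable_on E" and "(\<lambda>x. a (mass x)) summable_on E"
    and "cmod (\<Sum>\<^sub>\<infinity>x\<in>E. a (mass x)) \<le> vnorm A a"
proof -
  have le: "(\<Sum>x\<in>F. cmod (a (mass x))) \<le> vnorm A a" if "finite F" "F \<subseteq> E" for F
    using sum_masses_le[OF a that(1)] that(2) E by blast
  show s: "(\<lambda>x. cmod (a (mass x))) summable_on E"
    by (rule nonneg_bdd_above_summable_on) (auto intro!: bdd_aboveI[of _ "vnorm A a"] le)
  show "(\<lambda>x. a (mass x)) summable_on E" by (rule abs_summable_summable[OF s])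
  have "cmod (\<Sum>\<^sub>\<infinity>x\<in>E. a (mass x)) \<le> (\<Sum>\<^sub>\<infinity>x\<in>E. cmod (a (mass x)))"
    by (rule norm_infsum_bound[OF s])
  also have "\<dots> \<le> vnorm A a" by (rule infsum_le_finite_sums[OF s le])
  finally show "cmod (\<Sum>\<^sub>\<infinity>x\<in>E. a (mass x)) \<le> vnorm A a" .
qed

lemma mass_on_dual:
  assumes E: "E \<subseteq> topspace T"
  shows "mass_on E \<in> carrier (dual A)"
proof (rule in_dualI[where C=1])
  show "mass_on E \<in> extensional (carrier A)" by (simp add: mass_on_def)
  fix a assume a: "a \<in> carrier A"
  note s = masses_abs_summable[OF a E]
  have m: "mass x \<in> X" if "x \<in> E" for x using that E mass_X by blast
  show "cmod (mass_on E a) \<le> 1 * vnorm A a" using s(3) a by (simp add: mass_on_def)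
  have "(\<Sum>\<^sub>\<infinity>x\<in>E. vscale A c a (mass x)) = (\<Sum>\<^sub>\<infinity>x\<in>E. c * a (mass x))" for c
    by (rule infsum_cong) (simp add: A_op_apply m)
  then show "mass_on E (vscale A c a) = c * mass_on E a" for c
    using a nspaceD(3)[OF nspace_A a] by (simp add: mass_on_def infsum_cmult_right')
  fix b assume b: "b \<in> carrier A"
  have "(\<Sum>\<^sub>\<infinity>x\<in>E. vadd A a b (mass x)) = (\<Sum>\<^sub>\<infinity>x\<in>E. a (mass x) + b (mass x))"
    by (rule infsum_cong) (simp add: A_op_apply m)
  then show "mass_on E (vadd A a b) = mass_on E a + mass_on E b"
    using a b nspaceD(2)[OF nspace_A a b] s(2) masses_abs_summable(2)[OF b E]
    by (simp add: mass_on_def infsum_add)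
qed

lemma mass_on_point:
  assumes E: "E \<subseteq> topspace T" and z: "z \<in> topspace T"
  shows "mass_on E (point z) = (if z \<in> E then 1 else 0)"
proof -
  have "(\<Sum>\<^sub>\<infinity>x\<in>E. point z (mass x)) = (\<Sum>\<^sub>\<infinity>x\<in>E \<inter> {z}. 1)"
    by (rule infsum_cong_neutral) (use E in \<open>auto simp: point_mass[OF _ z] subset_iff\<close>)
  then show ?thesis using point_A(1)[OF z] by (auto simp: mass_on_def)
qed

text \<open>The pairs \<open>(x\<^sub>j, y\<^sub>j)\<close> are chosen successively: first \<open>x\<^sub>j\<close> and then \<open>y\<^sub>j\<close> has to avoid the
  finitely many values that would produce a coincidence with an earlier product.\<close>

lemma interleaved_sequences:
  assumes S: "infinite S" "S \<subseteq> carrier G"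
  obtains x y :: "nat \<Rightarrow> 'a" where "\<And>n. x n \<in> S" "\<And>n. y n \<in> S"
    "\<And>n m n' m'. m < n \<Longrightarrow> n' \<le> m' \<Longrightarrow> x n \<otimes> y m \<noteq> x n' \<otimes> y m'"
proof -
  \<comment> \<open>For \<open>r\<close> as the pair of stage \<open>j\<close>, the first inequality
    concerns only the new \<open>x\<close>, tested against products of earlier stages. The second
    concerns the new \<open>y\<close>; writing \<open>f(j := r)\<close> lets the new
    \<open>x\<close> take part in both products.\<close>
  define P where "P f j r \<longleftrightarrow> fst r \<in> S \<and> snd r \<in> S \<and>
      (\<forall>m<j. \<forall>m'<j. \<forall>n'\<le>m'. fst r \<otimes> snd (f m) \<noteq> fst (f n') \<otimes> snd (f m')) \<and>
      (\<forall>n\<le>j. \<forall>n'\<le>j. \<forall>m<n'. fst ((f(j := r)) n) \<otimes> snd r \<noteq> fst ((f(j := r)) n') \<otimes> snd (f m))"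
    for f :: "nat \<Rightarrow> 'a \<times> 'a" and j r
  have "\<exists>f. \<forall>j. P f j (f j)"
  proof (rule dependent_wellorder_choice)
    fix r f g and j :: nat
    assume eq: "\<And>i. i < j \<Longrightarrow> f i = (g i :: 'a \<times> 'a)"
    have e2: "(f(j := r)) i = (g(j := r)) i" if "i \<le> j" for i using eq that by (cases "i = j") auto
    have e3: "i < j" if "i < n'" "n' \<le> j" for i n' using that by simp
    show "P f j r = P g j r"
      unfolding P_def using eq e2 by (auto dest: e3)
  next
    fix j :: nat and f :: "nat \<Rightarrow> 'a \<times> 'a"
    assume IH: "\<And>i. i < j \<Longrightarrow> P f i (f i)"
    have f: "fst (f i) \<in> carrier G" "snd (f i) \<in> carrier G" if "i < j" for i
      using IH[OF that] S(2) by (auto simp: P_def)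
    define D where "D = (\<Union>m<j. \<Union>m'<j. \<Union>n'\<le>m'. {(fst (f n') \<otimes> snd (f m')) \<otimes> inv (snd (f m))})"
    have "infinite (S - D)" using S(1) by (intro Diff_infinite_finite) (auto simp: D_def)
    then obtain x where x: "x \<in> S" "x \<notin> D" using infinite_imp_nonempty by blast
    have xc: "x \<in> carrier G" using x S(2) by blast
    have x_new: "x \<otimes> snd (f m) \<noteq> fst (f n') \<otimes> snd (f m')" if m: "m < j" "m' < j" "n' \<le> m'" for m m' n'
    proof
      assume "x \<otimes> snd (f m) = fst (f n') \<otimes> snd (f m')"
      then have "x = (fst (f n') \<otimes> snd (f m')) \<otimes> inv (snd (f m))"
        using xc f m by (metis inv_solve_right' le_less_trans m_closed)
      then show False using x(2) m unfolding D_def by blast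
    qed
    define h where "h n = (if n = j then x else fst (f n))" for n
    have hc: "h n \<in> carrier G" if "n \<le> j" for n using that xc f(1)[of n] by (simp add: h_def)
    define D' where "D' = (\<Union>n\<le>j. \<Union>n'\<le>j. \<Union>m<n'. {inv (h n) \<otimes> (h n' \<otimes> snd (f m))})"
    have "infinite (S - D')" using S(1) by (intro Diff_infinite_finite) (auto simp: D'_def)
    then obtain y where y: "y \<in> S" "y \<notin> D'" using infinite_imp_nonempty by blast
    have yc: "y \<in> carrier G" using y S(2) by blast
    have y_new: "h n \<otimes> y \<noteq> h n' \<otimes> snd (f m)" if m: "n \<le> j" "n' \<le> j" "m < n'" for n n' m
    proof
      assume "h n \<otimes> y = h n' \<otimes> snd (f m)"
      then have "y = inv (h n) \<otimes> (h n' \<otimes> snd (f m))"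
        using yc hc m f(2)[of m] by (metis inv_solve_left less_le_trans m_closed)
      then show False using y(2) m unfolding D'_def by blast
    qed
    have hx: "fst ((f(j := (x, y))) n) = h n" for n by (simp add: h_def)
    have "P f j (x, y)" unfolding P_def hx using x(1) y(1) x_new y_new by simp
    then show "\<exists>r. P f j r" by blast
  qed
  then obtain f where f: "\<And>j. P f j (f j)" by blast
  have upd: "f(j := f j) = f" for j by simp
  show thesis
  proof (rule that[of "\<lambda>n. fst (f n)" "\<lambda>n. snd (f n)"])
    show "fst (f n) \<in> S" "snd (f n) \<in> S" for n using f[of n] by (simp_all add: P_def)
    fix n m n' m' :: nat assume "m < n" "n' \<le> m'"
    show "fst (f n) \<otimes> snd (f m) \<noteq> fst (f n') \<otimes> snd (f m')"
    \<comment> \<open>The coincidence is excluded at the later stage: by the choice of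
      \<open>x n\<close> if \<open>m' < n\<close>, and otherwise by the choice of
      \<open>y m'\<close>.\<close>
    proof (cases "m' < n")
      case True
      then show ?thesis using f[of n] \<open>m < n\<close> \<open>n' \<le> m'\<close> unfolding P_def by blast
    next
      case False
      then have "fst (f n') \<otimes> snd (f m') \<noteq> fst (f n) \<otimes> snd (f m)"
        using f[of m'] \<open>m < n\<close> \<open>n' \<le> m'\<close> unfolding P_def upd by (meson not_less)
      then show ?thesis by metis
    qed
  qed
qed

text \<open>The bound \<open>k\<close> on the weight keeps the elements \<open>point (x n)\<close>
  and \<open>point (y n)\<close> bounded in norm, as the double limit criterion requires. For fixed
  \<open>n\<close> the values are eventually 1 in \<open>m\<close>, and for fixed \<open>m\<close>
  eventually 0 in \<open>n\<close>.\<close>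

lemma finite_sublevel:
  assumes reg: "arens_regular A"
  shows "finite {x \<in> topspace T. \<omega> x \<le> k}"
proof (rule ccontr)
  let ?S = "{x \<in> topspace T. \<omega> x \<le> k}"
  assume inf: "infinite ?S"
  have sub: "?S \<subseteq> carrier G" by (auto simp: topspace_eq_carrier)
  obtain x y where xy: "\<And>n :: nat. x n \<in> ?S" "\<And>n :: nat. y n \<in> ?S"
    "\<And>n m n' m'. m < n \<Longrightarrow> n' \<le> m' \<Longrightarrow> x n \<otimes> y m \<noteq> x n' \<otimes> y m'"
    by (rule interleaved_sequences[OF inf sub]) (rule that; assumption)
  have t: "x n \<in> topspace T" "y n \<in> topspace T" "\<omega> (x n) \<le> k" "\<omega> (y n) \<le> k" for n using xy(1,2)[of n] by auto
  have tm: "x n \<otimes> y m \<in> topspace T" for n m using t by (simp add: topspace_eq_carrier)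
  define E where "E = {x n \<otimes> y m | n m. n \<le> m}"
  have E: "E \<subseteq> topspace T" using tm by (auto simp: E_def)
  have v: "mass_on E (vmult A (point (x n)) (point (y m))) = (if n \<le> m then 1 else 0)" for n m
  proof -
    have "x n \<otimes> y m \<in> E \<longleftrightarrow> n \<le> m"
    proof
      assume "x n \<otimes> y m \<in> E"
      then obtain n' m' where "n' \<le> m'" "x n \<otimes> y m = x n' \<otimes> y m'" by (auto simp: E_def)
      then show "n \<le> m" using xy(3)[of m n n' m'] by (meson not_less)
    qed (auto simp: E_def)
    then show ?thesis by (simp add: point_mult[OF t(1,2)] mass_on_point[OF E tm])
  qed
  have "(1 :: complex) = 0"
  proof (rule arens_regular_iterated_limits[OF nalgebra_A reg mass_on_dual[OF E]])
    show "point (x n) \<in> carrier A" "point (y n) \<in> carrier A" for n by (intro point_A t)+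
    show "vnorm A (point (x n)) \<le> k" "vnorm A (point (y n)) \<le> k" for n
      using point_A(2)[OF t(1)[of n]] point_A(2)[OF t(2)[of n]] t(3,4)[of n] by linarith+
    show "(\<lambda>m. mass_on E (vmult A (point (x n)) (point (y m)))) \<longlonglongrightarrow> 1" for n
      unfolding v by (rule tendsto_eventually) (auto simp: eventually_sequentially intro!: exI[of _ n])
    show "(\<lambda>n. mass_on E (vmult A (point (x n)) (point (y m)))) \<longlonglongrightarrow> 0" for m
      unfolding v by (rule tendsto_eventually) (auto simp: eventually_sequentially intro!: exI[of _ "Suc m"])
  qed
  then show False by simp
qed

lemma countable_of_arens_regular:
  assumes "arens_regular A"
  shows "countable (carrier G)"
proof -
  have "carrier G \<subseteq> (\<Union>k :: nat. {x \<in> topspace T. \<omega> x \<le> real k})"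
  proof
    fix x assume "x \<in> carrier G"
    moreover obtain k :: nat where "\<omega> x \<le> real k" using real_arch_simple by blast
    ultimately show "x \<in> (\<Union>k :: nat. {x \<in> topspace T. \<omega> x \<le> real k})"
      by (auto simp: topspace_eq_carrier)
  qed
  moreover have "countable (\<Union>k :: nat. {x \<in> topspace T. \<omega> x \<le> real k})"
    by (intro countable_UN countable_finite finite_sublevel[OF assms] countableI_type)
  ultimately show ?thesis by (rule countable_subset)
qed

end

section \<open>Arens regularity for proper weights\<close>

lemma dual_approx_apply:
  fixes \<phi> :: "'i \<Rightarrow> 'v \<Rightarrow> complex"
  assumes V: "nspace V" and \<Psi>: "\<Psi> \<in> carrier (dual (dual V))" and I: "finite I"
    and \<phi>: "\<And>i. i \<in> I \<Longrightarrow> \<phi> i \<in> carrier (dual V)" and g: "g \<in> carrier (dual V)" and e: "0 \<le> e"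
    and le: "\<And>x. x \<in> carrier V \<Longrightarrow> cmod (g x - (\<Sum>i\<in>I. c i * \<phi> i x)) \<le> e * vnorm V x"
  shows "cmod (\<Psi> g - (\<Sum>i\<in>I. c i * \<Psi> (\<phi> i))) \<le> vnorm (dual (dual V)) \<Psi> * e"
proof -
  let ?s = "\<lambda>x\<in>carrier V. \<Sum>i\<in>I. c i * \<phi> i x"
  have s: "?s \<in> carrier (dual V)" "\<Psi> ?s = (\<Sum>i\<in>I. c i * \<Psi> (\<phi> i))"
    using dual_sum_apply[where c=c, OF V \<Psi> I \<phi>] by simp_all
  note ms = dual_vscale_closed[OF V s(1), of "-1"]
  let ?d = "vadd (dual V) g (vscale (dual V) (-1) ?s)"
  have d: "?d \<in> carrier (dual V)" by (rule dual_vadd_closed[OF V g ms])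
  have "vnorm (dual V) ?d \<le> e"
    by (rule dual_norm_le[OF V e]) (use le in \<open>simp add: dual_apply\<close>)
  then have "vnorm (dual (dual V)) \<Psi> * vnorm (dual V) ?d \<le> vnorm (dual (dual V)) \<Psi> * e"
    by (rule mult_left_mono) (rule dual_norm_nonneg[OF nspace_dual[OF V] \<Psi>])
  moreover have "\<Psi> ?d = \<Psi> g - (\<Sum>i\<in>I. c i * \<Psi> (\<phi> i))"
    using in_dualD(2)[OF \<Psi> g ms] in_dualD(3)[OF \<Psi> s(1), of "-1"] s(2) by simp
  ultimately show ?thesis
    using dual_bound[OF nspace_dual[OF V] \<Psi> d] by simp
qed

text \<open>For a form of finite rank both orders of application give the same sum of products
  \<open>\<Phi> (\<phi> i) * \<Psi> (\<psi> i)\<close>. An approximation that is uniform in the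
  norms changes either side by at most a multiple of \<open>e\<close>, so the equality survives in
  the limit.\<close>

lemma iterated_bidual_commute:
  assumes V: "nspace V" and \<Phi>: "\<Phi> \<in> carrier (dual (dual V))" and \<Psi>: "\<Psi> \<in> carrier (dual (dual V))"
    and left: "\<And>a. a \<in> carrier V \<Longrightarrow> (\<lambda>b\<in>carrier V. \<beta> a b) \<in> carrier (dual V)"
    and right: "\<And>b. b \<in> carrier V \<Longrightarrow> (\<lambda>a\<in>carrier V. \<beta> a b) \<in> carrier (dual V)"
    and L: "(\<lambda>a\<in>carrier V. \<Psi> (\<lambda>b\<in>carrier V. \<beta> a b)) \<in> carrier (dual V)"
    and R: "(\<lambda>b\<in>carrier V. \<Phi> (\<lambda>a\<in>carrier V. \<beta> a b)) \<in> carrier (dual V)"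
    and approx: "\<And>e. 0 < e \<Longrightarrow> \<exists>(I :: 'i set) \<phi> \<psi>. finite I \<and>
      (\<forall>i\<in>I. \<phi> i \<in> carrier (dual V) \<and> \<psi> i \<in> carrier (dual V)) \<and>
      (\<forall>a\<in>carrier V. \<forall>b\<in>carrier V. cmod (\<beta> a b - (\<Sum>i\<in>I. \<phi> i a * \<psi> i b)) \<le> e * vnorm V a * vnorm V b)"
  shows "\<Phi> (\<lambda>a\<in>carrier V. \<Psi> (\<lambda>b\<in>carrier V. \<beta> a b)) = \<Psi> (\<lambda>b\<in>carrier V. \<Phi> (\<lambda>a\<in>carrier V. \<beta> a b))"
    (is "?l = ?r")
proof -
  let ?n = "vnorm (dual (dual V))"
  have n0: "0 \<le> ?n \<Phi>" "0 \<le> ?n \<Psi>" using dual_norm_nonneg[OF nspace_dual[OF V]] \<Phi> \<Psi> by blast+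
  have le: "cmod (?l - ?r) \<le> 2 * (?n \<Phi> * ?n \<Psi>) * e" if e: "0 < e" for e
  proof -
    from approx[OF e] obtain I :: "'i set" and \<phi> \<psi> where *: "finite I \<and>
        (\<forall>i\<in>I. \<phi> i \<in> carrier (dual V) \<and> \<psi> i \<in> carrier (dual V)) \<and>
        (\<forall>a\<in>carrier V. \<forall>b\<in>carrier V. cmod (\<beta> a b - (\<Sum>i\<in>I. \<phi> i a * \<psi> i b)) \<le> e * vnorm V a * vnorm V b)"
      by (elim exE) (rule that)
    have I: "finite I" "\<And>i. i \<in> I \<Longrightarrow> \<phi> i \<in> carrier (dual V)" "\<And>i. i \<in> I \<Longrightarrow> \<psi> i \<in> carrier (dual V)"
      "\<And>a b. a \<in> carrier V \<Longrightarrow> b \<in> carrier V \<Longrightarrow> cmod (\<beta> a b - (\<Sum>i\<in>I. \<phi> i a * \<psi> i b)) \<le> e * vnorm V a * vnorm V b"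
      using * by blast+
    let ?s = "\<Sum>i\<in>I. \<Psi> (\<psi> i) * \<Phi> (\<phi> i)"
    have l: "cmod (?l - ?s) \<le> ?n \<Phi> * (?n \<Psi> * e)"
    proof (rule dual_approx_apply[OF V \<Phi> I(1,2) L])
      fix a assume a: "a \<in> carrier V"
      have "cmod (\<Psi> (\<lambda>b\<in>carrier V. \<beta> a b) - (\<Sum>i\<in>I. \<phi> i a * \<Psi> (\<psi> i))) \<le> ?n \<Psi> * (e * vnorm V a)"
        by (rule dual_approx_apply[OF V \<Psi> I(1,3) left[OF a]])
          (use I(4)[OF a] e nspaceD(4)[OF V a] in simp_all)
      then show "cmod ((\<lambda>a\<in>carrier V. \<Psi> (\<lambda>b\<in>carrier V. \<beta> a b)) a - (\<Sum>i\<in>I. \<Psi> (\<psi> i) * \<phi> i a)) \<le> ?n \<Psi> * e * vnorm V a"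
        using a by (simp add: mult.commute[of "\<Psi> _"] mult.assoc)
    qed (use n0 e in simp_all)
    have r: "cmod (?r - (\<Sum>i\<in>I. \<Phi> (\<phi> i) * \<Psi> (\<psi> i))) \<le> ?n \<Psi> * (?n \<Phi> * e)"
    proof (rule dual_approx_apply[OF V \<Psi> I(1,3) R])
      fix b assume b: "b \<in> carrier V"
      have "cmod (\<Phi> (\<lambda>a\<in>carrier V. \<beta> a b) - (\<Sum>i\<in>I. \<psi> i b * \<Phi> (\<phi> i))) \<le> ?n \<Phi> * (e * vnorm V b)"
        by (rule dual_approx_apply[OF V \<Phi> I(1,2) right[OF b]])
          (use I(4)[OF _ b] e nspaceD(4)[OF V b] in \<open>simp_all add: mult_ac\<close>)
      then show "cmod ((\<lambda>b\<in>carrier V. \<Phi> (\<lambda>a\<in>carrier V. \<beta> a b)) b - (\<Sum>i\<in>I. \<Phi> (\<phi> i) * \<psi> i b)) \<le> ?n \<Phi> * e * vnorm V b"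
        using b by (simp add: mult.commute[of "\<Phi> _"] mult.assoc)
    qed (use n0 e in simp_all)
    have eq: "(\<Sum>i\<in>I. \<Phi> (\<phi> i) * \<Psi> (\<psi> i)) = ?s" by (simp add: mult.commute)
    have "cmod (?l - ?r) = cmod ((?l - ?s) - (?r - ?s))" by simp
    also have "\<dots> \<le> cmod (?l - ?s) + cmod (?r - ?s)" by (rule norm_triangle_ineq4)
    also have "\<dots> \<le> ?n \<Phi> * (?n \<Psi> * e) + ?n \<Psi> * (?n \<Phi> * e)"
      using l r unfolding eq by (rule add_mono)
    finally show ?thesis by (simp add: algebra_simps)
  qed
  have "cmod (?l - ?r) \<le> 0"
  proof (rule field_le_epsilon)
    fix d :: real assume d: "0 < d"
    define C where "C = 2 * (?n \<Phi> * ?n \<Psi>)"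
    have C: "0 \<le> C" using n0 by (simp add: C_def)
    have "cmod (?l - ?r) \<le> C * (d / (C + 1))"
      unfolding C_def by (rule le) (use d C in \<open>simp add: C_def\<close>)
    also have "\<dots> = d * (C / (C + 1))" by simp
    also have "\<dots> \<le> d * 1" using d C by (intro mult_left_mono) auto
    finally show "cmod (?l - ?r) \<le> 0 + d" by simp
  qed
  then show ?thesis by simp
qed

lemma right_act_props:
  assumes A: "nalgebra A K" and f: "f \<in> carrier (dual A)" and b: "b \<in> carrier A"
  shows right_act_closed: "(\<lambda>a\<in>carrier A. f (vmult A a b)) \<in> carrier (dual A)"
    and right_act_norm: "vnorm (dual A) (\<lambda>a\<in>carrier A. f (vmult A a b)) \<le> K * vnorm (dual A) f * vnorm A b"
proof -
  note V = nalgebraD(1)[OF A] and D = nalgebraD[OF A]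
  let ?g = "\<lambda>a\<in>carrier A. f (vmult A a b)"
  have bd: "cmod (?g a) \<le> (K * vnorm (dual A) f * vnorm A b) * vnorm A a" if a: "a \<in> carrier A" for a
  proof -
    have "cmod (f (vmult A a b)) \<le> vnorm (dual A) f * vnorm A (vmult A a b)"
      by (rule dual_bound[OF V f D(3)[OF a b]])
    also have "\<dots> \<le> vnorm (dual A) f * (K * vnorm A a * vnorm A b)"
      by (intro mult_left_mono D(4)[OF a b] dual_norm_nonneg[OF V f])
    finally show ?thesis using a by (simp add: mult_ac)
  qed
  show "?g \<in> carrier (dual A)"
  proof (rule in_dualI[OF _ _ _ bd])
    show "?g \<in> extensional (carrier A)" by (rule restrict_extensional)
  qed (use b in \<open>simp_all add: D nspaceD[OF V] in_dualD[OF f]\<close>)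
  have "0 \<le> K * vnorm (dual A) f * vnorm A b"
    using D(2) dual_norm_nonneg[OF V f] nspaceD(4)[OF V b] by simp
  then show "vnorm (dual A) ?g \<le> K * vnorm (dual A) f * vnorm A b"
    by (rule dual_norm_le[OF V _ bd])
qed

text \<open>This is the action of \<open>\<Phi>\<close> on \<open>f\<close> that defines the second
  Arens product. It will be the witness \<open>g\<close> in \<open>arens_regularI\<close>:
  regularity means that both products agree.\<close>

lemma second_arens_act_closed:
  assumes A: "nalgebra A K" and f: "f \<in> carrier (dual A)" and \<Phi>: "\<Phi> \<in> carrier (dual (dual A))"
  shows "(\<lambda>b\<in>carrier A. \<Phi> (\<lambda>a\<in>carrier A. f (vmult A a b))) \<in> carrier (dual A)"
proof -
  note V = nalgebraD(1)[OF A] and V' = nspace_dual[OF nalgebraD(1)[OF A]] and D = nalgebraD[OF A]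
  let ?r = "\<lambda>b. \<lambda>a\<in>carrier A. f (vmult A a b)"
  let ?n = "vnorm (dual (dual A)) \<Phi>"
  have add: "?r (vadd A b b') = vadd (dual A) (?r b) (?r b')" if "b \<in> carrier A" "b' \<in> carrier A" for b b'
    using that by (auto simp: fun_eq_iff dual_simps(2) D in_dualD[OF f])
  have sc: "?r (vscale A c b) = vscale (dual A) c (?r b)" if "b \<in> carrier A" for b c
    using that by (auto simp: fun_eq_iff dual_simps(3) D in_dualD[OF f])
  show ?thesis
  proof (rule in_dualI[where C="?n * (K * vnorm (dual A) f)"])
    show "(\<lambda>b\<in>carrier A. \<Phi> (?r b)) \<in> extensional (carrier A)" by (rule restrict_extensional)
    fix b assume b: "b \<in> carrier A"
    note rb = right_act_closed[OF A f b]
    have "cmod (\<Phi> (?r b)) \<le> ?n * vnorm (dual A) (?r b)" by (rule dual_bound[OF V' \<Phi> rb])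
    also have "\<dots> \<le> ?n * (K * vnorm (dual A) f * vnorm A b)"
      by (intro mult_left_mono right_act_norm[OF A f b] dual_norm_nonneg[OF V' \<Phi>])
    finally show "cmod ((\<lambda>b\<in>carrier A. \<Phi> (?r b)) b) \<le> ?n * (K * vnorm (dual A) f) * vnorm A b"
      using b by (simp add: mult.assoc del: restrict_apply add: restrict_apply'[OF b])
    show "(\<lambda>b\<in>carrier A. \<Phi> (?r b)) (vscale A c b) = c * (\<lambda>b\<in>carrier A. \<Phi> (?r b)) b" for c
      unfolding restrict_apply'[OF b] restrict_apply'[OF nspaceD(3)[OF V b]] sc[OF b]
      by (rule in_dualD(3)[OF \<Phi> rb])
    fix b' assume b': "b' \<in> carrier A"
    show "(\<lambda>b\<in>carrier A. \<Phi> (?r b)) (vadd A b b') = (\<lambda>b\<in>carrier A. \<Phi> (?r b)) b + (\<lambda>b\<in>carrier A. \<Phi> (?r b)) b'"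
      unfolding restrict_apply'[OF b] restrict_apply'[OF b'] restrict_apply'[OF nspaceD(2)[OF V b b']] add[OF b b']
      by (rule in_dualD(2)[OF \<Phi> rb right_act_closed[OF A f b']])
  qed
qed

context weighted_group
begin

section \<open>Restriction in the dual of \<open>M_star\<close>, and regularity for proper
  weights\<close>

text \<open>\<open>A\<close> adds only the product to the record of \<open>dual XS\<close>, so both
  have the same bounded functionals, and facts about the bidual of \<open>XS\<close> apply to the
  dual of \<open>A\<close>.\<close>

lemma dual_A: "carrier (dual A) = carrier (dual (dual XS))"
  by (simp add: dual_simps(1) bounded_functionals_def A_simps)

text \<open>The second transpose of \<open>res\<close>: it extends restriction of measures to all of
  \<open>A\<close>.\<close>

definition ares :: "'a set \<Rightarrow> ((('a set \<Rightarrow> complex) \<Rightarrow> complex) \<Rightarrow> complex) \<Rightarrow> (('a set \<Rightarrow> complex) \<Rightarrow> complex) \<Rightarrow> complex" where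
  "ares C a = (\<lambda>h\<in>X. a (hres C h))"

lemma hres_norm:
  assumes h: "h \<in> carrier (dual M)" and C: "C \<in> sets B"
  shows "vnorm (dual M) (hres C h) \<le> vnorm (dual M) h"
proof (rule dual_norm_le[OF nspace_M dual_norm_nonneg[OF nspace_M h]])
  fix \<mu> assume \<mu>: "\<mu> \<in> carrier M"
  have "vnorm (dual M) h * nrm (res C \<mu>) \<le> vnorm (dual M) h * nrm \<mu>"
    by (intro mult_left_mono res_le[OF \<mu> C] dual_norm_nonneg[OF nspace_M h])
  then show "cmod (hres C h \<mu>) \<le> vnorm (dual M) h * nrm \<mu>"
    using hres_bound[OF h C \<mu>] by linarith
qed

lemma ares_props:
  assumes a: "a \<in> carrier A" and C: "C \<in> sets B"
  shows ares_closed: "ares C a \<in> carrier A" and ares_norm: "vnorm A (ares C a) \<le> vnorm A a"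
proof -
  have b: "cmod (ares C a h) \<le> vnorm A a * vnorm (dual M) h" if h: "h \<in> X" for h
  proof -
    have "cmod (a (hres C h)) \<le> vnorm A a * vnorm (dual M) (hres C h)"
      by (rule A_apply(3)[OF a hres_X[OF h C]])
    also have "\<dots> \<le> vnorm A a * vnorm (dual M) h"
      by (intro mult_left_mono hres_norm[OF X_dual[OF h] C] A_norm_nonneg[OF a])
    finally show ?thesis using h by (simp add: ares_def)
  qed
  have add: "hres C (vadd (dual M) g h) = vadd (dual M) (hres C g) (hres C h)" for g h
    using res_closed[OF _ C] by (auto simp: hres_def dual_simps(2) fun_eq_iff)
  have sc: "hres C (vscale (dual M) c g) = vscale (dual M) c (hres C g)" for c g
    using res_closed[OF _ C] by (auto simp: hres_def dual_simps(3) fun_eq_iff)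
  show "ares C a \<in> carrier A"
  proof (rule A_I[OF _ _ _ b])
    show "ares C a \<in> extensional X" unfolding ares_def by (rule restrict_extensional)
    fix g assume g: "g \<in> X"
    show "ares C a (vscale (dual M) c g) = c * ares C a g" for c
      using g X_vscale[OF g] A_apply(2)[OF a hres_X[OF g C]] by (simp add: ares_def sc)
    fix h assume h: "h \<in> X"
    show "ares C a (vadd (dual M) g h) = ares C a g + ares C a h"
      using g h X_vadd[OF g h] A_apply(1)[OF a hres_X[OF g C] hres_X[OF h C]] by (simp add: ares_def add)
  qed
  show "vnorm A (ares C a) \<le> vnorm A a" by (rule A_norm_le[OF A_norm_nonneg[OF a] b])
qed

lemma ares_linear:
  assumes a: "a \<in> carrier A" and C: "C \<in> sets B"
  shows "b \<in> carrier A \<Longrightarrow> ares C (vadd A a b) = vadd A (ares C a) (ares C b)"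
    and "ares C (vscale A c a) = vscale A c (ares C a)"
proof -
  note cl = nspaceD(2,3)[OF nspace_A]
  show "ares C (vadd A a b) = vadd A (ares C a) (ares C b)" if b: "b \<in> carrier A"
    by (rule A_ext) (simp_all add: ares_closed cl a b C A_op_apply, simp add: ares_def A_op_apply hres_X[OF _ C])
  show "ares C (vscale A c a) = vscale A c (ares C a)"
    by (rule A_ext) (simp_all add: ares_closed cl a C A_op_apply, simp add: ares_def A_op_apply hres_X[OF _ C])
qed

lemma ares_split:
  assumes a: "a \<in> carrier A" and C: "C \<in> sets B"
  shows "vadd A (ares C a) (ares (topspace T - C) a) = a"
proof (rule A_ext[OF _ a])
  note C' = sets_compl[OF C]
  show "vadd A (ares C a) (ares (topspace T - C) a) \<in> carrier A"
    by (intro nspaceD(2)[OF nspace_A] ares_closed a C C')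
  fix g assume g: "g \<in> X"
  show "vadd A (ares C a) (ares (topspace T - C) a) g = a g"
    using A_apply(1)[OF a hres_X[OF g C] hres_X[OF g C']] hres_split[OF X_dual[OF g] C] g
    by (simp add: A_op_apply ares_def)
qed

text \<open>Cutting \<open>h\<close> off to the finite set \<open>F\<close> gives the combination of
  the functionals \<open>mass x\<close> with coefficients \<open>h (dirac x)\<close>. Hence
  \<open>ares F a\<close> is a combination of point masses, and this is where finite rank comes
  from.\<close>

lemma ares_finite:
  assumes a: "a \<in> carrier A" and F: "finite F" "F \<subseteq> topspace T" and f: "f \<in> carrier (dual A)"
  shows "f (ares F a) = (\<Sum>x\<in>F. a (mass x) * f (point x))"
proof -
  have sum_h: "h (\<lambda>E. \<Sum>x\<in>F. \<mu> {x} * dirac x E) = (\<Sum>x\<in>F. h (dirac x) * \<mu> {x})"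
    if h: "h \<in> X" and \<mu>: "\<mu> \<in> carrier M" for h \<mu>
    using F
  proof (induction F)
    case empty
    have "h (vscale M 0 \<mu>) = 0" using in_dualD(3)[OF X_dual[OF h] \<mu>, of 0] by simp
    then show ?case by (simp add: M_simps)
  next
    case (insert x F)
    have x: "x \<in> topspace T" and F: "F \<subseteq> topspace T" using insert.prems by simp_all
    have d: "(\<lambda>E. \<mu> {x} * dirac x E) \<in> carrier M" by (rule vscale_closed(1)[OF dirac_closed[OF x]])
    have r: "(\<lambda>E. \<Sum>x\<in>F. \<mu> {x} * dirac x E) \<in> carrier M"
      using res_closed[OF \<mu> finite_sets[OF insert.hyps(1) F]] res_finite[OF \<mu> insert.hyps(1) F] by simp
    have "h (\<lambda>E. \<mu> {x} * dirac x E + (\<Sum>x\<in>F. \<mu> {x} * dirac x E)) = h (\<lambda>E. \<mu> {x} * dirac x E) + h (\<lambda>E. \<Sum>x\<in>F. \<mu> {x} * dirac x E)"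
      using in_dualD(2)[OF X_dual[OF h] d r] by (simp add: M_simps)
    moreover have "h (\<lambda>E. \<mu> {x} * dirac x E) = \<mu> {x} * h (dirac x)"
      using in_dualD(3)[OF X_dual[OF h] dirac_closed[OF x], of "\<mu> {x}"] by (simp add: M_simps)
    ultimately show ?case using insert.hyps insert.IH[OF F] by (simp add: mult.commute)
  qed
  have "ares F a = (\<lambda>h\<in>carrier XS. \<Sum>x\<in>F. a (mass x) * point x h)"
  proof
    fix h
    show "ares F a h = (\<lambda>h\<in>carrier XS. \<Sum>x\<in>F. a (mass x) * point x h) h"
    proof (cases "h \<in> X")
      case True
      have "hres F h = (\<lambda>\<mu>\<in>carrier M. \<Sum>x\<in>F. h (dirac x) * \<mu> {x})"
        unfolding hres_def by (rule restrict_ext) (simp add: res_finite F sum_h[OF True])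
      then have "ares F a h = (\<Sum>x\<in>F. h (dirac x) * a (mass x))"
        using True conjunct2[OF A_masses[OF a F, of "\<lambda>x. h (dirac x)"]] by (simp add: ares_def)
      then show ?thesis using True by (simp add: point_def mult.commute)
    qed (simp add: ares_def)
  qed
  moreover have "f (\<lambda>h\<in>carrier XS. \<Sum>x\<in>F. a (mass x) * point x h) = (\<Sum>x\<in>F. a (mass x) * f (point x))"
    using dual_sum_apply[OF nspace_XS f[unfolded dual_A] F(1), of point "\<lambda>x. a (mass x)"] point_A(1) F(2)
    by (simp add: A_simps subset_iff)
  ultimately show ?thesis by simp
qed

text \<open>The estimate of \<open>convolution_bound\<close> for measures supported in
  \<open>C\<close> is lifted through two dualities, from the inside out: first \<open>\<nu>\<close>
  is absorbed into a dual norm to which \<open>b\<close> is applied, then \<open>\<mu>\<close> into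
  one to which \<open>a\<close> is applied.\<close>

lemma ares_mult_norm:
  assumes a: "a \<in> carrier A" and b: "b \<in> carrier A" and C: "C \<in> sets B"
    and r: "0 \<le> r" "\<And>x y. x \<in> C \<Longrightarrow> y \<in> C \<Longrightarrow> \<omega> (x \<otimes> y) \<le> r * \<omega> x * \<omega> y"
  shows "vnorm A (vmult A (ares C a) (ares C b)) \<le> r * vnorm A a * vnorm A b"
proof (rule A_norm_le)
  show "0 \<le> r * vnorm A a * vnorm A b" using r(1) A_norm_nonneg[OF a] A_norm_nonneg[OF b] by simp
  fix h assume h: "h \<in> X"
  note hD = X_dual[OF h] and h0 = dual_norm_nonneg[OF nspace_M X_dual[OF h]]
  note C' = sets_compl[OF C]
  note b' = ares_closed[OF b C]
  let ?g = "bidual_act M (ares C b) h"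
  have g: "?g \<in> X" by (rule bidual_act_X[OF b' h])
  have "vnorm (dual M) (hres C ?g) \<le> vnorm A b * (r * vnorm (dual M) h)"
  proof (rule dual_norm_le[OF nspace_M])
    show "0 \<le> vnorm A b * (r * vnorm (dual M) h)" using A_norm_nonneg[OF b] r(1) h0 by simp
    fix \<mu> assume \<mu>: "\<mu> \<in> carrier M"
    note \<mu>' = res_closed[OF \<mu> C]
    let ?k = "functional_act M h (res C \<mu>)"
    have k: "?k \<in> X" by (rule functional_act_X[OF h \<mu>'])
    have "vnorm (dual M) (hres C ?k) \<le> r * vnorm (dual M) h * nrm \<mu>"
    proof (rule dual_norm_le[OF nspace_M])
      show "0 \<le> r * vnorm (dual M) h * nrm \<mu>" using r(1) h0 nrm_nonneg[OF \<mu>] by simp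
      fix \<nu> assume \<nu>: "\<nu> \<in> carrier M"
      note \<nu>' = res_closed[OF \<nu> C]
      let ?c = "convolution G T (res C \<mu>) (res C \<nu>)"
      have n: "null (topspace T - C) (res C \<mu>)" "null (topspace T - C) (res C \<nu>)"
        by (rule null_res(2)[OF \<mu> C C'] null_res(2)[OF \<nu> C C'], blast)+
      have c: "?c \<in> carrier M" "nrm ?c \<le> r * nrm (res C \<mu>) * nrm (res C \<nu>)"
        using convolution_bound[OF \<mu>' \<nu>' C C n r] by blast+
      have "cmod (h ?c) \<le> vnorm (dual M) h * nrm ?c" by (rule dual_bound[OF nspace_M hD c(1)])
      also have "\<dots> \<le> vnorm (dual M) h * (r * nrm (res C \<mu>) * nrm (res C \<nu>))"
        by (intro mult_left_mono c(2) h0)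
      also have "\<dots> \<le> vnorm (dual M) h * (r * nrm \<mu> * nrm \<nu>)"
        by (intro mult_left_mono mult_mono res_le[OF \<mu> C] res_le[OF \<nu> C] h0 r(1) mult_nonneg_nonneg
            nrm_nonneg[OF \<mu>] nrm_nonneg[OF \<nu>'] order_refl nrm_nonneg[OF \<mu>'])
      finally show "cmod (hres C ?k \<nu>) \<le> r * vnorm (dual M) h * nrm \<mu> * nrm \<nu>"
        using \<nu> \<nu>' by (simp add: hres_def functional_act_def M_simps mult_ac)
    qed
    then have "vnorm A b * vnorm (dual M) (hres C ?k) \<le> vnorm A b * (r * vnorm (dual M) h * nrm \<mu>)"
      by (rule mult_left_mono) (rule A_norm_nonneg[OF b])
    with A_apply(3)[OF b hres_X[OF k C]]
    have "cmod (b (hres C ?k)) \<le> vnorm A b * (r * vnorm (dual M) h) * nrm \<mu>" by (simp add: mult_ac)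
    moreover have "hres C ?g \<mu> = ?g (res C \<mu>)"
      unfolding hres_def[of C ?g] by (rule restrict_apply'[OF \<mu>])
    moreover have "?g (res C \<mu>) = ares C b ?k"
      unfolding bidual_act_def by (rule restrict_apply'[OF \<mu>'])
    moreover have "ares C b ?k = b (hres C ?k)"
      unfolding ares_def by (rule restrict_apply'[OF k])
    ultimately show "cmod (hres C ?g \<mu>) \<le> vnorm A b * (r * vnorm (dual M) h) * nrm \<mu>" by simp
  qed
  then have "vnorm A a * vnorm (dual M) (hres C ?g) \<le> vnorm A a * (vnorm A b * (r * vnorm (dual M) h))"
    by (rule mult_left_mono) (rule A_norm_nonneg[OF a])
  with A_apply(3)[OF a hres_X[OF g C]]
  have "cmod (a (hres C ?g)) \<le> r * vnorm A a * vnorm A b * vnorm (dual M) h" by (simp add: mult_ac)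
  then show "cmod (vmult A (ares C a) (ares C b) h) \<le> r * vnorm A a * vnorm A b * vnorm (dual M) h"
    using h g by (simp add: A_op_apply ares_def[of C a])
qed

lemma ares_dual:
  assumes f: "f \<in> carrier (dual A)" and C: "C \<in> sets B"
  shows "(\<lambda>a\<in>carrier A. f (ares C a)) \<in> carrier (dual A)"
proof (rule in_dualI[where C="vnorm (dual A) f"])
  show "(\<lambda>a\<in>carrier A. f (ares C a)) \<in> extensional (carrier A)" by (rule restrict_extensional)
  fix a assume a: "a \<in> carrier A"
  note a' = ares_closed[OF a C]
  have "cmod (f (ares C a)) \<le> vnorm (dual A) f * vnorm A (ares C a)" by (rule dual_bound[OF nspace_A f a'])
  also have "\<dots> \<le> vnorm (dual A) f * vnorm A a"
    by (intro mult_left_mono ares_norm[OF a C] dual_norm_nonneg[OF nspace_A f])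
  finally show "cmod ((\<lambda>a\<in>carrier A. f (ares C a)) a) \<le> vnorm (dual A) f * vnorm A a" using a by simp
  show "(\<lambda>a\<in>carrier A. f (ares C a)) (vscale A c a) = c * (\<lambda>a\<in>carrier A. f (ares C a)) a" for c
    using a nspaceD(3)[OF nspace_A a, of c] in_dualD(3)[OF f a', of c] by (simp add: ares_linear(2)[OF a C])
  fix b assume b: "b \<in> carrier A"
  show "(\<lambda>a\<in>carrier A. f (ares C a)) (vadd A a b) = (\<lambda>a\<in>carrier A. f (ares C a)) a + (\<lambda>a\<in>carrier A. f (ares C a)) b"
    using a b nspaceD(2)[OF nspace_A a b] in_dualD(2)[OF f a' ares_closed[OF b C]]
    by (simp add: ares_linear(1)[OF a C b])
qed

lemma mass_on_singleton: "a \<in> carrier A \<Longrightarrow> mass_on {x} a = a (mass x)"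
  by (simp add: mass_on_def)

text \<open>Split \<open>a\<close> and \<open>b\<close> into their restrictions to a finite set \<open>F\<close> and to its complement \<open>C\<close>. Off \<open>F\<close>,
  \<open>\<omega>(xy) / (\<omega>(x) \<omega>(y))\<close> is small, so the form \<open>f(a\<^sub>C b\<^sub>C)\<close> has small norm, while \<open>f(a\<^sub>F b)\<close> and
  \<open>f(a\<^sub>C b\<^sub>F)\<close> have finite rank.\<close>

lemma arens_regular_of_proper:
  assumes sub: "\<And>x y. x \<in> topspace T \<Longrightarrow> y \<in> topspace T \<Longrightarrow> \<omega> (x \<otimes> y) \<le> \<omega> x + \<omega> y"
    and fin: "\<And>R. finite {x \<in> topspace T. \<omega> x \<le> R}"
  shows "arens_regular A"
proof (rule arens_regularI[OF nalgebra_A])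
  fix f \<Phi> assume f: "f \<in> carrier (dual A)" and \<Phi>: "\<Phi> \<in> carrier (dual (dual A))"
  let ?g = "\<lambda>b\<in>carrier A. \<Phi> (\<lambda>a\<in>carrier A. f (vmult A a b))"
  have g: "?g \<in> carrier (dual A)" by (rule second_arens_act_closed[OF nalgebra_A f \<Phi>])
  have n0: "0 \<le> vnorm (dual A) f" by (rule dual_norm_nonneg[OF nspace_A f])
  have approx: "\<exists>(I :: ('a + 'a) set) \<phi> \<psi>. finite I \<and>
      (\<forall>i\<in>I. \<phi> i \<in> carrier (dual A) \<and> \<psi> i \<in> carrier (dual A)) \<and>
      (\<forall>a\<in>carrier A. \<forall>b\<in>carrier A. cmod (f (vmult A a b) - (\<Sum>i\<in>I. \<phi> i a * \<psi> i b)) \<le> e * vnorm A a * vnorm A b)"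
    if e: "0 < e" for e
  proof -
    \<comment> \<open>This makes \<open>vnorm (dual A) f * r\<close> at most \<open>e\<close>, the
      error allowed for the form; the summand 1 covers \<open>f = 0\<close>.\<close>
    define r where "r = e / (vnorm (dual A) f + 1)"
    have r: "0 < r" using e n0 by (simp add: r_def)
    \<comment> \<open>Off \<open>F\<close> both \<open>r * \<omega> x\<close> and
      \<open>r * \<omega> y\<close> are at least 2, so \<open>2 * \<omega> x\<close> and
      \<open>2 * \<omega> y\<close> are each at most \<open>r * \<omega> x * \<omega> y\<close>;
      averaging bounds \<open>\<omega> x + \<omega> y\<close>, hence
      \<open>\<omega> (x \<otimes> y)\<close>.\<close>
    define F where "F = {x \<in> topspace T. \<omega> x \<le> 2 / r}"
    have F: "finite F" "F \<subseteq> topspace T" using fin by (auto simp: F_def)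
    have Fs: "F \<in> sets B" by (rule finite_sets[OF F])
    define C where "C = topspace T - F"
    have C: "C \<in> sets B" unfolding C_def by (rule sets_compl[OF Fs])
    have rC: "\<omega> (x \<otimes> y) \<le> r * \<omega> x * \<omega> y" if "x \<in> C" "y \<in> C" for x y
    proof -
      have xy: "x \<in> topspace T" "y \<in> topspace T" "2 / r < \<omega> x" "2 / r < \<omega> y"
        using that by (auto simp: C_def F_def)
      then have l: "2 \<le> r * \<omega> x" "2 \<le> r * \<omega> y" using r by (simp_all add: divide_less_eq mult.commute)
      have "2 * \<omega> y \<le> (r * \<omega> x) * \<omega> y" "2 * \<omega> x \<le> (r * \<omega> y) * \<omega> x"
        using \<omega>_ge_1[OF xy(1)] \<omega>_ge_1[OF xy(2)] by (intro mult_right_mono l; simp)+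
      moreover have "(r * \<omega> y) * \<omega> x = (r * \<omega> x) * \<omega> y" by simp
      ultimately have "\<omega> x + \<omega> y \<le> r * \<omega> x * \<omega> y" by linarith
      then show ?thesis using sub[OF xy(1,2)] by linarith
    qed
    \<comment> \<open>\<open>Inl\<close> indexes the terms in which \<open>a\<close> is replaced by
      its point masses on \<open>F\<close>, and \<open>Inr\<close> those in which \<open>b\<close>
      is. In the latter the restriction of \<open>a\<close> to \<open>C\<close> is part of the
      factor on the side of \<open>a\<close>.\<close>
    define \<phi> where "\<phi> i = (case i of Inl x \<Rightarrow> mass_on {x} | Inr y \<Rightarrow> (\<lambda>a\<in>carrier A. (\<lambda>a\<in>carrier A. f (vmult A a (point y))) (ares C a)))" for i
    define \<psi> where "\<psi> i = (case i of Inl x \<Rightarrow> functional_act A f (point x) | Inr y \<Rightarrow> mass_on {y})" for i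
    have pt: "point x \<in> carrier A" if "x \<in> F" for x using that F(2) point_A(1) by blast
    have mo: "mass_on {x} \<in> carrier (dual A)" if "x \<in> F" for x using that F(2) by (intro mass_on_dual) auto
    have mem: "\<phi> i \<in> carrier (dual A) \<and> \<psi> i \<in> carrier (dual A)" if i: "i \<in> F <+> F" for i
    proof (cases i)
      case (Inl x)
      then have "x \<in> F" using i by auto
      then show ?thesis
        using mo[of x] functional_act_closed[OF nalgebra_A f pt[of x]] Inl by (simp add: \<phi>_def \<psi>_def)
    next
      case (Inr y)
      then have y: "y \<in> F" using i by auto
      have "(\<lambda>a\<in>carrier A. (\<lambda>a\<in>carrier A. f (vmult A a (point y))) (ares C a)) \<in> carrier (dual A)"
        by (rule ares_dual[OF right_act_closed[OF nalgebra_A f pt[OF y]] C])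
      then show ?thesis using mo[OF y] Inr by (simp add: \<phi>_def \<psi>_def del: restrict_apply)
    qed
    have "cmod (f (vmult A a b) - (\<Sum>i\<in>F <+> F. \<phi> i a * \<psi> i b)) \<le> e * vnorm A a * vnorm A b"
      if a: "a \<in> carrier A" and b: "b \<in> carrier A" for a b
    proof -
      note aF = ares_closed[OF a Fs] and aC = ares_closed[OF a C] and bF = ares_closed[OF b Fs] and bC = ares_closed[OF b C]
      have "f (vmult A a b) = f (vmult A (ares F a) b) + f (vmult A (ares C a) b)"
        using ares_split[OF a Fs] nalgebraD(5)[OF nalgebra_A aF aC b]
          in_dualD(2)[OF f A_mult(1)[OF aF b] A_mult(1)[OF aC b]] by (simp add: C_def)
      also have "f (vmult A (ares C a) b) = f (vmult A (ares C a) (ares F b)) + f (vmult A (ares C a) (ares C b))"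
        using ares_split[OF b Fs] nalgebraD(6)[OF nalgebra_A aC bF bC]
          in_dualD(2)[OF f A_mult(1)[OF aC bF] A_mult(1)[OF aC bC]] by (simp add: C_def)
      also have "f (vmult A (ares F a) b) = (\<Sum>x\<in>F. a (mass x) * f (vmult A (point x) b))"
      proof -
        have "f (vmult A (ares F a) b) = (\<lambda>a\<in>carrier A. f (vmult A a b)) (ares F a)" using aF by simp
        also have "\<dots> = (\<Sum>x\<in>F. a (mass x) * (\<lambda>a\<in>carrier A. f (vmult A a b)) (point x))"
          by (rule ares_finite[OF a F right_act_closed[OF nalgebra_A f b]])
        also have "\<dots> = (\<Sum>x\<in>F. a (mass x) * f (vmult A (point x) b))"
          by (rule sum.cong) (simp_all add: pt)
        finally show ?thesis .
      qed
      also have "f (vmult A (ares C a) (ares F b)) = (\<Sum>y\<in>F. b (mass y) * f (vmult A (ares C a) (point y)))"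
      proof -
        have "f (vmult A (ares C a) (ares F b)) = functional_act A f (ares C a) (ares F b)"
          using bF by (simp add: functional_act_def)
        also have "\<dots> = (\<Sum>y\<in>F. b (mass y) * functional_act A f (ares C a) (point y))"
          by (rule ares_finite[OF b F functional_act_closed[OF nalgebra_A f aC]])
        also have "\<dots> = (\<Sum>y\<in>F. b (mass y) * f (vmult A (ares C a) (point y)))"
          by (rule sum.cong) (simp_all add: pt functional_act_def)
        finally show ?thesis .
      qed
      finally have eq: "f (vmult A a b) = (\<Sum>x\<in>F. a (mass x) * f (vmult A (point x) b)) +
          ((\<Sum>y\<in>F. b (mass y) * f (vmult A (ares C a) (point y))) + f (vmult A (ares C a) (ares C b)))" .
      have "(\<Sum>i\<in>F <+> F. \<phi> i a * \<psi> i b) = (\<Sum>x\<in>F. \<phi> (Inl x) a * \<psi> (Inl x) b) + (\<Sum>y\<in>F. \<phi> (Inr y) a * \<psi> (Inr y) b)"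
        by (simp add: sum.Plus F)
      also have "\<dots> = (\<Sum>x\<in>F. a (mass x) * f (vmult A (point x) b)) + (\<Sum>y\<in>F. b (mass y) * f (vmult A (ares C a) (point y)))"
        using a b aC by (simp add: \<phi>_def \<psi>_def mass_on_singleton functional_act_def mult.commute[of "f _"])
      finally have "f (vmult A a b) - (\<Sum>i\<in>F <+> F. \<phi> i a * \<psi> i b) = f (vmult A (ares C a) (ares C b))"
        using eq by simp
      moreover have "cmod (f (vmult A (ares C a) (ares C b))) \<le> vnorm (dual A) f * vnorm A (vmult A (ares C a) (ares C b))"
        by (rule dual_bound[OF nspace_A f A_mult(1)[OF aC bC]])
      moreover have "vnorm (dual A) f * vnorm A (vmult A (ares C a) (ares C b)) \<le> vnorm (dual A) f * (r * vnorm A a * vnorm A b)"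
        using r by (intro mult_left_mono n0 ares_mult_norm[OF a b C _ rC]) auto
      moreover have "vnorm (dual A) f * (r * vnorm A a * vnorm A b) = (vnorm (dual A) f * r) * (vnorm A a * vnorm A b)" by simp
      moreover have "(vnorm (dual A) f * r) * (vnorm A a * vnorm A b) \<le> e * (vnorm A a * vnorm A b)"
      proof (rule mult_right_mono)
        have "vnorm (dual A) f * r = e * (vnorm (dual A) f / (vnorm (dual A) f + 1))" by (simp add: r_def)
        also have "\<dots> \<le> e * 1" using e n0 by (intro mult_left_mono) auto
        finally show "vnorm (dual A) f * r \<le> e" by simp
        show "0 \<le> vnorm A a * vnorm A b" using A_norm_nonneg[OF a] A_norm_nonneg[OF b] by simp
      qed
      ultimately show ?thesis by (simp add: mult.assoc)
    qed
    moreover have "finite (F <+> F)" using F(1) by simp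
    ultimately show ?thesis
      using mem by - (rule exI[of _ "F <+> F"], rule exI[of _ \<phi>], rule exI[of _ \<psi>], blast)
  qed
  show "\<exists>g\<in>carrier (dual A). \<forall>\<Psi>\<in>carrier (dual (dual A)). \<Phi> (bidual_act A \<Psi> f) = \<Psi> g"
  proof (rule bexI[OF _ g], rule ballI)
    fix \<Psi> assume \<Psi>: "\<Psi> \<in> carrier (dual (dual A))"
    have fa: "functional_act A f = (\<lambda>a. \<lambda>b\<in>carrier A. f (vmult A a b))" by (auto simp: functional_act_def)
    have L: "(\<lambda>a\<in>carrier A. \<Psi> (\<lambda>b\<in>carrier A. f (vmult A a b))) = bidual_act A \<Psi> f"
      unfolding bidual_act_def fa ..
    have "\<Phi> (\<lambda>a\<in>carrier A. \<Psi> (\<lambda>b\<in>carrier A. f (vmult A a b))) = \<Psi> ?g"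
    proof (rule iterated_bidual_commute[OF nspace_A \<Phi> \<Psi> _ _ _ g approx])
      show "(\<lambda>b\<in>carrier A. f (vmult A a b)) \<in> carrier (dual A)" if "a \<in> carrier A" for a
        using functional_act_closed[OF nalgebra_A f that] unfolding fa .
      show "(\<lambda>a\<in>carrier A. f (vmult A a b)) \<in> carrier (dual A)" if "b \<in> carrier A" for b
        by (rule right_act_closed[OF nalgebra_A f that])
      show "(\<lambda>a\<in>carrier A. \<Psi> (\<lambda>b\<in>carrier A. f (vmult A a b))) \<in> carrier (dual A)"
        unfolding L by (rule bidual_act_full(1)[OF nalgebra_A \<Psi> f])
    qed
    then show "\<Phi> (bidual_act A \<Psi> f) = \<Psi> ?g" unfolding L .
  qed
qed

end

section \<open>Weights on countable discrete groups\<close>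

text \<open>An exhaustion of a countable group by finite sets, in place of the balls of a word metric
  (the group need not be finitely generated).\<close>

primrec word_ball :: "('a, 'm) monoid_scheme \<Rightarrow> nat \<Rightarrow> 'a set" where
  "word_ball G 0 = {\<one>\<^bsub>G\<^esub>}"
| "word_ball G (Suc n) =
     insert (from_nat_into (carrier G) n) ((\<lambda>(x, y). x \<otimes>\<^bsub>G\<^esub> y) ` (word_ball G n \<times> word_ball G n))"

lemma finite_word_ball: "finite (word_ball G n)"
  by (induction n) auto

context group
begin

lemma word_ball_closed: "word_ball G n \<subseteq> carrier G"
proof (induction n)
  case (Suc n)
  have "from_nat_into (carrier G) n \<in> carrier G" by (rule from_nat_into) auto
  then show ?case using Suc by auto
qed simp

lemma one_in_word_ball: "\<one> \<in> word_ball G n"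
proof (induction n)
  case (Suc n)
  have "\<one> = \<one> \<otimes> \<one>" by simp
  then show ?case using Suc by force
qed simp

lemma word_ball_mult: "x \<in> word_ball G n \<Longrightarrow> y \<in> word_ball G n \<Longrightarrow> x \<otimes> y \<in> word_ball G (Suc n)"
  by force

lemma word_ball_mono: "m \<le> n \<Longrightarrow> word_ball G m \<subseteq> word_ball G n"
proof (induction n rule: dec_induct)
  case (step n)
  have "x \<in> word_ball G (Suc n)" if x: "x \<in> word_ball G n" for x
    using word_ball_mult[OF x one_in_word_ball] subsetD[OF word_ball_closed x] by simp
  then show ?case using step by blast
qed simp

lemma word_ball_covers:
  assumes "countable (carrier G)" and "x \<in> carrier G"
  shows "\<exists>n. x \<in> word_ball G n"
proof -
  have "x \<in> range (from_nat_into (carrier G))"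
    using assms by (subst range_from_nat_into) auto
  then obtain n where "x = from_nat_into (carrier G) n" by blast
  then have "x \<in> word_ball G (Suc n)" by simp
  then show ?thesis ..
qed

text \<open>The weight is 1 plus the index of the first ball that contains the element. Each ball
  contains all products from the previous one, so the length of a product is at most one more than
  the larger of the two lengths. A sublevel set lies in a single ball and is finite.\<close>

lemma proper_subadditive_weight:
  assumes "countable (carrier G)"
  obtains \<omega> :: "'a \<Rightarrow> real" where "\<And>x. 1 \<le> \<omega> x" "\<omega> \<one> = 1"
    "\<And>x y. x \<in> carrier G \<Longrightarrow> y \<in> carrier G \<Longrightarrow> \<omega> (x \<otimes> y) \<le> \<omega> x * \<omega> y"
    "\<And>x y. x \<in> carrier G \<Longrightarrow> y \<in> carrier G \<Longrightarrow> \<omega> (x \<otimes> y) \<le> \<omega> x + \<omega> y"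
    "\<And>R. finite {x \<in> carrier G. \<omega> x \<le> R}"
proof -
  define l where "l x = (LEAST n. x \<in> word_ball G n)" for x
  have l: "x \<in> word_ball G (l x)" if "x \<in> carrier G" for x
    unfolding l_def using word_ball_covers[OF assms that] by (rule LeastI_ex)
  have l_le: "l x \<le> n" if "x \<in> word_ball G n" for x n
    unfolding l_def using that by (rule Least_le)
  have l_one: "l \<one> = 0" using l_le[of \<one> 0] by simp
  have l_zero: "x = \<one>" if "x \<in> carrier G" "l x = 0" for x
    using l[OF that(1)] that(2) by simp
  have l_mult: "l (x \<otimes> y) \<le> Suc (max (l x) (l y))" if "x \<in> carrier G" "y \<in> carrier G" for x y
  proof (rule l_le[OF word_ball_mult])
    show "x \<in> word_ball G (max (l x) (l y))"
      by (rule subsetD[OF word_ball_mono l[OF that(1)]]) simp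
    show "y \<in> word_ball G (max (l x) (l y))"
      by (rule subsetD[OF word_ball_mono l[OF that(2)]]) simp
  qed
  show ?thesis
  proof (rule that[of "\<lambda>x. 1 + real (l x)"])
    show "1 + real (l \<one>) = 1" by (simp add: l_one)
    fix x y assume xy: "x \<in> carrier G" "y \<in> carrier G"
    show "1 + real (l (x \<otimes> y)) \<le> 1 + real (l x) + (1 + real (l y))" using l_mult[OF xy] by linarith
    show "1 + real (l (x \<otimes> y)) \<le> (1 + real (l x)) * (1 + real (l y))"
    proof (cases "x = \<one> \<or> y = \<one>")
      case True
      then show ?thesis using xy by (auto simp: l_one)
    next
      case False
      \<comment> \<open>Only the identity has length 0. For two other elements both lengths are at
        least 1, so one more than the maximum is at most the sum.\<close>
      then have "l x \<noteq> 0" "l y \<noteq> 0" using l_zero xy by blast+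
      then have "l (x \<otimes> y) \<le> l x + l y" using l_mult[OF xy] by linarith
      moreover have "0 \<le> real (l x) * real (l y)" by simp
      moreover have "(1 + real (l x)) * (1 + real (l y)) = 1 + real (l x) + real (l y) + real (l x) * real (l y)"
        by (simp add: algebra_simps)
      ultimately show ?thesis by linarith
    qed
  next
    fix R :: real
    have "x \<in> word_ball G (nat \<lceil>R\<rceil>)" if "x \<in> carrier G" "1 + real (l x) \<le> R" for x
      by (rule subsetD[OF word_ball_mono l[OF that(1)]]) (use that(2) in linarith)
    then show "finite {x \<in> carrier G. 1 + real (l x) \<le> R}"
      by (intro finite_subset[OF _ finite_word_ball[of G "nat \<lceil>R\<rceil>"]]) blast
  qed simp
qed

lemma weight_regular_of_countable:
  assumes "countable (carrier G)"
  shows "weight_regular G (discrete_topology (carrier G))"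
proof -
  let ?T = "discrete_topology (carrier G)"
  interpret locally_compact_group G ?T
  proof unfold_locales
    have "continuous_map (discrete_topology (carrier G \<times> carrier G)) ?T (\<lambda>(x, y). x \<otimes> y)"
      by auto
    then show "continuous_map (prod_topology ?T ?T) ?T (\<lambda>(x, y). x \<otimes> y)"
      by (simp add: prod_topology_discrete_topology)
    show "locally_compact_space ?T" by (rule locally_compact_space_discrete_topology)
  qed auto
  show ?thesis
  proof (rule proper_subadditive_weight[OF assms])
    fix \<omega> :: "'a \<Rightarrow> real"
    assume w: "\<And>x. 1 \<le> \<omega> x" "\<omega> \<one> = 1"
      "\<And>x y. x \<in> carrier G \<Longrightarrow> y \<in> carrier G \<Longrightarrow> \<omega> (x \<otimes> y) \<le> \<omega> x * \<omega> y"
      "\<And>x y. x \<in> carrier G \<Longrightarrow> y \<in> carrier G \<Longrightarrow> \<omega> (x \<otimes> y) \<le> \<omega> x + \<omega> y"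
      "\<And>R. finite {x \<in> carrier G. \<omega> x \<le> R}"
    have weight: "weight G ?T \<omega>"
      unfolding weight_def using w(1-3) by auto
    interpret weighted_group G ?T \<omega>
      by (intro weighted_group.intro locally_compact_group_axioms weighted_group_axioms.intro weight)
    have "arens_regular (introverted_dual (measure_algebra G ?T \<omega>) (M_star G ?T \<omega>))"
      by (rule arens_regular_of_proper) (use w(4,5) in auto)
    then show ?thesis
      unfolding weight_regular_def
      by (intro conjI locally_compact_group_axioms exI[of _ \<omega>] weight)
  qed
qed

end

text \<open>The group is a countable union of closed singletons. If none were open, all would have
  empty interior, and the Baire theorem for locally compact regular spaces would make the interior
  of the whole group empty. Translation then spreads one open singleton to every point.\<close>

lemma (in locally_compact_group) discrete_of_countable:
  assumes c: "countable (carrier G)"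
  shows "T = discrete_topology (carrier G)"
proof -
  have sing: "closedin T {x}" if "x \<in> carrier G" for x
    using Hausdorff that by (simp add: closedin_Hausdorff_singleton topspace_eq_carrier)
  have "\<exists>x\<in>carrier G. openin T {x}"
  proof (rule ccontr)
    assume no: "\<not> ?thesis"
    have "T interior_of (\<Union>x\<in>carrier G. {x}) = {}"
    proof (rule Baire_category_alt)
      show "completely_metrizable_space T \<or> locally_compact_space T \<and> regular_space T"
        using locally_compact locally_compact_Hausdorff_imp_regular_space[OF locally_compact Hausdorff] by simp
      show "countable ((\<lambda>x. {x}) ` carrier G)" using c by simp
      fix S assume "S \<in> (\<lambda>x. {x}) ` carrier G"
      then obtain x where x: "x \<in> carrier G" and S: "S = {x}" by blast
      have "T interior_of {x} \<subseteq> {x}" "openin T (T interior_of {x})" by (auto simp: interior_of_subset)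
      then have "T interior_of {x} = {}" using no x by (metis subset_singletonD)
      then show "closedin T S \<and> T interior_of S = {}" using sing[OF x] S by simp
    qed
    moreover have "T interior_of (carrier G) = carrier G"
      using interior_of_topspace[of T] by (simp add: topspace_eq_carrier)
    ultimately show False using one_closed by simp
  qed
  then obtain x where x: "x \<in> carrier G" "openin T {x}" by blast
  have "openin T {y}" if y: "y \<in> carrier G" for y
  proof -
    \<comment> \<open>Right translation by \<open>inv y \<otimes> x\<close> is injective and sends
      \<open>y\<close> to \<open>x\<close>, so \<open>{y}\<close> is the preimage of the open set
      \<open>{x}\<close>.\<close>
    have "right_section G {x} (inv y \<otimes> x) = {y}"
    proof -
      have "z = y" if "z \<in> carrier G" "z \<otimes> (inv y \<otimes> x) = x" for z
      proof -
        have "(z \<otimes> inv y) \<otimes> x = x" using that x(1) y by (simp add: m_assoc)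
        then have "z \<otimes> inv y = \<one>" using that(1) x(1) y by (metis inv_closed m_closed r_cancel_one')
        then show ?thesis using that(1) y by (metis inv_closed inv_equality inv_inv)
      qed
      moreover have "y \<otimes> (inv y \<otimes> x) = x" using x(1) y by (simp add: m_assoc[symmetric])
      ultimately show ?thesis using y by (auto simp: right_section_def)
    qed
    then show ?thesis using openin_right_section[OF x(2), of "inv y \<otimes> x"] x(1) y by simp
  qed
  then show ?thesis using discrete_topology_unique[of "carrier G" T] topspace_eq_carrier by auto
qed

lemma weight_regular_countable_discrete:
  assumes "weight_regular G T"
  shows "countable (carrier G)" and "T = discrete_topology (carrier G)"
proof -
  obtain \<omega> where lc: "locally_compact_group G T" and w: "weight G T \<omega>"
    and reg: "arens_regular (introverted_dual (measure_algebra G T \<omega>) (M_star G T \<omega>))"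
    using assms unfolding weight_regular_def by blast
  interpret locally_compact_group G T by (rule lc)
  interpret weighted_group G T \<omega> by unfold_locales (rule w)
  show c: "countable (carrier G)" by (rule countable_of_arens_regular[OF reg])
  show "T = discrete_topology (carrier G)" by (rule discrete_of_countable[OF c])
qed

lemma quotient_topology_discrete:
  "quotient_topology (discrete_topology S) f = discrete_topology (f ` S)"
  unfolding topology_eq by (auto simp: openin_quotient_topology)

theorem corollary3p8:
  fixes G :: "('a, 'm) monoid_scheme" and T :: "'a topology" and N :: "'a set"
  assumes "locally_compact_group G T"
    and "normal N G"
  shows "(weight_regular G T \<longrightarrow>
            weight_regular (G Mod N) (quotient_topology T (\<lambda>x. N #>\<^bsub>G\<^esub> x)) \<and>
            countable N \<and> openin T N) \<and>
         (weight_regular G T \<and>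
          split_short_exact (G\<lparr>carrier := N\<rparr>) (\<lambda>x. x) G (\<lambda>x. N #>\<^bsub>G\<^esub> x) (G Mod N) \<longrightarrow>
            weight_regular (G Mod N) (quotient_topology T (\<lambda>x. N #>\<^bsub>G\<^esub> x)) \<and>
            weight_regular (G\<lparr>carrier := N\<rparr>) (subtopology T N))"
proof -
  interpret normal N G by (rule assms(2))
  have "weight_regular (G Mod N) (quotient_topology T (\<lambda>x. N #>\<^bsub>G\<^esub> x)) \<and> countable N \<and> openin T N \<and>
      weight_regular (G\<lparr>carrier := N\<rparr>) (subtopology T N)" if reg: "weight_regular G T"
  proof (intro conjI)
    note c = weight_regular_countable_discrete(1)[OF reg]
    note d = weight_regular_countable_discrete(2)[OF reg]
    have Q: "carrier (G Mod N) = (\<lambda>x. N #>\<^bsub>G\<^esub> x) ` carrier G"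
      by (auto simp: FactGroup_def RCOSETS_def)
    \<comment> \<open>The quotient topology of a discrete topology is discrete on the set of cosets,
      and a countable group has countably many cosets.\<close>
    show "weight_regular (G Mod N) (quotient_topology T (\<lambda>x. N #>\<^bsub>G\<^esub> x))"
      unfolding d quotient_topology_discrete Q[symmetric]
      by (rule group.weight_regular_of_countable[OF factorgroup_is_group]) (simp add: Q c)
    show cN: "countable N" by (rule countable_subset[OF subset c])
    show "openin T N" unfolding d using subset by simp
    have "weight_regular (G\<lparr>carrier := N\<rparr>) (discrete_topology (carrier (G\<lparr>carrier := N\<rparr>)))"
      by (rule group.weight_regular_of_countable[OF subgroup_imp_group[OF subgroup_axioms]]) (simp add: cN)
    then show "weight_regular (G\<lparr>carrier := N\<rparr>) (subtopology T N)"
      unfolding d using subset by (simp add: Int_absorb1 Int_absorb2)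
  qed
  then show ?thesis by blast
qed

end
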